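(* Let $\eta$ be a nilpotent endomorphism of Jordan type $\lambda$ of an $n$-dimensional vector space $V$ over an infinite field. Let $P,Q\in\mathcal T_\lambda$, and let $\sigma\in\mathbf S_n$ with $(P^{\rm t},Q^{\rm t})=RS(\sigma)$. For all $(f,f')$ in a dense open subset of $\mathcal F_{\eta,P}\times\mathcal F^*_{\eta,Q}$, the family $\bigl(J(\eta_{f_i/(f_i\cap f'_{n-j})})\bigr)_{0\le i,j\le n}$ is of type $RS^{\rm t}$, and in particular $\pi(f,f')\,\tilde n=\sigma$.
   Context: Varieties carry the Zariski topology. A complete flag $f$ in $V$ is a chain $0=f_0\subset f_1\subset\cdots\subset f_n=V$ with $\dim f_i=i$; it is $\eta$-stable if $\eta(f_i)\subset f_i$ for all $i$; $\mathcal F_\eta$ is the variety of these. For $\eta$-stable subspaces $V'\subset V''$, $\eta_{V''/V'}$ is the endomorphism of $V''/V'$ induced by $\eta$; $\eta|_{V'}$ and $\eta_{/V'}$ are the endomorphisms induced on $V'$ and $V/V'$. $J(\xi)$ is the Jordan type of a nilpotent $\xi$ (the partition formed by the sizes of its Jordan blocks). A partition $\lambda$ is a weakly decreasing sequence $\lambda_0\ge\lambda_1\ge\cdots$ of natural numbers with finite sum $|\lambda|$, with Young diagram $Y(\lambda)=\{(i,j)\in\mathbb N^2:j<\lambda_i\}$; $\lambda^{\rm t}$ is the transposed partition. Write $\mu\prec\lambda$ if $Y(\mu)\subset Y(\lambda)$ and $|\mu|=|\lambda|-1$, and $\mu\preceq\lambda$ if $\mu\prec\lambda$ or $\mu=\lambda$.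 $\mathcal T_\lambda$ is the set of standard Young tableaux of shape $\lambda$ with entries $0,\dots,|\lambda|-1$ (rows and columns increasing); $T^{\rm t}$ is the transposed tableau; $\operatorname{ch}T$ is the chain of shapes from $\lambda$ to $(0)$ obtained by removing squares in order of decreasing entries. For $f\in\mathcal F_\eta$, $r_\eta(f),q_\eta(f)\in\mathcal T_\lambda$ are given by $\operatorname{ch}r_\eta(f)=(J(\eta),J(\eta|_{f_{n-1}}),J(\eta|_{f_{n-2}}),\dots,(0))$ and $\operatorname{ch}q_\eta(f)=(J(\eta),J(\eta_{/f_1}),J(\eta_{/f_2}),\dots,(0))$. $\mathcal F_{\eta,T}=\{f\in\mathcal F_\eta:r_\eta(f)=T\}$ and $\mathcal F^*_{\eta,T}=\{f\in\mathcal F_\eta:q_\eta(f)=T\}$. $\mathbf S_n$ is the group of permutations of $\{0,\dots,n-1\}$, written as sequences $\sigma_0,\dots,\sigma_{n-1}$, with product $(\sigma\tau)_i=\sigma_{\tau_i}$; $\tilde n\in\mathbf S_n$ is the order reversing permutation, $\tilde n_i=n-1-i$. $RS(\sigma)=(P,Q)$ is the pair of tableaux given by the Schensted row insertion algorithm: $P$ is obtained by successively row-inserting $\sigma_0,\dots,\sigma_{n-1}$, and $Q$ is the recording tableau, with entry $j$ in the square added when $\sigma_j$ is inserted. The relative position $\pi(f,f')\in\mathbf S_n$ of two complete flags is the unique $\sigma$ such that there is a basis $e_0,\dots,e_{n-1}$ of $V$ with $f_i=\langle e_0,\dots,e_{i-1}\rangle$ and $f'_i=\langle e_{\sigma_0},\dots,e_{\sigma_{i-1}}\rangle$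 for all $i\le n$. An arrangement of four partitions $\begin{pmatrix}\nu&\mu\\ \mu'&\lambda\end{pmatrix}$ is of type $RS1$ if $\nu=\mu=\mu'\prec\lambda$ and $\mu_0=\lambda_0-1$; $RS2$ if $\nu\prec\mu=\mu'\prec\lambda$, with $\mu_{i+1}=\lambda_{i+1}-1$ and $\nu_i=\mu_i-1$ for some $i\ge0$; $RS3$ if $\nu\prec\mu\prec\lambda$, $\nu\prec\mu'\prec\lambda$ and $\mu\ne\mu'$; $RS0$ if $\nu=\mu\preceq\mu'=\lambda$ or $\nu=\mu'\preceq\mu=\lambda$. A family of partitions $(\lambda^{[i,j]})$ is of type $RS$ if every configuration $\begin{pmatrix}\lambda^{[i,j]}&\lambda^{[i,j+1]}\\ \lambda^{[i+1,j]}&\lambda^{[i+1,j+1]}\end{pmatrix}$ is of one of the types $RS0$–$RS3$; it is of type $RS^{\rm t}$ if the family of transposed partitions is of type $RS$. *)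

theory Defs
  imports
    "HOL-Analysis.Abstract_Topology"
    "HOL-Combinatorics.Permutations"
    "Jordan_Normal_Form.Determinant"
begin

section \<open>Partitions\<close>

definition is_partition :: "(nat \<Rightarrow> nat) \<Rightarrow> bool" where
  "is_partition l \<longleftrightarrow> antimono l \<and> finite {i. l i \<noteq> 0}"

definition psize :: "(nat \<Rightarrow> nat) \<Rightarrow> nat" where
  "psize l = (\<Sum>i | l i \<noteq> 0. l i)"

definition young_diagram :: "(nat \<Rightarrow> nat) \<Rightarrow> (nat \<times> nat) set" where
  "young_diagram l = {(i, j). j < l i}"

definition ptranspose :: "(nat \<Rightarrow> nat) \<Rightarrow> nat \<Rightarrow> nat" where
  "ptranspose l j = card {i. (i, j) \<in> young_diagram l}"

definition covered_by :: "(nat \<Rightarrow> nat) \<Rightarrow> (nat \<Rightarrow> nat) \<Rightarrow> bool" where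
  "covered_by m l \<longleftrightarrow> young_diagram m \<subseteq> young_diagram l \<and> psize m + 1 = psize l"

definition covered_by_eq :: "(nat \<Rightarrow> nat) \<Rightarrow> (nat \<Rightarrow> nat) \<Rightarrow> bool" where
  "covered_by_eq m l \<longleftrightarrow> covered_by m l \<or> m = l"


section \<open>Families of type RS\<close>

text \<open>The arguments \<open>v m m' l\<close> stand for the arrangement with first row \<open>v m\<close> and second
  row \<open>m' l\<close>.\<close>

definition RS0_config where
  "RS0_config v m m' l \<longleftrightarrow>
     (v = m \<and> covered_by_eq m m' \<and> m' = l) \<or> (v = m' \<and> covered_by_eq m' m \<and> m = l)"

definition RS1_config where
  "RS1_config v m m' l \<longleftrightarrow> v = m \<and> m = m' \<and> covered_by m' l \<and> m 0 + 1 = l 0"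

definition RS2_config where
  "RS2_config v m m' l \<longleftrightarrow> covered_by v m \<and> m = m' \<and> covered_by m' l \<and>
     (\<exists>i. m (i + 1) + 1 = l (i + 1) \<and> v i + 1 = m i)"

definition RS3_config where
  "RS3_config v m m' l \<longleftrightarrow> covered_by v m \<and> covered_by m l \<and>
     covered_by v m' \<and> covered_by m' l \<and> m \<noteq> m'"

definition type_RS :: "nat \<Rightarrow> (nat \<Rightarrow> nat \<Rightarrow> nat \<Rightarrow> nat) \<Rightarrow> bool" where
  "type_RS n L \<longleftrightarrow> (\<forall>i\<le>n. \<forall>j\<le>n. is_partition (L i j)) \<and>
     (\<forall>i<n. \<forall>j<n. \<exists>config \<in> {RS0_config, RS1_config, RS2_config, RS3_config}.
        config (L i j) (L i (j + 1)) (L (i + 1) j) (L (i + 1) (j + 1)))"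

definition type_RSt :: "nat \<Rightarrow> (nat \<Rightarrow> nat \<Rightarrow> nat \<Rightarrow> nat) \<Rightarrow> bool" where
  "type_RSt n L \<longleftrightarrow> (\<forall>i\<le>n. \<forall>j\<le>n. is_partition (L i j)) \<and>
     type_RS n (\<lambda>i j. ptranspose (L i j))"


section \<open>Tableaux and the Schensted algorithm\<close>

text \<open>A tableau is the list of its (nonempty) rows; its transpose is \<^const>\<open>List.transpose\<close>.\<close>

type_synonym tableau = "nat list list"

definition shape :: "tableau \<Rightarrow> nat \<Rightarrow> nat" where
  "shape T i = (if i < length T then length (T ! i) else 0)"

definition SYT :: "(nat \<Rightarrow> nat) \<Rightarrow> tableau set" where
  "SYT l = {T. is_partition l \<and> [] \<notin> set T \<and> shape T = l \<and>
     distinct (concat T) \<and> set (concat T) = {..<psize l} \<and>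
     (\<forall>r \<in> set T. sorted_wrt (<) r) \<and> (\<forall>c \<in> set (List.transpose T). sorted_wrt (<) c)}"

definition ch :: "tableau \<Rightarrow> (nat \<Rightarrow> nat) list" where
  "ch T = map (\<lambda>m. shape (map (filter (\<lambda>x. x < m)) T)) (rev [0..<Suc (length (concat T))])"

text \<open>The new row, and the entry bumped out of it, if any.\<close>

fun row_insert :: "nat \<Rightarrow> nat list \<Rightarrow> nat list \<times> nat option" where
  "row_insert x [] = ([x], None)"
| "row_insert x (y # ys) =
     (if x < y then (x # ys, Some y)
      else (let (zs, b) = row_insert x ys in (y # zs, b)))"

text \<open>The new tableau, and the index of the row in which a square was added.\<close>

fun schensted_insert :: "nat \<Rightarrow> tableau \<Rightarrow> tableau \<times> nat" where
  "schensted_insert x [] = ([[x]], 0)"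
| "schensted_insert x (r # rs) =
     (case row_insert x r of
        (r', None) \<Rightarrow> (r' # rs, 0)
      | (r', Some y) \<Rightarrow> (let (rs', i) = schensted_insert y rs in (r' # rs', Suc i)))"

definition add_entry :: "nat \<Rightarrow> nat \<Rightarrow> tableau \<Rightarrow> tableau" where
  "add_entry i x T = (if i < length T then T[i := T ! i @ [x]] else T @ [[x]])"

definition RS :: "nat \<Rightarrow> (nat \<Rightarrow> nat) \<Rightarrow> tableau \<times> tableau" where
  "RS n s = fold (\<lambda>j (P, Q). let (P', i) = schensted_insert (s j) P in (P', add_entry i j Q))
     [0..<n] ([], [])"

definition reversal :: "nat \<Rightarrow> nat \<Rightarrow> nat" where
  "reversal n i = (if i < n then n - 1 - i else i)"


section \<open>Jordan types of subquotients\<close>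

context finite_dimensional_vector_space
begin

text \<open>The cosets of the \<open>b i\<close>, for \<open>i\<close> in the finite set \<open>I\<close>, form a basis of \<open>U / W\<close>.\<close>

definition quotient_basis :: "'b set \<Rightarrow> 'b set \<Rightarrow> 'i set \<Rightarrow> ('i \<Rightarrow> 'b) \<Rightarrow> bool" where
  "quotient_basis U W I b \<longleftrightarrow> (\<forall>i\<in>I. b i \<in> U) \<and>
     (\<forall>x\<in>U. \<exists>c. x - (\<Sum>i\<in>I. scale (c i) (b i)) \<in> W) \<and>
     (\<forall>c. (\<Sum>i\<in>I. scale (c i) (b i)) \<in> W \<longrightarrow> (\<forall>i\<in>I. c i = 0))"

text \<open>The endomorphism induced by \<open>\<eta>\<close> on \<open>U / W\<close> has a basis consisting of Jordan strings
  \<open>v i, \<eta> (v i), \<eta>\<^sup>2 (v i), \<dots>\<close> of lengths \<open>l i\<close>, that is, a basis in which its matrix is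
  block diagonal with nilpotent Jordan blocks of sizes \<open>l i\<close>.\<close>

definition jordan_basis ::
  "('b \<Rightarrow> 'b) \<Rightarrow> 'b set \<Rightarrow> 'b set \<Rightarrow> (nat \<Rightarrow> nat) \<Rightarrow> (nat \<Rightarrow> 'b) \<Rightarrow> bool" where
  "jordan_basis \<eta> U W l v \<longleftrightarrow>
     quotient_basis U W (young_diagram l) (\<lambda>(i, j). (\<eta> ^^ j) (v i)) \<and>
     (\<forall>i. l i \<noteq> 0 \<longrightarrow> (\<eta> ^^ l i) (v i) \<in> W)"

definition jordan_type :: "('b \<Rightarrow> 'b) \<Rightarrow> 'b set \<Rightarrow> 'b set \<Rightarrow> nat \<Rightarrow> nat" where
  "jordan_type \<eta> U W = (THE l. is_partition l \<and> (\<exists>v. jordan_basis \<eta> U W l v))"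

end


section \<open>Multihomogeneous polynomial functions\<close>

text \<open>Variables indexed by \<open>I\<close> are divided into groups by \<open>g\<close>; \<open>d\<close> gives the degree
  in each group of variables.\<close>

inductive multihom :: "'i set \<Rightarrow> ('i \<Rightarrow> 'g) \<Rightarrow> ('g \<Rightarrow> nat) \<Rightarrow> (('i \<Rightarrow> 'a::comm_ring_1) \<Rightarrow> 'a) \<Rightarrow> bool"
  for I :: "'i set" and g :: "'i \<Rightarrow> 'g" where
  const: "multihom I g (\<lambda>_. 0) (\<lambda>_. c)"
| var: "i \<in> I \<Longrightarrow> multihom I g (\<lambda>k. if k = g i then 1 else 0) (\<lambda>x. x i)"
| add: "multihom I g d p \<Longrightarrow> multihom I g d q \<Longrightarrow> multihom I g d (\<lambda>x. p x + q x)"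
| mult: "multihom I g d p \<Longrightarrow> multihom I g d' q \<Longrightarrow> multihom I g (\<lambda>k. d k + d' k) (\<lambda>x. p x * q x)"


section \<open>Flags\<close>

context finite_dimensional_vector_space
begin

text \<open>Since \<open>f (dim UNIV) = UNIV\<close> and \<open>f\<close> is increasing, \<open>f i = UNIV\<close> for all larger \<open>i\<close>,
  so that a flag is determined by its members up to \<open>dim UNIV\<close>.\<close>

definition complete_flags :: "(nat \<Rightarrow> 'b set) set" where
  "complete_flags = {f. f 0 = {0} \<and> f (dim UNIV) = UNIV \<and>
     (\<forall>i. subspace (f i) \<and> f i \<subseteq> f (Suc i)) \<and> (\<forall>i\<le>dim UNIV. dim (f i) = i)}"

definition stable_flags :: "('b \<Rightarrow> 'b) \<Rightarrow> (nat \<Rightarrow> 'b set) set" where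
  "stable_flags \<eta> = {f \<in> complete_flags. \<forall>i\<le>dim UNIV. \<eta> ` f i \<subseteq> f i}"

definition r_tableau :: "('b \<Rightarrow> 'b) \<Rightarrow> (nat \<Rightarrow> 'b set) \<Rightarrow> tableau" where
  "r_tableau \<eta> f = (THE T. T \<in> SYT (jordan_type \<eta> UNIV {0}) \<and>
     ch T = map (\<lambda>i. jordan_type \<eta> (f i) {0}) (rev [0..<Suc (dim UNIV)]))"

definition q_tableau :: "('b \<Rightarrow> 'b) \<Rightarrow> (nat \<Rightarrow> 'b set) \<Rightarrow> tableau" where
  "q_tableau \<eta> f = (THE T. T \<in> SYT (jordan_type \<eta> UNIV {0}) \<and>
     ch T = map (\<lambda>i. jordan_type \<eta> UNIV (f i)) [0..<Suc (dim UNIV)])"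

definition r_flags :: "('b \<Rightarrow> 'b) \<Rightarrow> tableau \<Rightarrow> (nat \<Rightarrow> 'b set) set" where
  "r_flags \<eta> T = {f \<in> stable_flags \<eta>. r_tableau \<eta> f = T}"

definition q_flags :: "('b \<Rightarrow> 'b) \<Rightarrow> tableau \<Rightarrow> (nat \<Rightarrow> 'b set) set" where
  "q_flags \<eta> T = {f \<in> stable_flags \<eta>. q_tableau \<eta> f = T}"

definition basis_seq :: "(nat \<Rightarrow> 'b) \<Rightarrow> bool" where
  "basis_seq e \<longleftrightarrow> inj_on e {..<dim UNIV} \<and> independent (e ` {..<dim UNIV}) \<and>
     span (e ` {..<dim UNIV}) = UNIV"

definition adapted :: "(nat \<Rightarrow> 'b set) \<Rightarrow> (nat \<Rightarrow> 'b) \<Rightarrow> bool" where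
  "adapted f e \<longleftrightarrow> (\<forall>i\<le>dim UNIV. f i = span (e ` {..<i}))"

definition relative_position :: "(nat \<Rightarrow> 'b set) \<Rightarrow> (nat \<Rightarrow> 'b set) \<Rightarrow> nat \<Rightarrow> nat" where
  "relative_position f f' = (THE s. s permutes {..<dim UNIV} \<and>
     (\<exists>e. basis_seq e \<and> adapted f e \<and> adapted f' (e \<circ> s)))"


section \<open>The Zariski topology on pairs of flags\<close>

text \<open>The flag variety is viewed as a subvariety of the product of the Grassmannians of
  \<open>i\<close>-dimensional subspaces, \<open>i \<le> dim UNIV\<close>, each embedded into a projective space by its
  Pluecker coordinates.  For a list \<open>ks\<close> of \<open>i\<close> vectors of the fixed basis of the ambient
  space, \<open>plucker f ks\<close> is the minor, on the rows \<open>ks\<close>, of the matrix of coordinates of a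
  basis of \<open>f i\<close>.  A different choice of the adapted basis multiplies the coordinates with
  \<open>i\<close> indices by a common nonzero factor, so the vanishing of a multihomogeneous polynomial
  does not depend on it.  Lists that are not increasing for some order of the basis give
  redundant coordinates, which agree up to sign with others or vanish.\<close>

definition plucker :: "(nat \<Rightarrow> 'b set) \<Rightarrow> 'b list \<Rightarrow> 'a" where
  "plucker f ks = (let e = (SOME e. basis_seq e \<and> adapted f e) in
     det (mat (length ks) (length ks) (\<lambda>(a, b). representation Basis (e b) (ks ! a))))"

definition plucker_pair :: "(nat \<Rightarrow> 'b set) \<times> (nat \<Rightarrow> 'b set) \<Rightarrow> 'b list + 'b list \<Rightarrow> 'a" where
  "plucker_pair ff = case_sum (plucker (fst ff)) (plucker (snd ff))"

definition plucker_polys :: "(('b list + 'b list \<Rightarrow> 'a) \<Rightarrow> 'a) set" where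
  "plucker_polys = {p. \<exists>d. multihom
     (let K = {ks. set ks \<subseteq> Basis \<and> length ks \<le> dim UNIV} in K <+> K)
     (map_sum length length) d p}"

definition zero_locus ::
  "(('b list + 'b list \<Rightarrow> 'a) \<Rightarrow> 'a) set \<Rightarrow> ((nat \<Rightarrow> 'b set) \<times> (nat \<Rightarrow> 'b set)) set" where
  "zero_locus S = {ff \<in> complete_flags \<times> complete_flags. \<forall>p\<in>S. p (plucker_pair ff) = 0}"

definition zariski_flag_pairs :: "((nat \<Rightarrow> 'b set) \<times> (nat \<Rightarrow> 'b set)) topology" where
  "zariski_flag_pairs = topology (\<lambda>U. U \<subseteq> complete_flags \<times> complete_flags \<and>
     (\<exists>S \<subseteq> plucker_polys. complete_flags \<times> complete_flags - U = zero_locus S))"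

lemma plucker_polys_mult:
  "p \<in> plucker_polys \<Longrightarrow> q \<in> plucker_polys \<Longrightarrow> (\<lambda>x. p x * q x) \<in> plucker_polys"
  unfolding plucker_polys_def mem_Collect_eq by (elim exE) (rule exI, rule multihom.mult)

lemma zero_locus_Un:
  "zero_locus S \<union> zero_locus S' = zero_locus {\<lambda>x. p x * q x |p q. p \<in> S \<and> q \<in> S'}"
  (is "_ = zero_locus ?SS")
proof
  show "zero_locus S \<union> zero_locus S' \<subseteq> zero_locus ?SS"
    unfolding zero_locus_def by auto
  show "zero_locus ?SS \<subseteq> zero_locus S \<union> zero_locus S'"
  proof
    fix ff assume ff: "ff \<in> zero_locus ?SS"
    have prod: "p (plucker_pair ff) * q (plucker_pair ff) = 0" if "p \<in> S" "q \<in> S'" for p q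
    proof -
      have "(\<lambda>x. p x * q x) \<in> ?SS" using that by blast
      moreover have "\<forall>h\<in>?SS. h (plucker_pair ff) = 0"
        using ff unfolding zero_locus_def mem_Collect_eq by (rule conjunct2)
      ultimately show ?thesis by (rule bspec[rotated])
    qed
    have F: "ff \<in> complete_flags \<times> complete_flags"
      using ff unfolding zero_locus_def mem_Collect_eq by (rule conjunct1)
    show "ff \<in> zero_locus S \<union> zero_locus S'"
    proof (cases "\<forall>p\<in>S. p (plucker_pair ff) = 0")
      case True
      with F show ?thesis by (simp add: zero_locus_def)
    next
      case False
      then obtain p where "p \<in> S" "p (plucker_pair ff) \<noteq> 0" by blast
      with prod have "\<forall>q\<in>S'. q (plucker_pair ff) = 0" by (metis mult_eq_0_iff)
      with F show ?thesis by (simp add: zero_locus_def)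
    qed
  qed
qed

lemma istopology_zariski_flag_pairs:
  "istopology (\<lambda>U. U \<subseteq> complete_flags \<times> complete_flags \<and>
     (\<exists>S \<subseteq> plucker_polys. complete_flags \<times> complete_flags - U = zero_locus S))"
  (is "istopology (\<lambda>U. U \<subseteq> ?F \<and> ?closed (?F - U))")
  unfolding istopology_def
proof (intro conjI allI impI)
  fix U V assume U: "U \<subseteq> ?F \<and> ?closed (?F - U)" and V: "V \<subseteq> ?F \<and> ?closed (?F - V)"
  from U obtain S where S: "S \<subseteq> plucker_polys" "?F - U = zero_locus S" by blast
  from V obtain S' where S': "S' \<subseteq> plucker_polys" "?F - V = zero_locus S'" by blast
  have "?F - U \<inter> V = zero_locus {\<lambda>x. p x * q x |p q. p \<in> S \<and> q \<in> S'}"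
    by (simp add: Diff_Int S(2) S'(2) zero_locus_Un)
  moreover have "{\<lambda>x. p x * q x |p q. p \<in> S \<and> q \<in> S'} \<subseteq> plucker_polys"
    using S(1) S'(1) plucker_polys_mult by blast
  ultimately show "?closed (?F - U \<inter> V)" by blast
  show "U \<inter> V \<subseteq> ?F" using U by blast
next
  fix \<U> assume "\<forall>U\<in>\<U>. U \<subseteq> ?F \<and> ?closed (?F - U)"
  then have sub: "\<And>U. U \<in> \<U> \<Longrightarrow> U \<subseteq> ?F" and "\<forall>U\<in>\<U>. ?closed (?F - U)" by blast+
  then obtain S where S: "\<And>U. U \<in> \<U> \<Longrightarrow> S U \<subseteq> plucker_polys"
    "\<And>U. U \<in> \<U> \<Longrightarrow> ?F - U = zero_locus (S U)" by metis
  have "?F - \<Union>\<U> = ?F \<inter> (\<Inter>U\<in>\<U>. ?F - U)" by blast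
  also have "\<dots> = ?F \<inter> (\<Inter>U\<in>\<U>. zero_locus (S U))" using S(2) by simp
  also have "\<dots> = zero_locus (\<Union>U\<in>\<U>. S U)"
    unfolding zero_locus_def by blast
  finally have "?F - \<Union>\<U> = zero_locus (\<Union>U\<in>\<U>. S U)" .
  moreover have "(\<Union>U\<in>\<U>. S U) \<subseteq> plucker_polys" using S(1) by (rule UN_least)
  ultimately show "?closed (?F - \<Union>\<U>)" by (intro exI conjI)
  show "\<Union>\<U> \<subseteq> ?F" using sub by blast
qed

lemma openin_zariski_flag_pairs:
  "openin zariski_flag_pairs U \<longleftrightarrow> U \<subseteq> complete_flags \<times> complete_flags \<and>
     (\<exists>S \<subseteq> plucker_polys. complete_flags \<times> complete_flags - U = zero_locus S)"
  unfolding zariski_flag_pairs_def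
  by (simp only: topology_inverse'[OF istopology_zariski_flag_pairs])

lemma topspace_zariski_flag_pairs: "topspace zariski_flag_pairs = complete_flags \<times> complete_flags"
proof -
  have "(\<lambda>_. 1) \<in> plucker_polys"
    unfolding plucker_polys_def mem_Collect_eq by (rule exI, rule multihom.const)
  moreover have "complete_flags \<times> complete_flags - complete_flags \<times> complete_flags
      = zero_locus {\<lambda>_. 1}"
    by (simp add: zero_locus_def)
  ultimately have "openin zariski_flag_pairs (complete_flags \<times> complete_flags)"
    unfolding openin_zariski_flag_pairs by blast
  then have "complete_flags \<times> complete_flags \<subseteq> topspace zariski_flag_pairs"
    by (rule openin_subset)
  moreover have "topspace zariski_flag_pairs \<subseteq> complete_flags \<times> complete_flags"
    using openin_topspace[of zariski_flag_pairs] unfolding openin_zariski_flag_pairs by blast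
  ultimately show ?thesis by blast
qed

end

end

theory Submission imports Defs begin

text \<open>
  For stable flags \<open>f\<close>, \<open>f'\<close> let \<open>r m i j\<close> be the rank of \<open>\<eta>\<^sup>m\<close> on \<open>f\<^sub>i / (f\<^sub>i \<inter> f'\<^bsub>n-j\<^esub>)\<close>.  These ranks
  satisfy two linear inequalities in neighbouring indices, whereas the tail sums of the
  shapes in the growth diagram of \<open>\<sigma>\<close> satisfy the corresponding octahedron relation.  On
  \<open>r_flags \<eta> P \<times> q_flags \<eta> Q\<close> both functions agree where \<open>i = n\<close> or \<open>j = n\<close>, so the ranks are at most
  the tail sums as soon as they are at least the tail sums: equality holds on the open set where
  the ranks are large.

  This set contains a point.  By Greene's theorem the growth diagram is computed by families of
  decreasing subsequences, which give for each index a nilpotent map preserving two flags in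
  relative position determined by \<open>\<sigma>\<close> with the rank wanted there; a generic such map has all of the
  ranks, hence Jordan type \<open>\<lambda>\<close>, and can be conjugated to \<open>\<eta>\<close>.

  The set is dense because any two points of each of the two varieties lie on a curve with a
  polynomial parametrization over the complement of a finite subset of the infinite field, built
  from automorphisms of \<open>\<eta>\<close>-stable subquotients.
\<close>

section \<open>Growth of shapes under Schensted insertion\<close>

text \<open>The transposes vanish once types are encoded by ranks: the rank of the m-th power of a
  nilpotent map of type \<open>l\<close> is the m-th tail sum of the transpose of \<open>l\<close>,
  so Schensted shapes of \<open>\<sigma>\<close> enter through their own tail sums.

  Semicontinuity bounds generic ranks only from below; the obstacle is the upper bound. The two
  inequalities bound the sum of the ranks at (m,i,j) and (m+1,i+1,j+1) by a minimum, while the same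
  sum of tail sums is at least the analogous minimum. Solving for one corner turns a lower bound
  everywhere into equality. This happens in two directions: for (m+1,i+1,j+1) from trivially known
  values at i = 0, j = 0, m = 0, which gives existence, and for (m,i,j) from the edges fixed by
  \<open>P\<close> and \<open>Q\<close>.

  Only the existence half of Greene's theorem is used, and for each m only one number of
  subsequences: k, the length of row m. The first k columns hold m*k boxes plus the m-th tail sum.
  Shifting k strings m times loses at most m vectors per string, which leaves the tail sum.\<close>

abbreviation restrict_tableau :: "nat \<Rightarrow> tableau \<Rightarrow> tableau" where
  "restrict_tableau i T \<equiv> map (filter (\<lambda>z. z < i)) T"

section \<open>Adding a box, and tail sums\<close>

definition add_box :: "(nat \<Rightarrow> nat) \<Rightarrow> nat \<Rightarrow> nat \<Rightarrow> nat" where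
  "add_box s k = s(k := Suc (s k))"

text \<open>If \<open>s\<close> is the transpose of the Jordan type of a nilpotent map, this is the
  rank of its m-th power: a block of size b contributes b - m when b > m.\<close>

definition tails :: "(nat \<Rightarrow> nat) \<Rightarrow> nat \<Rightarrow> nat" where
  "tails s m = (\<Sum>r | m \<le> r \<and> s r \<noteq> 0. s r)"

lemma tails_eq_sum:
  assumes "\<And>r. N \<le> r \<Longrightarrow> s r = 0"
  shows "tails s m = (\<Sum>r\<in>{m..<N}. s r)"
  unfolding tails_def
proof (intro sum.mono_neutral_left subsetI ballI)
  fix r assume "r \<in> {r. m \<le> r \<and> s r \<noteq> 0}"
  then show "r \<in> {m..<N}" using assms[of r] by (cases "N \<le> r") auto
qed auto

lemma finite_support_bound:
  assumes "finite {r. s r \<noteq> (0::nat)}"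
  obtains N :: nat where "\<And>r. N \<le> r \<Longrightarrow> s r = 0"
proof -
  obtain N where "\<forall>r\<in>{r. s r \<noteq> 0}. r < N"
    using assms finite_nat_set_iff_bounded by blast
  then show thesis using that[of N] by fastforce
qed

lemma tails_Suc:
  assumes "finite {r. s r \<noteq> 0}"
  shows "tails s m = s m + tails s (Suc m)"
proof -
  obtain N where N: "\<And>r. N \<le> r \<Longrightarrow> s r = 0" using finite_support_bound[OF assms] by blast
  show ?thesis
  proof (cases "m < N")
    case True
    then show ?thesis by (simp add: tails_eq_sum[OF N] sum.atLeast_Suc_lessThan)
  next
    case False
    then show ?thesis using N by (simp add: tails_eq_sum[OF N])
  qed
qed

lemma finite_support_add_box: "finite {r. s r \<noteq> 0} \<Longrightarrow> finite {r. add_box s k r \<noteq> 0}"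
  by (rule finite_subset[of _ "insert k {r. s r \<noteq> 0}"]) (auto simp: add_box_def)

lemma tails_add_box:
  assumes "finite {r. s r \<noteq> 0}"
  shows "tails (add_box s k) m = tails s m + (if m \<le> k then 1 else 0)"
proof -
  obtain N where N: "\<And>r. N \<le> r \<Longrightarrow> s r = 0" using finite_support_bound[OF assms] by blast
  define M where "M = max N (Suc k)"
  have M: "\<And>r. M \<le> r \<Longrightarrow> s r = 0" "\<And>r. M \<le> r \<Longrightarrow> add_box s k r = 0" "k < M"
    using N by (auto simp: M_def add_box_def)
  have "(\<Sum>r\<in>{m..<M}. add_box s k r) = (\<Sum>r\<in>{m..<M}. s r + (if r = k then 1 else 0))"
    by (intro sum.cong) (auto simp: add_box_def)
  then show ?thesis
    using M(3) by (simp add: tails_eq_sum[OF M(1)] tails_eq_sum[OF M(2)] sum.distrib)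
qed

lemma shape_Nil [simp]: "shape [] = (\<lambda>_. 0)"
  by (auto simp: shape_def fun_eq_iff)

lemma shape_Cons_0 [simp]: "shape (r # rs) 0 = length r"
  and shape_Cons_Suc [simp]: "shape (r # rs) (Suc k) = shape rs k"
  by (auto simp: shape_def)

lemma shape_Cons_eqI:
  assumes "length r = length r'" "shape rs = shape rs'"
  shows "shape (r # rs) = shape (r' # rs')"
proof
  fix k show "shape (r # rs) k = shape (r' # rs') k"
    using assms by (cases k) auto
qed

lemma shape_add_box_0:
  "length r' = Suc (length r) \<Longrightarrow> shape rs' = shape rs \<Longrightarrow> shape (r' # rs') = add_box (shape (r # rs)) 0"
  by (rule ext) (case_tac x, auto simp: add_box_def)

lemma shape_add_box_Suc:
  "length r' = length r \<Longrightarrow> shape rs' = add_box (shape rs) k \<Longrightarrow>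
    shape (r' # rs') = add_box (shape (r # rs)) (Suc k)"
  by (rule ext) (case_tac x, auto simp: add_box_def)

lemma finite_support_shape: "finite {r. shape T r \<noteq> 0}"
  by (rule finite_subset[of _ "{..<length T}"]) (auto simp: shape_def)

section \<open>Bumping routes and truncation to small entries\<close>

lemma row_insert_NoneD: "row_insert x r = (r', None) \<Longrightarrow> r' = r @ [x] \<and> (\<forall>z\<in>set r. z \<le> x)"
  by (induction r arbitrary: r') (auto split: if_splits prod.splits)

lemma row_insert_SomeD:
  "row_insert x r = (r', Some y) \<Longrightarrow>
    \<exists>a b. r = a @ y # b \<and> r' = a @ x # b \<and> (\<forall>z\<in>set a. z \<le> x) \<and> x < y"
proof (induction r arbitrary: r')
  case (Cons c r)
  show ?case
  proof (cases "x < c")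
    case True
    then show ?thesis using Cons.prems by (intro exI[of _ "[]"] exI[of _ r]) auto
  next
    case False
    then obtain zs where zs: "row_insert x r = (zs, Some y)" "r' = c # zs"
      using Cons.prems by (auto split: prod.splits)
    obtain a b where "r = a @ y # b \<and> zs = a @ x # b \<and> (\<forall>z\<in>set a. z \<le> x) \<and> x < y"
      using Cons.IH[OF zs(1)] by blast
    then show ?thesis using False zs(2) by (intro exI[of _ "c # a"] exI[of _ b]) auto
  qed
qed simp

lemma schensted_insert_cases:
  obtains (None) "row_insert x r = (r @ [x], None)" "\<forall>z\<in>set r. z \<le> x"
      "schensted_insert x (r # rs) = ((r @ [x]) # rs, 0)"
  | (Some) a y b rs' q where "row_insert x r = (a @ x # b, Some y)" "r = a @ y # b"
      "\<forall>z\<in>set a. z \<le> x" "x < y" "schensted_insert y rs = (rs', q)"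
      "schensted_insert x (r # rs) = ((a @ x # b) # rs', Suc q)"
proof (cases "row_insert x r")
  case (Pair r' m)
  show thesis
  proof (cases m)
    case None
    with Pair row_insert_NoneD[of x r r'] that(1) show thesis by auto
  next
    case (Some y)
    with Pair row_insert_SomeD[of x r r' y] obtain a b where
      ab: "r = a @ y # b" "r' = a @ x # b" "\<forall>z\<in>set a. z \<le> x" "x < y" by blast
    obtain rs' q where q: "schensted_insert y rs = (rs', q)" by fastforce
    show thesis
      by (rule that(2)[OF _ ab(1,3,4) q]) (use Pair Some ab q in simp_all)
  qed
qed

lemma set_schensted_insert:
  "set (concat (fst (schensted_insert x T))) = insert x (set (concat T))"
proof (induction T arbitrary: x)
  case (Cons r rs)
  show ?case
  proof (cases rule: schensted_insert_cases[of x r rs])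
    case None
    then show ?thesis by auto
  next
    case (Some a y b rs' q)
    then show ?thesis using Cons.IH[of y] by auto
  qed
qed simp

lemma distinct_schensted_insert:
  assumes "distinct (concat T)" "x \<notin> set (concat T)"
  shows "distinct (concat (fst (schensted_insert x T)))"
  using assms
proof (induction T arbitrary: x)
  case (Cons r rs)
  show ?case
  proof (cases rule: schensted_insert_cases[of x r rs])
    case None
    then show ?thesis using Cons.prems by auto
  next
    case (Some a y b rs' q)
    have s: "set (concat rs') = insert y (set (concat rs))"
      using set_schensted_insert[of y rs] unfolding Some(5) by simp
    have "distinct (concat rs)" "y \<notin> set (concat rs)"
      using Cons.prems unfolding Some(2) by auto
    then have "distinct (concat rs')" using Cons.IH[of y] unfolding Some(5) by simp
    then show ?thesis
      using Cons.prems[unfolded Some(2)] s unfolding Some(6) by (auto simp del: set_concat)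
  qed
qed simp

lemma shape_schensted_insert:
  "shape (fst (schensted_insert x T)) = add_box (shape T) (snd (schensted_insert x T))"
proof (induction T arbitrary: x)
  case Nil
  then show ?case by (auto simp: add_box_def shape_def fun_eq_iff)
next
  case (Cons r rs)
  show ?case
  proof (cases rule: schensted_insert_cases[of x r rs])
    case None
    then show ?thesis by (auto intro: shape_add_box_0)
  next
    case (Some a y b rs' q)
    have "shape rs' = add_box (shape rs) q" using Cons.IH[of y] Some(5) by simp
    with Some show ?thesis by (auto intro: shape_add_box_Suc)
  qed
qed

text \<open>The row in which the restriction to entries below \<open>i\<close> grows when \<open>x\<close> is inserted: the
  restriction only sees the part of the bumping route that consists of entries below \<open>i\<close>.\<close>

fun growth_row :: "nat \<Rightarrow> nat \<Rightarrow> tableau \<Rightarrow> nat" where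
  "growth_row i x [] = 0"
| "growth_row i x (r # rs) = (case snd (row_insert x r) of None \<Rightarrow> 0
     | Some y \<Rightarrow> if y < i then Suc (growth_row i y rs) else 0)"

text \<open>Bumped entries only grow, so the whole route stays among entries at least
  \<open>i\<close>, all of which the restriction discards.\<close>

lemma shape_restrict_insert_ge:
  "i \<le> x \<Longrightarrow> shape (restrict_tableau i (fst (schensted_insert x T))) = shape (restrict_tableau i T)"
proof (induction T arbitrary: x)
  case Nil
  then show ?case by (auto simp: shape_def fun_eq_iff)
next
  case (Cons r rs)
  show ?case
  proof (cases rule: schensted_insert_cases[of x r rs])
    case None
    then show ?thesis using Cons.prems by (auto intro: shape_Cons_eqI)
  next
    case (Some a y b rs' q)
    have "shape (restrict_tableau i rs') = shape (restrict_tableau i rs)"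
      using Cons.IH[of y] Some Cons.prems by simp
    with Some Cons.prems show ?thesis by (auto intro!: shape_Cons_eqI)
  qed
qed

text \<open>Before its truncated end the route exchanges one visible entry for another. In the row
  where it ends, \<open>x\<close> is appended or displaces some \<open>y \<ge> i\<close>; that row
  gains a visible entry, and the fate of \<open>y\<close> further down is invisible.\<close>

lemma shape_restrict_insert_less:
  "x < i \<Longrightarrow> shape (restrict_tableau i (fst (schensted_insert x T))) =
     add_box (shape (restrict_tableau i T)) (growth_row i x T)"
proof (induction T arbitrary: x)
  case Nil
  then show ?case by (auto simp: shape_def add_box_def fun_eq_iff)
next
  case (Cons r rs)
  show ?case
  proof (cases rule: schensted_insert_cases[of x r rs])
    case None
    then show ?thesis using Cons.prems by (auto intro: shape_add_box_0)
  next
    case (Some a y b rs' q)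
    show ?thesis
    proof (cases "y < i")
      case True
      have "shape (restrict_tableau i rs') = add_box (shape (restrict_tableau i rs)) (growth_row i y rs)"
        using Cons.IH[OF True] Some by simp
      with Some Cons.prems True show ?thesis by (auto intro!: shape_add_box_Suc)
    next
      case False
      have "shape (restrict_tableau i rs') = shape (restrict_tableau i rs)"
        using shape_restrict_insert_ge[of i y rs] False Some by simp
      with Some Cons.prems False show ?thesis by (auto intro!: shape_add_box_0)
    qed
  qed
qed

lemma shape_restrict_Suc_notin:
  assumes "i \<notin> set (concat T)"
  shows "shape (restrict_tableau (Suc i) T) = shape (restrict_tableau i T)"
proof -
  have "restrict_tableau (Suc i) T = restrict_tableau i T"
    using assms by (auto intro!: filter_cong simp: less_Suc_eq)
  then show ?thesis by (rule arg_cong)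
qed

lemma length_filter_less_Suc:
  assumes "distinct r"
  shows "length (filter (\<lambda>z. z < Suc i) r) = length (filter (\<lambda>z. z < i) r) + (if i \<in> set r then 1 else 0)"
  using assms by (induction r) (auto simp: less_Suc_eq intro!: arg_cong[where f = length] filter_cong)

lemma shape_restrict_Suc_in:
  assumes "distinct (concat T)" "k < length T" "i \<in> set (T ! k)"
  shows "shape (restrict_tableau (Suc i) T) = add_box (shape (restrict_tableau i T)) k"
  using assms
proof (induction T arbitrary: k)
  case (Cons r rs)
  show ?case
  proof (cases k)
    case 0
    then have "i \<notin> set (concat rs)" "i \<in> set r" using Cons.prems by auto
    then show ?thesis
      using 0 Cons.prems length_filter_less_Suc[of r i] shape_restrict_Suc_notin[of i rs]
      by (auto intro!: shape_add_box_0)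
  next
    case (Suc k')
    then have "i \<in> set (concat rs)" using Cons.prems nth_mem[of k' rs] by auto
    then have "i \<notin> set r" using Cons.prems by auto
    then show ?thesis
      using Suc Cons.prems Cons.IH[of k'] length_filter_less_Suc[of r i]
      by (auto intro!: shape_add_box_Suc)
  qed
qed simp

text \<open>The two truncated routes differ only in whether the entry \<open>i\<close> counts. They
  agree unless the route bumps exactly \<open>i\<close>, which then stands in the row where the
  shorter route ends and moves down one row. Since rows increase, a route that bumps something
  beyond \<open>i\<close> proves that \<open>i\<close> is not in that row.\<close>

lemma growth_row_Suc:
  assumes "x < i" "\<forall>r\<in>set T. sorted_wrt (<) r"
  shows "(growth_row (Suc i) x T = growth_row i x T \<and>
      \<not> (growth_row i x T < length T \<and> i \<in> set (T ! growth_row i x T))) \<or>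
    (growth_row (Suc i) x T = Suc (growth_row i x T) \<and>
      growth_row i x T < length T \<and> i \<in> set (T ! growth_row i x T))"
  using assms
proof (induction T arbitrary: x)
  case (Cons r rs)
  show ?case
  proof (cases rule: schensted_insert_cases[of x r rs])
    case None
    then show ?thesis using Cons.prems by auto
  next
    case (Some a y b rs' q)
    consider "y < i" | "y = i" | "i < y" by linarith
    then show ?thesis
    proof cases
      case 1
      then have "growth_row i x (r # rs) = Suc (growth_row i y rs)"
        "growth_row (Suc i) x (r # rs) = Suc (growth_row (Suc i) y rs)"
        using Some(1) by simp_all
      then show ?thesis using Cons.IH[OF 1] Cons.prems(2) by simp
    next
      case 2
      \<comment> \<open>In the next row \<open>i\<close> can only be appended or bump something
        larger, which is invisible below \<open>Suc i\<close>.\<close>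
      have "growth_row (Suc i) i rs = 0"
      proof (cases rs)
        case (Cons r' rs')
        show ?thesis unfolding Cons
          by (cases rule: schensted_insert_cases[of i r' rs']) auto
      qed simp
      then show ?thesis using 2 Some by auto
    next
      case 3
      have "i \<notin> set r"
        using Cons.prems Some 3 by (auto simp: sorted_wrt_append)
      then show ?thesis using 3 Some by auto
    qed
  qed
qed simp

text \<open>Fomin's local rules. One direction of the square admits the value \<open>i\<close>, the
  other inserts \<open>x\<close>. \<open>new\<close> is the square with \<open>x = i\<close>; in
  \<open>bump\<close> both additions claim the same box, so \<open>i\<close> is pushed into the next
  row; in \<open>commute\<close> they claim boxes in different rows.\<close>

lemma growth_cases:
  fixes i :: nat and s s' t t' :: "nat \<Rightarrow> nat"
  assumes sorted: "\<forall>r\<in>set T. sorted_wrt (<) r" and dist: "distinct (concat T)"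
    and x: "x \<notin> set (concat T)"
    and T': "T' = fst (schensted_insert x T)"
    and s_def: "s = shape (restrict_tableau i T)" and s'_def: "s' = shape (restrict_tableau (Suc i) T)"
    and t_def: "t = shape (restrict_tableau i T')" and t'_def: "t' = shape (restrict_tableau (Suc i) T')"
  obtains (same) "s' = s" "t' = t" "t = s \<or> (\<exists>k. t = add_box s k)"
  | (same') k where "t = s" "t' = s'" "s' = add_box s k"
  | (new) "s' = s" "t = s" "t' = add_box s 0"
  | (bump) k where "t = add_box s k" "s' = add_box s k" "t' = add_box (add_box s k) (Suc k)"
  | (commute) k k' where "k \<noteq> k'" "t = add_box s k" "s' = add_box s k'"
      "t' = add_box (add_box s k) k'" "t' = add_box (add_box s k') k"
proof -
  have swap: "add_box (add_box s k) k' = add_box (add_box s k') k" if "k \<noteq> k'" for s :: "nat \<Rightarrow> nat" and k k'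
    using that by (auto simp: add_box_def fun_eq_iff)
  show thesis
  proof (cases "i \<in> set (concat T)")
    case False
    then have s: "s' = s" unfolding s_def s'_def by (rule shape_restrict_Suc_notin)
    show thesis
    proof (cases "x = i")
      case True
      \<comment> \<open>As the largest visible entry, \<open>i\<close> joins the visible part of row
        0.\<close>
      have "growth_row (Suc i) i T = 0"
      proof (cases T)
        case (Cons r' rs')
        show ?thesis unfolding Cons by (cases rule: schensted_insert_cases[of i r' rs']) auto
      qed simp
      then have "t' = add_box s' 0"
        unfolding t'_def s'_def T' True using shape_restrict_insert_less[of i "Suc i" T] by simp
      moreover have "t = s"
        unfolding t_def s_def T' using True by (simp add: shape_restrict_insert_ge)
      ultimately show thesis using s new by simp
    next
      case neq: False
      have "i \<notin> set (concat T')" unfolding T' using set_schensted_insert[of x T] False neq by simp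
      then have "t' = t" unfolding t_def t'_def by (rule shape_restrict_Suc_notin)
      moreover have "t = s \<or> (\<exists>k. t = add_box s k)"
        unfolding t_def s_def T'
        using shape_restrict_insert_ge[of i x T] shape_restrict_insert_less[of x i T] not_less by blast
      ultimately show thesis using s same by blast
    qed
  next
    case True
    then obtain k' where k': "k' < length T" "i \<in> set (T ! k')"
      unfolding set_concat by (metis UN_E in_set_conv_nth)
    then have s': "s' = add_box s k'"
      unfolding s_def s'_def using shape_restrict_Suc_in[OF dist] by simp
    show thesis
    proof (cases "i < x")
      case True
      then show thesis using same'[of k'] s'
        unfolding t_def t'_def s_def s'_def T' by (simp add: shape_restrict_insert_ge)
    next
      case False
      with x True have xi: "x < i" by (metis linorder_cases)
      define k where "k = growth_row i x T"
      have t: "t = add_box s k"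
        unfolding t_def s_def T' k_def using shape_restrict_insert_less[OF xi] .
      have t': "t' = add_box s' (growth_row (Suc i) x T)"
        unfolding t'_def s'_def T' using shape_restrict_insert_less[of x "Suc i" T] xi by simp
      consider "growth_row (Suc i) x T = k" "\<not> (k < length T \<and> i \<in> set (T ! k))"
        | "growth_row (Suc i) x T = Suc k" "k < length T" "i \<in> set (T ! k)"
        using growth_row_Suc[OF xi sorted] unfolding k_def by blast
      then show thesis
      proof cases
        case 1
        then have "k \<noteq> k'" using k' by blast
        then show thesis
          using t' s' 1(1) swap[of k k' s] by (intro commute[OF _ t s']) simp_all
      next
        case 2
        have "add_box s k = s'"
          unfolding s_def s'_def using shape_restrict_Suc_in[OF dist 2(2,3)] by simp
        then have s'k: "s' = add_box s k" ..
        have "t' = add_box (add_box s k) (Suc k)" unfolding t' 2(1) s'k ..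
        with t s'k show thesis by (rule bump)
      qed
    qed
  qed
qed

lemma psize_eq_tails: "psize s = tails s 0"
  by (simp add: psize_def tails_def)

lemma covered_by_add_box:
  assumes "finite {r. s r \<noteq> 0}"
  shows "covered_by s (add_box s k)"
  using tails_add_box[OF assms, of k 0]
  by (auto simp: covered_by_def psize_eq_tails young_diagram_def add_box_def split: if_splits)

lemma growth_config:
  assumes "\<forall>r\<in>set T. sorted_wrt (<) r" "distinct (concat T)" "x \<notin> set (concat T)"
    "T' = fst (schensted_insert x T)"
  shows "\<exists>config \<in> {RS0_config, RS1_config, RS2_config, RS3_config}.
     config (shape (restrict_tableau i T)) (shape (restrict_tableau i T'))
       (shape (restrict_tableau (Suc i) T)) (shape (restrict_tableau (Suc i) T'))"
proof -
  define s s' t t' where st: "s = shape (restrict_tableau i T)" "s' = shape (restrict_tableau (Suc i) T)"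
    "t = shape (restrict_tableau i T')" "t' = shape (restrict_tableau (Suc i) T')"
  have fin: "finite {r. s r \<noteq> 0}" unfolding st by (rule finite_support_shape)
  have cov: "covered_by s (add_box s k)"
    "covered_by (add_box s k) (add_box (add_box s k) k')" for k k'
    using covered_by_add_box[OF fin] covered_by_add_box[OF finite_support_add_box[OF fin]] by blast+
  have "RS0_config s t s' t' \<or> RS1_config s t s' t' \<or> RS2_config s t s' t' \<or> RS3_config s t s' t'"
  proof (cases rule: growth_cases[OF assms st, consumes 0, case_names same same' new bump commute])
    case same
    then show ?thesis using cov(1) by (auto simp: RS0_config_def covered_by_eq_def)
  next
    case (same' k)
    then show ?thesis using cov(1)[of k] by (simp add: RS0_config_def covered_by_eq_def)
  next
    case new
    then have "RS1_config s t s' t'"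
      using cov(1)[of 0] unfolding RS1_config_def by (simp add: add_box_def)
    then show ?thesis by blast
  next
    case (bump k)
    have "RS2_config s t s' t'"
      unfolding RS2_config_def bump
      by (intro conjI exI[of _ k] cov refl) (simp_all add: add_box_def)
    then show ?thesis by blast
  next
    case (commute k k')
    have "add_box s k \<noteq> add_box s k'"
      using commute(1) by (auto simp: add_box_def dest: fun_cong[of _ _ k])
    moreover have "covered_by (add_box s k) t'" unfolding commute(4) by (rule cov)
    moreover have "covered_by (add_box s k') t'" unfolding commute(5) by (rule cov)
    ultimately have "RS3_config s t s' t'"
      unfolding RS3_config_def commute(2,3) by (intro conjI cov)
    then show ?thesis by blast
  qed
  then show ?thesis unfolding st by blast
qed

text \<open>Each case compares indicator terms from \<open>tails_add_box\<close>. Only in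
  \<open>commute\<close> does the choice in the minimum depend on \<open>m\<close>: the first sum
  works if \<open>m \<noteq> k\<close>, the second if \<open>m = k\<close>, because then
  \<open>k' \<noteq> m\<close>.\<close>

lemma growth_octahedron:
  assumes "\<forall>r\<in>set T. sorted_wrt (<) r" "distinct (concat T)" "x \<notin> set (concat T)"
    "T' = fst (schensted_insert x T)"
  shows "min (tails (shape (restrict_tableau i T')) m + tails (shape (restrict_tableau (Suc i) T)) (Suc m))
      (tails (shape (restrict_tableau i T')) (Suc m) + tails (shape (restrict_tableau (Suc i) T)) m)
    \<le> tails (shape (restrict_tableau i T)) m + tails (shape (restrict_tableau (Suc i) T')) (Suc m)"
proof -
  define s s' t t' where st: "s = shape (restrict_tableau i T)" "s' = shape (restrict_tableau (Suc i) T)"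
    "t = shape (restrict_tableau i T')" "t' = shape (restrict_tableau (Suc i) T')"
  have fin: "finite {r. s r \<noteq> 0}" unfolding st by (rule finite_support_shape)
  note add = tails_add_box[OF fin] tails_add_box[OF finite_support_add_box[OF fin]]
  have "min (tails t m + tails s' (Suc m)) (tails t (Suc m) + tails s' m) \<le> tails s m + tails t' (Suc m)"
  proof (cases rule: growth_cases[OF assms st, consumes 0, case_names same same' new bump commute])
    case (commute k k')
    show ?thesis unfolding commute(2,3,4) using commute(1) by (auto simp: add)
  next
    case same
    show ?thesis unfolding same(1,2) by simp
  next
    case (same' k)
    show ?thesis unfolding same'(1,2) by simp
  next
    case new
    show ?thesis unfolding new by (simp add: add)
  next
    case (bump k)
    show ?thesis unfolding bump by (simp add: add)
  qed
  then show ?thesis unfolding st .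
qed

section \<open>Knuth equivalence and families of decreasing subsequences\<close>

definition row_above :: "nat list \<Rightarrow> nat list \<Rightarrow> bool" where
  "row_above r r' \<longleftrightarrow> length r' \<le> length r \<and> (\<forall>c<length r'. r ! c < r' ! c)"

fun is_tableau :: "tableau \<Rightarrow> bool" where
  "is_tableau [] = True"
| "is_tableau (r # rs) = (sorted_wrt (<) r \<and> (rs \<noteq> [] \<longrightarrow> row_above r (hd rs)) \<and> is_tableau rs)"

lemma is_tableau_rows: "is_tableau T \<Longrightarrow> \<forall>r\<in>set T. sorted_wrt (<) r"
  by (induction T) auto

lemma row_above_trans: "row_above r r' \<Longrightarrow> row_above r' r'' \<Longrightarrow> row_above r r''"
  unfolding row_above_def by (meson less_le_trans order.strict_trans order_trans)

lemma is_tableau_row_above: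
  "is_tableau T \<Longrightarrow> p < q \<Longrightarrow> q < length T \<Longrightarrow> row_above (T ! p) (T ! q)"
proof (induction T arbitrary: p q)
  case (Cons r rs)
  obtain q' where q: "q = Suc q'" using Cons.prems by (cases q) auto
  show ?case
  proof (cases p)
    case (Suc p')
    then show ?thesis using q Cons by auto
  next
    case 0
    have rs: "rs \<noteq> []" "row_above r (rs ! 0)" "is_tableau rs" "q' < length rs"
      using Cons.prems q by (auto simp: hd_conv_nth)
    show ?thesis
    proof (cases q')
      case 0
      then show ?thesis using rs q \<open>p = 0\<close> by simp
    next
      case (Suc q'')
      then have "row_above (rs ! 0) (rs ! q')" using Cons.IH[of 0 q'] rs by simp
      then show ?thesis using row_above_trans[OF rs(2)] q \<open>p = 0\<close> by simp
    qed
  qed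
qed simp

lemma sorted_row_insert:
  assumes "sorted_wrt (<) r" "x \<notin> set r"
  shows "sorted_wrt (<) (fst (row_insert x r))"
proof (cases rule: schensted_insert_cases[of x r "[]"])
  case None
  then show ?thesis using assms by (auto simp: sorted_wrt_append le_less)
next
  case (Some a y b)
  have "\<forall>z\<in>set a. z < x" using Some(2,3) assms(2) by (auto simp: le_less)
  then show ?thesis using assms(1) Some(1,2,4) by (auto simp: sorted_wrt_append)
qed

text \<open>The entry below \<open>y\<close> in its column exceeds \<open>y\<close>, so
  \<open>y\<close> enters the next row weakly to the left of the place it left. Up to that place all
  entries of the changed row are below \<open>y\<close>, and further right nothing gets
  worse.\<close>

lemma row_above_row_insert:
  assumes r: "sorted_wrt (<) r" and above: "row_above r r'" and ins: "row_insert x r = (r1, Some y)"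
  shows "row_above r1 (fst (row_insert y r'))"
proof -
  obtain a b where ab: "r = a @ y # b" "r1 = a @ x # b" "x < y" "\<forall>z\<in>set a. z \<le> x"
    using row_insert_SomeD[OF ins] by blast
  have len: "length r1 = length r" using ab by simp
  have le: "r1 ! c \<le> r ! c" if "c < length r" for c
    using ab that by (auto simp: nth_append nth_Cons split: nat.splits)
  \<comment> \<open>The column \<open>length a\<close> now holds \<open>x < y\<close>, and the
    columns before it hold entries at most \<open>x\<close>.\<close>
  have ly: "r1 ! c < y" if "c \<le> length a" for c
  proof (cases "c < length a")
    case True
    then have "a ! c \<le> x" using ab(4) by simp
    then show ?thesis using True ab(2,3) by (simp add: nth_append)
  next
    case False
    then show ?thesis using that ab by (simp add: nth_append)
  qed
  show ?thesis
  proof (cases rule: schensted_insert_cases[of y r' "[]"])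
    case None
    have "length r' \<le> length a"
    proof (rule ccontr)
      assume "\<not> ?thesis"
      then have c: "length a < length r'" by simp
      then have "r ! length a < r' ! length a" using above by (simp add: row_above_def)
      then have "y < r' ! length a" using ab by simp
      then show False using None(2) c by (meson leD nth_mem)
    qed
    then have 1: "length (r' @ [y]) \<le> length r1" using ab by simp
    have "r1 ! c < (r' @ [y]) ! c" if "c < length (r' @ [y])" for c
    proof (cases "c < length r'")
      case True
      then have "r ! c < r' ! c" "c < length r" using above by (auto simp: row_above_def)
      then show ?thesis using le[of c] True by (simp add: nth_append)
    next
      case False
      then have "c = length r'" using that by simp
      then show ?thesis using ly[of c] \<open>length r' \<le> length a\<close> by (simp add: nth_append)
    qed
    with 1 show ?thesis unfolding row_above_def None(1) by simp
  next
    case (Some a' y' b')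
    have "length a' \<le> length a"
    proof (rule ccontr)
      assume "\<not> ?thesis"
      then have c: "length a < length a'" by simp
      then have "r ! length a < r' ! length a" using above Some(2) by (simp add: row_above_def)
      then have "y < a' ! length a" using ab Some(2) c by (simp add: nth_append)
      then show False using Some(3) c by (meson leD nth_mem)
    qed
    have "r1 ! c < (a' @ y # b') ! c" if "c < length (a' @ y # b')" for c
    proof (cases "c = length a'")
      case True
      then show ?thesis using ly[of c] \<open>length a' \<le> length a\<close> by simp
    next
      case False
      have c: "r ! c < r' ! c" "c < length r" using above that Some(2) by (auto simp: row_above_def)
      have "(a' @ y # b') ! c = r' ! c"
        using False Some(2) by (auto simp: nth_append nth_Cons split: nat.splits)
      then show ?thesis using le[OF c(2)] c(1) by simp
    qed
    moreover have "length (a' @ y # b') \<le> length r1"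
      using above Some(2) len by (simp add: row_above_def)
    ultimately show ?thesis unfolding row_above_def Some(1) by simp
  qed
qed

text \<open>The clause about \<open>hd\<close> identifies the new top row below the current one as
  the result of inserting the bumped entry, which is the form in which
  \<open>row_above_row_insert\<close> compares the two rows.\<close>

lemma is_tableau_schensted_insert:
  assumes "is_tableau T" "distinct (concat T)" "x \<notin> set (concat T)"
  shows "is_tableau (fst (schensted_insert x T)) \<and> fst (schensted_insert x T) \<noteq> [] \<and>
    hd (fst (schensted_insert x T)) = fst (row_insert x (case T of [] \<Rightarrow> [] | r # _ \<Rightarrow> r))"
  using assms
proof (induction T arbitrary: x)
  case (Cons r rs)
  have srt: "sorted_wrt (<) (fst (row_insert x r))"
    using Cons.prems by (intro sorted_row_insert) auto
  show ?case
  proof (cases rule: schensted_insert_cases[of x r rs])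
    case None
    have "row_above (r @ [x]) (hd rs)" if "rs \<noteq> []"
      using that Cons.prems by (auto simp: row_above_def nth_append)
    then show ?thesis using None srt Cons.prems by auto
  next
    case (Some a y b rs' q)
    have y: "y \<notin> set (concat rs)" "is_tableau rs" "distinct (concat rs)"
      using Cons.prems Some(2) by auto
    note IH = Cons.IH[OF y(2,3,1), unfolded Some(5) fst_conv]
    have "row_above (a @ x # b) (hd rs')"
    proof (cases rs)
      case Nil
      then have "hd rs' = [y]" using IH by simp
      moreover have "(a @ x # b) ! 0 < y" using Some(3,4) by (cases a) auto
      ultimately show ?thesis by (simp add: row_above_def)
    next
      case (Cons r' rs'')
      then have "hd rs' = fst (row_insert y r')" using IH by simp
      moreover have "row_above r r'" "sorted_wrt (<) r" using Cons.prems Cons by auto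
      ultimately show ?thesis using row_above_row_insert[OF _ _ Some(1)] by simp
    qed
    then show ?thesis using Some srt IH by auto
  qed
qed simp

section \<open>Knuth equivalence of words\<close>

inductive knuth_step :: "nat list \<Rightarrow> nat list \<Rightarrow> bool" where
  left: "x < y \<Longrightarrow> y < z \<Longrightarrow> knuth_step (u @ [y, x, z] @ v) (u @ [y, z, x] @ v)"
| right: "x < y \<Longrightarrow> y < z \<Longrightarrow> knuth_step (u @ [x, z, y] @ v) (u @ [z, x, y] @ v)"

definition knuth :: "nat list \<Rightarrow> nat list \<Rightarrow> bool" where
  "knuth = (\<lambda>v w. knuth_step v w \<or> knuth_step w v)\<^sup>*\<^sup>*"

lemma knuth_refl [simp]: "knuth w w"
  and knuth_trans: "knuth u v \<Longrightarrow> knuth v w \<Longrightarrow> knuth u w"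
  and knuth_stepI: "knuth_step u v \<Longrightarrow> knuth u v"
  and knuth_stepI': "knuth_step u v \<Longrightarrow> knuth v u"
  by (auto simp: knuth_def)

lemma knuth_step_context: "knuth_step w w' \<Longrightarrow> knuth_step (p @ w @ q) (p @ w' @ q)"
proof (induction rule: knuth_step.induct)
  case (left x y z u v)
  then show ?case using knuth_step.left[of x y z "p @ u" "v @ q"] by simp
next
  case (right x y z u v)
  then show ?case using knuth_step.right[of x y z "p @ u" "v @ q"] by simp
qed

lemma knuth_context: "knuth w w' \<Longrightarrow> knuth (p @ w @ q) (p @ w' @ q)"
  unfolding knuth_def
proof (induction rule: rtranclp_induct)
  case (step y z)
  then show ?case using knuth_step_context by (metis (mono_tags, lifting) rtranclp.simps)
qed simp

text \<open>\<open>z\<close> is the largest of the three letters. If it survives, so do all three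
  and the move remains a Knuth move; if not, the filtered words coincide.\<close>

lemma knuth_step_filter:
  "knuth_step w w' \<Longrightarrow> knuth (filter (\<lambda>a. a < i) w) (filter (\<lambda>a. a < i) w')"
proof (induction rule: knuth_step.induct)
  case (left x y z u v)
  show ?case
  proof (cases "z < i")
    case True
    then show ?thesis
      using left knuth_stepI[OF knuth_step.left[of x y z "filter (\<lambda>a. a < i) u" "filter (\<lambda>a. a < i) v"]] by simp
  qed simp
next
  case (right x y z u v)
  show ?case
  proof (cases "z < i")
    case True
    then show ?thesis
      using right knuth_stepI[OF knuth_step.right[of x y z "filter (\<lambda>a. a < i) u" "filter (\<lambda>a. a < i) v"]] by simp
  qed simp
qed

lemma knuth_sym: "knuth v w \<Longrightarrow> knuth w v"
  unfolding knuth_def by (rule sympD[OF symp_rtranclp]) (auto simp: symp_def)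

lemma knuth_filter: "knuth w w' \<Longrightarrow> knuth (filter (\<lambda>a. a < i) w) (filter (\<lambda>a. a < i) w')"
  unfolding knuth_def[of] 
proof (induction rule: rtranclp_induct)
  case (step y z)
  then have "knuth (filter (\<lambda>a. a < i) y) (filter (\<lambda>a. a < i) z)"
    using knuth_step_filter knuth_sym by blast
  then show ?case using step.IH knuth_trans unfolding knuth_def by blast
qed simp

lemma knuth_move_left: "sorted_wrt (<) (y # b) \<Longrightarrow> x < y \<Longrightarrow> knuth (y # b @ [x]) (y # x # b)"
proof (induction b arbitrary: y)
  case (Cons c b)
  have "knuth (c # b @ [x]) (c # x # b)" using Cons by auto
  from knuth_context[OF this, of "[y]" "[]"]
  have "knuth (y # (c # b) @ [x]) (y # c # x # b)" by simp
  moreover have "knuth (y # c # x # b) (y # x # c # b)"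
    using knuth_stepI'[OF knuth_step.left[of x y c "[]" b]] Cons.prems by simp
  ultimately show ?case by (rule knuth_trans)
qed simp

lemma knuth_move_front: "sorted_wrt (<) (a @ [x]) \<Longrightarrow> x < y \<Longrightarrow> knuth (a @ [y, x]) (y # a @ [x])"
proof (induction a arbitrary: x rule: rev_induct)
  case (snoc c a)
  have cx: "c < x" "sorted_wrt (<) (a @ [c])" "c < y"
    using snoc.prems by (auto simp: sorted_wrt_append)
  have "knuth (a @ [c, y, x]) (a @ [y, c, x])"
    using knuth_stepI[OF knuth_step.right[of c x y a "[]"]] cx snoc.prems by simp
  moreover have "knuth (a @ [y, c, x]) (y # a @ [c, x])"
    using knuth_context[OF snoc.IH[OF cx(2,3)], of "[]" "[x]"] by simp
  ultimately show ?case using knuth_trans by fastforce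
qed simp

text \<open>\<open>x\<close> travels left across \<open>b\<close> until it follows \<open>y\<close>,
  with \<open>y\<close> as witness; then \<open>y\<close> travels left across \<open>a\<close>, with
  its right neighbour \<open>x\<close> and the last letter of \<open>a\<close> as the other two
  letters of the first move.\<close>

lemma knuth_row_insert:
  assumes "sorted_wrt (<) (a @ y # b)" "x < y" "\<forall>z\<in>set a. z < x"
  shows "knuth ((a @ y # b) @ [x]) (y # a @ x # b)"
proof -
  have "knuth (a @ (y # b @ [x]) @ []) (a @ (y # x # b) @ [])"
    using assms by (intro knuth_context knuth_move_left) (auto simp: sorted_wrt_append)
  moreover have "knuth ([] @ (a @ [y, x]) @ b) ([] @ (y # a @ [x]) @ b)"
    using assms by (intro knuth_context knuth_move_front) (auto simp: sorted_wrt_append)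
  ultimately show ?thesis using knuth_trans by fastforce
qed

text \<open>Bottom row first: an entry bumped to the front of its row then stands right behind the
  word of the rows below, where it is to be inserted next.\<close>

definition reading_word :: "tableau \<Rightarrow> nat list" where
  "reading_word T = concat (rev T)"

lemma set_reading_word: "set (reading_word T) = set (concat T)"
  by (simp add: reading_word_def)

lemma knuth_schensted_insert:
  assumes "\<forall>r\<in>set T. sorted_wrt (<) r" "distinct (concat T)" "x \<notin> set (concat T)"
  shows "knuth (reading_word T @ [x]) (reading_word (fst (schensted_insert x T)))"
  using assms
proof (induction T arbitrary: x)
  case Nil
  then show ?case by (simp add: reading_word_def)
next
  case (Cons r rs)
  show ?case
  proof (cases rule: schensted_insert_cases[of x r rs])
    case None
    then show ?thesis by (simp add: reading_word_def)
  next
    case (Some a y b rs' q)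
    have lt: "\<forall>z\<in>set a. z < x" using Some(2,3) Cons.prems(3) by (auto simp: le_less)
    have "knuth (r @ [x]) (y # a @ x # b)"
      unfolding Some(2) using Cons.prems Some(2) by (intro knuth_row_insert Some(4) lt) auto
    from knuth_context[OF this, of "reading_word rs" "[]"]
    have 1: "knuth (reading_word (r # rs) @ [x]) (reading_word rs @ [y] @ a @ x # b)"
      by (simp add: reading_word_def)
    have "knuth (reading_word rs @ [y]) (reading_word rs')"
      using Cons.IH[of y] Cons.prems Some(2,5) by auto
    from knuth_context[OF this, of "[]" "a @ x # b"]
    have "knuth (reading_word rs @ [y] @ a @ x # b) (reading_word rs' @ a @ x # b)" by simp
    with 1 show ?thesis using knuth_trans Some(6) by (fastforce simp: reading_word_def)
  qed
qed

text \<open>The values coloured by numbers below \<open>k\<close> form \<open>k\<close> disjoint decreasing subsequences.\<close>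

definition dec_colouring :: "nat \<Rightarrow> nat list \<Rightarrow> (nat \<Rightarrow> nat) \<Rightarrow> bool" where
  "dec_colouring k w hue \<longleftrightarrow> sorted_wrt (\<lambda>a b. hue a = hue b \<and> hue a < k \<longrightarrow> b < a) w"

definition dec_family :: "nat \<Rightarrow> nat list \<Rightarrow> nat \<Rightarrow> bool" where
  "dec_family k w s \<longleftrightarrow> (\<exists>hue. dec_colouring k w hue \<and> card {a \<in> set w. hue a < k} = s)"

lemma dec_colouring_split:
  "dec_colouring k (u @ m @ v) hue \<longleftrightarrow> dec_colouring k u hue \<and> dec_colouring k m hue \<and> dec_colouring k v hue \<and>
    (\<forall>a\<in>set u. \<forall>b\<in>set m. hue a = hue b \<and> hue a < k \<longrightarrow> b < a) \<and>
    (\<forall>a\<in>set u. \<forall>b\<in>set v. hue a = hue b \<and> hue a < k \<longrightarrow> b < a) \<and>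
    (\<forall>a\<in>set m. \<forall>b\<in>set v. hue a = hue b \<and> hue a < k \<longrightarrow> b < a)"
  by (auto simp: dec_colouring_def sorted_wrt_append)

lemma dec_colouring_cong:
  "(\<And>a. a \<in> set w \<Longrightarrow> hue' a = hue a) \<Longrightarrow> dec_colouring k w hue' \<longleftrightarrow> dec_colouring k w hue"
  unfolding dec_colouring_def by (induction w) auto

text \<open>The only obstruction to keeping a colouring is that \<open>z\<close> and \<open>x\<close> have the same colour.  Then
  \<open>y\<close> takes over from one of them if it is not coloured, and otherwise the two subsequences
  passing through \<open>x, z\<close> and through \<open>y\<close> exchange their tails.\<close>

lemma dec_family_swap:
  assumes xyz: "x < y" "y < z" and dist: "distinct (u @ m @ v)"
    and m: "m = [z, x, y] \<and> m' = [x, z, y] \<or> m = [y, z, x] \<and> m' = [y, x, z]"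
    and fam: "dec_family k (u @ m @ v) s"
  shows "dec_family k (u @ m' @ v) s"
proof -
  obtain hue where hue: "dec_colouring k (u @ m @ v) hue" and card: "card {a \<in> set (u @ m @ v). hue a < k} = s"
    using fam by (auto simp: dec_family_def)
  have sets: "set m' = {x, y, z}" "set m = {x, y, z}" using m by auto
  have notin: "x \<notin> set u" "y \<notin> set u" "z \<notin> set u" "x \<notin> set v" "y \<notin> set v" "z \<notin> set v"
    "set u \<inter> set v = {}" using dist sets by auto
  note D = hue[unfolded dec_colouring_split sets]
  show ?thesis
  proof (cases "hue z = hue x \<and> hue x < k")
    case False
    then have "dec_colouring k m' hue"
      using D m xyz by (auto simp: dec_colouring_def)
    then have "dec_colouring k (u @ m' @ v) hue"
      using D unfolding dec_colouring_split sets by blast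
    then show ?thesis using card sets by (auto simp: dec_family_def)
  next
    case True
    define p where "p = hue x"
    have p: "hue x = p" "hue z = p" "p < k" using True by (auto simp: p_def)
    define q where "q = hue y"
    have pq: "p \<noteq> q" using D m xyz p q_def by (auto simp: dec_colouring_def)
    have U: "z < a" if "a \<in> set u" "hue a = p" for a using D that p by auto
    have V: "b < x" if "b \<in> set v" "hue b = p" for b using D that p by auto
    show ?thesis
    proof (cases "q < k")
      case False
      \<comment> \<open>\<open>y\<close> joins the letter with which it is in decreasing order in
        \<open>m'\<close>: \<open>z\<close> in \<open>[x, z, y]\<close>, \<open>x\<close> in
        \<open>[y, x, z]\<close>. The other one, \<open>o'\<close>, receives the old value
        \<open>q \<ge> k\<close> of \<open>y\<close> and so leaves the family; the count is
        unchanged.\<close>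
      define o' where "o' = (if m = [z, x, y] then x else z)"
      define hue' where "hue' = hue(o' := q, y := p)"
      have o': "o' = x \<or> o' = z" by (simp add: o'_def)
      have m': "dec_colouring k m' hue'"
        using m xyz p False by (auto simp: dec_colouring_def hue'_def o'_def)
      have uv: "hue' a = hue a" if "a \<in> set u \<union> set v" for a
        using that notin o' by (auto simp: hue'_def)
      have y: "hue' y = p" "o' \<noteq> y" using o' xyz by (auto simp: hue'_def)
      have cm: "hue' a = q \<or> hue' a = p" if "a \<in> {x, y, z}" for a
        using that p by (auto simp: hue'_def)
      have um: "b < a" if "a \<in> set u" "b \<in> {x, y, z}" "hue' a = hue' b" "hue' a < k" for a b
      proof -
        have "hue a = p" using that cm[of b] uv[of a] False by auto
        then show ?thesis using U[OF that(1)] that(2) xyz by auto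
      qed
      have mv: "b < a" if "a \<in> {x, y, z}" "b \<in> set v" "hue' a = hue' b" "hue' a < k" for a b
      proof -
        have "hue b = p" using that cm[of a] uv[of b] False by auto
        then show ?thesis using V[OF that(2)] that(1) xyz by auto
      qed
      have "dec_colouring k (u @ m' @ v) hue'"
        unfolding dec_colouring_split sets
        using m' um mv D uv dec_colouring_cong[of u hue' hue] dec_colouring_cong[of v hue' hue]
        by auto
      moreover have "card {a \<in> set (u @ m' @ v). hue' a < k} = s"
      proof -
        let ?A = "{a \<in> set (u @ m @ v). hue a < k}"
        have *: "{a \<in> set (u @ m' @ v). hue' a < k} = insert y (?A - {o'})"
          using sets p False y o' by (auto simp: hue'_def q_def)
        have mem: "o' \<in> ?A" "y \<notin> ?A" using o' p sets False by (auto simp: q_def)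
        have "card (insert y (A - {o'})) = card A" if "finite A" "o' \<in> A" "y \<notin> A" for A
          using that by (metis Diff_iff card_Suc_Diff1 card_insert_disjoint finite_Diff)
        from this[OF _ mem] have "card (insert y (?A - {o'})) = card ?A" by simp
        then show ?thesis unfolding * card .
      qed
      ultimately show ?thesis by (auto simp: dec_family_def)
    next
      case True
      have Uy: "y < a" if "a \<in> set u" "hue a = q" for a using D that True by (auto simp: q_def)
      have Vy: "b < y" if "b \<in> set v" "hue b = q" for b using D that True by (auto simp: q_def)
      \<comment> \<open>\<open>z\<close> keeps \<open>p\<close>, \<open>x\<close> moves to
        \<open>q\<close>, and \<open>y\<close> joins \<open>z\<close> or \<open>x\<close> according
        to their order in \<open>m'\<close>. Behind the triple the colours \<open>p\<close> and
        \<open>q\<close> are exchanged: the old tail of \<open>p\<close> is below \<open>x\<close>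
        and may follow \<open>q\<close>, the old tail of \<open>q\<close> is below
        \<open>y < z\<close> and may follow \<open>p\<close>.\<close>
      define hue' where "hue' a = (if a = x then q else if a = z then p
        else if a = y then (if m = [z, x, y] then p else q)
        else if a \<in> set v then (if hue a = p then q else if hue a = q then p else hue a) else hue a)" for a
      have uc: "hue' a = hue a" if "a \<in> set u" for a
        using that notin by (auto simp: hue'_def)
      have vc: "hue' a = (if hue a = p then q else if hue a = q then p else hue a)" if "a \<in> set v" for a
        using that notin by (auto simp: hue'_def)
      have vc_eq: "hue' a = hue' b \<longleftrightarrow> hue a = hue b" "hue' a < k \<longleftrightarrow> hue a < k"
        if "a \<in> set v" "b \<in> set v" for a b
        using vc that p True pq by (auto split: if_splits)
      have m': "dec_colouring k m' hue'"
        using m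
      proof (elim disjE conjE)
        assume m: "m = [z, x, y]" "m' = [x, z, y]"
        then have "hue' x = q" "hue' z = p" "hue' y = p" using xyz by (simp_all add: hue'_def)
        then show ?thesis using xyz pq by (simp add: m(2) dec_colouring_def)
      next
        assume m: "m = [y, z, x]" "m' = [y, x, z]"
        then have "hue' x = q" "hue' z = p" "hue' y = q" using xyz by (simp_all add: hue'_def)
        then show ?thesis using xyz pq by (simp add: m(2) dec_colouring_def)
      qed
      have v': "dec_colouring k v hue'"
        using D unfolding dec_colouring_def by (auto simp: vc_eq elim!: sorted_wrt_mono_rel[rotated])
      have u': "dec_colouring k u hue'" using D dec_colouring_cong[of u hue' hue] uc by blast
      have um: "b < a" if "a \<in> set u" "b \<in> {x, y, z}" "hue' a = hue' b" for a b
        using that(2,3) uc[OF that(1)] U[OF that(1)] Uy[OF that(1)] xyz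
        by (auto simp: hue'_def split: if_splits)
      have uv: "b < a" if ab: "a \<in> set u" "b \<in> set v" "hue' a = hue' b" "hue' a < k" for a b
      proof -
        consider "hue b = p" | "hue b = q" | "hue b \<noteq> p" "hue b \<noteq> q" by blast
        then show ?thesis
        proof cases
          case 1
          then have "hue a = q" using ab uc vc by auto
          then show ?thesis using Uy[OF ab(1)] V[OF ab(2) 1] xyz by simp
        next
          case 2
          then have "hue a = p" using ab uc vc pq by auto
          then show ?thesis using U[OF ab(1)] Vy[OF ab(2) 2] xyz by simp
        next
          case 3
          then show ?thesis using D ab uc vc by auto
        qed
      qed
      have mv: "b < a" if ab: "a \<in> {x, y, z}" "b \<in> set v" "hue' a = hue' b" for a b
      proof -
        have "hue' a = p \<or> hue' a = q" using ab(1) by (auto simp: hue'_def)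
        then consider "hue b = p" "hue' a = q" | "hue b = q" "hue' a = p"
          using ab(3) vc[OF ab(2)] pq by (auto split: if_splits)
        then show ?thesis
        proof cases
          case 1
          then show ?thesis using V[OF ab(2) 1(1)] ab(1) xyz by auto
        next
          case 2
          then have "a \<noteq> x" using pq by (auto simp: hue'_def)
          then show ?thesis using Vy[OF ab(2) 2(1)] ab(1) xyz by auto
        qed
      qed
      have "dec_colouring k (u @ m' @ v) hue'"
        unfolding dec_colouring_split sets using m' v' u' um uv mv by blast
      moreover have "{a \<in> set (u @ m' @ v). hue' a < k} = {a \<in> set (u @ m @ v). hue a < k}"
      proof -
        have "hue' a < k \<longleftrightarrow> hue a < k" if "a \<in> set (u @ m @ v)" for a
        proof (cases "a \<in> {x, y, z}")
          case True
          then show ?thesis using p \<open>q < k\<close> by (auto simp: hue'_def q_def)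
        next
          case False
          then have "a \<in> set u \<or> a \<in> set v" using that sets by auto
          then show ?thesis using uc vc_eq(2) by auto
        qed
        moreover have "set (u @ m' @ v) = set (u @ m @ v)" using sets by simp
        ultimately show ?thesis by auto
      qed
      ultimately show ?thesis using card by (auto simp: dec_family_def)
    qed
  qed
qed

text \<open>In the old order \<open>x\<close> precedes the larger \<open>z\<close>, so they do not
  share a subsequence; with \<open>z\<close> first there is no constraint on them, and the same
  colouring works.\<close>

lemma dec_family_swap_trivial:
  assumes "x < z" "m = [x, z, y] \<and> m' = [z, x, y] \<or> m = [y, x, z] \<and> m' = [y, z, x]"
    and fam: "dec_family k (u @ m @ v) s"
  shows "dec_family k (u @ m' @ v) s"
proof -
  obtain hue where hue: "dec_colouring k (u @ m @ v) hue" and card: "card {a \<in> set (u @ m @ v). hue a < k} = s"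
    using fam by (auto simp: dec_family_def)
  have sets: "set m' = set m" using assms by auto
  have "dec_colouring k m' hue"
    using hue[unfolded dec_colouring_split] assms(1,2) by (auto simp: dec_colouring_def)
  then have "dec_colouring k (u @ m' @ v) hue"
    using hue unfolding dec_colouring_split sets by blast
  then show ?thesis using card sets by (auto simp: dec_family_def)
qed

lemma set_knuth_step: "knuth_step w w' \<Longrightarrow> set w' = set w \<and> (distinct w' \<longleftrightarrow> distinct w)"
  by (induction rule: knuth_step.induct) auto

lemma dec_family_knuth_step:
  assumes "knuth_step w w'" "distinct w"
  shows "dec_family k w s \<longleftrightarrow> dec_family k w' s"
  using assms
proof (induction rule: knuth_step.induct)
  case (left x y z u v)
  show ?case
    using dec_family_swap[OF left(1,2), of u "[y, z, x]" v "[y, x, z]" k s]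
      dec_family_swap_trivial[of x z "[y, x, z]" y "[y, z, x]" k u v s] left by auto
next
  case (right x y z u v)
  show ?case
    using dec_family_swap[OF right(1,2), of u "[z, x, y]" v "[x, z, y]" k s]
      dec_family_swap_trivial[of x z "[x, z, y]" y "[z, x, y]" k u v s] right by auto
qed

lemma dec_family_knuth:
  assumes "knuth w w'" "distinct w"
  shows "distinct w' \<and> (dec_family k w s \<longleftrightarrow> dec_family k w' s)"
  using assms unfolding knuth_def
proof (induction rule: rtranclp_induct)
  case (step y z)
  then show ?case using dec_family_knuth_step set_knuth_step by blast
qed simp

section \<open>The growth diagram of a permutation\<close>

lemma filter_sorted_less_nth:
  "sorted_wrt (<) (r::nat list) \<Longrightarrow> c < length (filter (\<lambda>z. z < i) r) \<longleftrightarrow> c < length r \<and> r ! c < i"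
proof (induction r arbitrary: c)
  case (Cons x r)
  show ?case
  proof (cases "x < i")
    case True
    then show ?thesis using Cons by (cases c) auto
  next
    case False
    then have "filter (\<lambda>z. z < i) r = []" using Cons.prems by (auto simp: filter_empty_conv)
    moreover have "\<not> r ! c < i" if "c < length r" for c
    proof -
      have "x < r ! c" using Cons.prems that by simp
      then show ?thesis using False by simp
    qed
    ultimately show ?thesis using False by (cases c) auto
  qed
qed simp

lemma column_function:
  assumes "distinct (concat T)"
  shows "\<exists>hue. \<forall>p<length T. \<forall>c<length (T ! p). hue (T ! p ! c) = c"
  using assms
proof (induction T)
  case (Cons r rs)
  then obtain hue where hue: "\<forall>p<length rs. \<forall>c<length (rs ! p). hue (rs ! p ! c) = c" by auto
  define hue' where "hue' a = (if a \<in> set r then (THE c. c < length r \<and> r ! c = a) else hue a)" for a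
  have 1: "hue' (r ! c) = c" if "c < length r" for c
  proof -
    have "(THE d. d < length r \<and> r ! d = r ! c) = c"
      using that Cons.prems by (intro the_equality) (auto simp: nth_eq_iff_index_eq)
    then show ?thesis using that by (simp add: hue'_def)
  qed
  have 2: "hue' (rs ! p ! c) = c" if "p < length rs" "c < length (rs ! p)" for p c
  proof -
    have "rs ! p ! c \<in> set (concat rs)" using that unfolding set_concat by (intro UN_I[of "rs ! p"]) auto
    then have "rs ! p ! c \<notin> set r" using Cons.prems by auto
    then show ?thesis using hue that by (simp add: hue'_def)
  qed
  have "hue' ((r # rs) ! p ! c) = c" if "p < length (r # rs)" "c < length ((r # rs) ! p)" for p c
    using that 1 2 by (cases p) auto
  then show ?case by blast
qed simp

text \<open>The reading word lists lower rows first, hence every column from bottom to top, which is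
  decreasing.\<close>

lemma dec_colouring_columns:
  assumes T: "is_tableau T" "distinct (concat T)"
    and hue: "\<forall>p<length T. \<forall>c<length (T ! p). hue (T ! p ! c) = c"
  shows "dec_colouring k (reading_word T) hue"
  using assms
proof (induction T)
  case Nil
  then show ?case by (simp add: dec_colouring_def reading_word_def)
next
  case (Cons r rs)
  have hue_rs: "\<forall>p<length rs. \<forall>c<length (rs ! p). hue (rs ! p ! c) = c"
    and hue_r: "\<forall>c<length r. hue (r ! c) = c"
    using Cons.prems(3) by (metis Suc_less_eq length_Cons nth_Cons_Suc) (use Cons.prems(3) in fastforce)
  have 1: "dec_colouring k (reading_word rs) hue" using Cons hue_rs by auto
  have 2: "dec_colouring k r hue"
    unfolding dec_colouring_def sorted_wrt_iff_nth_less using hue_r by auto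
  have "b < a" if a: "a \<in> set (reading_word rs)" and b: "b \<in> set r" and "hue a = hue b" for a b
  proof -
    obtain p c where p: "p < length rs" "c < length (rs ! p)" "a = rs ! p ! c"
      using a unfolding set_reading_word set_concat by (metis UN_E in_set_conv_nth)
    obtain d where d: "d < length r" "b = r ! d" using b by (metis in_set_conv_nth)
    have "row_above ((r # rs) ! 0) ((r # rs) ! Suc p)"
      using is_tableau_row_above[OF Cons.prems(1), of 0 "Suc p"] p by simp
    moreover have "c = d" using that(3) p d hue_rs hue_r by auto
    ultimately show ?thesis using p d by (simp add: row_above_def)
  qed
  then show ?case
    using 1 2 by (auto simp: dec_colouring_def reading_word_def sorted_wrt_append)
qed

text \<open>In an increasing row the entries below \<open>i\<close> form an initial segment, so each
  row contributes the smaller of \<open>k\<close> and the length of that segment.\<close>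

lemma card_columns:
  assumes T: "\<forall>r\<in>set T. sorted_wrt (<) r" "distinct (concat T)"
    and hue: "\<forall>p<length T. \<forall>c<length (T ! p). hue (T ! p ! c) = c"
  shows "card {a \<in> set (concat T). a < i \<and> hue a < k} = (\<Sum>p<length T. min k (shape (restrict_tableau i T) p))"
  using assms
proof (induction T)
  case (Cons r rs)
  have hue_rs: "\<forall>p<length rs. \<forall>c<length (rs ! p). hue (rs ! p ! c) = c"
    and hue_r: "\<forall>c<length r. hue (r ! c) = c"
    using Cons.prems(3) by (metis Suc_less_eq length_Cons nth_Cons_Suc) (use Cons.prems(3) in fastforce)
  have IH: "card {a \<in> set (concat rs). a < i \<and> hue a < k} = (\<Sum>p<length rs. min k (shape (restrict_tableau i rs) p))"
    using Cons hue_rs by auto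
  have r: "sorted_wrt (<) r" "distinct r" using Cons.prems by auto
  let ?N = "min k (length (filter (\<lambda>z. z < i) r))"
  have "{a \<in> set r. a < i \<and> hue a < k} = (!) r ` {..<?N}"
  proof (intro equalityI subsetI)
    fix a assume "a \<in> {a \<in> set r. a < i \<and> hue a < k}"
    then obtain c where "c < length r" "a = r ! c" "r ! c < i" "hue (r ! c) < k"
      by (auto simp: in_set_conv_nth)
    then show "a \<in> (!) r ` {..<?N}"
      using hue_r filter_sorted_less_nth[OF r(1), of c i] by auto
  next
    fix a assume "a \<in> (!) r ` {..<?N}"
    then obtain c where "c < k" "c < length (filter (\<lambda>z. z < i) r)" "a = r ! c" by auto
    then show "a \<in> {a \<in> set r. a < i \<and> hue a < k}"
      using hue_r filter_sorted_less_nth[OF r(1), of c i] by auto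
  qed
  moreover have "inj_on ((!) r) {..<?N}"
  proof -
    have "?N \<le> length r" by (meson length_filter_le min.coboundedI2)
    then show ?thesis using r(2) by (intro inj_onI) (auto simp: nth_eq_iff_index_eq)
  qed
  ultimately have cr: "card {a \<in> set r. a < i \<and> hue a < k} = ?N" by (simp add: card_image)
  have "{a \<in> set (concat (r # rs)). a < i \<and> hue a < k} =
      {a \<in> set r. a < i \<and> hue a < k} \<union> {a \<in> set (concat rs). a < i \<and> hue a < k}" by auto
  moreover have "{a \<in> set r. a < i \<and> hue a < k} \<inter> {a \<in> set (concat rs). a < i \<and> hue a < k} = {}"
    using Cons.prems by auto
  ultimately have "card {a \<in> set (concat (r # rs)). a < i \<and> hue a < k} =
      ?N + (\<Sum>p<length rs. min k (shape (restrict_tableau i rs) p))"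
    using cr IH by (subst \<open>_ = _ \<union> _\<close>, subst card_Un_disjoint) auto
  then show ?case by (simp add: sum.lessThan_Suc_shift del: sum.lessThan_Suc)
qed simp

lemma shape_restrict_antimono:
  assumes "is_tableau T" "p \<le> q"
  shows "shape (restrict_tableau i T) q \<le> shape (restrict_tableau i T) p"
proof (cases "q < length T \<and> p < q")
  case True
  then have above: "row_above (T ! p) (T ! q)" using is_tableau_row_above assms by blast
  have srt: "sorted_wrt (<) (T ! p)" "sorted_wrt (<) (T ! q)"
    using is_tableau_rows[OF assms(1)] True by auto
  have "length (filter (\<lambda>z. z < i) (T ! q)) \<le> length (filter (\<lambda>z. z < i) (T ! p))"
  proof (rule ccontr)
    assume "\<not> ?thesis"
    define c where "c = length (filter (\<lambda>z. z < i) (T ! p))"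
    then have "c < length (filter (\<lambda>z. z < i) (T ! q))" using \<open>\<not> _\<close> by simp
    then have "c < length (T ! q)" "T ! q ! c < i" using filter_sorted_less_nth[OF srt(2)] by auto
    then have "c < length (T ! p)" "T ! p ! c < i" using above by (auto simp: row_above_def)
    then have "c < length (filter (\<lambda>z. z < i) (T ! p))" using filter_sorted_less_nth[OF srt(1)] by blast
    then show False by (simp add: c_def)
  qed
  then show ?thesis using True by (simp add: shape_def)
next
  case False
  then show ?thesis using assms by (cases "p = q") (auto simp: shape_def)
qed

text \<open>With the bound \<open>s m\<close>, rows before \<open>m\<close> are cut to exactly
  \<open>s m\<close> and all later rows are counted in full. This is what singles out
  \<open>k = s m\<close> among the numbers of columns in Greene's theorem.\<close>

lemma sum_min_eq_tails:
  assumes anti: "\<And>p q. p \<le> q \<Longrightarrow> s q \<le> (s p :: nat)" and N: "\<And>r. N \<le> r \<Longrightarrow> s r = 0"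
  shows "(\<Sum>p<N. min (s m) (s p)) = m * s m + tails s m"
proof (cases "m < N")
  case True
  have "{..<N} = {..<m} \<union> {m..<N}" using True by auto
  then have "(\<Sum>p<N. min (s m) (s p)) = (\<Sum>p<m. min (s m) (s p)) + (\<Sum>p\<in>{m..<N}. min (s m) (s p))"
    by (simp add: sum.union_disjoint ivl_disj_int)
  also have "(\<Sum>p<m. min (s m) (s p)) = (\<Sum>p<m. s m)" using anti by (intro sum.cong) (auto simp: min_def)
  also have "(\<Sum>p\<in>{m..<N}. min (s m) (s p)) = (\<Sum>p\<in>{m..<N}. s p)"
    using anti by (intro sum.cong) (auto simp: min_def intro: antisym)
  finally show ?thesis by (simp add: tails_eq_sum[OF N])
next
  case False
  then show ?thesis using N[of m] by (simp add: tails_eq_sum[OF N])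
qed

text \<open>The growth diagram of \<open>s\<close>: \<open>j\<close> bounds positions and
  \<open>i\<close> bounds values, so the entry depends on the points of the permutation in a j by i
  rectangle.\<close>

definition RS_shapes :: "(nat \<Rightarrow> nat) \<Rightarrow> nat \<Rightarrow> nat \<Rightarrow> nat \<Rightarrow> nat" where
  "RS_shapes s i j = shape (restrict_tableau i (fst (RS j s)))"

lemma RS_0 [simp]: "RS 0 s = ([], [])"
  by (simp add: RS_def)

lemma RS_Suc:
  "RS (Suc n) s = (fst (schensted_insert (s n) (fst (RS n s))),
     add_entry (snd (schensted_insert (s n) (fst (RS n s)))) n (snd (RS n s)))"
  by (simp add: RS_def split: prod.splits)

lemma RS_tableau:
  assumes "inj_on s {..<n}"
  shows "is_tableau (fst (RS n s)) \<and> distinct (concat (fst (RS n s))) \<and>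
    set (concat (fst (RS n s))) = s ` {..<n} \<and> knuth (map s [0..<n]) (reading_word (fst (RS n s)))"
  using assms
proof (induction n)
  case 0
  then show ?case by (simp add: reading_word_def)
next
  case (Suc n)
  let ?T = "fst (RS n s)"
  have IH: "is_tableau ?T" "distinct (concat ?T)" "set (concat ?T) = s ` {..<n}"
    "knuth (map s [0..<n]) (reading_word ?T)"
    using Suc by (auto simp: lessThan_Suc)
  have new: "s n \<notin> set (concat ?T)"
    unfolding IH(3) using inj_on_image_mem_iff[OF Suc.prems, of n "{..<n}"] by auto
  have "knuth (map s [0..<n] @ [s n]) (reading_word ?T @ [s n])"
    using knuth_context[OF IH(4), of "[]" "[s n]"] by simp
  then have "knuth (map s [0..<Suc n]) (reading_word (fst (schensted_insert (s n) ?T)))"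
    using knuth_trans knuth_schensted_insert[OF is_tableau_rows[OF IH(1)] IH(2) new] by fastforce
  moreover have "set (concat (fst (schensted_insert (s n) ?T))) = s ` {..<Suc n}"
    using set_schensted_insert[of "s n" ?T] IH(3) by (auto simp: lessThan_Suc)
  ultimately show ?case
    using is_tableau_schensted_insert[OF IH(1,2) new] distinct_schensted_insert[OF IH(2) new]
    unfolding RS_Suc by simp
qed

lemma RS_shapes_config:
  assumes "inj_on s {..<Suc j}"
  shows "\<exists>config \<in> {RS0_config, RS1_config, RS2_config, RS3_config}.
     config (RS_shapes s i j) (RS_shapes s i (Suc j)) (RS_shapes s (Suc i) j) (RS_shapes s (Suc i) (Suc j))"
    and RS_shapes_octahedron: "min (tails (RS_shapes s i (Suc j)) m + tails (RS_shapes s (Suc i) j) (Suc m))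
      (tails (RS_shapes s i (Suc j)) (Suc m) + tails (RS_shapes s (Suc i) j) m)
    \<le> tails (RS_shapes s i j) m + tails (RS_shapes s (Suc i) (Suc j)) (Suc m)"
proof -
  have inj: "inj_on s {..<j}" using assms by (rule inj_on_subset) auto
  note T = RS_tableau[OF inj]
  have new: "s j \<notin> set (concat (fst (RS j s)))"
    using inj_on_image_mem_iff[OF assms, of j "{..<j}"] T by auto
  have "fst (RS (Suc j) s) = fst (schensted_insert (s j) (fst (RS j s)))" by (simp add: RS_Suc)
  note * = is_tableau_rows[OF conjunct1[OF T]] conjunct1[OF conjunct2[OF T]] new this
  show "\<exists>config \<in> {RS0_config, RS1_config, RS2_config, RS3_config}.
     config (RS_shapes s i j) (RS_shapes s i (Suc j)) (RS_shapes s (Suc i) j) (RS_shapes s (Suc i) (Suc j))"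
    unfolding RS_shapes_def by (rule growth_config[OF *])
  show "min (tails (RS_shapes s i (Suc j)) m + tails (RS_shapes s (Suc i) j) (Suc m))
      (tails (RS_shapes s i (Suc j)) (Suc m) + tails (RS_shapes s (Suc i) j) m)
    \<le> tails (RS_shapes s i j) m + tails (RS_shapes s (Suc i) (Suc j)) (Suc m)"
    unfolding RS_shapes_def by (rule growth_octahedron[OF *])
qed

lemma finite_support_RS_shapes: "finite {r. RS_shapes s i j r \<noteq> 0}"
  unfolding RS_shapes_def by (rule finite_support_shape)

lemma RS_shapes_0_left [simp]: "RS_shapes s 0 j = (\<lambda>_. 0)"
  and RS_shapes_0_right [simp]: "RS_shapes s i 0 = (\<lambda>_. 0)"
  by (auto simp: RS_shapes_def shape_def fun_eq_iff)

text \<open>The existence half of Greene's theorem. The columns of the insertion tableau give the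
  family for the reading word; Knuth equivalence, which survives the restriction to values below
  \<open>i\<close>, carries it to the word of \<open>s\<close>.\<close>

lemma RS_shapes_dec_family:
  assumes "inj_on s {..<j}"
  shows "dec_family (RS_shapes s i j m) (filter (\<lambda>a. a < i) (map s [0..<j]))
    (m * RS_shapes s i j m + tails (RS_shapes s i j) m)"
proof -
  let ?T = "fst (RS j s)" and ?k = "RS_shapes s i j m"
  note T = RS_tableau[OF assms]
  obtain hue where hue: "\<forall>p<length ?T. \<forall>c<length (?T ! p). hue (?T ! p ! c) = c"
    using column_function T by blast
  have "dec_colouring ?k (reading_word ?T) hue"
    using dec_colouring_columns[OF _ _ hue] T by blast
  then have 1: "dec_colouring ?k (filter (\<lambda>a. a < i) (reading_word ?T)) hue"
    unfolding dec_colouring_def by (rule sorted_wrt_filter)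
  have "card {a \<in> set (concat ?T). a < i \<and> hue a < ?k} = (\<Sum>p<length ?T. min ?k (RS_shapes s i j p))"
    unfolding RS_shapes_def using card_columns[OF is_tableau_rows _ hue] T by blast
  also have "\<dots> = m * ?k + tails (RS_shapes s i j) m"
  proof (rule sum_min_eq_tails)
    show "RS_shapes s i j q \<le> RS_shapes s i j p" if "p \<le> q" for p q
      unfolding RS_shapes_def using shape_restrict_antimono that T by blast
    show "RS_shapes s i j r = 0" if "length ?T \<le> r" for r
      using that by (simp add: RS_shapes_def shape_def)
  qed
  finally have "card {a \<in> set (filter (\<lambda>a. a < i) (reading_word ?T)). hue a < ?k} =
      m * ?k + tails (RS_shapes s i j) m"
    by (simp add: set_reading_word conj_assoc del: set_concat)
  with 1 have fam: "dec_family ?k (filter (\<lambda>a. a < i) (reading_word ?T)) (m * ?k + tails (RS_shapes s i j) m)"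
    by (auto simp: dec_family_def)
  have "distinct (map s [0..<j])" using assms by (simp add: distinct_map atLeast0LessThan)
  then have "distinct (filter (\<lambda>a. a < i) (map s [0..<j]))" by (rule distinct_filter)
  then show ?thesis using dec_family_knuth[OF knuth_filter] T fam by blast
qed

lemma tails_RS_shapes_0:
  assumes "inj_on s {..<j}"
  shows "tails (RS_shapes s i j) 0 = card {p. p < j \<and> s p < i}"
proof -
  let ?T = "fst (RS j s)"
  note T = RS_tableau[OF assms]
  have "tails (RS_shapes s i j) 0 = (\<Sum>p\<in>{0..<length ?T}. RS_shapes s i j p)"
    by (rule tails_eq_sum) (simp add: RS_shapes_def shape_def)
  also have "\<dots> = length (filter (\<lambda>z. z < i) (concat ?T))"
    unfolding RS_shapes_def by (induction ?T arbitrary: rule: list.induct)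
      (auto simp: shape_def filter_concat length_concat sum_list_sum_nth o_def)
  also have "\<dots> = card {a \<in> s ` {..<j}. a < i}"
    using T distinct_card[of "filter (\<lambda>z. z < i) (concat ?T)"] by auto
  also have "{a \<in> s ` {..<j}. a < i} = s ` {p. p < j \<and> s p < i}" by auto
  also have "card \<dots> = card {p. p < j \<and> s p < i}"
    using assms by (intro card_image) (auto simp: inj_on_def)
  finally show ?thesis .
qed

section \<open>Partitions and standard tableaux\<close>

lemma less_ptranspose_iff:
  assumes "is_partition l"
  shows "i < ptranspose l m \<longleftrightarrow> m < l i"
proof -
  have anti: "l q \<le> l p" if "p \<le> q" for p q using assms that by (auto simp: is_partition_def antimono_def)
  obtain N where N: "\<And>r. N \<le> r \<Longrightarrow> l r = 0"
    using finite_support_bound[of l] assms by (auto simp: is_partition_def)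
  define M where "M = (LEAST i. \<not> m < l i)"
  have M: "\<not> m < l M" unfolding M_def by (rule LeastI[of _ N]) (simp add: N)
  have "{i. m < l i} = {..<M}"
  proof (intro equalityI subsetI)
    fix i assume "i \<in> {i. m < l i}"
    then show "i \<in> {..<M}" using M anti[of M i] by (cases "M \<le> i") auto
  next
    fix i assume "i \<in> {..<M}"
    then show "i \<in> {i. m < l i}" using not_less_Least[of i "\<lambda>i. \<not> m < l i"] by (simp add: M_def)
  qed
  then have "ptranspose l m = M" by (simp add: ptranspose_def young_diagram_def)
  then show ?thesis using \<open>{i. m < l i} = {..<M}\<close> by auto
qed

lemma is_partition_ptranspose:
  assumes "is_partition l"
  shows "is_partition (ptranspose l)"
proof -
  note iff = less_ptranspose_iff[OF assms]
  have "ptranspose l q \<le> ptranspose l p" if "p \<le> q" for p q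
    using iff[of "ptranspose l p" q] iff[of "ptranspose l p" p] that by fastforce
  moreover have "ptranspose l r = 0" if "l 0 \<le> r" for r
    using iff[of 0 r] that by simp
  then have "finite {r. ptranspose l r \<noteq> 0}"
    by (metis (mono_tags, lifting) bounded_nat_set_is_finite linorder_not_le mem_Collect_eq)
  ultimately show ?thesis by (auto simp: is_partition_def antimono_def)
qed

lemma partition_eqI:
  assumes "is_partition l" "is_partition l'" "ptranspose l = ptranspose l'"
  shows "l = l'"
proof
  fix i
  have "m < l i \<longleftrightarrow> m < l' i" for m
    using less_ptranspose_iff[OF assms(1), of i m] less_ptranspose_iff[OF assms(2), of i m] assms(3) by simp
  from this[of "l i"] this[of "l' i"] show "l i = l' i" by simp
qed

lemma finite_young_diagram:
  assumes "is_partition l"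
  shows "finite (young_diagram l)"
proof -
  obtain N where N: "\<And>r. N \<le> r \<Longrightarrow> l r = 0"
    using finite_support_bound[of l] assms by (auto simp: is_partition_def)
  have "l i \<le> l 0" for i using assms by (auto simp: is_partition_def antimono_def)
  then have "young_diagram l \<subseteq> {..<N} \<times> {..<l 0}"
    unfolding young_diagram_def
  proof (clarsimp)
    fix i j assume le: "\<And>i. l i \<le> l 0" and j: "j < l i"
    show "i < N \<and> j < l 0" using N[of i] le[of i] j by (cases "N \<le> i") auto
  qed
  then show ?thesis by (rule finite_subset) simp
qed

lemma card_young_diagram_ge:
  assumes "is_partition l"
  shows "card {(i, j) \<in> young_diagram l. m \<le> j} = tails (ptranspose l) m"
proof -
  have le: "l i \<le> l 0" for i using assms by (auto simp: is_partition_def antimono_def)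
  have fin: "finite {i. j < l i}" for j
    using assms by (auto simp: is_partition_def intro: rev_finite_subset)
  have "j < l 0" if "j < l i" for i j using le[of i] that by simp
  then have "{(i, j) \<in> young_diagram l. m \<le> j} = (\<lambda>(j, i). (i, j)) ` (SIGMA j:{m..<l 0}. {i. j < l i})"
    by (auto simp: young_diagram_def image_iff)
  moreover have "inj_on (\<lambda>(j, i). (i, j)) (SIGMA j:{m..<l 0}. {i. j < l i})"
    by (auto simp: inj_on_def)
  ultimately have "card {(i, j) \<in> young_diagram l. m \<le> j} = card (SIGMA j:{m..<l 0}. {i. j < l i})"
    by (simp add: card_image)
  also have "\<dots> = (\<Sum>j\<in>{m..<l 0}. ptranspose l j)"
    using fin by (simp add: card_SigmaI ptranspose_def young_diagram_def)
  also have "\<dots> = tails (ptranspose l) m"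
  proof (rule tails_eq_sum[symmetric])
    show "ptranspose l r = 0" if "l 0 \<le> r" for r
      using less_ptranspose_iff[OF assms, of 0 r] that by simp
  qed
  finally show ?thesis .
qed

lemma psize_eq_tails_ptranspose:
  assumes "is_partition l"
  shows "psize l = tails (ptranspose l) 0"
proof -
  obtain N where N: "\<And>r. N \<le> r \<Longrightarrow> l r = 0"
    using finite_support_bound[of l] assms by (auto simp: is_partition_def)
  have "young_diagram l = (SIGMA i:{0..<N}. {..<l i})"
    using N by (auto simp: young_diagram_def) (metis not_le not_less_zero)
  then have "card (young_diagram l) = (\<Sum>i\<in>{0..<N}. l i)" by (simp add: card_SigmaI)
  also have "\<dots> = psize l" unfolding psize_eq_tails by (rule tails_eq_sum[OF N, symmetric])
  finally show ?thesis using card_young_diagram_ge[OF assms, of 0] by simp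
qed

lemma partition_eqI_tails:
  assumes "is_partition l" "is_partition l'" "\<And>m. tails (ptranspose l) m = tails (ptranspose l') m"
  shows "l = l'"
proof (rule partition_eqI[OF assms(1,2)], rule ext)
  fix m
  have fin: "finite {r. ptranspose l r \<noteq> 0}" "finite {r. ptranspose l' r \<noteq> 0}"
    using assms(1,2)[THEN is_partition_ptranspose] by (auto simp: is_partition_def)
  show "ptranspose l m = ptranspose l' m"
    using tails_Suc[OF fin(1), of m] tails_Suc[OF fin(2), of m] assms(3) by simp
qed

text \<open>Consecutive differences of tail sums are column lengths. A difference of 1 exactly below
  \<open>c\<close> therefore means one additional box, in column \<open>c - 1\<close>.\<close>

lemma covered_by_tails:
  assumes l: "is_partition l" and k: "is_partition k" and "0 < c"
    and t: "\<And>m. tails (ptranspose l) m = tails (ptranspose k) m + (if m < c then 1 else 0)"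
  shows "covered_by k l"
proof -
  have fin: "finite {r. ptranspose l r \<noteq> 0}" "finite {r. ptranspose k r \<noteq> 0}"
    using l k is_partition_ptranspose by (auto simp: is_partition_def)
  have "ptranspose k m \<le> ptranspose l m" for m
    using tails_Suc[OF fin(1), of m] tails_Suc[OF fin(2), of m] t[of m] t[of "Suc m"]
    by (auto split: if_splits)
  then have "m < l i" if "m < k i" for m i
    using that less_ptranspose_iff[OF k, of i m] less_ptranspose_iff[OF l, of i m] less_le_trans by blast
  then have "young_diagram k \<subseteq> young_diagram l" by (auto simp: young_diagram_def)
  then show ?thesis
    using t[of 0] \<open>0 < c\<close> by (simp add: covered_by_def psize_eq_tails_ptranspose l k)
qed

lemma covered_by_imp_add_box:
  assumes "covered_by k l" "is_partition l" "is_partition k"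
  obtains r where "l = add_box k r"
proof -
  have le: "k i \<le> l i" for i
    using assms(1) unfolding covered_by_def young_diagram_def
    by (metis (mono_tags, lifting) case_prod_conv in_mono linorder_not_less mem_Collect_eq order_less_irrefl)
  have fin: "finite {r. l r \<noteq> 0}" "finite {r. k r \<noteq> 0}" using assms by (auto simp: is_partition_def)
  have "\<exists>r. k r \<noteq> l r" using assms(1) unfolding covered_by_def by (metis ext n_not_Suc_n Suc_eq_plus1)
  then obtain r where r: "k r < l r" using le by (metis order_le_imp_less_or_eq)
  obtain N where N: "\<And>r. N \<le> r \<Longrightarrow> l r = 0" using finite_support_bound[OF fin(1)] by blast
  have le': "add_box k r i \<le> l i" for i using le r by (simp add: add_box_def Suc_leI)
  have N'': "add_box k r i = 0" if "N \<le> i" for i using le'[of i] N[OF that] by simp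
  have "(\<Sum>i\<in>{0..<N}. add_box k r i) = (\<Sum>i\<in>{0..<N}. l i)"
  proof -
    have "tails (add_box k r) 0 = tails k 0 + 1" using tails_add_box[OF fin(2), of r 0] by simp
    also have "\<dots> = tails l 0" using assms(1) by (simp add: covered_by_def psize_eq_tails)
    finally show ?thesis by (simp add: tails_eq_sum[OF N] tails_eq_sum[OF N''])
  qed
  then have "add_box k r i = l i" if "i < N" for i
    using sum_mono_inv[of "add_box k r" "{0..<N}" l i] le' that by auto
  then have "l = add_box k r" using N N'' by (metis ext not_le)
  then show thesis by (rule that)
qed

section \<open>Standard tableaux as chains of shapes\<close>

lemma mset_concat_add_entry: "mset (concat (add_entry r x T)) = add_mset x (mset (concat T))"
proof (induction T arbitrary: r)
  case Nil
  then show ?case by (simp add: add_entry_def)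
next
  case (Cons t T)
  show ?case
  proof (cases r)
    case 0
    then show ?thesis by (simp add: add_entry_def)
  next
    case (Suc r')
    then show ?thesis using Cons[of r'] by (auto simp: add_entry_def split: if_splits)
  qed
qed

lemma shape_add_entry: "r \<le> length T \<Longrightarrow> shape (add_entry r x T) = add_box (shape T) r"
  by (auto simp: shape_def add_entry_def add_box_def fun_eq_iff nth_append nth_list_update)

lemma length_add_entry: "r \<le> length T \<Longrightarrow> length (add_entry r x T) = max (length T) (Suc r)"
  by (auto simp: add_entry_def)

lemma shape_restrict_add_entry:
  "m \<le> x \<Longrightarrow> shape (restrict_tableau m (add_entry r x T)) = shape (restrict_tableau m T)"
  by (auto simp: shape_def add_entry_def fun_eq_iff nth_append nth_list_update)

lemma restrict_tableau_all: "set (concat T) \<subseteq> {..<m} \<Longrightarrow> restrict_tableau m T = T"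
  by (intro map_idI filter_True) auto

lemma is_tableau_iff:
  "is_tableau T \<longleftrightarrow> (\<forall>r\<in>set T. sorted_wrt (<) r) \<and> (\<forall>p. Suc p < length T \<longrightarrow> row_above (T ! p) (T ! Suc p))"
proof (induction T)
  case (Cons r T)
  have "(\<forall>p. Suc p < length (r # T) \<longrightarrow> row_above ((r # T) ! p) ((r # T) ! Suc p)) \<longleftrightarrow>
    (T \<noteq> [] \<longrightarrow> row_above r (hd T)) \<and> (\<forall>p. Suc p < length T \<longrightarrow> row_above (T ! p) (T ! Suc p))" (is "?L \<longleftrightarrow> ?R")
  proof
    assume L: ?L
    have "row_above r (hd T)" if "T \<noteq> []" using L[rule_format, of 0] that by (simp add: hd_conv_nth)
    moreover have "row_above (T ! p) (T ! Suc p)" if "Suc p < length T" for p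
      using L[rule_format, of "Suc p"] that by simp
    ultimately show ?R by blast
  next
    assume R: ?R
    show ?L
    proof (intro allI impI)
      fix p assume "Suc p < length (r # T)"
      then show "row_above ((r # T) ! p) ((r # T) ! Suc p)"
        using R by (cases p) (auto simp: hd_conv_nth)
    qed
  qed
  then show ?case using Cons by auto
qed simp

lemma is_tableau_columns:
  assumes "is_tableau T" "c \<in> set (List.transpose T)"
  shows "sorted_wrt (<) c"
proof -
  obtain i where i: "i < length (List.transpose T)" "c = List.transpose T ! i"
    using assms(2) by (metis in_set_conv_nth)
  have "sorted_wrt row_above T"
    unfolding sorted_wrt_iff_nth_less using is_tableau_row_above[OF assms(1)] by blast
  then have "sorted_wrt row_above (filter (\<lambda>ys. i < length ys) T)" by (rule sorted_wrt_filter)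
  then have "sorted_wrt (\<lambda>r r'. r ! i < r' ! i) (filter (\<lambda>ys. i < length ys) T)"
    by (rule sorted_wrt_mono_rel[rotated]) (auto simp: row_above_def)
  then show ?thesis using i by (simp add: nth_transpose sorted_wrt_map)
qed

text \<open>The new entry exceeds all others, so only the existence of a box above it is in
  question, and that follows from the monotonicity of the enlarged shape.\<close>

lemma is_tableau_add_entry:
  assumes T: "is_tableau T" "set (concat T) \<subseteq> {..<x}" and r: "r \<le> length T"
    and anti: "antimono (add_box (shape T) r)"
  shows "is_tableau (add_entry r x T)"
proof -
  have lt: "y < x" if "p < length T" "y \<in> set (T ! p)" for p y
    using T(2) that by (auto dest: nth_mem)
  have sh: "shape T p = length (T ! p)" if "p < length T" for p using that by (simp add: shape_def)
  have rows: "\<forall>t\<in>set T. sorted_wrt (<) t" and ab: "\<And>p. Suc p < length T \<Longrightarrow> row_above (T ! p) (T ! Suc p)"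
    using T(1) by (auto simp: is_tableau_iff)
  have dec: "add_box (shape T) r (Suc p) \<le> add_box (shape T) r p" for p
    using anti by (simp add: antimono_def)
  have new: "row_above (T ! p) (t @ [x])" if p: "p < length T" "Suc p = r" and t: "length t < length (T ! p)"
    "\<And>c. c < length t \<Longrightarrow> T ! p ! c < t ! c" for p t
    using t lt[OF p(1)] by (auto simp: row_above_def nth_append less_Suc_eq)
  show ?thesis
  proof (cases "r < length T")
    case True
    have E: "add_entry r x T = T[r := T ! r @ [x]]" using True by (simp add: add_entry_def)
    have "sorted_wrt (<) (T ! r @ [x])" using rows True lt[OF True] by (auto simp: sorted_wrt_append)
    then have "\<forall>t\<in>set (T[r := T ! r @ [x]]). sorted_wrt (<) t"
      using rows by (auto dest: subsetD[OF set_update_subset_insert])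
    moreover have "row_above (T[r := T ! r @ [x]] ! p) (T[r := T ! r @ [x]] ! Suc p)"
      if p: "Suc p < length T" for p
    proof -
      consider "p = r" | "Suc p = r" | "p \<noteq> r" "Suc p \<noteq> r" by blast
      then show ?thesis
      proof cases
        case 1
        then show ?thesis using ab[OF p] p by (auto simp: row_above_def nth_append)
      next
        case 2
        have "length (T ! r) < length (T ! p)"
          using dec[of p] 2 p True sh[of p] sh[of r] by (auto simp: add_box_def)
        then show ?thesis using 2 p new[of p "T ! r"] ab[OF p] by (auto simp: row_above_def)
      next
        case 3
        then show ?thesis using ab[OF p] by simp
      qed
    qed
    ultimately show ?thesis unfolding E is_tableau_iff by simp
  next
    case False
    then have r: "r = length T" using r by simp
    have E: "add_entry r x T = T @ [[x]]" using False by (simp add: add_entry_def)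
    have "row_above ((T @ [[x]]) ! p) ((T @ [[x]]) ! Suc p)" if p: "Suc p < length (T @ [[x]])" for p
    proof (cases "Suc p < length T")
      case True
      then show ?thesis using ab[OF True] by (simp add: nth_append)
    next
      case False
      then have p': "Suc p = r" "p < length T" using p r by auto
      have "0 < length (T ! p)"
        using dec[of p] p' sh[of p] r by (auto simp: add_box_def shape_def)
      then show ?thesis using new[of p "[]"] p' r by (simp add: nth_append)
    qed
    then show ?thesis unfolding E is_tableau_iff using rows by auto
  qed
qed

text \<open>The box by which \<open>K (Suc n)\<close> exceeds \<open>K n\<close> receives the entry
  \<open>n\<close>. Restrictions to smaller bounds do not see it, so the earlier shapes
  persist.\<close>

lemma SYT_chain_exists:
  assumes "K 0 = (\<lambda>_. 0)" "\<And>i. i \<le> n \<Longrightarrow> is_partition (K i)" "\<And>i. i < n \<Longrightarrow> covered_by (K i) (K (Suc i))"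
  shows "psize (K n) = n \<and> (\<exists>T. T \<in> SYT (K n) \<and> is_tableau T \<and> (\<forall>m\<le>n. shape (restrict_tableau m T) = K m))"
  using assms
proof (induction n)
  case 0
  have "[] \<in> SYT (K 0)" using 0 by (auto simp: SYT_def psize_def)
  then show ?case using 0 by (auto simp: psize_def intro!: exI[of _ "[]"])
next
  case (Suc n)
  then obtain T where T: "T \<in> SYT (K n)" "is_tableau T" "\<And>m. m \<le> n \<Longrightarrow> shape (restrict_tableau m T) = K m"
    and size: "psize (K n) = n" by fastforce
  have part: "is_partition (K n)" "is_partition (K (Suc n))" using Suc.prems(2) by auto
  obtain r where r: "K (Suc n) = add_box (K n) r"
    using covered_by_imp_add_box[OF Suc.prems(3) part(2,1)] by auto
  have shape: "shape T = K n" and set_T: "set (concat T) = {..<n}" and dist: "distinct (concat T)" and ne: "[] \<notin> set T"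
    using T(1) size by (auto simp: SYT_def)
  have anti: "antimono (add_box (shape T) r)" using part(2) r shape by (simp add: is_partition_def)
  have rle: "r \<le> length T"
  proof (rule ccontr)
    assume "\<not> r \<le> length T"
    then have "shape T (length T) = 0" "length T < r" by (auto simp: shape_def)
    moreover have "add_box (shape T) r r \<le> add_box (shape T) r (length T)"
      using anti \<open>length T < r\<close> by (simp add: antimono_def)
    ultimately show False by (simp add: add_box_def)
  qed
  define T' where "T' = add_entry r n T"
  have tab: "is_tableau T'" unfolding T'_def using is_tableau_add_entry[OF T(2) _ rle anti] set_T by simp
  have size': "psize (K (Suc n)) = Suc n" using Suc.prems(3)[of n] size by (simp add: covered_by_def)
  have ms: "mset (concat T') = add_mset n (mset (concat T))"
    unfolding T'_def by (rule mset_concat_add_entry)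
  have "set (concat T') = insert n (set (concat T))"
    using arg_cong[OF ms, of set_mset] by (simp only: set_mset_mset set_mset_add_mset_insert)
  then have set_T': "set (concat T') = {..<Suc n}" using set_T by auto
  have "mset (concat T') = mset (n # concat T)" using ms by simp
  then have dist': "distinct (concat T')"
    using mset_eq_imp_distinct_iff[of "concat T'" "n # concat T"] dist set_T by auto
  have ne': "[] \<notin> set T'"
    using ne unfolding T'_def add_entry_def by (auto dest: subsetD[OF set_update_subset_insert])
  have shape': "shape T' = K (Suc n)" unfolding T'_def shape_add_entry[OF rle] shape r ..
  have "T' \<in> SYT (K (Suc n))"
    unfolding SYT_def using part(2) ne' shape' dist' set_T' size' is_tableau_rows[OF tab] is_tableau_columns[OF tab]
    by auto
  moreover have "shape (restrict_tableau m T') = K m" if "m \<le> Suc n" for m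
  proof (cases "m = Suc n")
    case True
    then show ?thesis using restrict_tableau_all[of T' m] set_T' shape' by simp
  next
    case False
    then show ?thesis using that T(3)[of m] unfolding T'_def by (simp add: shape_restrict_add_entry)
  qed
  ultimately show ?case using tab size' by blast
qed

text \<open>An entry \<open>x\<close> lies in row \<open>p\<close> precisely when that row grows
  between the restrictions to \<open>x\<close> and to \<open>Suc x\<close>; an increasing row is
  determined by its set.\<close>

lemma SYT_eqI:
  assumes T: "T \<in> SYT l" and T': "T' \<in> SYT l"
    and eq: "\<And>m. m \<le> psize l \<Longrightarrow> shape (restrict_tableau m T) = shape (restrict_tableau m T')"
  shows "T = T'"
proof (rule nth_equalityI)
  have len: "p < length T \<longleftrightarrow> l p \<noteq> 0" if "T \<in> SYT l" for p T
  proof -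
    have "shape T = l" "[] \<notin> set T" using that by (auto simp: SYT_def)
    then show ?thesis by (metis length_0_conv nth_mem shape_def)
  qed
  show leneq: "length T = length T'" 
    using len[OF T, of "length T"] len[OF T', of "length T"] len[OF T, of "length T'"] len[OF T', of "length T'"]
    by auto
  fix p assume p: "p < length T"
  have srt: "sorted_wrt (<) (T ! p)" "sorted_wrt (<) (T' ! p)" using T T' p leneq by (auto simp: SYT_def)
  then have dist: "distinct (T ! p)" "distinct (T' ! p)" by (auto simp: strict_sorted_iff)
  have sub: "set (T ! p) \<subseteq> {..<psize l}" "set (T' ! p) \<subseteq> {..<psize l}"
    using T T' p leneq by (auto simp: SYT_def)
  have "x \<in> set (T ! p) \<longleftrightarrow> x \<in> set (T' ! p)" if x: "x < psize l" for x
  proof -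
    have "length (filter (\<lambda>z. z < m) (T ! p)) = length (filter (\<lambda>z. z < m) (T' ! p))" if "m \<le> psize l" for m
      using fun_cong[OF eq[OF that], of p] p leneq by (simp add: shape_def)
    from this[of x] this[of "Suc x"] x show ?thesis
      using length_filter_less_Suc[OF dist(1), of x] length_filter_less_Suc[OF dist(2), of x]
      by (auto split: if_splits)
  qed
  then have "set (T ! p) = set (T' ! p)" using sub by blast
  then show "T ! p = T' ! p" using srt strict_sorted_equal by blast
qed

lemma ch_eq_iff:
  assumes "T \<in> SYT l" "psize l = n"
  shows "ch T = map K (rev [0..<Suc n]) \<longleftrightarrow> (\<forall>m\<le>n. shape (restrict_tableau m T) = K m)"
proof -
  have "length (concat T) = n" using assms distinct_card[of "concat T"] by (auto simp: SYT_def)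
  then have "ch T = map (\<lambda>m. shape (restrict_tableau m T)) (rev [0..<Suc n])" by (simp only: ch_def)
  then show ?thesis by (auto simp: rev_map[symmetric] less_Suc_eq_le)
qed

lemma SYT_chain_ex1:
  assumes "K 0 = (\<lambda>_. 0)" "\<And>i. i \<le> n \<Longrightarrow> is_partition (K i)" "\<And>i. i < n \<Longrightarrow> covered_by (K i) (K (Suc i))"
  shows "\<exists>!T. T \<in> SYT (K n) \<and> ch T = map K (rev [0..<Suc n])"
proof -
  obtain T where T: "psize (K n) = n" "T \<in> SYT (K n)" "\<And>m. m \<le> n \<Longrightarrow> shape (restrict_tableau m T) = K m"
    using SYT_chain_exists[of K n] assms by blast
  show ?thesis
  proof (rule ex1I[of _ T])
    show "T \<in> SYT (K n) \<and> ch T = map K (rev [0..<Suc n])" using T ch_eq_iff by blast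
    fix T' assume "T' \<in> SYT (K n) \<and> ch T' = map K (rev [0..<Suc n])"
    then show "T' = T" using T ch_eq_iff[of T' "K n" n K] SYT_eqI[of T' "K n" T] by auto
  qed
qed

text \<open>Both sides at \<open>c\<close> count the rows of \<open>P\<close> that have an entry
  below \<open>m\<close> in column \<open>c\<close>; on the right this uses that restriction cuts an
  increasing row to an initial segment.\<close>

lemma shape_restrict_transpose:
  assumes "\<forall>r\<in>set P. sorted_wrt (<) r"
  shows "shape (restrict_tableau m (List.transpose P)) = ptranspose (shape (restrict_tableau m P))"
proof
  fix c
  have "{r. c < shape (restrict_tableau m P) r} = {r. r < length P \<and> c < length (P ! r) \<and> P ! r ! c < m}"
    using filter_sorted_less_nth assms by (auto simp: shape_def split: if_splits)
  then have R: "ptranspose (shape (restrict_tableau m P)) c = length (filter (\<lambda>r. c < length r \<and> r ! c < m) P)"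
    by (simp add: ptranspose_def young_diagram_def length_filter_conv_card)
  show "shape (restrict_tableau m (List.transpose P)) c = ptranspose (shape (restrict_tableau m P)) c"
  proof (cases "c < length (List.transpose P)")
    case True
    then show ?thesis unfolding R by (simp add: shape_def nth_transpose filter_map o_def conj_commute)
  next
    case False
    have "length r \<le> foldr (\<lambda>xs. max (length xs)) P 0" if "r \<in> set P" for r
      using that by (induction P) auto
    then have "\<forall>r\<in>set P. \<not> c < length r" using False by (force simp: length_transpose)
    then have "filter (\<lambda>r. c < length r \<and> r ! c < m) P = []" by (auto simp: filter_empty_conv)
    then show ?thesis unfolding R using False by (simp add: shape_def)
  qed
qed

lemma schensted_insert_length:
  "snd (schensted_insert x T) \<le> length T \<and>
    length (fst (schensted_insert x T)) = max (length T) (Suc (snd (schensted_insert x T)))"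
proof (induction T arbitrary: x)
  case (Cons r rs)
  show ?case
  proof (cases rule: schensted_insert_cases[of x r rs])
    case None
    then show ?thesis by auto
  next
    case (Some a y b rs' q)
    then show ?thesis using Cons[of y] by auto
  qed
qed simp

text \<open>The recording tableau receives its boxes where the insertion tableau grows, with growing
  entries, so its restriction to entries below \<open>j\<close> has the shape reached after
  \<open>j\<close> insertions.\<close>

lemma RS_recording:
  "length (snd (RS n s)) = length (fst (RS n s)) \<and> shape (snd (RS n s)) = shape (fst (RS n s)) \<and>
    set (concat (snd (RS n s))) \<subseteq> {..<n} \<and>
    (\<forall>j\<le>n. shape (restrict_tableau j (snd (RS n s))) = shape (fst (RS j s)))"
proof (induction n)
  case (Suc n)
  let ?P = "fst (RS n s)" and ?Q = "snd (RS n s)"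
  define r where "r = snd (schensted_insert (s n) ?P)"
  have r: "r \<le> length ?Q" "length (fst (RS (Suc n) s)) = max (length ?P) (Suc r)"
    using schensted_insert_length[of "s n" ?P] Suc by (auto simp: r_def RS_Suc)
  have Q: "snd (RS (Suc n) s) = add_entry r n ?Q" by (simp add: RS_Suc r_def)
  have sh: "shape (snd (RS (Suc n) s)) = shape (fst (RS (Suc n) s))"
    unfolding Q shape_add_entry[OF r(1)] using Suc shape_schensted_insert[of "s n" ?P] by (simp add: RS_Suc r_def)
  have "set (concat (snd (RS (Suc n) s))) = insert n (set (concat ?Q))"
    unfolding Q using arg_cong[OF mset_concat_add_entry[of r n ?Q], of set_mset]
    by (simp only: set_mset_mset set_mset_add_mset_insert)
  then have set': "set (concat (snd (RS (Suc n) s))) \<subseteq> {..<Suc n}" using Suc by (auto simp del: set_concat)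
  have "shape (restrict_tableau j (snd (RS (Suc n) s))) = shape (fst (RS j s))" if "j \<le> Suc n" for j
  proof (cases "j = Suc n")
    case True
    then show ?thesis using restrict_tableau_all[OF set'] sh by simp
  next
    case False
    then show ?thesis using that Suc unfolding Q by (simp add: shape_restrict_add_entry)
  qed
  then show ?case using sh set' r Suc Q length_add_entry[OF r(1)] by simp
qed simp

section \<open>Ranks and Jordan types of subquotients\<close>

context finite_dimensional_vector_space
begin

abbreviation lin :: "('b \<Rightarrow> 'b) \<Rightarrow> bool" where
  "lin \<equiv> Vector_Spaces.linear scale scale"

sublocale self: finite_dimensional_vector_space_pair_1 scale Basis scale ..

lemma lin_compose: "lin f \<Longrightarrow> lin g \<Longrightarrow> lin (\<lambda>x. g (f x))"
  using Vector_Spaces.linear_compose[of scale scale f scale g] by (simp add: o_def)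

lemma lin_funpow: "lin f \<Longrightarrow> lin (f ^^ m)"
proof (induction m)
  case 0
  then show ?case using linear_id by (simp add: id_def)
next
  case (Suc m)
  then show ?case using lin_compose[of "f ^^ m" f] by (simp add: o_def)
qed

lemma lin_subspace_image: "lin f \<Longrightarrow> subspace U \<Longrightarrow> subspace (f ` U)"
  by (rule self.linear_subspace_image)

lemma lin_subspace_preimage:
  assumes "lin f" "subspace U" "subspace W"
  shows "subspace {x \<in> U. f x \<in> W}"
proof -
  have "subspace (U \<inter> {x. f x \<in> W})"
    by (intro subspace_inter self.linear_subspace_linear_preimage assms)
  then show ?thesis by (simp add: Int_def)
qed

lemma funpow_stable: "h ` U \<subseteq> U \<Longrightarrow> (h ^^ m) ` U \<subseteq> U"
  by (induction m) auto

lemma funpow_image_antimono: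
  assumes "h ` U \<subseteq> U" "m \<le> k"
  shows "(h ^^ k) ` U \<subseteq> (h ^^ m) ` U"
proof -
  have "(h ^^ k) ` U = (h ^^ m) ` ((h ^^ (k - m)) ` U)"
    using assms(2) by (simp add: image_comp funpow_add[symmetric])
  then show ?thesis using funpow_stable[OF assms(1), of "k - m"] by auto
qed

section \<open>Dimension formulas and the rank inequalities\<close>

lemma dim_Un_Int:
  assumes "subspace A" "subspace B"
  shows "dim (A \<union> B) + dim (A \<inter> B) = dim A + dim B"
proof -
  have "span (A \<union> B) = {x + y |x y. x \<in> A \<and> y \<in> B}"
    unfolding span_Un span_eq_iff[THEN iffD2, OF assms(1)] span_eq_iff[THEN iffD2, OF assms(2)] ..
  then have "dim (A \<union> B) = dim {x + y |x y. x \<in> A \<and> y \<in> B}" by (metis dim_span)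
  then show ?thesis using dim_sums_Int[OF assms] by simp
qed

lemma rank_nullity:
  assumes T: "lin T" and U: "subspace U"
  shows "dim (T ` U) + dim {x \<in> U. T x = 0} = dim U"
proof -
  interpret T: Vector_Spaces.linear scale scale T by (rule T)
  obtain g where g: "g ` UNIV \<subseteq> U" "lin g" "\<forall>v\<in>T ` U. T (g v) = v"
    using self.linear_exists_right_inverse_on[OF T U] by blast
  interpret g: Vector_Spaces.linear scale scale g by (rule g)
  let ?K = "{x \<in> U. T x = 0}" and ?G = "g ` T ` U"
  have K: "subspace ?K" using lin_subspace_preimage[OF T U subspace_single_0] by simp
  have G: "subspace ?G" by (intro lin_subspace_image g T U)
  have "?K \<inter> ?G = {0}"
  proof (intro equalityI subsetI)
    fix x assume "x \<in> ?K \<inter> ?G"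
    then obtain v where v: "v \<in> T ` U" "x = g v" "T x = 0" by blast
    then have "v = 0" using g(3) by auto
    then show "x \<in> {0}" using v g.zero by simp
  next
    fix x :: 'b assume "x \<in> {0}"
    then show "x \<in> ?K \<inter> ?G" using subspace_0[OF K] subspace_0[OF G] by auto
  qed
  moreover have "span (?K \<union> ?G) = U"
  proof (rule span_subspace)
    show "?K \<union> ?G \<subseteq> U" using g(1) by auto
    show "U \<subseteq> span (?K \<union> ?G)"
    proof
      fix x assume x: "x \<in> U"
      have "x - g (T x) \<in> ?K" using x g U by (auto simp: T.diff intro: subspace_diff)
      moreover have "g (T x) \<in> ?G" using x by auto
      ultimately have "(x - g (T x)) + g (T x) \<in> span (?K \<union> ?G)" by (intro span_add span_base) auto
      then show "x \<in> span (?K \<union> ?G)" by simp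
    qed
  qed (rule U)
  then have "dim (?K \<union> ?G) = dim U" by (metis dim_span)
  moreover have "dim ?G = dim (T ` U)"
  proof (rule self.dim_image_eq[OF g(2)])
    have "span (T ` U) = T ` U" using lin_subspace_image[OF T U] by simp
    then show "inj_on g (span (T ` U))" using g(3) by (metis inj_onI)
  qed
  ultimately show ?thesis using dim_Un_Int[OF K G] by simp
qed

text \<open>Rank-nullity for the map from \<open>U\<close> to the quotient by \<open>W\<close>; it
  translates ranks modulo \<open>W\<close> into dimensions of kernels modulo
  \<open>W\<close>.\<close>

lemma dim_image_Un_preimage:
  assumes T: "lin T" and U: "subspace U" and W: "subspace W"
  shows "dim (T ` U \<union> W) + dim {x \<in> U. T x \<in> W} = dim U + dim W"
proof -
  have "T ` {x \<in> U. T x \<in> W} = T ` U \<inter> W" by auto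
  moreover have "{x \<in> {x \<in> U. T x \<in> W}. T x = 0} = {x \<in> U. T x = 0}" using subspace_0[OF W] by auto
  ultimately have "dim (T ` U \<inter> W) + dim {x \<in> U. T x = 0} = dim {x \<in> U. T x \<in> W}"
    using rank_nullity[OF T lin_subspace_preimage[OF T U W]] by simp
  then show ?thesis
    using rank_nullity[OF T U] dim_Un_Int[OF lin_subspace_image[OF T U] W] by simp
qed

lemma dim_Un_le_submodular:
  assumes "subspace X" "subspace Y" "Z \<subseteq> span (X \<union> Y)" "V \<subseteq> X" "V \<subseteq> Y"
  shows "dim Z + dim V \<le> dim X + dim Y"
proof -
  have "dim Z \<le> dim (X \<union> Y)" using dim_mono[OF assms(3)] .
  moreover have "dim V \<le> dim (X \<inter> Y)" using assms by (intro dim_subset) auto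
  ultimately show ?thesis using dim_Un_Int[OF assms(1,2)] by simp
qed

text \<open>The two halves of the octahedron inequality: a restriction of the surjection
  \<open>V / B' \<rightarrow> V / B\<close>, and an injection of subquotients of \<open>A \<subseteq> A'\<close>.\<close>

lemma rank_inequality_image:
  assumes h: "lin h" and A: "subspace A" "subspace A'" "h ` A' \<subseteq> A" and B: "subspace B" "subspace B'" "B' \<subseteq> B"
  shows "dim ((h ^^ m) ` A \<union> B) + dim ((h ^^ Suc m) ` A' \<union> B')
    \<le> dim ((h ^^ m) ` A \<union> B') + dim ((h ^^ Suc m) ` A' \<union> B)"
proof -
  let ?C = "(h ^^ m) ` A" and ?D = "(h ^^ Suc m) ` A'"
  have DC: "?D \<subseteq> ?C"
  proof -
    have "?D = (h ^^ m) ` (h ` A')" by (simp add: image_comp funpow_swap1 o_def)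
    then show ?thesis using A(3) by auto
  qed
  \<comment> \<open>Since \<open>?D \<subseteq> ?C\<close> and \<open>B' \<subseteq> B\<close>, the
    spaces \<open>?C + B'\<close> and \<open>?D + B\<close> have sum \<open>?C + B\<close> and both
    contain \<open>?D + B'\<close>.\<close>
  have "dim (?C \<union> B) + dim (?D \<union> B') \<le> dim (span (?C \<union> B')) + dim (span (?D \<union> B))"
  proof (rule dim_Un_le_submodular)
    show "?C \<union> B \<subseteq> span (span (?C \<union> B') \<union> span (?D \<union> B))" by (auto intro!: span_base)
    show "?D \<union> B' \<subseteq> span (?C \<union> B')" using DC by (auto intro!: span_base)
    show "?D \<union> B' \<subseteq> span (?D \<union> B)" using B(3) by (auto intro!: span_base)
  qed auto
  then show ?thesis by simp
qed

lemma rank_inequality_preimage: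
  assumes h: "lin h" and A: "subspace A" "subspace A'" "A \<subseteq> A'" and B: "subspace B" "subspace B'" "h ` B \<subseteq> B'"
  shows "dim ((h ^^ m) ` A \<union> B) + dim ((h ^^ Suc m) ` A' \<union> B')
    \<le> dim ((h ^^ Suc m) ` A \<union> B') + dim ((h ^^ m) ` A' \<union> B)"
proof -
  let ?K = "\<lambda>U. {x \<in> U. (h ^^ m) x \<in> B}" and ?L = "\<lambda>U. {x \<in> U. (h ^^ Suc m) x \<in> B'}"
  note sub = lin_subspace_preimage[OF lin_funpow[OF h]]
  have KL: "?K U \<subseteq> ?L U" for U using B(3) by auto
  \<comment> \<open>\<open>?K\<close> and \<open>?L\<close> are kernels modulo \<open>B\<close> and
    \<open>B'\<close>. Inside \<open>?L A'\<close> the subspaces \<open>?L A\<close> and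
    \<open>?K A'\<close> intersect in \<open>?K A\<close>.\<close>
  have "dim (?L A) + dim (?K A') \<le> dim (?K A) + dim (?L A')"
  proof -
    have "?L A \<inter> ?K A' = ?K A" using A(3) KL[of A] B(3) by auto
    moreover have "dim (?L A \<union> ?K A') \<le> dim (?L A')" using A(3) KL[of A'] by (intro dim_subset) auto
    moreover have "dim (?L A \<union> ?K A') + dim (?L A \<inter> ?K A') = dim (?L A) + dim (?K A')"
      by (intro dim_Un_Int sub A B)
    ultimately show ?thesis by presburger
  qed
  then show ?thesis
    using dim_image_Un_preimage[OF lin_funpow[OF h] A(1) B(1), of m]
      dim_image_Un_preimage[OF lin_funpow[OF h] A(2) B(2), of "Suc m"]
      dim_image_Un_preimage[OF lin_funpow[OF h] A(1) B(2), of "Suc m"]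
      dim_image_Un_preimage[OF lin_funpow[OF h] A(2) B(1), of m] by linarith
qed

section \<open>Bases of quotients and Jordan strings\<close>

lemma span_family_Un_iff:
  assumes "finite I" "subspace W"
  shows "x \<in> span (b ` I \<union> W) \<longleftrightarrow> (\<exists>c. x - (\<Sum>i\<in>I. c i *s b i) \<in> W)"
proof
  assume "\<exists>c. x - (\<Sum>i\<in>I. c i *s b i) \<in> W"
  then obtain c where c: "x - (\<Sum>i\<in>I. c i *s b i) \<in> W" by blast
  have "(x - (\<Sum>i\<in>I. c i *s b i)) + (\<Sum>i\<in>I. c i *s b i) \<in> span (b ` I \<union> W)"
    using c by (intro span_add span_sum span_scale) (auto intro: span_base)
  then show "x \<in> span (b ` I \<union> W)" by simp
next
  assume "x \<in> span (b ` I \<union> W)"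
  then show "\<exists>c. x - (\<Sum>i\<in>I. c i *s b i) \<in> W"
  proof (induction rule: span_induct_alt)
    case base
    show ?case by (intro exI[of _ "\<lambda>_. 0"]) (simp add: subspace_0[OF assms(2)])
  next
    case (step a y z)
    then obtain c where c: "z - (\<Sum>i\<in>I. c i *s b i) \<in> W" by blast
    show ?case
    proof (cases "y \<in> W")
      case True
      then have "a *s y + (z - (\<Sum>i\<in>I. c i *s b i)) \<in> W"
        using c assms(2) by (intro subspace_add subspace_scale)
      then show ?thesis by (intro exI[of _ c]) (simp add: algebra_simps)
    next
      case False
      then obtain k where k: "k \<in> I" "y = b k" using step by auto
      have "(\<Sum>i\<in>I. (c i + (if i = k then a else 0)) *s b i) = (\<Sum>i\<in>I. c i *s b i + (if i = k then a *s b k else 0))"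
        by (intro sum.cong) (auto simp: scale_left_distrib)
      also have "\<dots> = (\<Sum>i\<in>I. c i *s b i) + a *s b k"
        using k assms(1) by (simp add: sum.distrib)
      finally have "a *s y + z - (\<Sum>i\<in>I. (c i + (if i = k then a else 0)) *s b i) = z - (\<Sum>i\<in>I. c i *s b i)"
        using k by simp
      then have "a *s y + z - (\<Sum>i\<in>I. (c i + (if i = k then a else 0)) *s b i) \<in> W" using c by (simp only:)
      then show ?thesis by (rule exI[of _ "\<lambda>i. c i + (if i = k then a else 0)"])
    qed
  qed
qed

lemma dim_family_Un_le: "finite I \<Longrightarrow> dim (b ` I \<union> W) \<le> dim W + card I"
proof (induction I rule: finite_induct)
  case (insert i I)
  then show ?case by (simp add: dim_insert)
qed simp

lemma dim_family_Un_eq: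
  assumes "finite I" "subspace W" "\<And>c. (\<Sum>i\<in>I. c i *s b i) \<in> W \<Longrightarrow> \<forall>i\<in>I. c i = 0"
  shows "dim (b ` I \<union> W) = dim W + card I"
  using assms
proof (induction I rule: finite_induct)
  case (insert k I)
  have ext: "\<forall>i\<in>insert k I. c i = 0" if "(\<Sum>i\<in>insert k I. c i *s b i) \<in> W" for c
    using insert.prems that by blast
  have "\<forall>i\<in>I. c i = 0" if "(\<Sum>i\<in>I. c i *s b i) \<in> W" for c
  proof -
    have "(\<Sum>i\<in>I. (c(k := 0)) i *s b i) = (\<Sum>i\<in>I. c i *s b i)" using insert.hyps by (intro sum.cong) auto
    then have "(\<Sum>i\<in>insert k I. (c(k := 0)) i *s b i) \<in> W" using that insert.hyps by simp
    then have "\<forall>i\<in>insert k I. (c(k := 0)) i = 0" by (rule ext)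
    then show ?thesis using insert.hyps by (metis fun_upd_apply insertI2)
  qed
  then have IH: "dim (b ` I \<union> W) = dim W + card I" using insert by blast
  have "b k \<notin> span (b ` I \<union> W)"
  proof
    assume "b k \<in> span (b ` I \<union> W)"
    then obtain c where c: "b k - (\<Sum>i\<in>I. c i *s b i) \<in> W" using span_family_Un_iff insert by blast
    have "(\<Sum>i\<in>I. ((\<lambda>i. - c i)(k := 1)) i *s b i) = (\<Sum>i\<in>I. - (c i *s b i))"
      using insert.hyps by (intro sum.cong) (auto simp: scale_minus_left)
    then have "(\<Sum>i\<in>insert k I. ((\<lambda>i. - c i)(k := 1)) i *s b i) = b k - (\<Sum>i\<in>I. c i *s b i)"
      using insert.hyps by (simp add: sum_negf)
    then show False using ext[of "(\<lambda>i. - c i)(k := 1)"] c by auto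
  qed
  then show ?case using IH insert.hyps by (simp add: dim_insert)
qed simp

text \<open>A spanning family with as many members as the dimension is independent. Constructions of
  Jordan bases can thus be checked by spanning and counting boxes.\<close>

lemma quotient_basis_iff:
  assumes fin: "finite I" and U: "subspace U" and W: "subspace W" "W \<subseteq> U"
  shows "quotient_basis U W I b \<longleftrightarrow> b ` I \<subseteq> U \<and> U \<subseteq> span (b ` I \<union> W) \<and> dim U = dim W + card I"
proof
  assume qb: "quotient_basis U W I b"
  then have b: "b ` I \<subseteq> U" "U \<subseteq> span (b ` I \<union> W)"
    using span_family_Un_iff[OF fin W(1)] by (auto simp: quotient_basis_def)
  have "span (b ` I \<union> W) = U" using b W by (intro span_subspace U) auto
  then have "dim U = dim (b ` I \<union> W)" by (metis dim_span)
  then show "b ` I \<subseteq> U \<and> U \<subseteq> span (b ` I \<union> W) \<and> dim U = dim W + card I"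
    using b dim_family_Un_eq[OF fin W(1)] qb unfolding quotient_basis_def by metis
next
  assume R: "b ` I \<subseteq> U \<and> U \<subseteq> span (b ` I \<union> W) \<and> dim U = dim W + card I"
  have "\<forall>i\<in>I. c i = 0" if c: "(\<Sum>i\<in>I. c i *s b i) \<in> W" for c
  proof (rule ccontr)
    assume "\<not> ?thesis"
    then obtain k where k: "k \<in> I" "c k \<noteq> 0" by blast
    let ?S = "b ` (I - {k}) \<union> W"
    have "c k *s b k = (\<Sum>i\<in>I. c i *s b i) - (\<Sum>i\<in>I - {k}. c i *s b i)"
      using k fin by (simp add: sum.remove)
    also have "\<dots> \<in> span ?S"
    proof (rule span_diff)
      show "(\<Sum>i\<in>I. c i *s b i) \<in> span ?S" using c by (auto intro: span_base)
      show "(\<Sum>i\<in>I - {k}. c i *s b i) \<in> span ?S"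
        by (intro span_sum span_scale) (auto intro: span_base)
    qed
    finally have "(1 / c k) *s (c k *s b k) \<in> span ?S" by (rule span_scale)
    then have "b k \<in> span ?S" using k by simp
    then have "b ` I \<union> W \<subseteq> span ?S" by (auto intro: span_base)
    then have "U \<subseteq> span ?S" using R span_minimal[of "b ` I \<union> W" "span ?S"] by auto
    then have "dim U \<le> dim ?S" by (rule dim_mono)
    also have "\<dots> \<le> dim W + card (I - {k})" using fin by (intro dim_family_Un_le) auto
    finally show False using R k fin card_gt_0_iff[of I] by (auto simp: card_Diff_singleton)
  qed
  then show "quotient_basis U W I b"
    using R span_family_Un_iff[OF fin W(1)] unfolding quotient_basis_def by blast
qed

text \<open>\<open>h ^^ m\<close> shifts the box (i, j) to (i, m + j), or into \<open>W\<close> when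
  that leaves the row. The image is spanned modulo \<open>W\<close> by the boxes in columns from
  \<open>m\<close> on.\<close>

lemma jordan_basis_rank:
  assumes jb: "jordan_basis h U W l v" and l: "is_partition l" and h: "lin h"
    and U: "subspace U" and W: "subspace W" "W \<subseteq> U" "h ` W \<subseteq> W"
  shows "dim ((h ^^ m) ` U \<union> W) = dim W + tails (ptranspose l) m"
proof -
  let ?b = "\<lambda>(i, j). (h ^^ j) (v i)" and ?Y = "young_diagram l"
  let ?Ym = "{(i, j) \<in> ?Y. m \<le> j}"
  have fin: "finite ?Y" by (rule finite_young_diagram[OF l])
  have qb: "quotient_basis U W ?Y ?b" and top: "\<And>i. l i \<noteq> 0 \<Longrightarrow> (h ^^ l i) (v i) \<in> W"
    using jb by (auto simp: jordan_basis_def)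
  have b: "?b ` ?Y \<subseteq> U" "U \<subseteq> span (?b ` ?Y \<union> W)"
    using qb quotient_basis_iff[OF fin U W(1,2)] by blast+
  have hW: "(h ^^ k) w \<in> W" if "w \<in> W" for k w using funpow_stable[OF W(3)] that by blast
  have "span ((h ^^ m) ` U \<union> W) = span (?b ` ?Ym \<union> W)"
  proof (rule span_eq[THEN iffD2], intro conjI Un_least)
    have "(h ^^ m) ` U \<subseteq> (h ^^ m) ` span (?b ` ?Y \<union> W)" using b(2) by auto
    also have "\<dots> = span ((h ^^ m) ` (?b ` ?Y \<union> W))"
      using self.linear_span_image[OF lin_funpow[OF h]] by simp
    also have "\<dots> \<subseteq> span (?b ` ?Ym \<union> W)"
    proof (rule span_minimal)
      show "(h ^^ m) ` (?b ` ?Y \<union> W) \<subseteq> span (?b ` ?Ym \<union> W)"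
      proof
        fix x assume "x \<in> (h ^^ m) ` (?b ` ?Y \<union> W)"
        then obtain y where y: "y \<in> ?b ` ?Y \<union> W" "x = (h ^^ m) y" by blast
        show "x \<in> span (?b ` ?Ym \<union> W)"
        proof (cases "y \<in> W")
          case True
          then show ?thesis using hW y by (auto intro: span_base)
        next
          case False
          then have "y \<in> ?b ` ?Y" using y(1) by blast
          then obtain i j where ij: "(i, j) \<in> ?Y" "y = (h ^^ j) (v i)" by auto
          have x: "x = (h ^^ (m + j)) (v i)" using y ij by (simp add: funpow_add)
          have li: "l i \<noteq> 0" using ij by (auto simp: young_diagram_def)
          show ?thesis
          proof (cases "m + j < l i")
            case True
            then have "(i, m + j) \<in> ?Ym" by (auto simp: young_diagram_def)
            then show ?thesis using x by (intro span_base) force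
          next
            case False
            then have "x = (h ^^ (m + j - l i + l i)) (v i)" using x by simp
            then have "x = (h ^^ (m + j - l i)) ((h ^^ l i) (v i))" by (simp only: funpow_add o_apply)
            then show ?thesis using hW top[OF li] by (auto intro: span_base)
          qed
        qed
      qed
    qed simp
    finally show "(h ^^ m) ` U \<subseteq> span (?b ` ?Ym \<union> W)" .
    show "W \<subseteq> span (?b ` ?Ym \<union> W)" "W \<subseteq> span ((h ^^ m) ` U \<union> W)" by (auto intro: span_base)
    show "?b ` ?Ym \<subseteq> span ((h ^^ m) ` U \<union> W)"
    proof
      fix x assume "x \<in> ?b ` ?Ym"
      then obtain i j where ij: "(i, j) \<in> ?Y" "m \<le> j" "x = (h ^^ j) (v i)" by auto
      have "(i, j - m) \<in> ?Y" using ij by (auto simp: young_diagram_def)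
      then have "(h ^^ (j - m)) (v i) \<in> U" using b(1) by force
      moreover have "x = (h ^^ (m + (j - m))) (v i)" using ij by simp
      then have "x = (h ^^ m) ((h ^^ (j - m)) (v i))" by (simp only: funpow_add o_apply)
      ultimately show "x \<in> span ((h ^^ m) ` U \<union> W)" by (auto intro: span_base)
    qed
  qed
  then have "dim ((h ^^ m) ` U \<union> W) = dim (?b ` ?Ym \<union> W)" by (rule span_eq_dim)
  also have "\<dots> = dim W + card ?Ym"
  proof (rule dim_family_Un_eq[OF _ W(1)])
    show "finite ?Ym" using fin by (rule rev_finite_subset) auto
    fix c assume c: "(\<Sum>p\<in>?Ym. c p *s ?b p) \<in> W"
    define d where "d p = (if p \<in> ?Ym then c p else 0)" for p
    have "(\<Sum>p\<in>?Y. d p *s ?b p) = (\<Sum>p\<in>?Ym. d p *s ?b p)"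
      using fin by (intro sum.mono_neutral_right) (auto simp: d_def)
    also have "\<dots> = (\<Sum>p\<in>?Ym. c p *s ?b p)" by (intro sum.cong) (auto simp: d_def)
    finally have "\<forall>p\<in>?Y. d p = 0" using c qb unfolding quotient_basis_def by metis
    then show "\<forall>p\<in>?Ym. c p = 0" by (auto simp: d_def split: if_splits)
  qed
  finally show ?thesis using card_young_diagram_ge[OF l] by simp
qed

lemma jordan_basis_permute:
  assumes jb: "jordan_basis h U W l v" and l: "finite (young_diagram l)"
    and U: "subspace U" and W: "subspace W" "W \<subseteq> U" and p: "bij p"
  shows "jordan_basis h U W (l \<circ> p) (v \<circ> p)"
proof -
  let ?g = "\<lambda>(i, j). (p i, j)"
  let ?b = "\<lambda>v (i, j). (h ^^ j) (v i)"
  have bij: "bij_betw ?g (young_diagram (l \<circ> p)) (young_diagram l)"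
    using p by (intro bij_betw_byWitness[where f' = "\<lambda>(i, j). (inv_into UNIV p i, j)"])
      (auto simp: young_diagram_def bij_is_inj bij_is_surj surj_f_inv_f)
  note img = bij_betw_imp_surj_on[OF bij] and card = bij_betw_same_card[OF bij]
  have fin: "finite (young_diagram (l \<circ> p))" using bij_betw_finite[OF bij] l by blast
  have "?b (v \<circ> p) ` young_diagram (l \<circ> p) = ?b v ` ?g ` young_diagram (l \<circ> p)"
    by (simp add: image_image case_prod_unfold)
  then have "?b (v \<circ> p) ` young_diagram (l \<circ> p) = ?b v ` young_diagram l" unfolding img .
  then show ?thesis
    using jb quotient_basis_iff[OF l U W, of "?b v"] quotient_basis_iff[OF fin U W, of "?b (v \<circ> p)"] card
    unfolding jordan_basis_def by simp
qed

text \<open>After correcting \<open>e\<close> by an element of \<open>U\<close>, its image is modulo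
  \<open>W\<close> a combination of string heads \<open>v i\<close>. The longest string that occurs
  is replaced by one starting at the corrected vector, one longer; if none occurs, a new string of
  length 1 appears.\<close>

lemma jordan_basis_extend:
  assumes jb: "jordan_basis h U W l v" and l: "is_partition l" and h: "lin h"
    and U: "subspace U" "h ` U \<subseteq> U" and W: "subspace W" "W \<subseteq> U" "h ` W \<subseteq> W"
    and e: "e \<notin> U" "h e \<in> U"
  shows "\<exists>l' v'. is_partition l' \<and> jordan_basis h (span (insert e U)) W l' v'"
proof -
  interpret h: Vector_Spaces.linear scale scale h by (rule h)
  let ?b = "\<lambda>v (i, j). (h ^^ j) (v i)" and ?Y = "young_diagram l"
  let ?Y1 = "{p \<in> ?Y. snd p \<noteq> 0}" and ?I = "{i. l i \<noteq> 0}"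
  have fin: "finite ?Y" by (rule finite_young_diagram[OF l])
  have finI: "finite ?I" using l by (simp add: is_partition_def)
  have anti: "\<And>p q. p \<le> q \<Longrightarrow> l q \<le> l p" using l by (auto simp: is_partition_def antimono_def)
  have top: "\<And>i. l i \<noteq> 0 \<Longrightarrow> (h ^^ l i) (v i) \<in> W" using jb by (auto simp: jordan_basis_def)
  have b: "?b v ` ?Y \<subseteq> U" "U \<subseteq> span (?b v ` ?Y \<union> W)" "dim U = dim W + card ?Y"
    using jb quotient_basis_iff[OF fin U(1) W(1,2), of "?b v"] by (auto simp: jordan_basis_def)
  have hW: "(h ^^ k) w \<in> W" if "w \<in> W" for k w using funpow_stable[OF W(3)] that by blast
  have bU: "(h ^^ j) (v i) \<in> U" if "j < l i" for i j
    using b(1) that by (force simp: young_diagram_def)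
  have bS: "(h ^^ j) (v i) \<in> W" if "l i \<noteq> 0" "l i \<le> j" for i j
  proof -
    have "(h ^^ j) (v i) = (h ^^ (j - l i + l i)) (v i)" using that by simp
    also have "\<dots> = (h ^^ (j - l i)) ((h ^^ l i) (v i))" by (simp only: funpow_add o_apply)
    finally show ?thesis using hW top[OF that(1)] by simp
  qed
  obtain c where c: "h e - (\<Sum>p\<in>?Y. c p *s ?b v p) \<in> W"
    using e(2) b(2) span_family_Un_iff[OF fin W(1), of "h e" "?b v"] by blast
  \<comment> \<open>An explicit preimage of the part of \<open>h e\<close> that involves no string
    head; subtracting it leaves only heads.\<close>
  define d where "d = (\<Sum>p\<in>?Y1. c p *s (h ^^ (snd p - 1)) (v (fst p)))"
  have dU: "d \<in> U" unfolding d_def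
    using bU by (intro subspace_sum subspace_scale U) (auto simp: young_diagram_def)
  define e' where "e' = e - d"
  define a where "a i = c (i, 0)" for i
  have Y0: "?Y - ?Y1 = (\<lambda>i. (i, 0)) ` ?I" by (auto simp: young_diagram_def)
  have hd: "h d = (\<Sum>p\<in>?Y1. c p *s ?b v p)"
  proof -
    have "h ((h ^^ (snd p - 1)) (v (fst p))) = ?b v p" if "p \<in> ?Y1" for p
    proof -
      obtain i k where p: "p = (i, Suc k)" using \<open>p \<in> ?Y1\<close> by (cases p; cases "snd p") auto
      show ?thesis unfolding p by simp
    qed
    then show ?thesis unfolding d_def by (simp add: h.sum h.scale)
  qed
  have "(\<Sum>p\<in>?Y. c p *s ?b v p) = (\<Sum>p\<in>?Y - ?Y1. c p *s ?b v p) + h d"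
    unfolding hd using fin by (intro sum.subset_diff) auto
  also have "(\<Sum>p\<in>?Y - ?Y1. c p *s ?b v p) = (\<Sum>i\<in>?I. a i *s v i)"
    unfolding Y0 by (subst sum.reindex) (auto simp: inj_on_def a_def)
  finally have w: "h e' - (\<Sum>i\<in>?I. a i *s v i) \<in> W"
    using c unfolding e'_def h.diff by (simp add: algebra_simps)
  let ?U = "span (insert e U)"
  have U': "subspace ?U" "W \<subseteq> ?U" "U \<subseteq> ?U" using W(2) by (auto intro: span_base)
  have eU: "e' \<in> ?U" unfolding e'_def using dU by (intro span_diff span_base) auto
  have dimU: "dim ?U = dim U + 1" 
  proof -
    have "span U = U" using U(1) by simp
    then have "e \<notin> span U" using e(1) by metis
    then show ?thesis by (simp add: dim_insert)
  qed
  have "\<exists>k v'. jordan_basis h ?U W (l(k := Suc (l k))) v'"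
  proof -
    \<comment> \<open>Row \<open>k\<close> is replaced by a string from \<open>e'\<close>. What has
      to be supplied is that the longer string ends in \<open>W\<close> and that the vectors of the
      old string \<open>k\<close> are still spanned; the count of boxes then gives
      independence.\<close>
    have jbI: "jordan_basis h ?U W (l(k := Suc (l k))) v'"
      if v': "\<And>i. i \<noteq> k \<Longrightarrow> v' i = v i" "v' k = e'" and htop: "(h ^^ Suc (l k)) e' \<in> W"
        and low: "\<And>j. j < l k \<Longrightarrow> (h ^^ j) (v k) \<in> span (?b v' ` young_diagram (l(k := Suc (l k))) \<union> W)"
      for k v'
    proof -
      let ?l = "l(k := Suc (l k))"
      let ?Y' = "young_diagram ?l" and ?S = "span (?b v' ` young_diagram ?l \<union> W)"
      have Y': "?Y' = insert (k, l k) ?Y" by (auto simp: young_diagram_def split: if_splits)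
      have fin': "finite ?Y'" using fin Y' by simp
      have "card ?Y' = Suc (card ?Y)" unfolding Y' using fin by (simp add: young_diagram_def)
      then have card: "dim ?U = dim W + card ?Y'" using dimU b(3) by simp
      have in_S: "(h ^^ j) (v' i) \<in> ?S" if "j < ?l i" for i j
        using that by (intro span_base) (force simp: young_diagram_def)
      have hk: "(h ^^ j) (v' k) \<in> ?U" if "j < ?l k" for j
      proof (cases j)
        case 0
        then show ?thesis using v' eU by simp
      next
        case (Suc j')
        have "h e' \<in> U" unfolding e'_def h.diff using e dU U by (auto intro: subspace_diff)
        then have "(h ^^ j') (h e') \<in> U" using funpow_stable[OF U(2)] by blast
        then show ?thesis using Suc v' U'(3) by (auto simp: funpow_swap1)
      qed
      have "?b v' ` ?Y' \<subseteq> ?U"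
      proof
        fix x assume "x \<in> ?b v' ` ?Y'"
        then obtain i j where ij: "j < ?l i" "x = (h ^^ j) (v' i)" by (auto simp: young_diagram_def)
        show "x \<in> ?U"
        proof (cases "i = k")
          case True
          then show ?thesis using hk ij by simp
        next
          case False
          then show ?thesis using ij v' bU[of j i] U'(3) by auto
        qed
      qed
      moreover have "?U \<subseteq> ?S"
      proof -
        have "?b v ` ?Y \<subseteq> ?S"
        proof
          fix x assume "x \<in> ?b v ` ?Y"
          then obtain i j where ij: "j < l i" "x = (h ^^ j) (v i)" by (auto simp: young_diagram_def)
          show "x \<in> ?S"
          proof (cases "i = k")
            case True
            then show ?thesis using low ij by simp
          next
            case False
            then show ?thesis using ij v' in_S[of j i] by simp
          qed
        qed
        then have "?b v ` ?Y \<union> W \<subseteq> ?S" by (auto intro: span_base)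
        then have "span (?b v ` ?Y \<union> W) \<subseteq> ?S" by (intro span_minimal) auto
        then have US: "U \<subseteq> ?S" using b(2) by blast
        have "e' \<in> ?S" using in_S[of 0 k] v' by simp
        then have "e' + d \<in> ?S" using dU US by (intro span_add) auto
        then have "e \<in> ?S" by (simp add: e'_def)
        then show ?thesis using US by (intro span_minimal) auto
      qed
      ultimately have "quotient_basis ?U W ?Y' (?b v')"
        using quotient_basis_iff[OF fin' U'(1) W(1) U'(2), of "?b v'"] card by blast
      moreover have "(h ^^ ?l i) (v' i) \<in> W" if "?l i \<noteq> 0" for i
        using that htop v' top[of i] by (cases "i = k") auto
      ultimately show ?thesis unfolding jordan_basis_def by blast
    qed
    show ?thesis
    proof (cases "\<forall>i\<in>?I. a i = 0")
      case True
      then have "(\<Sum>i\<in>?I. a i *s v i) = 0" by (intro sum.neutral) auto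
      then have he: "h e' \<in> W" using w by simp
      obtain N where N: "\<And>r. N \<le> r \<Longrightarrow> l r = 0" using finite_support_bound[OF finI] by blast
      \<comment> \<open>No head occurs in \<open>h e'\<close>, so \<open>e'\<close> is a string of
        length 1 and takes the first empty row.\<close>
      define k where "k = (LEAST k. l k = 0)"
      have k: "l k = 0" unfolding k_def by (rule LeastI[of _ N]) (simp add: N)
      have "jordan_basis h ?U W (l(k := Suc (l k))) (v(k := e'))"
        by (rule jbI) (use k he in auto)
      then show ?thesis by (intro exI)
    next
      case False
      let ?A = "{i \<in> ?I. a i \<noteq> 0}"
      have A: "finite ?A" "?A \<noteq> {}" using finI False by auto
      \<comment> \<open>Maximality of \<open>l k\<close> makes \<open>h ^^ l k\<close> send all
        heads that occur into \<open>W\<close>, so the new string has length exactly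
        \<open>l k + 1\<close> modulo \<open>W\<close>.\<close>
      have "Max (l ` ?A) \<in> l ` ?A" using A by (intro Max_in) auto
      then obtain k where kM: "Max (l ` ?A) = l k" and k: "k \<in> ?A" by (rule imageE)
      have kmax: "l i \<le> l k" if "i \<in> ?A" for i
        unfolding kM[symmetric] using A that by (intro Max_ge) auto
      let ?v = "v(k := e')" and ?l = "l(k := Suc (l k))"
      let ?S = "span (?b ?v ` young_diagram ?l \<union> W)"
      have lk: "l k \<noteq> 0" "a k \<noteq> 0" using k by auto
      have expand: "(h ^^ j) (h e') - (\<Sum>i\<in>?I. a i *s (h ^^ j) (v i)) \<in> W" for j
      proof -
        interpret hj: Vector_Spaces.linear scale scale "h ^^ j" by (rule lin_funpow[OF h])
        have "(h ^^ j) (h e' - (\<Sum>i\<in>?I. a i *s v i)) \<in> W" using hW w by blast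
        then show ?thesis by (simp add: hj.diff hj.sum hj.scale)
      qed
      have "(\<Sum>i\<in>?I. a i *s (h ^^ l k) (v i)) \<in> W"
      proof (intro subspace_sum W(1))
        fix i assume i: "i \<in> ?I"
        show "a i *s (h ^^ l k) (v i) \<in> W"
        proof (cases "a i = 0")
          case True
          then show ?thesis using subspace_0[OF W(1)] by simp
        next
          case False
          then show ?thesis using i kmax[of i] bS[of i "l k"] W(1) by (auto intro: subspace_scale)
        qed
      qed
      then have "((h ^^ l k) (h e') - (\<Sum>i\<in>?I. a i *s (h ^^ l k) (v i))) + (\<Sum>i\<in>?I. a i *s (h ^^ l k) (v i)) \<in> W"
        using expand by (intro subspace_add W(1))
      then have htop: "(h ^^ Suc (l k)) e' \<in> W" by (simp add: funpow_swap1)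
      \<comment> \<open>As \<open>a k \<noteq> 0\<close>, the shifted relation for
        \<open>h e'\<close> can be solved for the vector of the old string \<open>k\<close>; the
        other heads belong to unchanged strings.\<close>
      have low: "(h ^^ j) (v k) \<in> ?S" if j: "j < l k" for j
      proof -
        have in_S: "(h ^^ j) (?v i) \<in> ?S" if "j < ?l i" for i j
          using that by (intro span_base) (force simp: young_diagram_def)
        have WS: "x \<in> ?S" if "x \<in> W" for x using that by (auto intro: span_base)
        have m1: "(h ^^ j) (h e') \<in> ?S" using in_S[of "Suc j" k] j by (simp add: funpow_swap1)
        have m2: "(\<Sum>i\<in>?I - {k}. a i *s (h ^^ j) (v i)) \<in> ?S"
        proof (intro span_sum span_scale)
          fix i assume i: "i \<in> ?I - {k}"
          show "(h ^^ j) (v i) \<in> ?S"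
          proof (cases "j < l i")
            case True
            then show ?thesis using in_S[of j i] i by simp
          next
            case False
            then show ?thesis using i bS[of i j] WS by simp
          qed
        qed
        have "(h ^^ j) (h e') - ((h ^^ j) (h e') - (\<Sum>i\<in>?I. a i *s (h ^^ j) (v i)))
            - (\<Sum>i\<in>?I - {k}. a i *s (h ^^ j) (v i)) \<in> ?S"
          by (rule span_diff[OF span_diff[OF m1 WS[OF expand]] m2])
        moreover have "(\<Sum>i\<in>?I. a i *s (h ^^ j) (v i)) = a k *s (h ^^ j) (v k) + (\<Sum>i\<in>?I - {k}. a i *s (h ^^ j) (v i))"
          using k finI by (intro sum.remove) auto
        ultimately have "a k *s (h ^^ j) (v k) \<in> ?S" by simp
        from span_scale[OF this, of "1 / a k"] show ?thesis using lk by simp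
      qed
      have "jordan_basis h ?U W ?l ?v" by (rule jbI[OF _ _ htop low]) simp_all
      then show ?thesis by (intro exI)
    qed
  qed
  then obtain k v' where k: "jordan_basis h ?U W (l(k := Suc (l k))) v'" by (elim exE)
  \<comment> \<open>Lengthening row \<open>k\<close> may violate the order of rows; exchanging it
    with the first row of the same length restores a partition.\<close>
  define q where "q = (LEAST q. l q = l k)"
  have q: "l q = l k" unfolding q_def by (rule LeastI[of _ k]) simp
  have qmin: "l k < l i" if "i < q" for i
  proof -
    have "q \<le> k" unfolding q_def by (rule Least_le) simp
    then have "l k \<le> l i" using that anti[of i k] by simp
    moreover have "l i \<noteq> l k" using not_less_Least[of i "\<lambda>q. l q = l k"] that by (simp add: q_def)
    ultimately show ?thesis by simp
  qed
  have l': "l(k := Suc (l k)) \<circ> Transposition.transpose q k = l(q := Suc (l q))"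
    using q by (auto simp: fun_eq_iff Transposition.transpose_def)
  have fin': "finite (young_diagram (l(k := Suc (l k))))"
    by (rule finite_subset[where B = "insert (k, l k) ?Y"]) (use fin in \<open>auto simp: young_diagram_def split: if_splits\<close>)
  have "jordan_basis h ?U W (l(q := Suc (l q))) (v' \<circ> Transposition.transpose q k)"
    using jordan_basis_permute[OF k fin' U'(1) W(1) U'(2), of "Transposition.transpose q k"] l' by simp
  moreover have "is_partition (l(q := Suc (l q)))"
  proof -
    have "(l(q := Suc (l q))) r \<le> (l(q := Suc (l q))) p" if "p \<le> r" for p r
      using anti[OF that] qmin[of p] that q by (cases "p < q") (auto simp: Suc_le_eq)
    moreover have "finite {i. (l(q := Suc (l q))) i \<noteq> 0}"
      by (rule finite_subset[where B = "insert q ?I"]) (use finI in auto)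
    ultimately show ?thesis by (auto simp: is_partition_def antimono_def)
  qed
  ultimately show ?thesis by blast
qed

section \<open>Existence of Jordan bases\<close>

definition nilpotent :: "('b \<Rightarrow> 'b) \<Rightarrow> bool" where
  "nilpotent h \<longleftrightarrow> (\<exists>m. \<forall>x. (h ^^ m) x = 0)"

text \<open>Nakayama's lemma: iterating \<open>U = h U + W\<close> gives
  \<open>U = h^m U + W\<close> for all m, and a high power of \<open>h\<close> vanishes.\<close>

lemma nilpotent_image_proper:
  assumes h: "lin h" "nilpotent h" and U: "subspace U" "h ` U \<subseteq> U" and W: "subspace W" "W \<subseteq> U" "h ` W \<subseteq> W"
    and eq: "span (h ` U \<union> W) = U"
  shows "U = W"
proof -
  have "U \<subseteq> span ((h ^^ m) ` U \<union> W)" for m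
  proof (induction m)
    case 0
    then show ?case by (auto intro: span_base)
  next
    case (Suc m)
    have "(h ^^ m) ` U = (h ^^ m) ` span (h ` U \<union> W)" using eq by simp
    also have "\<dots> = span ((h ^^ m) ` (h ` U \<union> W))"
      using self.linear_span_image[OF lin_funpow[OF h(1)]] by simp
    also have "\<dots> \<subseteq> span ((h ^^ Suc m) ` U \<union> W)"
      using funpow_stable[OF W(3), of m]
      by (intro span_mono) (auto simp: funpow_swap1 image_iff)
    finally have "span ((h ^^ m) ` U \<union> W) \<subseteq> span ((h ^^ Suc m) ` U \<union> W)"
      by (intro span_minimal) (auto intro: span_base)
    then show ?case using Suc by blast
  qed
  moreover obtain m where "\<And>x. (h ^^ m) x = 0" using h(2) by (auto simp: nilpotent_def)
  then have "(h ^^ m) ` U \<union> W \<subseteq> W" using subspace_0[OF W(1)] by auto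
  then have "span ((h ^^ m) ` U \<union> W) \<subseteq> W" using W(1) by (rule span_minimal)
  ultimately show ?thesis using W(2) by blast
qed

text \<open>By Nakayama's lemma \<open>h U + W\<close> is proper in \<open>U\<close>, so it lies in
  a hyperplane, which is stable; every vector outside has its image inside, and
  \<open>jordan_basis_extend\<close> applies.\<close>

lemma jordan_basis_exists:
  assumes h: "lin h" "nilpotent h" and W: "subspace W" "h ` W \<subseteq> W"
    and U: "subspace U" "h ` U \<subseteq> U" "W \<subseteq> U"
  shows "\<exists>l v. is_partition l \<and> jordan_basis h U W l v"
  using U
proof (induction "dim U" arbitrary: U rule: less_induct)
  case less
  show ?case
  proof (cases "U = W")
    case True
    have "jordan_basis h U W (\<lambda>_. 0) (\<lambda>_. 0)"
      by (auto simp: jordan_basis_def quotient_basis_def young_diagram_def True)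
    moreover have "is_partition (\<lambda>_. 0)" by (auto simp: is_partition_def antimono_def)
    ultimately show ?thesis by blast
  next
    case False
    let ?X = "span (h ` U \<union> W)"
    have XU: "?X \<subseteq> U" using less.prems by (intro span_minimal) auto
    have ne: "?X \<noteq> U" using nilpotent_image_proper[OF h less.prems(1,2) W(1) less.prems(3) W(2)] False by blast
    obtain B where B: "B \<subseteq> ?X" "independent B" "?X \<subseteq> span B" by (meson basis_exists)
    obtain C where C: "B \<subseteq> C" "C \<subseteq> U" "independent C" "U \<subseteq> span C"
      by (meson maximal_independent_subset_extend[of B U] B(1,2) XU order_trans)
    have "\<not> C \<subseteq> B"
    proof
      assume "C \<subseteq> B"
      then have "span C \<subseteq> ?X" using B(1) by (intro span_minimal) auto
      then show False using C(4) XU ne by blast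
    qed
    then obtain e where e: "e \<in> C" "e \<notin> B" by blast
    \<comment> \<open>A hyperplane of \<open>U\<close> that contains \<open>h U + W\<close>: the
      basis \<open>C\<close> extends one of that subspace, and \<open>e\<close> is one of the added
      vectors.\<close>
    define U' where "U' = span (C - {e})"
    have "span C = U" using C(2,4) less.prems(1) by (intro span_subspace) auto
    have e': "e \<notin> U'" using C(3) e by (auto simp: U'_def dependent_def)
    have XU': "?X \<subseteq> U'"
    proof -
      have "span B \<subseteq> span (C - {e})" using e C(1) by (intro span_mono) auto
      then show ?thesis using B(3) by (auto simp: U'_def)
    qed
    have U'U: "U' \<subseteq> U" unfolding U'_def using C(2) less.prems(1) by (intro span_minimal) auto
    have ins: "span (insert e U') = U"
    proof (rule span_subspace)
      show "insert e U' \<subseteq> U" using U'U e C(2) by auto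
      have "C \<subseteq> span (insert e U')" by (auto simp: U'_def intro: span_base)
      then have "span C \<subseteq> span (insert e U')" by (intro span_minimal) auto
      then show "U \<subseteq> span (insert e U')" using C(4) by blast
    qed (rule less.prems)
    have sU': "subspace U'" by (simp add: U'_def)
    have "U' \<subset> U" using U'U e' e C(2) by blast
    moreover have "span U' = U'" "span U = U" using sU' less.prems(1) by simp_all
    ultimately have "span U' \<subset> span U" by metis
    then have "dim U' < dim U" by (rule dim_psubset)
    moreover have "h ` U \<union> W \<subseteq> U'" using span_superset XU' by (rule order_trans)
    then have hU': "h ` U' \<subseteq> U'" "W \<subseteq> U'" and he: "h e \<in> U'" using U'U e(1) C(2) by auto
    ultimately obtain l v where lv: "is_partition l" "jordan_basis h U' W l v"
      using less.hyps[of U'] sU' by blast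
    show ?thesis
      using jordan_basis_extend[OF lv(2,1) h(1) sU' hU'(1) W(1) hU'(2) W(2) e' he] unfolding ins .
  qed
qed

lemma jordan_type_unique:
  assumes h: "lin h" and W: "subspace W" "h ` W \<subseteq> W" and U: "subspace U" "W \<subseteq> U"
    and l: "is_partition l" "jordan_basis h U W l v"
  shows "jordan_type h U W = l"
  unfolding jordan_type_def
proof (rule the_equality)
  show "is_partition l \<and> (\<exists>v. jordan_basis h U W l v)" using l by blast
  fix l' assume "is_partition l' \<and> (\<exists>v. jordan_basis h U W l' v)"
  then obtain v' where l': "is_partition l'" "jordan_basis h U W l' v'" by blast
  show "l' = l"
  proof (rule partition_eqI_tails[OF l'(1) l(1)])
    fix m show "tails (ptranspose l') m = tails (ptranspose l) m"
      using jordan_basis_rank[OF l(2,1) h U(1) W(1) U(2) W(2), of m]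
        jordan_basis_rank[OF l'(2,1) h U(1) W(1) U(2) W(2), of m] by simp
  qed
qed

lemma jordan_type_spec:
  assumes h: "lin h" "nilpotent h" and W: "subspace W" "h ` W \<subseteq> W"
    and U: "subspace U" "h ` U \<subseteq> U" "W \<subseteq> U"
  shows "is_partition (jordan_type h U W)" "\<exists>v. jordan_basis h U W (jordan_type h U W) v"
    "dim ((h ^^ m) ` U \<union> W) = dim W + tails (ptranspose (jordan_type h U W)) m"
proof -
  obtain l v where l: "is_partition l" "jordan_basis h U W l v" using jordan_basis_exists[OF assms] by blast
  have eq: "jordan_type h U W = l" by (rule jordan_type_unique[OF h(1) W U(1,3) l])
  show "is_partition (jordan_type h U W)" "\<exists>v. jordan_basis h U W (jordan_type h U W) v"
    "dim ((h ^^ m) ` U \<union> W) = dim W + tails (ptranspose (jordan_type h U W)) m"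
    unfolding eq using l jordan_basis_rank[OF l(2,1) h(1) U(1) W(1) U(3) W(2)] by blast+
qed

end

section \<open>The tableaux of a flag in terms of ranks\<close>

lemma sorted_wrt_filter_iff:
  "sorted_wrt R (filter p xs) \<longleftrightarrow> sorted_wrt (\<lambda>x y. p x \<and> p y \<longrightarrow> R x y) xs"
  by (induction xs) auto

lemma SYT_is_tableau:
  assumes "T \<in> SYT l"
  shows "is_tableau T"
proof -
  have rows: "\<forall>r\<in>set T. sorted_wrt (<) r" and cols: "\<forall>c\<in>set (List.transpose T). sorted_wrt (<) c"
    and l: "is_partition l" "shape T = l"
    using assms by (auto simp: SYT_def)
  have "row_above (T ! p) (T ! Suc p)" if p: "Suc p < length T" for p
    unfolding row_above_def
  proof (intro conjI allI impI)
    have "shape T (Suc p) \<le> shape T p" using l by (auto simp: is_partition_def antimono_def)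
    then show len: "length (T ! Suc p) \<le> length (T ! p)" using p by (simp add: shape_def)
    fix c assume c: "c < length (T ! Suc p)"
    have "length r \<le> foldr (\<lambda>xs. max (length xs)) T 0" if "r \<in> set T" for r
      using that by (induction T) auto
    then have ct: "c < length (List.transpose T)"
      using c nth_mem[OF p] less_le_trans by (fastforce simp: length_transpose)
    then have "sorted_wrt (<) (map (\<lambda>r. r ! c) (filter (\<lambda>r. c < length r) T))"
      using cols nth_mem[OF ct] by (simp add: nth_transpose)
    then have "sorted_wrt (\<lambda>r r'. c < length r \<and> c < length r' \<longrightarrow> r ! c < r' ! c) T"
      by (simp add: sorted_wrt_map sorted_wrt_filter_iff)
    then show "T ! p ! c < T ! Suc p ! c"
      using p c len by (auto simp: sorted_wrt_iff_nth_less)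
  qed
  then show ?thesis using rows by (simp add: is_tableau_iff)
qed

lemma SYT_restrict_partition:
  assumes "T \<in> SYT l"
  shows "is_partition (shape (restrict_tableau m T))"
  unfolding is_partition_def antimono_def
  using shape_restrict_antimono[OF SYT_is_tableau[OF assms]] finite_support_shape by blast

lemma the_conj_eq_iff:
  assumes "\<exists>!x. A x \<and> B x" "A p"
  shows "(THE x. A x \<and> B x) = p \<longleftrightarrow> B p"
  using theI'[OF assms(1)] the1_equality[OF assms(1), of p] assms(2) by blast

context finite_dimensional_vector_space
begin

lemma dim_Int_hyperplane:
  assumes A: "subspace A" and W: "subspace W" "subspace W'" "W \<subseteq> W'" "dim W' = dim W + 1"
  shows "dim (A \<inter> W') = dim (A \<inter> W) + (if A \<inter> W' \<subseteq> W then 0 else 1)"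
proof (cases "A \<inter> W' \<subseteq> W")
  case True
  then have "A \<inter> W' = A \<inter> W" using W(3) by auto
  then show ?thesis using True by simp
next
  case False
  then obtain x where x: "x \<in> A" "x \<in> W'" "x \<notin> W" by blast
  let ?X = "A \<inter> W'"
  have X: "subspace ?X" using A W by (intro subspace_inter)
  have "?X \<inter> W = A \<inter> W" using W(3) by auto
  moreover have "dim (?X \<union> W) = dim W + 1"
  proof (rule antisym)
    have "span W = W" using W(1) by simp
    then have "x \<notin> span W" using x by metis
    then have "dim W + 1 = dim (insert x W)" by (simp add: dim_insert)
    also have "\<dots> \<le> dim (?X \<union> W)" using x by (intro dim_subset) auto
    finally show "dim W + 1 \<le> dim (?X \<union> W)" .
    have "?X \<union> W \<subseteq> W'" using W(3) by auto
    then show "dim (?X \<union> W) \<le> dim W + 1" using dim_subset W(4) by metis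
  qed
  ultimately show ?thesis using dim_Un_Int[OF X W(1)] False by simp
qed

text \<open>The kernels of powers of \<open>h\<close> modulo \<open>W\<close> increase with the
  power and eventually leave the hyperplane \<open>U\<close> of \<open>U'\<close>. From that
  threshold \<open>c\<close> on the ranks agree; below it they differ by 1.\<close>

lemma jordan_type_covered_left:
  assumes h: "lin h" "nilpotent h" and W: "subspace W" "h ` W \<subseteq> W"
    and U: "subspace U" "h ` U \<subseteq> U" "W \<subseteq> U" and U': "subspace U'" "h ` U' \<subseteq> U'" "U \<subseteq> U'" "dim U' = dim U + 1"
  shows "covered_by (jordan_type h U W) (jordan_type h U' W)"
proof -
  define K where "K m = {x. (h ^^ m) x \<in> W}" for m
  have K: "subspace (K m)" for m
    using lin_subspace_preimage[OF lin_funpow[OF h(1)] subspace_UNIV W(1)] by (simp add: K_def)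
  have Kmono: "K m \<subseteq> K (m + k)" for m k
  proof (induction k)
    case (Suc k)
    then show ?case using W(2) by (auto simp: K_def)
  qed simp
  obtain N where "\<And>x. (h ^^ N) x = 0" using h(2) by (auto simp: nilpotent_def)
  then have "K N = UNIV" using subspace_0[OF W(1)] by (auto simp: K_def)
  then have N: "\<not> K N \<inter> U' \<subseteq> U" using U' by auto
  define c where "c = (LEAST m. \<not> K m \<inter> U' \<subseteq> U)"
  have c: "\<not> K c \<inter> U' \<subseteq> U" unfolding c_def by (rule LeastI[of _ N]) (rule N)
  have iff: "K m \<inter> U' \<subseteq> U \<longleftrightarrow> m < c" for m
  proof
    assume "K m \<inter> U' \<subseteq> U"
    then show "m < c" using c Kmono[of c "m - c"] by (cases "m < c") auto
  next
    assume "m < c"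
    then show "K m \<inter> U' \<subseteq> U" using not_less_Least[of m "\<lambda>m. \<not> K m \<inter> U' \<subseteq> U"] by (simp add: c_def)
  qed
  have "0 < c" using iff[of 0] U(3) by (simp add: K_def) auto
  have WU': "W \<subseteq> U'" using U(3) U'(3) by blast
  show ?thesis
  proof (rule covered_by_tails[OF jordan_type_spec(1)[OF h W U'(1,2) WU'] jordan_type_spec(1)[OF h W U] \<open>0 < c\<close>])
    fix m
    have e: "{x \<in> S. (h ^^ m) x \<in> W} = K m \<inter> S" for S by (auto simp: K_def)
    have "dim ((h ^^ m) ` U \<union> W) + dim (K m \<inter> U) = dim U + dim W"
      using dim_image_Un_preimage[OF lin_funpow[OF h(1)] U(1) W(1), of m] unfolding e .
    moreover have "dim ((h ^^ m) ` U' \<union> W) + dim (K m \<inter> U') = dim U' + dim W"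
      using dim_image_Un_preimage[OF lin_funpow[OF h(1)] U'(1) W(1), of m] unfolding e .
    moreover have "dim (K m \<inter> U') = dim (K m \<inter> U) + (if m < c then 0 else 1)"
      using dim_Int_hyperplane[OF K U(1) U'(1,3,4), of m] unfolding iff .
    ultimately show "tails (ptranspose (jordan_type h U' W)) m =
        tails (ptranspose (jordan_type h U W)) m + (if m < c then 1 else 0)"
      using jordan_type_spec(3)[OF h W U'(1,2) WU', of m] jordan_type_spec(3)[OF h W U, of m] U'(4)
      by (auto split: if_splits)
  qed
qed

text \<open>Dual to the previous threshold argument: now the decreasing images of powers of
  \<open>h\<close> meet \<open>W'\<close> outside \<open>W\<close> up to a threshold.\<close>

lemma jordan_type_covered_right:
  assumes h: "lin h" "nilpotent h" and W: "subspace W" "h ` W \<subseteq> W"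
    and U: "subspace U" "h ` U \<subseteq> U" and W': "subspace W'" "h ` W' \<subseteq> W'" "W \<subseteq> W'" "dim W' = dim W + 1" "W' \<subseteq> U"
  shows "covered_by (jordan_type h U W') (jordan_type h U W)"
proof -
  define A where "A m = (h ^^ m) ` U" for m
  have A: "subspace (A m)" for m
    unfolding A_def by (intro lin_subspace_image lin_funpow h U)
  have Amono: "A k \<subseteq> A m" if "m \<le> k" for m k unfolding A_def using funpow_image_antimono[OF U(2) that] .
  obtain N where "\<And>x. (h ^^ N) x = 0" using h(2) by (auto simp: nilpotent_def)
  then have N: "A N \<inter> W' \<subseteq> W" using subspace_0[OF W(1)] by (auto simp: A_def)
  define c where "c = (LEAST m. A m \<inter> W' \<subseteq> W)"
  have c: "A c \<inter> W' \<subseteq> W" unfolding c_def by (rule LeastI[of _ N]) (rule N)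
  have iff: "A m \<inter> W' \<subseteq> W \<longleftrightarrow> \<not> m < c" for m
  proof
    assume "A m \<inter> W' \<subseteq> W"
    then show "\<not> m < c" using not_less_Least[of m "\<lambda>m. A m \<inter> W' \<subseteq> W"] by (auto simp: c_def)
  next
    assume "\<not> m < c"
    then show "A m \<inter> W' \<subseteq> W" using c Amono[of c m] by auto
  qed
  have "\<not> W' \<subseteq> W"
  proof
    assume "W' \<subseteq> W"
    then have "W' = W" using W'(3) by blast
    then show False using W'(4) by simp
  qed
  then have "\<not> A 0 \<inter> W' \<subseteq> W" using W'(5) by (auto simp: A_def)
  then have "0 < c" using iff[of 0] by blast
  have WU: "W \<subseteq> U" using W' by blast
  show ?thesis
  proof (rule covered_by_tails[OF jordan_type_spec(1)[OF h W U WU] jordan_type_spec(1)[OF h W'(1,2) U W'(5)] \<open>0 < c\<close>])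
    fix m
    have "dim (A m \<inter> W') = dim (A m \<inter> W) + (if m < c then 1 else 0)"
      using dim_Int_hyperplane[OF A W(1) W'(1,3,4), of m] unfolding iff by simp
    then show "tails (ptranspose (jordan_type h U W)) m =
        tails (ptranspose (jordan_type h U W')) m + (if m < c then 1 else 0)"
      using jordan_type_spec(3)[OF h W U WU, of m] jordan_type_spec(3)[OF h W'(1,2) U W'(5), of m]
        dim_Un_Int[OF A W(1), of m] dim_Un_Int[OF A W'(1), of m] W'(4) unfolding A_def by linarith
  qed
qed

section \<open>Stable flags and their types\<close>

lemma complete_flagD:
  assumes "f \<in> complete_flags"
  shows "f 0 = {0}" "f (dim UNIV) = UNIV" "subspace (f i)" "f i \<subseteq> f (Suc i)" "i \<le> dim UNIV \<Longrightarrow> dim (f i) = i"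
  using assms by (auto simp: complete_flags_def)

lemma complete_flag_mono:
  assumes "f \<in> complete_flags" "i \<le> j"
  shows "f i \<subseteq> f j"
  using assms(2) complete_flagD(4)[OF assms(1)] by (rule lift_Suc_mono_le[rotated])

lemma complete_flag_UNIV:
  assumes "f \<in> complete_flags" "dim UNIV \<le> i"
  shows "f i = UNIV"
  using complete_flag_mono[OF assms] complete_flagD(2)[OF assms(1)] by blast

lemma stable_flag_stable:
  assumes "f \<in> stable_flags h"
  shows "f \<in> complete_flags" "h ` f i \<subseteq> f i"
proof -
  show f: "f \<in> complete_flags" using assms by (simp add: stable_flags_def)
  show "h ` f i \<subseteq> f i"
    using assms complete_flag_UNIV[OF f, of i] by (cases "i \<le> dim UNIV") (auto simp: stable_flags_def)
qed

text \<open>Nakayama's lemma makes \<open>h f_{i+1} + f_i\<close> proper in \<open>f_{i+1}\<close>,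
  and between \<open>f_i\<close> and \<open>f_{i+1}\<close> there is no room for another
  subspace.\<close>

lemma stable_flag_strict:
  assumes "f \<in> stable_flags h" "lin h" "nilpotent h" "i < dim UNIV"
  shows "h ` f (Suc i) \<subseteq> f i"
proof -
  note f = stable_flag_stable[OF assms(1)]
  note F = complete_flagD[OF f(1)]
  let ?X = "span (h ` f (Suc i) \<union> f i)"
  have "f (Suc i) \<noteq> f i" using F(5)[of i] F(5)[of "Suc i"] assms(4) by auto
  then have ne: "?X \<noteq> f (Suc i)"
    using nilpotent_image_proper[OF assms(2,3) F(3) f(2) F(3) F(4) f(2)] by blast
  have sub: "?X \<subseteq> f (Suc i)" using f(2) F(3,4) by (intro span_minimal) auto
  have "dim ?X \<noteq> dim (f (Suc i))"
    using subspace_dim_equal[OF subspace_span F(3) sub] ne by auto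
  then have "dim ?X \<le> dim (f i)"
    using dim_subset[OF sub] F(5)[of i] F(5)[of "Suc i"] assms(4) by simp
  moreover have "f i \<subseteq> ?X" by (auto intro: span_base)
  ultimately have "f i = ?X" by (intro subspace_dim_equal F(3)) auto
  then show ?thesis by (auto intro: span_base)
qed

lemma jordan_type_zero:
  assumes "lin h" "subspace U" "h ` U \<subseteq> U"
  shows "jordan_type h U U = (\<lambda>_. 0)"
proof (rule jordan_type_unique[OF assms(1,2,3,2)])
  show "is_partition (\<lambda>_. 0)" by (auto simp: is_partition_def antimono_def)
  show "jordan_basis h U U (\<lambda>_. 0) (\<lambda>_. 0)"
    by (auto simp: jordan_basis_def quotient_basis_def young_diagram_def)
qed simp

lemma lin_zero_stable: "lin h \<Longrightarrow> h ` {0} \<subseteq> {0}"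
  using self.linear_0 by auto

lemma r_flags_iff:
  assumes h: "lin h" "nilpotent h" and P: "P \<in> SYT (jordan_type h UNIV {0})"
  shows "f \<in> r_flags h P \<longleftrightarrow> f \<in> stable_flags h \<and>
    (\<forall>i\<le>dim UNIV. jordan_type h (f i) {0} = shape (restrict_tableau i P))"
proof (cases "f \<in> stable_flags h")
  case True
  note f = stable_flag_stable[OF True]
  note F = complete_flagD[OF f(1)]
  let ?K = "\<lambda>i. jordan_type h (f i) {0}" and ?n = "dim UNIV"
  have z: "subspace {0}" "h ` {0} \<subseteq> {0}" "{0} \<subseteq> f i" for i
    using lin_zero_stable[OF h(1)] subspace_0[OF F(3)] by auto
  have Kn: "?K ?n = jordan_type h UNIV {0}" using F(2) by simp
  have ex: "\<exists>!T. T \<in> SYT (?K ?n) \<and> ch T = map ?K (rev [0..<Suc ?n])"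
  proof (rule SYT_chain_ex1)
    show "?K 0 = (\<lambda>_. 0)" using jordan_type_zero[OF h(1) z(1,2)] F(1) by simp
    show "is_partition (?K i)" for i using jordan_type_spec(1)[OF h z(1,2) F(3) f(2) z(3)] .
    show "covered_by (?K i) (?K (Suc i))" if "i < ?n" for i
      using jordan_type_covered_left[OF h z(1,2) F(3) f(2) z(3) F(3) f(2) F(4)] F(5)[of i] F(5)[of "Suc i"] that
      by simp
  qed
  have size: "psize (jordan_type h UNIV {0}) = ?n"
    using SYT_chain_exists[of ?K ?n] jordan_type_covered_left[OF h z(1,2) F(3) f(2) z(3) F(3) f(2) F(4)]
      F(5) jordan_type_spec(1)[OF h z(1,2) F(3) f(2) z(3)] jordan_type_zero[OF h(1) z(1,2)] F(1) Kn by simp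
  have "r_tableau h f = P \<longleftrightarrow> ch P = map ?K (rev [0..<Suc ?n])"
    unfolding r_tableau_def using the_conj_eq_iff[OF ex[unfolded Kn] P] .
  also have "\<dots> \<longleftrightarrow> (\<forall>m\<le>?n. shape (restrict_tableau m P) = ?K m)" by (rule ch_eq_iff[OF P size])
  finally show ?thesis using True by (auto simp: r_flags_def)
qed (auto simp: r_flags_def)

lemma q_flags_iff:
  assumes h: "lin h" "nilpotent h" and Q: "Q \<in> SYT (jordan_type h UNIV {0})"
  shows "f \<in> q_flags h Q \<longleftrightarrow> f \<in> stable_flags h \<and>
    (\<forall>i\<le>dim UNIV. jordan_type h UNIV (f i) = shape (restrict_tableau (dim UNIV - i) Q))"
proof (cases "f \<in> stable_flags h")
  case True
  note f = stable_flag_stable[OF True]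
  note F = complete_flagD[OF f(1)]
  let ?n = "dim UNIV"
  \<comment> \<open>Indexing by codimension turns the chain of quotients, which shrinks along the
    flag, into a growing chain that starts with the zero partition.\<close>
  let ?K = "\<lambda>i. jordan_type h UNIV (f (?n - i))"
  note spec = jordan_type_spec[OF h F(3) f(2) subspace_UNIV subset_UNIV subset_UNIV]
  have Kn: "?K ?n = jordan_type h UNIV {0}" using F(1) by simp
  have K0: "?K 0 = (\<lambda>_. 0)" using jordan_type_zero[OF h(1) subspace_UNIV] F(2) by simp
  have cov: "covered_by (?K i) (?K (Suc i))" if "i < ?n" for i
  proof -
    have "?n - i = Suc (?n - Suc i)" using that by simp
    then show ?thesis
      using jordan_type_covered_right[OF h F(3) f(2) subspace_UNIV subset_UNIV F(3) f(2) F(4), of "?n - Suc i"]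
        F(5)[of "?n - i"] F(5)[of "?n - Suc i"] by simp
  qed
  have ex: "\<exists>!T. T \<in> SYT (?K ?n) \<and> ch T = map ?K (rev [0..<Suc ?n])"
    by (rule SYT_chain_ex1) (use K0 spec(1) cov in auto)
  have size: "psize (jordan_type h UNIV {0}) = ?n"
    using SYT_chain_exists[of ?K ?n] K0 spec(1) cov Kn by simp
  have rev: "map (\<lambda>i. jordan_type h UNIV (f i)) [0..<Suc ?n] = map ?K (rev [0..<Suc ?n])"
    by (rule nth_equalityI) (auto simp: rev_nth nth_append simp del: upt_Suc)
  have "q_tableau h f = Q \<longleftrightarrow> ch Q = map ?K (rev [0..<Suc ?n])"
    unfolding q_tableau_def rev using the_conj_eq_iff[OF ex[unfolded Kn] Q] .
  also have "\<dots> \<longleftrightarrow> (\<forall>m\<le>?n. shape (restrict_tableau m Q) = ?K m)" by (rule ch_eq_iff[OF Q size])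
  also have "\<dots> \<longleftrightarrow> (\<forall>i\<le>?n. jordan_type h UNIV (f i) = shape (restrict_tableau (?n - i) Q))"
    by (metis diff_diff_cancel diff_le_self)
  finally show ?thesis using True by (auto simp: q_flags_def)
qed (auto simp: q_flags_def)

lemma jordan_type_eq_iff_rank:
  assumes h: "lin h" "nilpotent h" and W: "subspace W" "h ` W \<subseteq> W"
    and U: "subspace U" "h ` U \<subseteq> U" "W \<subseteq> U" and l: "is_partition l"
  shows "jordan_type h U W = l \<longleftrightarrow> (\<forall>m. dim ((h ^^ m) ` U \<union> W) = dim W + tails (ptranspose l) m)"
  using jordan_type_spec(3)[OF h W U] partition_eqI_tails[OF jordan_type_spec(1)[OF h W U] l] by auto

text \<open>\<open>U / (U \<inter> W)\<close> embeds into the whole space modulo \<open>W\<close>,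
  so the ranks for the subquotient can be read off from sums with \<open>W\<close> itself.\<close>

lemma jordan_type_Int_rank:
  assumes h: "lin h" "nilpotent h" and W: "subspace W" "h ` W \<subseteq> W" and U: "subspace U" "h ` U \<subseteq> U"
  shows "dim ((h ^^ m) ` U \<union> W) = dim W + tails (ptranspose (jordan_type h U (U \<inter> W))) m"
proof -
  let ?A = "(h ^^ m) ` U"
  have A: "subspace ?A" by (intro lin_subspace_image lin_funpow h U)
  have UW: "subspace (U \<inter> W)" "h ` (U \<inter> W) \<subseteq> U \<inter> W" using U W by (auto intro: subspace_inter)
  have "?A \<inter> (U \<inter> W) = ?A \<inter> W" using funpow_stable[OF U(2), of m] by auto
  then show ?thesis
    using jordan_type_spec(3)[OF h UW U, of m] dim_Un_Int[OF A W(1)] dim_Un_Int[OF A UW(1)] by simp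
qed

end

section \<open>Determinants, polynomial functions and Pluecker coordinates\<close>

definition polyfun :: "('a::comm_ring_1 \<Rightarrow> 'a) \<Rightarrow> bool" where
  "polyfun p \<longleftrightarrow> (\<exists>q. p = poly q)"

lemma polyfun_const [intro]: "polyfun (\<lambda>_. c)"
  unfolding polyfun_def by (rule exI[of _ "[:c:]"]) auto

lemma polyfun_id [intro]: "polyfun (\<lambda>t. t)"
  unfolding polyfun_def by (rule exI[of _ "[:0, 1:]"]) auto

lemma polyfun_add [intro]: "polyfun p \<Longrightarrow> polyfun q \<Longrightarrow> polyfun (\<lambda>t. p t + q t)"
  unfolding polyfun_def by (elim exE, rule_tac x = "qa + qaa" in exI) (auto simp: fun_eq_iff)

lemma polyfun_mult [intro]: "polyfun p \<Longrightarrow> polyfun q \<Longrightarrow> polyfun (\<lambda>t. p t * q t)"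
  unfolding polyfun_def by (elim exE, rule_tac x = "qa * qaa" in exI) (auto simp: fun_eq_iff)

lemma polyfun_diff [intro]: "polyfun p \<Longrightarrow> polyfun q \<Longrightarrow> polyfun (\<lambda>t. p t - q t)"
  unfolding polyfun_def by (elim exE, rule_tac x = "qa - qaa" in exI) (auto simp: fun_eq_iff)

lemma polyfun_sum: "(\<And>a. a \<in> A \<Longrightarrow> polyfun (p a)) \<Longrightarrow> polyfun (\<lambda>t. \<Sum>a\<in>A. p a t)"
  by (induction A rule: infinite_finite_induct) auto

lemma polyfun_prod: "(\<And>a. a \<in> A \<Longrightarrow> polyfun (p a)) \<Longrightarrow> polyfun (\<lambda>t. \<Prod>a\<in>A. p a t)"
  by (induction A rule: infinite_finite_induct) auto

lemma permutes_lessD: "p permutes {0..<n::nat} \<Longrightarrow> i < n \<Longrightarrow> p i < n"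
  using permutes_in_image[of p "{0..<n}" i] by simp

lemma polyfun_det:
  assumes "\<And>i j. i < n \<Longrightarrow> j < n \<Longrightarrow> polyfun (\<lambda>t. M t i j)"
  shows "polyfun (\<lambda>t. det (mat n n (\<lambda>(i, j). M t i j)))"
proof -
  have "det (mat n n (\<lambda>(i, j). M t i j)) = (\<Sum>p\<in>{p. p permutes {0..<n}}. signof p * (\<Prod>i\<in>{0..<n}. M t i (p i)))" for t
    by (subst det_def'[of _ n]) (auto intro!: sum.cong prod.cong simp: permutes_lessD)
  then show ?thesis
    using assms by (auto intro!: polyfun_sum polyfun_mult polyfun_prod simp: permutes_lessD)
qed

lemma polyfun_finite_zeros:
  fixes p :: "'a::field \<Rightarrow> 'a"
  assumes "polyfun p" "p t0 \<noteq> 0"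
  shows "finite {t. p t = 0}"
proof -
  obtain q where q: "p = poly q" using assms by (auto simp: polyfun_def)
  then have "q \<noteq> 0" using assms(2) by auto
  then show ?thesis unfolding q by (rule poly_roots_finite)
qed

section \<open>Calculus of multihomogeneous functions\<close>

lemma multihom_cmult: "multihom I g d p \<Longrightarrow> multihom I g d (\<lambda>x. c * p x)"
  using multihom.mult[OF multihom.const[of I g c]] by fastforce

lemma multihom_sum:
  assumes "finite A" "A \<noteq> {}" "\<And>a. a \<in> A \<Longrightarrow> multihom I g d (p a)"
  shows "multihom I g d (\<lambda>x. \<Sum>a\<in>A. p a x)"
  using assms by (induction A rule: finite_ne_induct) (auto intro: multihom.add)

lemma multihom_prod:
  assumes "finite A" "\<And>a. a \<in> A \<Longrightarrow> multihom I g (d a) (p a)"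
  shows "multihom I g (\<lambda>k. \<Sum>a\<in>A. d a k) (\<lambda>x. \<Prod>a\<in>A. p a x)"
  using assms
proof (induction A rule: finite_induct)
  case empty
  then show ?case using multihom.const[of I g 1] by simp
next
  case (insert a A)
  then show ?case using multihom.mult[of I g "d a" "p a"] by simp
qed

text \<open>Every term of the determinant takes one entry from each column, so degrees that depend
  on the column alone add up to the same total.\<close>

lemma multihom_det:
  assumes "\<And>i j. i < n \<Longrightarrow> j < n \<Longrightarrow> multihom I g (d j) (\<lambda>x. M x i j)"
  shows "multihom I g (\<lambda>k. \<Sum>j\<in>{0..<n}. d j k) (\<lambda>x. det (mat n n (\<lambda>(i, j). M x i j)))"
proof -
  have "det (mat n n (\<lambda>(i, j). M x i j)) = (\<Sum>p\<in>{p. p permutes {0..<n}}. signof p * (\<Prod>i\<in>{0..<n}. M x i (p i)))" for x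
    by (subst det_def'[of _ n]) (auto intro!: sum.cong prod.cong simp: permutes_lessD)
  moreover have "multihom I g (\<lambda>k. \<Sum>j\<in>{0..<n}. d j k) (\<lambda>x. \<Prod>i\<in>{0..<n}. M x i (p i))"
    if p: "p permutes {0..<n}" for p
  proof -
    have "multihom I g (\<lambda>k. \<Sum>i\<in>{0..<n}. d (p i) k) (\<lambda>x. \<Prod>i\<in>{0..<n}. M x i (p i))"
      using p by (intro multihom_prod assms) (auto simp: permutes_lessD)
    moreover have "(\<Sum>i\<in>{0..<n}. d (p i) k) = (\<Sum>j\<in>{0..<n}. d j k)" for k
      using sum.permute[OF p, of "\<lambda>j. d j k"] by (simp add: o_def)
    ultimately show ?thesis by simp
  qed
  moreover have "finite {p. p permutes {0..<n}}" "{p. p permutes {0..<n}} \<noteq> {}"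
    using permutes_id[of "{0..<n}"] by (blast intro: finite_permutations)+
  ultimately show ?thesis
    by (simp only:) (rule multihom_sum, auto intro: multihom_cmult)
qed

lemma multihom_support: "multihom I g d p \<Longrightarrow> finite {k. d k \<noteq> 0}"
proof (induction rule: multihom.induct)
  case (var i)
  then show ?case by (rule_tac finite_subset[of _ "{g i}"]) (auto split: if_splits)
next
  case (mult d p d' q)
  then show ?case by (rule_tac finite_subset[of _ "{k. d k \<noteq> 0} \<union> {k. d' k \<noteq> 0}"]) auto
qed auto

text \<open>This is why vanishing does not depend on the adapted basis: a change of basis rescales
  all coordinates of one group by a common factor. The product runs over the finite support of
  \<open>d\<close>, since the group indices may form an infinite type.\<close>

lemma multihom_scale:
  assumes "multihom I g d p"
  shows "(\<And>i. i \<in> I \<Longrightarrow> y i = c (g i) * x i) \<Longrightarrow> p y = (\<Prod>k | d k \<noteq> 0. c k ^ d k) * p x"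
  using assms
proof (induction rule: multihom.induct)
  case (const c)
  then show ?case by simp
next
  case (var i)
  have "{k. (if k = g i then 1 else 0 :: nat) \<noteq> 0} = {g i}" by auto
  then show ?case using var by simp
next
  case (add d p q)
  then show ?case by (simp add: algebra_simps)
next
  case (mult d p d' q)
  let ?D = "{k. d k \<noteq> 0} \<union> {k. d' k \<noteq> 0}"
  have fin: "finite ?D" using multihom_support[OF mult.hyps(1)] multihom_support[OF mult.hyps(2)] by simp
  have ext: "(\<Prod>k | d k \<noteq> 0. c k ^ d k) = (\<Prod>k\<in>?D. c k ^ d k)" "(\<Prod>k | d' k \<noteq> 0. c k ^ d' k) = (\<Prod>k\<in>?D. c k ^ d' k)"
    by (rule prod.mono_neutral_left[OF fin]; simp)+
  have "{k. d k + d' k \<noteq> 0} = ?D" by auto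
  then have "(\<Prod>k | d k + d' k \<noteq> 0. c k ^ (d k + d' k)) = (\<Prod>k | d k \<noteq> 0. c k ^ d k) * (\<Prod>k | d' k \<noteq> 0. c k ^ d' k)"
    unfolding ext by (simp add: power_add prod.distrib)
  then show ?case using mult by (simp add: algebra_simps)
qed

lemma multihom_polyfun:
  assumes "multihom I g d p" "\<And>i. i \<in> I \<Longrightarrow> polyfun (\<lambda>t. x t i)"
  shows "polyfun (\<lambda>t. p (x t))"
  using assms by (induction rule: multihom.induct) auto

context finite_dimensional_vector_space
begin

section \<open>Coordinates, minors and generic rank\<close>

lemma rep_add [simp]: "representation Basis (x + y) b = representation Basis x b + representation Basis y b"
  and rep_scale [simp]: "representation Basis (c *s x) b = c * representation Basis x b"
  and rep_diff [simp]: "representation Basis (x - y) b = representation Basis x b - representation Basis y b"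
  by (simp_all add: representation_add representation_scale representation_diff independent_Basis span_Basis)

lemma rep_sum [simp]: "representation Basis (\<Sum>a\<in>A. x a) b = (\<Sum>a\<in>A. representation Basis (x a) b)"
  by (simp add: representation_sum independent_Basis span_Basis)

lemma rep_Basis: "k \<in> Basis \<Longrightarrow> representation Basis k b = (if b = k then 1 else 0)"
  by (simp add: representation_basis independent_Basis)

lemma rep_expand: "(\<Sum>b\<in>Basis. representation Basis x b *s b) = x"
  by (rule sum_representation_eq) (simp_all add: independent_Basis span_Basis finite_Basis)

lemma rep_eqI: "(\<And>b. b \<in> Basis \<Longrightarrow> representation Basis x b = representation Basis y b) \<Longrightarrow> x = y"
proof -
  assume "\<And>b. b \<in> Basis \<Longrightarrow> representation Basis x b = representation Basis y b"
  then have "(\<Sum>b\<in>Basis. representation Basis x b *s b) = (\<Sum>b\<in>Basis. representation Basis y b *s b)"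
    by (intro sum.cong) auto
  then show "x = y" by (simp only: rep_expand)
qed

lemma rep_sum_Basis: "k \<in> Basis \<Longrightarrow> representation Basis (\<Sum>b\<in>Basis. c b *s b) k = c k"
  using finite_Basis by (simp add: rep_Basis if_distrib cong: if_cong)

definition basis_list :: "'b list" where
  "basis_list = (SOME bs. distinct bs \<and> set bs = Basis)"

lemma basis_list: "distinct basis_list" "set basis_list = Basis" "length basis_list = dim UNIV"
proof -
  have "\<exists>bs. distinct bs \<and> set bs = Basis" using finite_distinct_list[OF finite_Basis] by blast
  then have *: "distinct basis_list \<and> set basis_list = Basis"
    unfolding basis_list_def by (rule someI_ex)
  then show "distinct basis_list" "set basis_list = Basis" by auto
  then show "length basis_list = dim UNIV" using distinct_card by force
qed

lemma independent_family_iff: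
  assumes "finite I"
  shows "(\<forall>c. (\<Sum>i\<in>I. c i *s Y i) = 0 \<longrightarrow> (\<forall>i\<in>I. c i = 0)) \<longleftrightarrow> dim (Y ` I) = card I"
proof -
  have "0 \<in> span (Y ` I)" by (rule span_zero)
  then have eq: "quotient_basis (span (Y ` I)) {0} I Y \<longleftrightarrow> Y ` I \<subseteq> span (Y ` I) \<and> span (Y ` I) \<subseteq> span (Y ` I \<union> {0}) \<and>
      dim (span (Y ` I)) = dim {0} + card I"
    by (intro quotient_basis_iff assms) auto
  have sp: "Y ` I \<subseteq> span (Y ` I)" "span (Y ` I) \<subseteq> span (Y ` I \<union> {0})"
    by (auto intro: span_base span_mono[THEN subsetD])
  have "quotient_basis (span (Y ` I)) {0} I Y \<longleftrightarrow> (\<forall>c. (\<Sum>i\<in>I. c i *s Y i) = 0 \<longrightarrow> (\<forall>i\<in>I. c i = 0))"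
    using span_family_Un_iff[OF assms subspace_single_0, of _ Y] sp unfolding quotient_basis_def by blast
  then show ?thesis using eq sp by simp
qed

lemma basis_seq_iff: "basis_seq Y \<longleftrightarrow> dim (Y ` {..<dim UNIV}) = dim UNIV"
proof
  assume "basis_seq Y"
  then show "dim (Y ` {..<dim UNIV}) = dim UNIV"
    unfolding basis_seq_def using dim_eq_card_independent card_image by fastforce
next
  assume d: "dim (Y ` {..<dim UNIV}) = dim UNIV"
  let ?B = "Y ` {..<dim UNIV}"
  have "dim ?B \<le> card ?B" by (rule dim_le_card') simp
  moreover have "card ?B \<le> dim UNIV" using card_image_le[of "{..<dim UNIV}" Y] by simp
  ultimately have card: "card ?B = dim UNIV" using d by linarith
  then have "inj_on Y {..<dim UNIV}" by (intro eq_card_imp_inj_on) auto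
  moreover have "independent ?B"
    by (rule card_le_dim_spanning[of ?B ?B]) (use card d span_superset in auto)
  moreover have "span ?B = UNIV"
    using d by (intro subspace_dim_equal) (simp_all del: dim_UNIV)
  ultimately show "basis_seq Y" by (simp add: basis_seq_def)
qed

lemma basis_seq_dim:
  assumes "basis_seq Y" "A \<subseteq> {..<dim UNIV}"
  shows "dim (Y ` A) = card A"
proof -
  have "independent (Y ` A)"
    using assms(1) independent_mono[OF _ image_mono[OF assms(2)]] by (simp add: basis_seq_def)
  moreover have "inj_on Y A" using assms by (auto simp: basis_seq_def intro: inj_on_subset)
  ultimately show ?thesis using dim_eq_card_independent card_image by fastforce
qed

text \<open>\<open>plucker\<close> with the adapted basis as an explicit argument in place of the
  chosen one.\<close>

definition coord_det :: "(nat \<Rightarrow> 'b) \<Rightarrow> 'b list \<Rightarrow> 'a" where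
  "coord_det Y ks = det (mat (length ks) (length ks) (\<lambda>(a, b). representation Basis (Y b) (ks ! a)))"

lemma coord_det_eq_0_iff:
  "coord_det Y ks = 0 \<longleftrightarrow> (\<exists>c. (\<exists>b<length ks. c b \<noteq> 0) \<and>
     (\<forall>a<length ks. representation Basis (\<Sum>b<length ks. c b *s Y b) (ks ! a) = 0))"
proof -
  let ?n = "length ks" and ?A = "mat (length ks) (length ks) (\<lambda>(a, b). representation Basis (Y b) (ks ! a))"
  have A: "?A \<in> carrier_mat ?n ?n" by simp
  have prod: "(?A *\<^sub>v v) $ a = representation Basis (\<Sum>b<?n. v $ b *s Y b) (ks ! a)"
    if "v \<in> carrier_vec ?n" "a < ?n" for v a
    using that by (auto simp: scalar_prod_def atLeast0LessThan mult.commute intro!: sum.cong)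
  have "coord_det Y ks = 0 \<longleftrightarrow> (\<exists>v. v \<in> carrier_vec ?n \<and> v \<noteq> 0\<^sub>v ?n \<and> ?A *\<^sub>v v = 0\<^sub>v ?n)"
    unfolding coord_det_def by (rule det_0_iff_vec_prod_zero_field[OF A])
  also have "\<dots> \<longleftrightarrow> (\<exists>c. (\<exists>b<?n. c b \<noteq> 0) \<and> (\<forall>a<?n. representation Basis (\<Sum>b<?n. c b *s Y b) (ks ! a) = 0))"
  proof
    assume "\<exists>v. v \<in> carrier_vec ?n \<and> v \<noteq> 0\<^sub>v ?n \<and> ?A *\<^sub>v v = 0\<^sub>v ?n"
    then obtain v where v: "v \<in> carrier_vec ?n" "v \<noteq> 0\<^sub>v ?n" "?A *\<^sub>v v = 0\<^sub>v ?n" by blast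
    have "\<exists>b<?n. v $ b \<noteq> 0"
    proof (rule ccontr)
      assume "\<not> ?thesis"
      then have "v = 0\<^sub>v ?n" using v(1) by (intro eq_vecI) auto
      then show False using v(2) by blast
    qed
    moreover have "\<forall>a<?n. representation Basis (\<Sum>b<?n. v $ b *s Y b) (ks ! a) = 0"
      using prod[OF v(1)] v(3) by (metis index_zero_vec(1))
    ultimately show "\<exists>c. (\<exists>b<?n. c b \<noteq> 0) \<and> (\<forall>a<?n. representation Basis (\<Sum>b<?n. c b *s Y b) (ks ! a) = 0)"
      by (intro exI[of _ "\<lambda>b. v $ b"]) blast
  next
    assume "\<exists>c. (\<exists>b<?n. c b \<noteq> 0) \<and> (\<forall>a<?n. representation Basis (\<Sum>b<?n. c b *s Y b) (ks ! a) = 0)"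
    then obtain c where c: "\<exists>b<?n. c b \<noteq> 0" "\<forall>a<?n. representation Basis (\<Sum>b<?n. c b *s Y b) (ks ! a) = 0" by blast
    have v: "vec ?n c \<in> carrier_vec ?n" by simp
    have "vec ?n c \<noteq> 0\<^sub>v ?n" using c(1) by (metis index_vec index_zero_vec(1))
    moreover have "?A *\<^sub>v vec ?n c = 0\<^sub>v ?n"
    proof (rule eq_vecI)
      fix a assume "a < dim_vec (0\<^sub>v ?n)"
      then have a: "a < ?n" by simp
      have "(\<Sum>b<?n. vec ?n c $ b *s Y b) = (\<Sum>b<?n. c b *s Y b)" by (intro sum.cong) auto
      then show "(?A *\<^sub>v vec ?n c) $ a = 0\<^sub>v ?n $ a" using prod[OF v a] c(2) a by simp
    qed simp
    ultimately show "\<exists>v. v \<in> carrier_vec ?n \<and> v \<noteq> 0\<^sub>v ?n \<and> ?A *\<^sub>v v = 0\<^sub>v ?n" using v by blast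
  qed
  finally show ?thesis .
qed

lemma coord_det_basis_list: "coord_det Y basis_list \<noteq> 0 \<longleftrightarrow> basis_seq Y"
proof -
  let ?n = "dim UNIV"
  have *: "(\<forall>a<?n. representation Basis x (basis_list ! a) = 0) \<longleftrightarrow> x = 0" for x
  proof
    assume *: "\<forall>a<?n. representation Basis x (basis_list ! a) = 0"
    have "representation Basis x b = representation Basis 0 b" if "b \<in> Basis" for b
      using that * basis_list(2,3) by (auto simp: representation_zero in_set_conv_nth[of b basis_list, unfolded basis_list])
    then show "x = 0" by (rule rep_eqI)
  qed (simp add: representation_zero)
  have "coord_det Y basis_list = 0 \<longleftrightarrow> (\<exists>c. (\<exists>b<?n. c b \<noteq> 0) \<and> (\<Sum>b<?n. c b *s Y b) = 0)"
    unfolding coord_det_eq_0_iff basis_list(3) by (simp only: *)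
  then have "coord_det Y basis_list \<noteq> 0 \<longleftrightarrow> (\<forall>c. (\<Sum>b\<in>{..<?n}. c b *s Y b) = 0 \<longrightarrow> (\<forall>b\<in>{..<?n}. c b = 0))"
    by auto
  then show ?thesis
    unfolding basis_seq_iff using independent_family_iff[of "{..<?n}" Y] by simp
qed

text \<open>A lower bound for a rank is certified by one nonzero determinant: independent members of
  the family, completed to a basis by fixed vectors \<open>c\<close>. For any other family the same
  expression being nonzero gives the same bound, which makes rank conditions open both along curves
  and in Pluecker coordinates.\<close>

lemma dim_witness:
  fixes Y :: "'i \<Rightarrow> 'b"
  assumes I: "finite I"
  obtains t :: "nat \<Rightarrow> 'i" and c :: "nat \<Rightarrow> 'b" where
    "\<And>b. b < dim (Y ` I) \<Longrightarrow> t b \<in> I"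
    "coord_det (\<lambda>b. if b < dim (Y ` I) then Y (t b) else c b) basis_list \<noteq> 0"
    "\<And>Z. coord_det (\<lambda>b. if b < dim (Y ` I) then Z (t b) else c b) basis_list \<noteq> 0 \<Longrightarrow> dim (Y ` I) \<le> dim (Z ` I)"
proof -
  let ?s = "dim (Y ` I)" and ?n = "dim UNIV"
  obtain B where B: "B \<subseteq> Y ` I" "independent B" "Y ` I \<subseteq> span B" "card B = ?s" by (meson basis_exists)
  obtain C where C: "B \<subseteq> C" "independent C" "UNIV \<subseteq> span C"
    by (meson maximal_independent_subset_extend[of B UNIV] B(2) subset_UNIV)
  have finC: "finite C" using C(2) by (rule finiteI_independent)
  have finB: "finite B" using B(2) by (rule finiteI_independent)
  have cardC: "card C = ?n" using basis_card_eq_dim[of C UNIV] C by simp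
  obtain g where g: "bij_betw g {..<?s} B"
    using ex_bij_betw_nat_finite[OF finB] B(4) by (auto simp: atLeast0LessThan)
  have "card (C - B) = ?n - ?s" using C(1) finB cardC B(4) by (simp add: card_Diff_subset)
  then obtain c0 where c0: "bij_betw c0 {..<?n - ?s} (C - B)"
    using ex_bij_betw_nat_finite[of "C - B"] finC by (auto simp: atLeast0LessThan)
  have sn: "?s \<le> ?n" by (rule dim_subset) simp
  have "\<exists>i. i \<in> I \<and> Y i = g b" if "b < ?s" for b
    using bij_betwE[OF g] that B(1) by fastforce
  then obtain t where t: "\<And>b. b < ?s \<Longrightarrow> t b \<in> I" "\<And>b. b < ?s \<Longrightarrow> Y (t b) = g b" by metis
  define c where "c b = c0 (b - ?s)" for b
  let ?q = "\<lambda>Z b. if b < ?s then Z (t b) else c b"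
  show thesis
  proof (rule that[of t c, OF t(1)])
    have "?q Y ` {..<?n} = C"
    proof -
      have "{..<?n} = {..<?s} \<union> {?s..<?n}" using sn by auto
      then have "?q Y ` {..<?n} = ?q Y ` {..<?s} \<union> ?q Y ` {?s..<?n}" by (metis image_Un)
      also have "?q Y ` {..<?s} = g ` {..<?s}" using t by (intro image_cong) auto
      also have "\<dots> = B" using g by (simp add: bij_betw_def)
      also have "?q Y ` {?s..<?n} = c0 ` {..<?n - ?s}"
      proof (intro equalityI subsetI)
        fix x assume "x \<in> ?q Y ` {?s..<?n}"
        then obtain b where "?s \<le> b" "b < ?n" "x = c0 (b - ?s)" by (auto simp: c_def)
        then show "x \<in> c0 ` {..<?n - ?s}" by auto
      next
        fix x assume "x \<in> c0 ` {..<?n - ?s}"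
        then obtain b where "b < ?n - ?s" "x = c0 b" by auto
        then show "x \<in> ?q Y ` {?s..<?n}" by (intro image_eqI[of _ _ "b + ?s"]) (auto simp: c_def)
      qed
      also have "\<dots> = C - B" using c0 by (simp add: bij_betw_def)
      finally show ?thesis using C(1) by auto
    qed
    then show "coord_det (?q Y) basis_list \<noteq> 0"
      unfolding coord_det_basis_list basis_seq_iff using C(2) cardC dim_eq_card_independent by simp
    fix Z assume "coord_det (?q Z) basis_list \<noteq> 0"
    then have "dim (?q Z ` {..<?s}) = ?s"
      unfolding coord_det_basis_list using basis_seq_dim[of "?q Z" "{..<?s}"] sn by simp
    moreover have "?q Z ` {..<?s} \<subseteq> Z ` I" using t(1) by auto
    ultimately show "?s \<le> dim (Z ` I)" using dim_subset by metis
  qed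
qed

definition vpolyfun :: "('a \<Rightarrow> 'b) \<Rightarrow> bool" where
  "vpolyfun x \<longleftrightarrow> (\<forall>b\<in>Basis. polyfun (\<lambda>t. representation Basis (x t) b))"

lemma vpolyfun_const: "vpolyfun (\<lambda>_. x)"
  by (auto simp: vpolyfun_def)

lemma vpolyfun_add: "vpolyfun x \<Longrightarrow> vpolyfun y \<Longrightarrow> vpolyfun (\<lambda>t. x t + y t)"
  by (auto simp: vpolyfun_def)

lemma vpolyfun_scale: "polyfun p \<Longrightarrow> vpolyfun x \<Longrightarrow> vpolyfun (\<lambda>t. p t *s x t)"
  by (auto simp: vpolyfun_def)

lemma vpolyfun_sum: "(\<And>a. a \<in> A \<Longrightarrow> vpolyfun (x a)) \<Longrightarrow> vpolyfun (\<lambda>t. \<Sum>a\<in>A. x a t)"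
  by (auto simp: vpolyfun_def intro!: polyfun_sum)

lemma vpolyfun_rep: "vpolyfun x \<Longrightarrow> polyfun (\<lambda>t. representation Basis (x t) b)"
proof (cases "b \<in> Basis")
  case False
  then have "representation Basis y b = 0" for y using representation_ne_zero[of Basis y b] by blast
  then show ?thesis by auto
qed (simp add: vpolyfun_def)

lemma vpolyfun_apply:
  assumes T: "\<And>t. lin (T t)" "\<And>y. vpolyfun (\<lambda>t. T t y)" and x: "vpolyfun x"
  shows "vpolyfun (\<lambda>t. T t (x t))"
proof -
  have "T t (x t) = (\<Sum>b\<in>Basis. representation Basis (x t) b *s T t b)" for t
  proof -
    interpret T: Vector_Spaces.linear scale scale "T t" by (rule T)
    have "T t (x t) = T t (\<Sum>b\<in>Basis. representation Basis (x t) b *s b)" by (simp add: rep_expand)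
    then show ?thesis by (simp add: T.sum T.scale)
  qed
  then show ?thesis using vpolyfun_sum[OF vpolyfun_scale[OF vpolyfun_rep[OF x] T(2)]] by simp
qed

lemma polyfun_coord_det:
  "(\<And>b. b < length ks \<Longrightarrow> vpolyfun (\<lambda>t. Y t b)) \<Longrightarrow> polyfun (\<lambda>t. coord_det (Y t) ks)"
  unfolding coord_det_def by (intro polyfun_det vpolyfun_rep)

text \<open>The certifying determinant for \<open>t0\<close> is a polynomial in \<open>t\<close>
  that does not vanish at \<open>t0\<close>.\<close>

lemma dim_generic:
  assumes I: "finite I" and Y: "\<And>i. i \<in> I \<Longrightarrow> vpolyfun (\<lambda>t. Y t i)"
  shows "finite {t. dim (Y t ` I) < dim (Y t0 ` I)}"
proof -
  obtain s c where s: "\<And>b. b < dim (Y t0 ` I) \<Longrightarrow> s b \<in> I"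
    "coord_det (\<lambda>b. if b < dim (Y t0 ` I) then Y t0 (s b) else c b) basis_list \<noteq> 0"
    "\<And>Z. coord_det (\<lambda>b. if b < dim (Y t0 ` I) then Z (s b) else c b) basis_list \<noteq> 0 \<Longrightarrow> dim (Y t0 ` I) \<le> dim (Z ` I)"
    using dim_witness[OF I, of "Y t0"] by blast
  let ?p = "\<lambda>t. coord_det (\<lambda>b. if b < dim (Y t0 ` I) then Y t (s b) else c b) basis_list"
  have "polyfun ?p"
  proof (rule polyfun_coord_det)
    fix b show "vpolyfun (\<lambda>t. if b < dim (Y t0 ` I) then Y t (s b) else c b)"
      using Y s(1) vpolyfun_const by (cases "b < dim (Y t0 ` I)") auto
  qed
  then have "finite {t. ?p t = 0}" using s(2) polyfun_finite_zeros by blast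
  then show ?thesis by (rule rev_finite_subset) (use s(3)[of "Y _"] not_le in blast)
qed

section \<open>Adapted bases and Pluecker coordinates\<close>

lemma adaptedI:
  assumes f: "f \<in> complete_flags" and e: "\<And>b. b < dim UNIV \<Longrightarrow> e b \<in> f (Suc b)" "\<And>b. b < dim UNIV \<Longrightarrow> e b \<notin> f b"
  shows "basis_seq e" "adapted f e"
proof -
  note F = complete_flagD[OF f]
  have sp: "f i = span (e ` {..<i})" if "i \<le> dim UNIV" for i
    using that
  proof (induction i)
    case 0
    then show ?case using F(1) by simp
  next
    case (Suc i)
    then have IH: "f i = span (e ` {..<i})" by simp
    have "e i \<notin> span (e ` {..<i})" using e(2)[of i] Suc.prems IH by auto
    then have "dim (e ` {..<Suc i}) = dim (e ` {..<i}) + 1" by (simp add: lessThan_Suc dim_insert)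
    also have "dim (e ` {..<i}) = dim (f i)" unfolding IH by simp
    also have "\<dots> = i" using F(5)[of i] Suc.prems by simp
    finally have d: "dim (e ` {..<Suc i}) = Suc i" by simp
    have "e b \<in> f (Suc i)" if "b < Suc i" for b
    proof -
      have "e b \<in> f (Suc b)" using e(1) that Suc.prems by simp
      moreover have "f (Suc b) \<subseteq> f (Suc i)" using that by (intro complete_flag_mono[OF f]) simp
      ultimately show ?thesis by blast
    qed
    then have "span (e ` {..<Suc i}) \<subseteq> f (Suc i)" by (intro span_minimal F(3)) auto
    moreover have "dim (f (Suc i)) \<le> dim (span (e ` {..<Suc i}))" using d F(5)[of "Suc i"] Suc.prems by simp
    ultimately show ?case using subspace_dim_equal[OF subspace_span F(3)] by blast
  qed
  then show "adapted f e" by (simp add: adapted_def)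
  have "span (e ` {..<dim UNIV}) = UNIV" using sp[of "dim UNIV"] F(2) by (simp del: dim_UNIV)
  then have "dim (e ` {..<dim UNIV}) = dim UNIV" by (metis dim_span)
  then show "basis_seq e" by (simp add: basis_seq_iff)
qed

lemma adapted_basis_exists:
  assumes f: "f \<in> complete_flags"
  shows "\<exists>e. basis_seq e \<and> adapted f e"
proof -
  note F = complete_flagD[OF f]
  have "\<exists>x. x \<in> f (Suc b) \<and> x \<notin> f b" if "b < dim UNIV" for b
  proof (rule ccontr)
    assume "\<not> ?thesis"
    then have "f (Suc b) \<subseteq> f b" by blast
    then have "dim (f (Suc b)) \<le> dim (f b)" by (rule dim_subset)
    then show False using F(5)[of b] F(5)[of "Suc b"] that by simp
  qed
  then obtain e where "\<And>b. b < dim UNIV \<Longrightarrow> e b \<in> f (Suc b) \<and> e b \<notin> f b" by metis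
  then show ?thesis using adaptedI[OF f, of e] by blast
qed

text \<open>Complete the first \<open>k\<close> vectors to a basis by members \<open>D\<close> of
  \<open>Basis\<close>. The minor on the remaining \<open>k\<close> members of \<open>Basis\<close>
  is nonzero, since a dependency would put a nonzero vector of the span into the span of
  \<open>D\<close>.\<close>

lemma coord_det_nonzero_exists:
  assumes e: "basis_seq e" and k: "k \<le> dim UNIV"
  shows "\<exists>ks. length ks = k \<and> set ks \<subseteq> Basis \<and> coord_det e ks \<noteq> 0"
proof -
  let ?B = "e ` {..<k}"
  have "?B \<subseteq> e ` {..<dim UNIV}" using k by (intro image_mono) auto
  then have indB: "independent ?B" using e independent_mono by (auto simp: basis_seq_def)
  have inj: "inj_on e {..<k}" using e k by (auto simp: basis_seq_def intro: inj_on_subset)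
  obtain C where C: "?B \<subseteq> C" "C \<subseteq> ?B \<union> Basis" "independent C" "?B \<union> Basis \<subseteq> span C"
    by (meson maximal_independent_subset_extend[of ?B "?B \<union> Basis"] indB Un_upper1)
  define D where "D = C - ?B"
  have D: "D \<subseteq> Basis" "independent D"
    using C(2) independent_mono[OF C(3), of D] by (auto simp: D_def)
  have "span Basis \<subseteq> span C" using C(4) by (intro span_minimal) auto
  then have "span C = UNIV" using span_Basis by blast
  then have cardC: "card C = dim UNIV" using C(3) by (metis dim_eq_card_independent dim_span)
  have cardB: "card ?B = k" using inj by (simp add: card_image)
  have cardD: "card D = dim UNIV - k" unfolding D_def using C(1) cardC cardB by (simp add: card_Diff_subset)
  obtain ks where ks: "set ks = Basis - D" "distinct ks" using finite_distinct_list[of "Basis - D"] finite_Basis by blast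
  have "card (Basis - D) = k"
    using D(1) finite_Basis cardD k finite_subset[OF D(1)] by (simp add: card_Diff_subset)
  then have len: "length ks = k" using ks distinct_card by metis
  have "coord_det e ks \<noteq> 0"
  proof
    assume "coord_det e ks = 0"
    then obtain c where c: "\<exists>b<k. c b \<noteq> 0" "\<forall>a<k. representation Basis (\<Sum>b<k. c b *s e b) (ks ! a) = 0"
      unfolding coord_det_eq_0_iff len by blast
    define x where "x = (\<Sum>b<k. c b *s e b)"
    have xB: "x \<in> span ?B" unfolding x_def by (intro span_sum span_scale span_base) auto
    have "representation Basis x b = 0" if "b \<in> Basis - D" for b
      using c(2) that ks len unfolding x_def[symmetric] by (metis in_set_conv_nth)
    then have "(\<Sum>b\<in>Basis. representation Basis x b *s b) \<in> span D"
      by (intro span_sum) (metis DiffI scale_zero_left span_base span_scale span_zero)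
    then have xD: "x \<in> span D" by (simp only: rep_expand)
    have "dim (span ?B \<union> span D) = dim UNIV"
    proof -
      have "C \<subseteq> span ?B \<union> span D" by (auto simp: D_def intro: span_base)
      then have "dim UNIV \<le> dim (span ?B \<union> span D)"
        using dim_subset[of C "span ?B \<union> span D"] cardC dim_eq_card_independent[OF C(3)] by simp
      moreover have "dim (span ?B \<union> span D) \<le> dim UNIV" by (rule dim_subset) simp
      ultimately show ?thesis by simp
    qed
    moreover have "dim (span ?B) = k" "dim (span D) = dim UNIV - k"
      using dim_eq_card_independent[OF indB] dim_eq_card_independent[OF D(2)] cardB cardD by simp_all
    ultimately have "dim (span ?B \<inter> span D) = 0"
      using dim_Un_Int[OF subspace_span subspace_span, of ?B D] k by simp
    then have "span ?B \<inter> span D \<subseteq> {0}" by (simp only: dim_eq_0)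
    then have "x = 0" using xB xD by blast
    moreover have "dim (e ` {..<k}) = card {..<k}" using dim_eq_card_independent[OF indB] cardB by simp
    ultimately have "\<forall>b\<in>{..<k}. c b = 0"
      using independent_family_iff[of "{..<k}" e] unfolding x_def by blast
    then show False using c(1) by auto
  qed
  then show ?thesis using len ks by blast
qed

lemma coord_det_same_span:
  assumes "span (e ` {..<k}) = span (e' ` {..<k})"
  shows "\<exists>c. \<forall>ks. length ks = k \<longrightarrow> coord_det e ks = c * coord_det e' ks"
proof -
  have "\<exists>c. e b = (\<Sum>b'<k. c b' *s e' b')" if "b < k" for b
  proof -
    have "e b \<in> span (e' ` {..<k} \<union> {0})"
    proof -
      have "e b \<in> span (e' ` {..<k})" using assms that by (metis image_eqI lessThan_iff span_base)
      then show ?thesis using span_mono[of "e' ` {..<k}" "e' ` {..<k} \<union> {0}"] by blast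
    qed
    then show ?thesis using span_family_Un_iff[of "{..<k}" "{0}" "e b" e'] by auto
  qed
  then obtain C where C: "\<And>b. b < k \<Longrightarrow> e b = (\<Sum>b'<k. C b b' *s e' b')" by metis
  let ?C = "mat k k (\<lambda>(b', b). C b b')"
  have "coord_det e ks = det ?C * coord_det e' ks" if "length ks = k" for ks
  proof -
    let ?E = "\<lambda>e. mat k k (\<lambda>(a, b). representation Basis (e b) (ks ! a))"
    have "?E e = ?E e' * ?C"
      by (rule eq_matI) (auto simp: C scalar_prod_def atLeast0LessThan mult.commute intro!: sum.cong)
    then have "det (?E e) = det (?E e') * det ?C" using det_mult[of "?E e'" k ?C] by simp
    then show ?thesis unfolding coord_det_def that by simp
  qed
  then show ?thesis by blast
qed

text \<open>The choice inside \<open>plucker\<close> is harmless up to one nonzero factor for each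
  number of rows, namely the determinant of a change of basis.\<close>

lemma plucker_eq_coord_det:
  assumes f: "f \<in> complete_flags" and e: "basis_seq e" "adapted f e"
  shows "\<exists>c. (\<forall>i\<le>dim UNIV. c i \<noteq> 0) \<and> (\<forall>ks. length ks \<le> dim UNIV \<longrightarrow> plucker f ks = c (length ks) * coord_det e ks)"
proof -
  define e0 where "e0 = (SOME e. basis_seq e \<and> adapted f e)"
  have e0: "basis_seq e0" "adapted f e0"
    using someI_ex[OF adapted_basis_exists[OF f]] unfolding e0_def by blast+
  have pl: "plucker f ks = coord_det e0 ks" for ks by (simp add: plucker_def coord_det_def e0_def Let_def)
  have "\<exists>c. c \<noteq> 0 \<and> (\<forall>ks. length ks = i \<longrightarrow> plucker f ks = c * coord_det e ks)" if i: "i \<le> dim UNIV" for i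
  proof -
    have "span (e0 ` {..<i}) = span (e ` {..<i})" using e0 e i by (auto simp: adapted_def)
    then obtain c where c: "\<forall>ks. length ks = i \<longrightarrow> plucker f ks = c * coord_det e ks"
      using coord_det_same_span pl by metis
    obtain ks where "length ks = i" "coord_det e0 ks \<noteq> 0" using coord_det_nonzero_exists[OF e0(1) i] by blast
    then have "c \<noteq> 0" using c pl by auto
    then show ?thesis using c by blast
  qed
  then show ?thesis by metis
qed

lemma plucker_is_coord_det:
  assumes "f \<in> complete_flags"
  obtains e where "basis_seq e" "adapted f e" "plucker f = coord_det e"
proof -
  define e0 where "e0 = (SOME e. basis_seq e \<and> adapted f e)"
  have e0: "basis_seq e0" "adapted f e0"
    using someI_ex[OF adapted_basis_exists[OF assms]] unfolding e0_def by blast+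
  have "plucker f ks = coord_det e0 ks" for ks by (simp add: plucker_def coord_det_def e0_def Let_def)
  then show thesis using that e0 by blast
qed

text \<open>By Cramer's rule these vectors form a basis of \<open>f (length ks)\<close> as soon as
  \<open>plucker f ks \<noteq> 0\<close>; their coordinates are linear in the Pluecker coordinates.\<close>

definition cramer :: "('b list \<Rightarrow> 'a) \<Rightarrow> 'b list \<Rightarrow> nat \<Rightarrow> 'b" where
  "cramer x ks a = (\<Sum>k\<in>Basis. x (ks[a := k]) *s k)"

text \<open>Laplace expansion along row \<open>a\<close> writes the vector as the combination of the
  adapted basis with cofactors as coefficients. Membership holds whether or not the minor
  vanishes.\<close>

lemma cramer_in_flag:
  assumes f: "f \<in> complete_flags" and ks: "length ks \<le> dim UNIV" and a: "a < length ks"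
  shows "cramer (plucker f) ks a \<in> f (length ks)"
proof -
  obtain e where e: "basis_seq e" "adapted f e" "plucker f = coord_det e" using plucker_is_coord_det[OF f] by blast
  let ?i = "length ks"
  define M where "M k = mat ?i ?i (\<lambda>(a', b). representation Basis (e b) (ks[a := k] ! a'))" for k
  define N where "N = mat ?i ?i (\<lambda>(a', b). representation Basis (e b) (ks ! a'))"
  \<comment> \<open>Row \<open>a\<close> is the only one that depends on \<open>k\<close>, and it is
    deleted in these cofactors.\<close>
  have cof: "cofactor (M k) a b = cofactor N a b" if "b < ?i" for b k
  proof -
    have "mat_delete (M k) a b = mat_delete N a b"
      by (rule eq_matI) (auto simp: mat_delete_def M_def N_def nth_list_update)
    then show ?thesis by (simp add: cofactor_def)
  qed
  have det: "plucker f (ks[a := k]) = (\<Sum>b<?i. representation Basis (e b) k * cofactor N a b)" for k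
  proof -
    have "plucker f (ks[a := k]) = det (M k)" by (simp add: e(3) coord_det_def M_def)
    also have "\<dots> = (\<Sum>b<?i. M k $$ (a, b) * cofactor (M k) a b)"
      by (rule laplace_expansion_row) (auto simp: M_def a)
    also have "\<dots> = (\<Sum>b<?i. representation Basis (e b) k * cofactor N a b)"
      using a cof by (intro sum.cong) (auto simp: M_def)
    finally show ?thesis .
  qed
  have "cramer (plucker f) ks a = (\<Sum>k\<in>Basis. \<Sum>b<?i. cofactor N a b *s (representation Basis (e b) k *s k))"
    unfolding cramer_def det by (simp add: scale_sum_left mult.commute)
  also have "\<dots> = (\<Sum>b<?i. \<Sum>k\<in>Basis. cofactor N a b *s (representation Basis (e b) k *s k))" by (rule sum.swap)
  also have "\<dots> = (\<Sum>b<?i. cofactor N a b *s (\<Sum>k\<in>Basis. representation Basis (e b) k *s k))"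
    by (simp only: scale_sum_right)
  also have "\<dots> = (\<Sum>b<?i. cofactor N a b *s e b)" by (simp only: rep_expand)
  also have "\<dots> \<in> span (e ` {..<?i})" by (intro span_sum span_scale span_base) auto
  finally show ?thesis using e(2) ks by (simp add: adapted_def)
qed

lemma coord_det_repeated:
  assumes "a < length ks" "b < length ks" "a \<noteq> b" "ks ! a = ks ! b"
  shows "coord_det e ks = 0"
  unfolding coord_det_def
  by (rule det_identical_rows[of _ "length ks" a b]) (use assms in \<open>auto intro!: eq_vecI\<close>)

text \<open>On the coordinates in \<open>ks\<close> the vectors form \<open>plucker f ks\<close>
  times the identity matrix, because replacing a row by another one repeats it.\<close>

lemma cramer_span:
  assumes f: "f \<in> complete_flags" and ks: "length ks \<le> dim UNIV" "set ks \<subseteq> Basis" "plucker f ks \<noteq> 0"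
  shows "span (cramer (plucker f) ks ` {..<length ks}) = f (length ks)"
proof -
  obtain e where e: "basis_seq e" "adapted f e" "plucker f = coord_det e" using plucker_is_coord_det[OF f] by blast
  let ?i = "length ks" and ?v = "cramer (plucker f) ks"
  note F = complete_flagD[OF f]
  have rep: "representation Basis (?v a) (ks ! a') = (if a = a' then plucker f ks else 0)"
    if "a < ?i" "a' < ?i" for a a'
  proof -
    have "ks ! a' \<in> Basis" using that ks(2) by auto
    then have "representation Basis (?v a) (ks ! a') = plucker f (ks[a := ks ! a'])"
      unfolding cramer_def by (rule rep_sum_Basis)
    also have "\<dots> = (if a = a' then plucker f ks else 0)"
    proof (cases "a = a'")
      case False
      then have "coord_det e (ks[a := ks ! a']) = 0"
        using that by (intro coord_det_repeated[of a _ a']) auto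
      then show ?thesis using False e(3) by simp
    qed simp
    finally show ?thesis .
  qed
  have "\<forall>a\<in>{..<?i}. c a = 0" if c: "(\<Sum>a\<in>{..<?i}. c a *s ?v a) = 0" for c
  proof
    fix a' assume a': "a' \<in> {..<?i}"
    have "0 = representation Basis (\<Sum>a\<in>{..<?i}. c a *s ?v a) (ks ! a')" using c by (simp add: representation_zero)
    also have "\<dots> = (\<Sum>a\<in>{..<?i}. c a * (if a = a' then plucker f ks else 0))"
      unfolding rep_sum rep_scale using rep a' by (intro sum.cong) auto
    also have "\<dots> = c a' * plucker f ks" using a' by (simp add: if_distrib cong: if_cong)
    finally show "c a' = 0" using ks(3) by simp
  qed
  then have "dim (?v ` {..<?i}) = ?i" using independent_family_iff[of "{..<?i}" ?v] by simp
  then have "dim (f ?i) \<le> dim (span (?v ` {..<?i}))" using F(5)[OF ks(1)] by simp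
  moreover have "span (?v ` {..<?i}) \<subseteq> f ?i"
    using cramer_in_flag[OF f ks(1)] by (intro span_minimal F(3)) auto
  ultimately show ?thesis using subspace_dim_equal[OF subspace_span F(3)] by blast
qed

end

context finite_dimensional_vector_space
begin

section \<open>Rank conditions as open conditions on pairs of flags\<close>

abbreviation plucker_indices :: "('b list + 'b list) set" where
  "plucker_indices \<equiv> (let K = {ks. set ks \<subseteq> Basis \<and> length ks \<le> dim UNIV} in K <+> K)"

lemma plucker_polysD: "p \<in> plucker_polys \<Longrightarrow> \<exists>d. multihom plucker_indices (map_sum length length) d p"
  by (simp add: plucker_polys_def)

text \<open>Each coordinate is a linear form in the variables of one flag and one number of rows;
  \<open>J\<close> selects the flag of the pair.\<close>

lemma multihom_cramer:
  assumes T: "lin T" and ks: "set ks \<subseteq> Basis" "length ks \<le> dim UNIV" and a: "a < length ks"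
    and J: "J = Inl \<or> J = Inr"
  shows "multihom plucker_indices (map_sum length length) (\<lambda>k. if k = map_sum length length (J ks) then 1 else 0)
    (\<lambda>x. representation Basis (T (cramer (\<lambda>l. x (J l)) ks a)) b)"
proof -
  interpret T: Vector_Spaces.linear scale scale T by (rule T)
  have eq: "representation Basis (T (cramer y ks a)) b = (\<Sum>k\<in>Basis. representation Basis (T k) b * y (ks[a := k]))" for y
    by (simp add: cramer_def T.sum T.scale mult.commute)
  have "Basis \<noteq> {}" using a ks(2) finite_Basis by auto
  moreover have "multihom plucker_indices (map_sum length length) (\<lambda>k. if k = map_sum length length (J ks) then 1 else 0)
      (\<lambda>x. representation Basis (T k) b * x (J (ks[a := k])))" if "k \<in> Basis" for k
  proof (rule multihom_cmult)
    have "set (ks[a := k]) \<subseteq> Basis" using ks(1) that set_update_subset_insert[of ks a k] by blast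
    then have "J (ks[a := k]) \<in> plucker_indices" using J ks(2) by (auto simp: Let_def)
    from multihom.var[OF this, of "map_sum length length"]
    show "multihom plucker_indices (map_sum length length) (\<lambda>k. if k = map_sum length length (J ks) then 1 else 0)
        (\<lambda>x. x (J (ks[a := k])))"
      using J by auto
  qed
  ultimately show ?thesis unfolding eq by (intro multihom_sum finite_Basis)
qed

text \<open>Fix minors that are nonzero at the base point. The Cramer vectors of these minors span
  the required spaces there, and lie in them for every pair of flags. Hence a determinant certifying
  the rank at the base point is a multihomogeneous polynomial whose nonvanishing bounds the rank
  from below elsewhere.\<close>

lemma rank_open:
  assumes f0: "f0 \<in> complete_flags" and f0': "f0' \<in> complete_flags" and T: "lin T"
    and i: "i \<le> dim UNIV" and k: "k \<le> dim UNIV"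
  shows "\<exists>p\<in>plucker_polys. p (plucker_pair (f0, f0')) \<noteq> 0 \<and>
    (\<forall>f\<in>complete_flags. \<forall>f'\<in>complete_flags. p (plucker_pair (f, f')) \<noteq> 0 \<longrightarrow>
      dim (T ` f0 i \<union> f0' k) \<le> dim (T ` f i \<union> f' k))"
proof -
  obtain e where e: "basis_seq e" "plucker f0 = coord_det e" using plucker_is_coord_det[OF f0] by blast
  obtain e' where e': "basis_seq e'" "plucker f0' = coord_det e'" using plucker_is_coord_det[OF f0'] by blast
  obtain ks where ks: "length ks = i" "set ks \<subseteq> Basis" "plucker f0 ks \<noteq> 0"
    using coord_det_nonzero_exists[OF e(1) i] e(2) by metis
  obtain ls where ls: "length ls = k" "set ls \<subseteq> Basis" "plucker f0' ls \<noteq> 0"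
    using coord_det_nonzero_exists[OF e'(1) k] e'(2) by metis
  define Z where "Z x b = (if b < i then T (cramer (\<lambda>l. x (Inl l)) ks b) else cramer (\<lambda>l. x (Inr l)) ls (b - i))"
    for x :: "'b list + 'b list \<Rightarrow> 'a" and b
  let ?I = "{..<i + k}"
  have pp: "(\<lambda>l. plucker_pair (f, f') (Inl l)) = plucker f" "(\<lambda>l. plucker_pair (f, f') (Inr l)) = plucker f'" for f f'
    by (simp_all add: plucker_pair_def)
  have sub: "Z (plucker_pair (f, f')) ` ?I \<subseteq> T ` f i \<union> f' k"
    if "f \<in> complete_flags" "f' \<in> complete_flags" for f f'
  proof
    fix x assume "x \<in> Z (plucker_pair (f, f')) ` ?I"
    then obtain b where b: "b < i + k" "x = Z (plucker_pair (f, f')) b" by auto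
    show "x \<in> T ` f i \<union> f' k"
    proof (cases "b < i")
      case True
      then show ?thesis using cramer_in_flag[OF that(1), of ks b] ks(1) i b(2) by (auto simp: Z_def pp)
    next
      case False
      then show ?thesis using cramer_in_flag[OF that(2), of ls "b - i"] ls(1) k b by (auto simp: Z_def pp)
    qed
  qed
  let ?x0 = "plucker_pair (f0, f0')"
  have "T ` f0 i \<union> f0' k \<subseteq> span (Z ?x0 ` ?I)"
  proof (rule Un_least)
    have "T ` f0 i = T ` span (cramer (plucker f0) ks ` {..<i})"
      using cramer_span[OF f0, of ks] ks i by simp
    also have "\<dots> = span (T ` cramer (plucker f0) ks ` {..<i})"
      using self.linear_span_image[OF T] by simp
    also have "\<dots> \<subseteq> span (Z ?x0 ` ?I)"
    proof (intro span_mono subsetI)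
      fix y assume "y \<in> T ` cramer (plucker f0) ks ` {..<i}"
      then obtain b where "b < i" "y = T (cramer (plucker f0) ks b)" by auto
      then show "y \<in> Z ?x0 ` ?I" by (intro image_eqI[of _ _ b]) (auto simp: Z_def pp)
    qed
    finally show "T ` f0 i \<subseteq> span (Z ?x0 ` ?I)" .
    have "f0' k = span (cramer (plucker f0') ls ` {..<k})"
      using cramer_span[OF f0', of ls] ls k by simp
    also have "\<dots> \<subseteq> span (Z ?x0 ` ?I)"
    proof (intro span_mono subsetI)
      fix y assume "y \<in> cramer (plucker f0') ls ` {..<k}"
      then obtain b where "b < k" "y = cramer (plucker f0') ls b" by auto
      then show "y \<in> Z ?x0 ` ?I" by (intro image_eqI[of _ _ "i + b"]) (auto simp: Z_def pp)
    qed
    finally show "f0' k \<subseteq> span (Z ?x0 ` ?I)" .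
  qed
  then have dim0: "dim (T ` f0 i \<union> f0' k) = dim (Z ?x0 ` ?I)"
    using dim_mono dim_subset[OF sub[OF f0 f0']] by (intro antisym) auto
  let ?s = "dim (Z ?x0 ` ?I)"
  obtain t c where t: "\<And>b. b < ?s \<Longrightarrow> t b \<in> ?I"
    "coord_det (\<lambda>b. if b < ?s then Z ?x0 (t b) else c b) basis_list \<noteq> 0"
    "\<And>Z'. coord_det (\<lambda>b. if b < ?s then Z' (t b) else c b) basis_list \<noteq> 0 \<Longrightarrow> ?s \<le> dim (Z' ` ?I)"
    using dim_witness[of ?I "Z ?x0"] by blast
  define p where "p x = coord_det (\<lambda>b. if b < ?s then Z x (t b) else c b) basis_list" for x
  have "p \<in> plucker_polys"
  proof -
    \<comment> \<open>A column is linear in the coordinates of one flag and one number of rows, or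
      constant; \<open>multihom_det\<close> needs degrees given column by column.\<close>
    define d where "d b = (if b < ?s then if t b < i then (\<lambda>k'. if k' = map_sum length length (Inl ks :: 'b list + 'b list) then 1 else 0)
      else (\<lambda>k'. if k' = map_sum length length (Inr ls :: 'b list + 'b list) then 1 else 0) else (\<lambda>_. 0 :: nat))" for b
    have "multihom plucker_indices (map_sum length length) (d b)
        (\<lambda>x. representation Basis (if b < ?s then Z x (t b) else c b) (basis_list ! a))" for a b
    proof (cases "b < ?s")
      case True
      show ?thesis
      proof (cases "t b < i")
        case True
        then show ?thesis
          using \<open>b < ?s\<close> multihom_cramer[OF T ks(2), of "t b" Inl] ks(1) i by (simp add: d_def Z_def)
      next
        case False
        moreover have "t b - i < k" using t(1)[OF \<open>b < ?s\<close>] False by simp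
        ultimately show ?thesis
          using \<open>b < ?s\<close> multihom_cramer[OF linear_id ls(2), of "t b - i" Inr] ls(1) k by (simp add: d_def Z_def)
      qed
    next
      case False
      then show ?thesis using multihom.const by (simp add: d_def)
    qed
    then have "multihom plucker_indices (map_sum length length) (\<lambda>k. \<Sum>b\<in>{0..<length basis_list}. d b k) p"
      unfolding p_def coord_det_def by (intro multihom_det)
    then show ?thesis unfolding plucker_polys_def by blast
  qed
  moreover have "p ?x0 \<noteq> 0" using t(2) by (simp add: p_def)
  moreover have "dim (T ` f0 i \<union> f0' k) \<le> dim (T ` f i \<union> f' k)"
    if f: "f \<in> complete_flags" "f' \<in> complete_flags" and "p (plucker_pair (f, f')) \<noteq> 0" for f f'
  proof -
    have "?s \<le> dim (Z (plucker_pair (f, f')) ` ?I)" using that(3) t(3) by (simp add: p_def)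
    also have "\<dots> \<le> dim (T ` f i \<union> f' k)" by (rule dim_subset[OF sub[OF f]])
    finally show ?thesis using dim0 by simp
  qed
  ultimately show ?thesis by blast
qed

lemma plucker_pair_nonzero_iff:
  assumes p: "p \<in> plucker_polys" and f: "f \<in> complete_flags" "basis_seq e" "adapted f e"
    and f': "f' \<in> complete_flags" "basis_seq e'" "adapted f' e'"
  shows "p (plucker_pair (f, f')) = 0 \<longleftrightarrow> p (case_sum (coord_det e) (coord_det e')) = 0"
proof -
  obtain d where d: "multihom plucker_indices (map_sum length length) d p" using plucker_polysD[OF p] by blast
  obtain c where c: "\<forall>i\<le>dim UNIV. c i \<noteq> 0" "\<forall>ks. length ks \<le> dim UNIV \<longrightarrow> plucker f ks = c (length ks) * coord_det e ks"
    using plucker_eq_coord_det[OF f] by blast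
  obtain c' where c': "\<forall>i\<le>dim UNIV. c' i \<noteq> 0" "\<forall>ks. length ks \<le> dim UNIV \<longrightarrow> plucker f' ks = c' (length ks) * coord_det e' ks"
    using plucker_eq_coord_det[OF f'] by blast
  define C where "C = case_sum (\<lambda>i. if i \<le> dim UNIV then c i else 1) (\<lambda>i. if i \<le> dim UNIV then c' i else 1)"
  have C: "C k \<noteq> 0" for k using c(1) c'(1) by (cases k) (auto simp: C_def)
  have "p (plucker_pair (f, f')) = (\<Prod>k | d k \<noteq> 0. C k ^ d k) * p (case_sum (coord_det e) (coord_det e'))"
    by (rule multihom_scale[OF d]) (use c(2) c'(2) in \<open>auto simp: Let_def plucker_pair_def C_def\<close>)
  moreover have "(\<Prod>k | d k \<noteq> 0. C k ^ d k) \<noteq> 0"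
    using multihom_support[OF d] C by simp
  ultimately show ?thesis by simp
qed

text \<open>The Pluecker coordinates involve a choice for each \<open>t\<close> and need not be
  polynomial in it. Those computed from \<open>e t\<close> and \<open>e' t\<close> are, and the
  zeros are the same outside \<open>Bad\<close>.\<close>

lemma plucker_curve_finite_zeros:
  assumes p: "p \<in> plucker_polys"
    and e: "\<And>b. b < dim UNIV \<Longrightarrow> vpolyfun (\<lambda>t. e t b)" and e': "\<And>b. b < dim UNIV \<Longrightarrow> vpolyfun (\<lambda>t. e' t b)"
    and f: "\<And>t. t \<notin> Bad \<Longrightarrow> F t \<in> complete_flags \<and> basis_seq (e t) \<and> adapted (F t) (e t)"
    and f': "\<And>t. t \<notin> Bad \<Longrightarrow> F' t \<in> complete_flags \<and> basis_seq (e' t) \<and> adapted (F' t) (e' t)"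
    and t0: "t0 \<notin> Bad" "p (plucker_pair (F t0, F' t0)) \<noteq> 0"
  shows "finite {t. t \<notin> Bad \<and> p (plucker_pair (F t, F' t)) = 0}"
proof -
  let ?q = "\<lambda>t. p (case_sum (coord_det (e t)) (coord_det (e' t)))"
  obtain d where d: "multihom plucker_indices (map_sum length length) d p" using plucker_polysD[OF p] by blast
  have "polyfun ?q"
    by (rule multihom_polyfun[OF d]) (auto simp: Let_def intro!: polyfun_coord_det e e')
  moreover have iff: "p (plucker_pair (F t, F' t)) = 0 \<longleftrightarrow> ?q t = 0" if "t \<notin> Bad" for t
    using plucker_pair_nonzero_iff[OF p] f f' that by blast
  then have "?q t0 \<noteq> 0" using t0 by blast
  ultimately have "finite {t. ?q t = 0}" using polyfun_finite_zeros by blast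
  then show ?thesis by (rule rev_finite_subset) (use iff in auto)
qed

section \<open>Curves in the varieties of flags of given type\<close>

lemma linI:
  assumes "\<And>x y. g (x + y) = g x + g y" "\<And>c x. g (c *s x) = c *s g x"
  shows "lin g"
  unfolding Vector_Spaces.linear_iff using assms vector_space_axioms by blast

lemma functional_exists:
  assumes U: "subspace U" and H: "subspace H" "H \<subseteq> U" "dim U = dim H + 1"
  shows "\<exists>\<phi>. (\<forall>x y. \<phi> (x + y) = \<phi> x + \<phi> y) \<and> (\<forall>c x. \<phi> (c *s x) = c * \<phi> x) \<and> (\<forall>x\<in>U. \<phi> x = (0::'a) \<longleftrightarrow> x \<in> H)"
proof -
  have "H \<noteq> U" using H(3) by auto
  then obtain z where z: "z \<in> U" "z \<notin> H" using H(2) by blast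
  obtain B where B: "B \<subseteq> H" "independent B" "H \<subseteq> span B" "card B = dim H" by (meson basis_exists)
  have sB: "span B = H" using B H(1) by (intro span_subspace) auto
  then have "z \<notin> span B" using z by simp
  then have ind: "independent (insert z B)" using B(2) by (simp add: independent_insert)
  obtain C where C: "insert z B \<subseteq> C" "independent C" "UNIV \<subseteq> span C"
    by (meson maximal_independent_subset_extend[of "insert z B" UNIV] ind subset_UNIV)
  have sp: "x \<in> span C" for x using C(3) by blast
  define \<phi> where "\<phi> x = representation C x z" for x
  have add: "\<phi> (x + y) = \<phi> x + \<phi> y" and scale: "\<phi> (c *s x) = c * \<phi> x" for x y c
    using C(2) sp by (simp_all add: \<phi>_def representation_add representation_scale)
  have zz: "\<phi> z = 1" using C by (simp add: \<phi>_def representation_basis)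
  have H0: "\<phi> x = 0" if "x \<in> H" for x
  proof -
    have "representation C x = representation B x"
      using C that sB by (intro representation_extend) auto
    moreover have "z \<notin> B" using \<open>z \<notin> span B\<close> span_base by blast
    ultimately show ?thesis using representation_ne_zero[of B x z] by (auto simp: \<phi>_def)
  qed
  have UH: "U \<subseteq> span (insert z B)"
  proof -
    have "span (insert z B) \<subseteq> U" using z B(1) H(2) U by (intro span_minimal) auto
    moreover have "dim U \<le> dim (span (insert z B))"
      using H(3) \<open>z \<notin> span B\<close> dim_eq_card_independent[OF B(2)] B(4) by (simp add: dim_insert)
    ultimately show ?thesis using subspace_dim_equal[OF subspace_span U] by blast
  qed
  have "x \<in> H" if x: "x \<in> U" "\<phi> x = 0" for x
  proof -
    obtain k where k: "x - k *s z \<in> H" using UH x(1) unfolding span_insert sB by blast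
    have "\<phi> x = \<phi> ((x - k *s z) + k *s z)" by simp
    also have "\<dots> = k" unfolding add scale using H0[OF k] zz by simp
    finally show ?thesis using k x(2) by simp
  qed
  then show ?thesis using add scale H0 by blast
qed

text \<open>The group of automorphisms of \<open>(U, h)\<close> acts transitively on the hyperplanes of a given
  type.  With \<open>\<phi>\<close>, \<open>\<phi>'\<close> functionals defining \<open>H\<close>, \<open>H'\<close>, and \<open>y\<close> in the kernel of \<open>h\<^bsup>d+1\<^esup>\<close> outside both,
  the automorphism differs from the identity by a map \<open>U \<rightarrow> k[h] y\<close>.\<close>

lemma hyperplane_automorphism:
  assumes h: "lin h" "nilpotent h" and U: "subspace U" "h ` U \<subseteq> U"
    and H: "subspace H" "H \<subseteq> U" "dim U = dim H + 1" "h ` U \<subseteq> H"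
    and H': "subspace H'" "H' \<subseteq> U" "dim U = dim H' + 1" "h ` U \<subseteq> H'"
    and ker: "\<And>x. x \<in> U \<Longrightarrow> (h ^^ d) x = 0 \<Longrightarrow> x \<in> H \<and> x \<in> H'"
    and y1: "y1 \<in> U" "(h ^^ Suc d) y1 = 0" "y1 \<notin> H" and y2: "y2 \<in> U" "(h ^^ Suc d) y2 = 0" "y2 \<notin> H'"
  shows "\<exists>g. lin g \<and> g ` U \<subseteq> U \<and> inj_on g U \<and> (\<forall>x\<in>U. g (h x) = h (g x)) \<and> g ` H = H'"
proof -
  have lh: "lin (h ^^ m)" for m by (rule lin_funpow[OF h(1)])
  have hadd: "(h ^^ m) (x + z) = (h ^^ m) x + (h ^^ m) z" and hscale: "(h ^^ m) (c *s x) = c *s (h ^^ m) x"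
    and h0: "(h ^^ m) 0 = 0" and hdiff: "(h ^^ m) (x - z) = (h ^^ m) x - (h ^^ m) z" for m x z c
    using self.linear_add[OF lh] self.linear_scale[OF lh] self.linear_0[OF lh] self.linear_diff[OF lh] by auto
  have hU: "(h ^^ m) x \<in> U" if "x \<in> U" for m x using funpow_stable[OF U(2)] that by blast
  obtain \<phi> where phi: "\<And>x y. \<phi> (x + y) = \<phi> x + \<phi> y" "\<And>c x. \<phi> (c *s x) = c * \<phi> x" "\<And>x. x \<in> U \<Longrightarrow> \<phi> x = 0 \<longleftrightarrow> x \<in> H"
    using functional_exists[OF U(1) H(1-3)] by blast
  obtain \<psi> where psi: "\<And>x y. \<psi> (x + y) = \<psi> x + \<psi> y" "\<And>c x. \<psi> (c *s x) = c * \<psi> x" "\<And>x. x \<in> U \<Longrightarrow> \<psi> x = 0 \<longleftrightarrow> x \<in> H'"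
    using functional_exists[OF U(1) H'(1-3)] by blast
  \<comment> \<open>No vector space is the union of two proper subspaces: one of \<open>y1\<close>,
    \<open>y2\<close>, \<open>y1 + y2\<close> avoids both.\<close>
  have "\<exists>y\<in>U. (h ^^ Suc d) y = 0 \<and> y \<notin> H \<and> y \<notin> H'"
  proof (cases "y1 \<notin> H' \<or> y2 \<notin> H")
    case True
    then show ?thesis using y1 y2 by blast
  next
    case False
    have "y1 + y2 \<notin> H"
    proof
      assume "y1 + y2 \<in> H"
      then have "(y1 + y2) - y2 \<in> H" using False H(1) by (intro subspace_diff) auto
      then show False using y1 by simp
    qed
    moreover have "y1 + y2 \<notin> H'"
    proof
      assume "y1 + y2 \<in> H'"
      then have "(y1 + y2) - y1 \<in> H'" using False H'(1) by (intro subspace_diff) auto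
      then show False using y2 by simp
    qed
    moreover have "(h ^^ Suc d) (y1 + y2) = 0" unfolding hadd using y1 y2 by simp
    ultimately show ?thesis using y1(1) y2(1) U(1) subspace_add by blast
  qed
  then obtain y where y: "y \<in> U" "(h ^^ Suc d) y = 0" "\<phi> y \<noteq> 0" "\<psi> y \<noteq> 0" using phi(3) psi(3) by blast
  \<comment> \<open>Rescaled so that \<open>\<phi>' y = 1\<close>; the kernel is still
    \<open>H'\<close>.\<close>
  define \<phi>' where "\<phi>' x = \<psi> x / \<psi> y" for x
  have phi': "\<phi>' (x + z) = \<phi>' x + \<phi>' z" "\<phi>' (c *s x) = c * \<phi>' x" for x z c
    by (simp_all add: \<phi>'_def psi add_divide_distrib)
  have phi'0: "\<phi>' x = 0 \<longleftrightarrow> x \<in> H'" if "x \<in> U" for x using psi(3)[OF that] y(4) by (simp add: \<phi>'_def)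
  have phi'y: "\<phi>' y = 1" using y(4) by (simp add: \<phi>'_def)
  obtain r where r: "range r \<subseteq> U" "lin r" "\<forall>v\<in>(h ^^ d) ` U. (h ^^ d) (r v) = v"
    using self.linear_exists_right_inverse_on[OF lh U(1)] by blast
  \<comment> \<open>The difference of the two functionals vanishes on the kernel of
    \<open>h ^^ d\<close> in \<open>U\<close>, so it factors through \<open>h ^^ d\<close>;
    \<open>\<theta>\<close> is this factor, extended by means of the right inverse
    \<open>r\<close>.\<close>
  define \<theta> where "\<theta> v = \<phi> (r v) - \<phi>' (r v)" for v
  have theta: "\<theta> (x + z) = \<theta> x + \<theta> z" "\<theta> (c *s x) = c * \<theta> x" for x z c
    using self.linear_add[OF r(2)] self.linear_scale[OF r(2)] by (simp_all add: \<theta>_def phi phi' algebra_simps)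
  have phi_diff: "\<phi> (x - z) = \<phi> x - \<phi> z" "\<phi>' (x - z) = \<phi>' x - \<phi>' z" for x z
    using phi(1)[of "x - z" z] phi'(1)[of "x - z" z] by auto
  have theta_hd: "\<theta> ((h ^^ d) w) = \<phi> w - \<phi>' w" if w: "w \<in> U" for w
  proof -
    let ?u = "r ((h ^^ d) w) - w"
    have u: "?u \<in> U" using r(1) w U(1) by (auto intro: subspace_diff)
    moreover have "(h ^^ d) ?u = 0" unfolding hdiff using r(3) w by auto
    ultimately have "?u \<in> H" "?u \<in> H'" using ker by blast+
    then have "\<phi> ?u = 0" "\<phi>' ?u = 0" using phi(3)[OF u] phi'0[OF u] by auto
    then show ?thesis unfolding phi_diff \<theta>_def by simp
  qed
  have theta_0: "\<theta> 0 = 0" using theta(2)[of 0 0] by simp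
  have theta_top: "\<theta> ((h ^^ Suc d) w) = 0" if w: "w \<in> U" for w
  proof -
    have hw: "h w \<in> U" "h w \<in> H" "h w \<in> H'" using w U(2) H(4) H'(4) by auto
    have "(h ^^ Suc d) w = (h ^^ d) (h w)" by (simp add: funpow_swap1)
    then show ?thesis using theta_hd[OF hw(1)] phi(3)[OF hw(1)] phi'0[OF hw(1)] hw by simp
  qed
  \<comment> \<open>The sum commutes with \<open>h\<close> by a shift of index whose boundary terms
    vanish: \<open>\<theta>\<close> kills the image of \<open>h ^^ Suc d\<close>, and
    \<open>h ^^ Suc d\<close> kills \<open>y\<close>. Under \<open>\<phi>'\<close> only the term
    \<open>j = d\<close> survives, so \<open>\<phi>' \<circ> g = \<phi>\<close> on
    \<open>U\<close>.\<close>
  define g where "g w = w + (\<Sum>j\<le>d. \<theta> ((h ^^ j) w) *s (h ^^ (d - j)) y)" for w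
  have g: "lin g"
    by (rule linI) (simp_all add: g_def hadd hscale theta scale_left_distrib sum.distrib
        scale_right_distrib scale_sum_right)
  have gU: "g w \<in> U" if "w \<in> U" for w
    unfolding g_def using that hU[OF y(1)] U(1) by (intro subspace_add subspace_sum subspace_scale) auto
  have comm: "g (h w) = h (g w)" if w: "w \<in> U" for w
  proof -
    interpret hh: Vector_Spaces.linear scale scale h by (rule h)
    have "g (h w) = h w + (\<Sum>j\<le>d. \<theta> ((h ^^ Suc j) w) *s (h ^^ (d - j)) y)"
      by (simp add: g_def funpow_swap1)
    also have "(\<Sum>j\<le>d. \<theta> ((h ^^ Suc j) w) *s (h ^^ (d - j)) y) = (\<Sum>j<d. \<theta> ((h ^^ Suc j) w) *s (h ^^ (d - j)) y)"
      using theta_top[OF w] by (simp add: lessThan_Suc_atMost[symmetric])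
    also have "\<dots> = (\<Sum>j<d. \<theta> ((h ^^ Suc j) w) *s (h ^^ Suc (d - Suc j)) y)"
      by (intro sum.cong) (auto simp: Suc_diff_Suc simp del: funpow.simps)
    also have "\<dots> = (\<Sum>j\<le>d. \<theta> ((h ^^ j) w) *s (h ^^ Suc (d - j)) y)"
      using y(2) by (simp add: sum.atMost_shift del: funpow.simps)
    also have "h w + \<dots> = h (g w)" by (simp add: g_def hh.add hh.sum hh.scale)
    finally show ?thesis .
  qed
  have phi_sum: "\<phi>' (\<Sum>j\<in>A. x j) = (\<Sum>j\<in>A. \<phi>' (x j))" for A :: "nat set" and x
    by (induction A rule: infinite_finite_induct) (use phi'(2)[of 0 0] in \<open>auto simp: phi'(1)\<close>)
  have phi_g: "\<phi>' (g w) = \<phi> w" if w: "w \<in> U" for w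
  proof -
    have "\<phi>' ((h ^^ (d - j)) y) = (if j = d then 1 else 0)" if j: "j \<le> d" for j
    proof (cases "j = d")
      case False
      then obtain m where m: "d - j = Suc m" using j by (cases "d - j") auto
      have "(h ^^ (d - j)) y \<in> H'" using hU[OF y(1), of m] H'(4) by (auto simp: m)
      then show ?thesis using False phi'0[OF hU[OF y(1)]] by simp
    qed (simp add: phi'y)
    then have "(\<Sum>j\<le>d. \<theta> ((h ^^ j) w) * \<phi>' ((h ^^ (d - j)) y)) = (\<Sum>j\<le>d. if j = d then \<theta> ((h ^^ j) w) else 0)"
      by (intro sum.cong) auto
    then show ?thesis unfolding g_def phi'(1) phi_sum phi'(2) using theta_hd[OF w] by simp
  qed
  have inj: "inj_on g U"
  proof -
    \<comment> \<open>The kernel of \<open>g\<close> is stable under \<open>h\<close>, so if nonzero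
      it contains some \<open>v \<noteq> 0\<close> with \<open>h v = 0\<close>. Then
      \<open>v\<close> is \<open>- \<theta> v\<close> times \<open>h^d y\<close>; applying
      \<open>\<theta>\<close> gives \<open>\<theta> v * \<phi> y = 0\<close>.\<close>
    have "w = 0" if w: "w \<in> U" "g w = 0" for w
    proof (rule ccontr)
      assume "w \<noteq> 0"
      obtain N where N: "(h ^^ N) w = 0" using h(2) by (auto simp: nilpotent_def)
      define s where "s = (LEAST s. (h ^^ s) w = 0)"
      have s: "(h ^^ s) w = 0" unfolding s_def by (rule LeastI[of _ N]) (rule N)
      then obtain s' where s': "s = Suc s'" using \<open>w \<noteq> 0\<close> by (cases s) auto
      define v where "v = (h ^^ s') w"
      have "v \<noteq> 0" using not_less_Least[of s' "\<lambda>s. (h ^^ s) w = 0"] s' by (simp add: v_def s_def)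
      have v: "v \<in> U" "h v = 0" using hU[OF w(1)] s s' by (auto simp: v_def)
      have "g ((h ^^ m) w) = 0" for m
      proof (induction m)
        case (Suc m)
        then show ?case using comm[OF hU[OF w(1)], of m] self.linear_0[OF h(1)] by simp
      qed (use w in simp)
      then have gv: "g v = 0" by (simp add: v_def)
      have "(\<Sum>j\<le>d. \<theta> ((h ^^ j) v) *s (h ^^ (d - j)) y) = \<theta> v *s (h ^^ d) y"
      proof -
        have "(h ^^ Suc j) v = 0" for j using v(2) h0[of j] by (simp only: funpow_Suc_right o_apply)
        then show ?thesis using theta_0 by (simp add: sum.atMost_shift del: funpow.simps)
      qed
      then have v_eq: "v = - (\<theta> v *s (h ^^ d) y)" using gv by (simp add: g_def eq_neg_iff_add_eq_0)
      then have "v = (- \<theta> v) *s (h ^^ d) y" by simp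
      then have "\<theta> v = - \<theta> v * (\<phi> y - 1)" using theta(2) theta_hd[OF y(1)] phi'y by metis
      then have "\<theta> v * \<phi> y = 0" by (simp add: algebra_simps)
      then have "\<theta> v = 0" using y(3) by simp
      then show False using v_eq \<open>v \<noteq> 0\<close> by simp
    qed
    then show ?thesis using self.linear_inj_on_iff_eq_0[OF g U(1)] by blast
  qed
  have "g ` H = H'"
  proof (rule subspace_dim_equal)
    show "subspace (g ` H)" by (rule lin_subspace_image[OF g H(1)])
    show "g ` H \<subseteq> H'"
    proof
      fix x assume "x \<in> g ` H"
      then obtain w where w: "w \<in> H" "x = g w" by blast
      then have "w \<in> U" using H(2) by blast
      then show "x \<in> H'" using phi_g phi'0[OF gU] phi(3) w by simp
    qed
    have "span H = H" using H(1) by simp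
    then have "inj_on g (span H)" using inj H(2) by (metis inj_on_subset)
    then have "dim (g ` H) = dim H" by (rule self.dim_image_eq[OF g])
    then show "dim H' \<le> dim (g ` H)" using H(3) H'(3) by simp
  qed (rule H')
  then show ?thesis using g gU inj comm by blast
qed

text \<open>Equality of ranks means that the kernels of powers of \<open>h\<close> leave
  \<open>H\<close> and \<open>H'\<close> at the same exponent; \<open>Suc d\<close> is this
  exponent.\<close>

lemma hyperplane_automorphism_rank:
  assumes h: "lin h" "nilpotent h" and U: "subspace U" "h ` U \<subseteq> U"
    and H: "subspace H" "H \<subseteq> U" "dim U = dim H + 1" "h ` U \<subseteq> H"
    and H': "subspace H'" "H' \<subseteq> U" "dim U = dim H' + 1" "h ` U \<subseteq> H'"
    and rank: "\<And>m. dim ((h ^^ m) ` H) = dim ((h ^^ m) ` H')"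
  shows "\<exists>g. lin g \<and> g ` U \<subseteq> U \<and> inj_on g U \<and> (\<forall>x\<in>U. g (h x) = h (g x)) \<and> g ` H = H'"
proof -
  define K where "K m = {x. (h ^^ m) x = 0}" for m
  have K: "subspace (K m)" for m
    using lin_subspace_preimage[OF lin_funpow[OF h(1)] subspace_UNIV subspace_single_0] by (simp add: K_def)
  have dimK: "dim ((h ^^ m) ` S) + dim (K m \<inter> S) = dim S" if "subspace S" for m S
  proof -
    have "{x \<in> S. (h ^^ m) x = 0} = K m \<inter> S" by (auto simp: K_def)
    then show ?thesis using rank_nullity[OF lin_funpow[OF h(1)] that, of m] by simp
  qed
  have iff: "K m \<inter> U \<subseteq> H \<longleftrightarrow> K m \<inter> U \<subseteq> H'" for m
    using dim_Int_hyperplane[OF K H(1) U(1) H(2,3), of m] dim_Int_hyperplane[OF K H'(1) U(1) H'(2,3), of m]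
      dimK[OF H(1), of m] dimK[OF H'(1), of m] rank[of m] H(3) H'(3) by (auto split: if_splits)
  obtain N where "\<And>x. (h ^^ N) x = 0" using h(2) by (auto simp: nilpotent_def)
  moreover have "\<not> U \<subseteq> H"
  proof
    assume "U \<subseteq> H"
    then have "U = H" using H(2) by blast
    then show False using H(3) by simp
  qed
  ultimately have N: "\<not> K N \<inter> U \<subseteq> H" by (auto simp: K_def)
  define c where "c = (LEAST m. \<not> K m \<inter> U \<subseteq> H)"
  have c: "\<not> K c \<inter> U \<subseteq> H" unfolding c_def by (rule LeastI[of _ N]) (rule N)
  moreover have "K 0 \<inter> U \<subseteq> H" using subspace_0[OF H(1)] by (auto simp: K_def)
  ultimately obtain d where d: "c = Suc d" by (cases c) auto
  have low: "K d \<inter> U \<subseteq> H" using not_less_Least[of d "\<lambda>m. \<not> K m \<inter> U \<subseteq> H"] d by (simp add: c_def)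
  obtain y1 where y1: "y1 \<in> U" "(h ^^ Suc d) y1 = 0" "y1 \<notin> H" using c unfolding d K_def by blast
  obtain y2 where y2: "y2 \<in> U" "(h ^^ Suc d) y2 = 0" "y2 \<notin> H'" using c iff[of c] unfolding d K_def by blast
  show ?thesis
  proof (rule hyperplane_automorphism[OF h U H H' _ y1 y2])
    fix x assume "x \<in> U" "(h ^^ d) x = 0"
    then show "x \<in> H \<and> x \<in> H'" using low iff[of d] by (auto simp: K_def)
  qed
qed

lemma inj_on_dim_image:
  assumes "lin g" "subspace U" "inj_on g U" "S \<subseteq> U"
  shows "dim (g ` S) = dim S"
proof (rule self.dim_image_eq[OF assms(1)])
  have "span S \<subseteq> U" using assms(2,4) by (intro span_minimal)
  then show "inj_on g (span S)" using assms(3) inj_on_subset by blast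
qed

lemma dim_image_inj_on:
  assumes "lin g" "subspace U" "dim U \<le> dim (g ` U)"
  shows "inj_on g U"
proof -
  have "dim {x \<in> U. g x = 0} = 0" using rank_nullity[OF assms(1,2)] assms(3) by linarith
  then have "{x \<in> U. g x = 0} \<subseteq> {0}" by (simp only: dim_eq_0)
  then show ?thesis using self.linear_inj_on_iff_eq_0[OF assms(1,2)] by auto
qed

text \<open>\<open>K i t\<close> accumulates the deformations from the top of the flag down to stage
  \<open>i\<close>, so it is controlled only on \<open>f0 i\<close>. The last clause says that
  passing from stage \<open>Suc i\<close> to \<open>i\<close> does not change the image of
  \<open>f0 i\<close>, which keeps the deformed members nested. The top stage
  \<open>dim UNIV + 1\<close> is the identity.\<close>

definition curve_step ::
  "('b \<Rightarrow> 'b) \<Rightarrow> (nat \<Rightarrow> 'b set) \<Rightarrow> (nat \<Rightarrow> 'b set) \<Rightarrow> 'a set \<Rightarrow> (nat \<Rightarrow> 'a \<Rightarrow> 'b \<Rightarrow> 'b) \<Rightarrow> nat \<Rightarrow> bool" where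
  "curve_step h f0 f1 Bad K i \<longleftrightarrow> (\<forall>t. lin (K i t)) \<and> (\<forall>x. vpolyfun (\<lambda>t. K i t x)) \<and>
    (\<forall>t. \<forall>x\<in>f0 i. K i t (h x) = h (K i t x)) \<and> (\<forall>x. K i 0 x = x) \<and> K i 1 ` f0 (i - 1) = f1 (i - 1) \<and>
    (\<forall>t. t \<notin> Bad \<longrightarrow> inj_on (K i t) (f0 i)) \<and>
    (i \<le> dim UNIV \<longrightarrow> (\<forall>t. t \<notin> Bad \<longrightarrow> K i t ` f0 i = K (Suc i) t ` f0 i))"

text \<open>A flag \<open>f1\<close> of the same type as \<open>f0\<close> is obtained from it by successively applying
  automorphisms \<open>g\<close> of \<open>f0 n\<close>, \<open>f0 (n - 1)\<close>, \<open>\<dots>\<close>; replacing each of them by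
  \<open>(1 - t) id + t g\<close> gives a curve from \<open>f0\<close> to \<open>f1\<close>.\<close>

lemma curve_steps_exist:
  assumes h: "lin h" "nilpotent h" and f0: "f0 \<in> stable_flags h" and f1: "f1 \<in> stable_flags h"
    and rank: "\<And>i m. i \<le> dim UNIV \<Longrightarrow> dim ((h ^^ m) ` f0 i) = dim ((h ^^ m) ` f1 i)"
    and "d \<le> dim UNIV"
  shows "\<exists>K Bad. finite Bad \<and> 0 \<notin> Bad \<and> 1 \<notin> Bad \<and>
    (\<forall>i\<in>{Suc (dim UNIV) - d..Suc (dim UNIV)}. curve_step h f0 f1 Bad K i)"
  using \<open>d \<le> dim UNIV\<close>
proof (induction d)
  case 0
  have "f0 (dim UNIV) = UNIV" "f1 (dim UNIV) = UNIV"
    using complete_flagD(2) stable_flag_stable(1) f0 f1 by blast+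
  then have "curve_step h f0 f1 {} (\<lambda>_ _ x. x) (Suc (dim UNIV))"
    unfolding curve_step_def using linear_ident by (auto simp: vpolyfun_const simp del: dim_UNIV)
  then show ?case by (intro exI[of _ "\<lambda>_ _ x. x"] exI[of _ "{}"]) (simp del: dim_UNIV)
next
  case (Suc d)
  define j where "j = dim UNIV - d"
  have j: "1 \<le> j" "j \<le> dim UNIV" "Suc (dim UNIV) - d = Suc j" "Suc (dim UNIV) - Suc d = j"
    using Suc.prems by (auto simp: j_def simp del: dim_UNIV)
  obtain K Bad where Bad: "finite Bad" "0 \<notin> Bad" "1 \<notin> Bad"
    and "\<forall>i\<in>{Suc (dim UNIV) - d..Suc (dim UNIV)}. curve_step h f0 f1 Bad K i"
    using Suc.IH[OF Suc_leD[OF Suc.prems]] by blast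
  then have K: "curve_step h f0 f1 Bad K i" if "i \<in> {Suc j..Suc (dim UNIV)}" for i
    using that unfolding j(3) by blast
  note F0 = complete_flagD[OF stable_flag_stable(1)[OF f0]] and F1 = complete_flagD[OF stable_flag_stable(1)[OF f1]]
  have "curve_step h f0 f1 Bad K (Suc j)" using K j(2) by (simp del: dim_UNIV)
  then have lin: "\<And>t. lin (K (Suc j) t)" and poly: "\<And>x. vpolyfun (\<lambda>t. K (Suc j) t x)"
    and comm: "\<And>t x. x \<in> f0 (Suc j) \<Longrightarrow> K (Suc j) t (h x) = h (K (Suc j) t x)"
    and K0: "\<And>x. K (Suc j) 0 x = x" and K1: "K (Suc j) 1 ` f0 j = f1 j"
    and inj: "\<And>t. t \<notin> Bad \<Longrightarrow> inj_on (K (Suc j) t) (f0 (Suc j))"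
    unfolding curve_step_def by (auto simp del: dim_UNIV)
  define M where "M = K (Suc j) 1"
  have M: "lin M" "inj_on M (f0 (Suc j))" "\<And>x. x \<in> f0 (Suc j) \<Longrightarrow> M (h x) = h (M x)" "M ` f0 j = f1 j"
    using lin inj[OF Bad(3)] comm K1 by (auto simp: M_def)
  have sub: "f0 j \<subseteq> f0 (Suc j)" by (rule F0)
  have Mpow: "M ((h ^^ m) x) = (h ^^ m) (M x)" if "x \<in> f0 j" for m x
  proof (induction m)
    case (Suc m)
    have "(h ^^ m) x \<in> f0 (Suc j)" using funpow_stable[OF stable_flag_stable(2)[OF f0], of m j] that sub by blast
    then show ?case using M(3) Suc by simp
  qed simp
  let ?U = "f0 j" and ?H = "f0 (j - 1)"
  \<comment> \<open>The target hyperplane pulled back by the map already reached at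
    \<open>t = 1\<close>; it has the same rank data as \<open>f0 (j - 1)\<close>, so an automorphism
    of \<open>f0 j\<close> can connect the two before that map is applied.\<close>
  define H' where "H' = {x \<in> f0 j. M x \<in> f1 (j - 1)}"
  have H': "subspace H'" unfolding H'_def by (rule lin_subspace_preimage[OF M(1) F0(3) F1(3)])
  have Sj: "Suc (j - 1) = j" using j(1) by simp
  have MH': "M ` H' = f1 (j - 1)"
  proof -
    have "f1 (j - 1) \<subseteq> M ` f0 j" using F1(4)[of "j - 1"] unfolding Sj M(4) .
    then show ?thesis by (auto simp: H'_def)
  qed
  have H'U: "H' \<subseteq> f0 j" by (auto simp: H'_def)
  have dimM: "dim (M ` S) = dim S" if "S \<subseteq> f0 j" for S
    using inj_on_dim_image[OF M(1) F0(3) M(2), of S] that sub by blast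
  have dims: "dim (f0 j) = j" "dim (f0 (j - 1)) = j - 1" "dim (f1 (j - 1)) = j - 1"
    using F0(5) F1(5) j(2) by (auto simp del: dim_UNIV)
  have dimH': "dim ?U = dim H' + 1" using dimM[OF H'U] MH' dims j(1) by simp
  have "(h ^^ m) ` H' \<subseteq> f0 j" for m
    using funpow_stable[OF stable_flag_stable(2)[OF f0], of m j] H'U by blast
  moreover have "M ` ((h ^^ m) ` H') = (h ^^ m) ` (M ` H')" for m
    unfolding image_image using Mpow H'U by (intro image_cong) auto
  ultimately have rankH': "dim ((h ^^ m) ` H') = dim ((h ^^ m) ` f1 (j - 1))" for m
    using dimM[of "(h ^^ m) ` H'"] MH' by simp
  have strict: "h ` f0 j \<subseteq> f0 (j - 1)" "h ` f1 j \<subseteq> f1 (j - 1)"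
    using stable_flag_strict[OF f0 h, of "j - 1"] stable_flag_strict[OF f1 h, of "j - 1"] j by (auto simp del: dim_UNIV)
  have "h ` f0 j \<subseteq> H'"
  proof
    fix x assume "x \<in> h ` f0 j"
    then obtain w where w: "w \<in> f0 j" "x = h w" by blast
    then have "M x = h (M w)" using M(3) sub by blast
    also have "\<dots> \<in> f1 (j - 1)" using w M(4) strict(2) by blast
    finally show "x \<in> H'" using w stable_flag_stable(2)[OF f0, of j] by (auto simp: H'_def)
  qed
  then obtain g where g: "lin g" "g ` ?U \<subseteq> ?U" "inj_on g ?U" "\<And>x. x \<in> ?U \<Longrightarrow> g (h x) = h (g x)" "g ` ?H = H'"
    using hyperplane_automorphism_rank[OF h F0(3) stable_flag_stable(2)[OF f0] F0(3) _ _ strict(1) H' H'U dimH']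
      F0(4)[of "j - 1"] Sj dims j rankH' rank[of "j - 1"] by (auto simp del: dim_UNIV)
  define G where "G t x = (1 - t) *s x + t *s g x" for t x
  have G: "lin (G t)" for t
    by (rule linI) (simp_all add: G_def self.linear_add[OF g(1)] self.linear_scale[OF g(1)] scale_right_distrib mult.commute add_ac)
  have Gpoly: "vpolyfun (\<lambda>t. G t x)" for x
    unfolding G_def by (intro vpolyfun_add vpolyfun_scale vpolyfun_const polyfun_diff polyfun_const polyfun_id)
  have GU: "G t ` ?U \<subseteq> ?U" for t
    using g(2) F0(3) by (auto simp: G_def intro!: subspace_add subspace_scale)
  have Gcomm: "G t (h x) = h (G t x)" if "x \<in> ?U" for t x
    using g(4)[OF that] by (simp add: G_def self.linear_add[OF h(1)] self.linear_scale[OF h(1)])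
  obtain e where e: "basis_seq e" "adapted f0 e" using adapted_basis_exists[OF stable_flag_stable(1)[OF f0]] by blast
  have eU: "?U = span (e ` {..<j})" using e(2) j(2) by (simp add: adapted_def)
  have Gspan: "dim (G t ` ?U) = dim ((\<lambda>b. G t (e b)) ` {..<j})" for t
  proof -
    have "G t ` ?U = span (G t ` e ` {..<j})" unfolding eU using self.linear_span_image[OF G] by simp
    then show ?thesis by (simp add: image_image)
  qed
  \<comment> \<open>Parameters for which \<open>G t\<close> is not injective on \<open>f0 j\<close>;
    0 and 1 are not among them because the identity and \<open>g\<close> are injective.\<close>
  define Bad' where "Bad' = {t. dim ((\<lambda>b. G t (e b)) ` {..<j}) < dim ((\<lambda>b. G 0 (e b)) ` {..<j})}"
  have fin': "finite Bad'" unfolding Bad'_def by (rule dim_generic) (auto intro: Gpoly)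
  have "G 0 ` ?U = ?U" by (simp add: G_def)
  then have G0: "dim ((\<lambda>b. G 0 (e b)) ` {..<j}) = j" using Gspan[of 0] dims(1) by simp
  have "G 1 ` ?U = g ` ?U" by (simp add: G_def)
  then have G1: "dim ((\<lambda>b. G 1 (e b)) ` {..<j}) = j"
    using Gspan[of 1] dims(1) inj_on_dim_image[OF g(1) F0(3) g(3), of ?U] by simp
  have bad': "0 \<notin> Bad'" "1 \<notin> Bad'" using G0 G1 by (auto simp: Bad'_def)
  have Gfull: "G t ` ?U = ?U" "inj_on (G t) ?U" if "t \<notin> Bad'" for t
  proof -
    have "dim ?U \<le> dim (G t ` ?U)" using that G0 Gspan[of t] dims(1) by (simp add: Bad'_def)
    then show "inj_on (G t) ?U" "G t ` ?U = ?U"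
      using dim_image_inj_on[OF G F0(3)] subspace_dim_equal[OF lin_subspace_image[OF G F0(3)] F0(3) GU] by blast+
  qed
  define K' where "K' i t = (if i = j then K (Suc j) t \<circ> G t else K i t)" for i t
  have K'j: "K' j t x = K (Suc j) t (G t x)" for t x by (simp add: K'_def)
  have K'i: "K' i = K i" if "i \<noteq> j" for i using that by (simp add: K'_def fun_eq_iff)
  have "curve_step h f0 f1 (Bad \<union> Bad') K' i" if i: "i \<in> {j..Suc (dim UNIV)}" for i
  proof (cases "i = j")
    case False
    then have "i \<in> {Suc j..Suc (dim UNIV)}" using i by auto
    then have "curve_step h f0 f1 Bad K i" by (rule K)
    then show ?thesis
      using False i unfolding curve_step_def K'i[OF False] by (subst K'i) (auto simp del: dim_UNIV)
  next
    case True
    have "lin (K' j t)" for t using lin_compose[OF G lin, of t "t"] by (simp add: K'_def o_def)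
    moreover have "vpolyfun (\<lambda>t. K' j t x)" for x
      unfolding K'j by (rule vpolyfun_apply[OF lin poly Gpoly])
    moreover have "K' j t (h x) = h (K' j t x)" if "x \<in> f0 j" for t x
      unfolding K'j Gcomm[OF that] using that GU[of t] sub by (intro comm) blast
    moreover have "K' j 0 x = x" for x by (simp add: K'j K0 G_def)
    moreover have "K' j 1 ` f0 (j - 1) = f1 (j - 1)"
    proof -
      have "K' j 1 ` f0 (j - 1) = M ` (g ` f0 (j - 1))" by (simp add: image_image K'j G_def M_def)
      then show ?thesis using g(5) MH' by simp
    qed
    moreover have "inj_on (K' j t) (f0 j)" if "t \<notin> Bad \<union> Bad'" for t
    proof -
      have "inj_on (K (Suc j) t) (G t ` f0 j)" using inj[of t] Gfull(1)[of t] that sub by (metis UnI1 UnI2 inj_on_subset)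
      then have "inj_on (K (Suc j) t \<circ> G t) (f0 j)" using Gfull(2)[of t] that by (intro comp_inj_on) auto
      then show ?thesis by (simp add: K'_def)
    qed
    moreover have "K' j t ` f0 j = K' (Suc j) t ` f0 j" if "t \<notin> Bad \<union> Bad'" for t
    proof -
      have "K' j t ` f0 j = K (Suc j) t ` (G t ` f0 j)" by (simp add: K'j image_image)
      then show ?thesis using Gfull(1)[of t] that by (simp add: K'_def)
    qed
    ultimately show ?thesis unfolding True curve_step_def by blast
  qed
  then show ?case
    unfolding j(4) using Bad bad' fin' by (intro exI[of _ K'] exI[of _ "Bad \<union> Bad'"]) blast
qed

text \<open>\<open>rk\<close> is left open so that the definition serves both varieties: the rank of
  the m-th power on \<open>f i\<close> fixes the tableau \<open>r\<close>, the one modulo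
  \<open>f i\<close> fixes \<open>q\<close>.\<close>

definition flag_curve :: "('b \<Rightarrow> 'b) \<Rightarrow> (nat \<Rightarrow> 'b set \<Rightarrow> nat) \<Rightarrow> (nat \<Rightarrow> 'b set) \<Rightarrow> (nat \<Rightarrow> 'b set) \<Rightarrow>
    ('a \<Rightarrow> nat \<Rightarrow> 'b set) \<Rightarrow> ('a \<Rightarrow> nat \<Rightarrow> 'b) \<Rightarrow> 'a set \<Rightarrow> bool" where
  "flag_curve h rk f0 f1 F e Bad \<longleftrightarrow> finite Bad \<and> 0 \<notin> Bad \<and> 1 \<notin> Bad \<and> F 0 = f0 \<and> F 1 = f1 \<and>
    (\<forall>b<dim UNIV. vpolyfun (\<lambda>t. e t b)) \<and>
    (\<forall>t. t \<notin> Bad \<longrightarrow> F t \<in> stable_flags h \<and> basis_seq (e t) \<and> adapted (F t) (e t) \<and>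
      (\<forall>i\<le>dim UNIV. \<forall>m. rk m (F t i) = rk m (f0 i)))"

lemma r_flag_curve:
  assumes h: "lin h" "nilpotent h" and f0: "f0 \<in> stable_flags h" and f1: "f1 \<in> stable_flags h"
    and rank: "\<And>i m. i \<le> dim UNIV \<Longrightarrow> dim ((h ^^ m) ` f0 i) = dim ((h ^^ m) ` f1 i)"
  shows "\<exists>F e Bad. flag_curve h (\<lambda>m W. dim ((h ^^ m) ` W)) f0 f1 F e Bad"
proof -
  let ?n = "dim UNIV"
  note S0 = stable_flag_stable[OF f0] and S1 = stable_flag_stable[OF f1]
  note F0 = complete_flagD[OF S0(1)] and F1 = complete_flagD[OF S1(1)]
  obtain K Bad where Bad: "finite Bad" "0 \<notin> Bad" "1 \<notin> Bad"
    and K: "\<forall>i\<in>{Suc ?n - ?n..Suc ?n}. curve_step h f0 f1 Bad K i"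
    using curve_steps_exist[OF h f0 f1 rank, of ?n] by blast
  have step: "curve_step h f0 f1 Bad K (Suc i)" if "i \<le> ?n" for i using K that by (simp del: dim_UNIV)
  have lin: "lin (K (Suc i) t)" and comm: "\<And>x. x \<in> f0 (Suc i) \<Longrightarrow> K (Suc i) t (h x) = h (K (Suc i) t x)"
    and K0: "\<And>x. K (Suc i) 0 x = x" and K1: "K (Suc i) 1 ` f0 i = f1 i"
    and poly: "\<And>x. vpolyfun (\<lambda>t. K (Suc i) t x)"
    and inj: "t \<notin> Bad \<Longrightarrow> inj_on (K (Suc i) t) (f0 (Suc i))"
    and nxt: "Suc i \<le> ?n \<Longrightarrow> t \<notin> Bad \<Longrightarrow> K (Suc i) t ` f0 (Suc i) = K (Suc (Suc i)) t ` f0 (Suc i)"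
    if "i \<le> ?n" for i t
    using step[OF that] unfolding curve_step_def by (auto simp del: dim_UNIV)
  \<comment> \<open>Member \<open>i\<close> is moved by stage \<open>Suc i\<close>, the stage that
    carries \<open>f0 i\<close> to \<open>f1 i\<close> at \<open>t = 1\<close>.\<close>
  define F where "F t i = (if i \<le> ?n then K (Suc i) t ` f0 i else UNIV)" for t i
  obtain e0 where e0: "basis_seq e0" "adapted f0 e0" using adapted_basis_exists[OF S0(1)] by blast
  \<comment> \<open>Stage \<open>Suc b\<close> is injective on \<open>f0 (Suc b)\<close>, so the
    image of \<open>e0 b\<close> stays outside \<open>F t b\<close>; it lies in
    \<open>F t (Suc b)\<close> since stages \<open>Suc b\<close> and \<open>Suc (Suc b)\<close> have
    the same image of \<open>f0 (Suc b)\<close>.\<close>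
  define e where "e t b = K (Suc b) t (e0 b)" for t b
  have dimF: "dim ((h ^^ m) ` F t i) = dim ((h ^^ m) ` f0 i)" and hF: "h ` F t i \<subseteq> F t i"
    if t: "t \<notin> Bad" and i: "i \<le> ?n" for t i m
  proof -
    have pow: "K (Suc i) t ((h ^^ m) x) = (h ^^ m) (K (Suc i) t x)" if "x \<in> f0 i" for x m
    proof (induction m)
      case (Suc m)
      have "(h ^^ m) x \<in> f0 (Suc i)" using funpow_stable[OF S0(2), of m i] F0(4)[of i] that by blast
      then show ?case using comm[OF i] Suc by simp
    qed simp
    have "(h ^^ m) ` F t i = K (Suc i) t ` ((h ^^ m) ` f0 i)"
      using i pow by (auto simp: F_def image_image simp del: dim_UNIV)
    moreover have "(h ^^ m) ` f0 i \<subseteq> f0 (Suc i)" using funpow_stable[OF S0(2), of m i] F0(4)[of i] by blast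
    ultimately show "dim ((h ^^ m) ` F t i) = dim ((h ^^ m) ` f0 i)"
      using inj_on_dim_image[OF lin[OF i] F0(3) inj[OF i t]] by simp
    show "h ` F t i \<subseteq> F t i"
    proof
      fix x assume "x \<in> h ` F t i"
      then obtain w where w: "w \<in> f0 i" "x = h (K (Suc i) t w)" using i by (auto simp: F_def)
      then have "x = K (Suc i) t (h w)" using pow[of w 1] by simp
      then show "x \<in> F t i" using w S0(2)[of i] i by (auto simp: F_def)
    qed
  qed
  have nextF: "F t (Suc i) = K (Suc i) t ` f0 (Suc i)" if "t \<notin> Bad" "Suc i \<le> ?n" for t i
    using nxt[of i t] that by (simp add: F_def del: dim_UNIV)
  have flag: "F t \<in> complete_flags" if t: "t \<notin> Bad" for t
    unfolding complete_flags_def mem_Collect_eq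
  proof (intro conjI allI impI)
    show "F t 0 = {0}" using self.linear_0[OF lin[of 0 t]] F0(1) by (simp add: F_def)
    show dimFi: "dim (F t i) = i" if "i \<le> ?n" for i
      using dimF[OF t that, of 0] F0(5)[OF that] by simp
    show sF: "subspace (F t i)" for i
      using lin_subspace_image[OF lin F0(3)] by (auto simp: F_def)
    show "F t ?n = UNIV"
      using subspace_dim_equal[OF sF subspace_UNIV subset_UNIV] dimFi[of ?n] by simp
    show "F t i \<subseteq> F t (Suc i)" for i
    proof (cases "Suc i \<le> ?n")
      case True
      then show ?thesis using nextF[OF t True] F0(4)[of i] by (auto simp: F_def)
    next
      case False
      then show ?thesis by (auto simp: F_def)
    qed
  qed
  have "F 0 = f0"
    proof
      fix i show "F 0 i = f0 i"
        using K0[of i] complete_flag_UNIV[OF S0(1), of i] by (cases "i \<le> ?n") (simp_all add: F_def del: dim_UNIV)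
    qed
  moreover have "F 1 = f1"
    proof
      fix i show "F 1 i = f1 i"
        using K1[of i] complete_flag_UNIV[OF S1(1), of i] by (cases "i \<le> ?n") (simp_all add: F_def del: dim_UNIV)
    qed
  moreover have "vpolyfun (\<lambda>t. e t b)" if "b < ?n" for b
      unfolding e_def using poly[of b] that by (simp del: dim_UNIV)
  moreover have "F t \<in> stable_flags h \<and> basis_seq (e t) \<and> adapted (F t) (e t)" if t: "t \<notin> Bad" for t
    proof -
      have "e t b \<in> F t (Suc b)" "e t b \<notin> F t b" if b: "b < ?n" for b
      proof -
        have sp: "f0 (Suc b) = span (e0 ` {..<Suc b})" "f0 b = span (e0 ` {..<b})"
          using e0(2) b by (auto simp: adapted_def simp del: dim_UNIV)
        have in0: "e0 b \<in> f0 (Suc b)" unfolding sp by (auto intro: span_base)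
        then show "e t b \<in> F t (Suc b)" using nextF[OF t] b by (simp add: e_def del: dim_UNIV)
        have notin: "e0 b \<notin> f0 b"
        proof
          assume "e0 b \<in> f0 b"
          then have "dim (e0 ` {..<Suc b}) = dim (e0 ` {..<b})" unfolding sp by (simp add: lessThan_Suc dim_insert)
          then show False using basis_seq_dim[OF e0(1), of "{..<Suc b}"] basis_seq_dim[OF e0(1), of "{..<b}"] b
            by (auto simp del: dim_UNIV)
        qed
        show "e t b \<notin> F t b"
        proof
          assume "e t b \<in> F t b"
          then obtain x where x: "x \<in> f0 b" "K (Suc b) t (e0 b) = K (Suc b) t x" using b by (auto simp: F_def e_def)
          then have "e0 b = x" using inj[of b t] t b in0 F0(4)[of b] by (auto simp: inj_on_def simp del: dim_UNIV)
          then show False using x notin by simp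
        qed
      qed
      then show ?thesis
        using adaptedI[OF flag[OF t], of "e t"] flag[OF t] hF[OF t] by (auto simp: stable_flags_def simp del: dim_UNIV)
    qed
  ultimately show ?thesis
    unfolding flag_curve_def using Bad dimF
    by (intro exI[of _ F] exI[of _ e] exI[of _ Bad]) (simp del: dim_UNIV)
qed

end

section \<open>Duality between subspaces and quotients\<close>

context finite_dimensional_vector_space
begin

text \<open>The symmetric bilinear form for which \<open>Basis\<close> is orthonormal. It identifies
  the space with its dual, so types of quotients for \<open>h\<close> become types of subspaces for
  its adjoint on the same space.\<close>

definition dot :: "'b \<Rightarrow> 'b \<Rightarrow> 'a" where
  "dot x y = (\<Sum>b\<in>Basis. representation Basis x b * representation Basis y b)"

lemma dot_add_left: "dot (x + y) z = dot x z + dot y z"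
  and dot_scale_left: "dot (c *s x) z = c * dot x z"
  and dot_add_right: "dot z (x + y) = dot z x + dot z y"
  and dot_scale_right: "dot z (c *s x) = c * dot z x"
  by (simp_all add: dot_def algebra_simps sum.distrib sum_distrib_left)

lemma dot_commute: "dot x y = dot y x"
  by (simp add: dot_def mult.commute)

lemma dot_zero [simp]: "dot 0 x = 0" "dot x 0 = 0"
  by (simp_all add: dot_def representation_zero)

lemma dot_sum_right: "dot z (\<Sum>a\<in>A. x a) = (\<Sum>a\<in>A. dot z (x a))"
  by (induction A rule: infinite_finite_induct) (auto simp: dot_add_right)

lemma dot_Basis: "b \<in> Basis \<Longrightarrow> dot x b = representation Basis x b"
  using finite_Basis by (simp add: dot_def rep_Basis if_distrib cong: if_cong)

lemma dot_nondegenerate: "(\<And>y. dot x y = 0) \<Longrightarrow> x = 0"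
proof (rule rep_eqI)
  fix b assume "\<And>y. dot x y = 0" "b \<in> Basis"
  then have "representation Basis x b = 0" using dot_Basis[of b x] by simp
  then show "representation Basis x b = representation Basis 0 b" by (simp add: representation_zero)
qed

definition adjoint :: "('b \<Rightarrow> 'b) \<Rightarrow> 'b \<Rightarrow> 'b" where
  "adjoint h x = (\<Sum>b\<in>Basis. dot x (h b) *s b)"

lemma dot_adjoint:
  assumes "lin h"
  shows "dot (adjoint h x) y = dot x (h y)"
proof -
  interpret h: Vector_Spaces.linear scale scale h by (rule assms)
  have "dot (adjoint h x) y = (\<Sum>b\<in>Basis. dot x (h b) * representation Basis y b)"
  proof -
    have "representation Basis (adjoint h x) b = dot x (h b)" if "b \<in> Basis" for b
      unfolding adjoint_def using that by (rule rep_sum_Basis)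
    then show ?thesis unfolding dot_def[of "adjoint h x"] by (intro sum.cong) auto
  qed
  also have "\<dots> = dot x (\<Sum>b\<in>Basis. representation Basis y b *s h b)"
    by (simp add: dot_sum_right dot_scale_right mult.commute)
  also have "(\<Sum>b\<in>Basis. representation Basis y b *s h b) = h (\<Sum>b\<in>Basis. representation Basis y b *s b)"
    by (simp add: h.sum h.scale)
  finally show ?thesis by (simp only: rep_expand)
qed

lemma lin_adjoint: "lin (adjoint h)"
  by (rule linI) (simp_all add: adjoint_def dot_add_left dot_scale_left scale_left_distrib sum.distrib scale_sum_right)

lemma dot_adjoint_pow:
  assumes "lin h"
  shows "dot ((adjoint h ^^ m) x) y = dot x ((h ^^ m) y)"
proof (induction m arbitrary: y)
  case (Suc m)
  have "dot ((adjoint h ^^ Suc m) x) y = dot ((adjoint h ^^ m) x) (h y)" by (simp add: dot_adjoint[OF assms])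
  also have "\<dots> = dot x ((h ^^ m) (h y))" by (rule Suc)
  finally show ?case by (simp only: funpow_Suc_right o_apply)
qed simp

lemma nilpotent_adjoint:
  assumes "lin h" "nilpotent h"
  shows "nilpotent (adjoint h)"
proof -
  obtain m where "\<And>x. (h ^^ m) x = 0" using assms(2) by (auto simp: nilpotent_def)
  then have "(adjoint h ^^ m) x = 0" for x
    by (intro dot_nondegenerate) (simp add: dot_adjoint_pow[OF assms(1)])
  then show ?thesis by (auto simp: nilpotent_def)
qed

definition perp :: "'b set \<Rightarrow> 'b set" where
  "perp W = {x. \<forall>y\<in>W. dot x y = 0}"

lemma subspace_perp: "subspace (perp W)"
  by (rule subspaceI) (auto simp: perp_def dot_add_left dot_scale_left)

lemma perp_antimono: "W \<subseteq> W' \<Longrightarrow> perp W' \<subseteq> perp W"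
  by (auto simp: perp_def)

lemma perp_span: "perp (span W) = perp W"
proof
  show "perp W \<subseteq> perp (span W)"
  proof
    fix x assume x: "x \<in> perp W"
    have "dot x y = 0" if "y \<in> span W" for y
      using that by (induction rule: span_induct_alt) (use x in \<open>auto simp: perp_def dot_add_right dot_scale_right\<close>)
    then show "x \<in> perp (span W)" by (simp add: perp_def)
  qed
qed (intro perp_antimono span_superset)

definition coord_mat :: "(nat \<Rightarrow> 'b) \<Rightarrow> 'a mat" where
  "coord_mat e = mat (dim UNIV) (dim UNIV) (\<lambda>(b, a). representation Basis (e b) (basis_list ! a))"

text \<open>The dual basis of \<open>e\<close> times the determinant of \<open>e\<close>. Taking the
  adjugate instead of the inverse avoids division and keeps the coordinates polynomial along a
  curve.\<close>

definition cobasis :: "(nat \<Rightarrow> 'b) \<Rightarrow> nat \<Rightarrow> 'b" where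
  "cobasis e b = (\<Sum>a<dim UNIV. adj_mat (coord_mat e) $$ (a, b) *s (basis_list ! a))"

lemma coord_mat: "coord_mat e \<in> carrier_mat (dim UNIV) (dim UNIV)"
  unfolding coord_mat_def by (rule mat_carrier)

lemma det_coord_mat: "det (coord_mat e) = coord_det e basis_list"
proof -
  have "coord_mat e = transpose_mat (mat (dim UNIV) (dim UNIV) (\<lambda>(a, b). representation Basis (e b) (basis_list ! a)))"
    unfolding coord_mat_def by (rule eq_matI) auto
  then show ?thesis unfolding coord_det_def basis_list(3) by (simp only:) (rule det_transpose, rule mat_carrier)
qed

lemma dot_cobasis:
  assumes "a < dim UNIV" "b < dim UNIV"
  shows "dot (e a) (cobasis e b) = (if a = b then coord_det e basis_list else 0)"
proof -
  let ?n = "dim UNIV" and ?A = "coord_mat e"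
  have bl: "basis_list ! c \<in> Basis" if "c < ?n" for c
    using basis_list(2,3) nth_mem[of c basis_list] that by (simp del: dim_UNIV)
  have adj: "adj_mat ?A \<in> carrier_mat ?n ?n" "?A * adj_mat ?A = det ?A \<cdot>\<^sub>m 1\<^sub>m ?n"
    using adj_mat[OF coord_mat] by blast+
  have "dot (e a) (cobasis e b) = (\<Sum>c<?n. adj_mat ?A $$ (c, b) * representation Basis (e a) (basis_list ! c))"
    unfolding cobasis_def dot_sum_right dot_scale_right using bl by (intro sum.cong) (auto simp: dot_Basis simp del: dim_UNIV)
  also have "\<dots> = (\<Sum>c<?n. ?A $$ (a, c) * adj_mat ?A $$ (c, b))"
    using assms by (intro sum.cong) (auto simp: coord_mat_def mult.commute simp del: dim_UNIV)
  also have "\<dots> = (?A * adj_mat ?A) $$ (a, b)"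
    using assms adj(1) coord_mat[of e]
    by (subst index_mult_mat) (auto simp: scalar_prod_def atLeast0LessThan simp del: dim_UNIV)
  also have "\<dots> = (if a = b then coord_det e basis_list else 0)"
    unfolding adj(2) using assms by (simp add: det_coord_mat del: dim_UNIV)
  finally show ?thesis .
qed

lemma basis_seq_cobasis:
  assumes "basis_seq e"
  shows "basis_seq (cobasis e)"
proof -
  let ?n = "dim UNIV"
  have D: "coord_det e basis_list \<noteq> 0" using assms coord_det_basis_list by blast
  have "\<forall>b\<in>{..<?n}. c b = 0" if c: "(\<Sum>b\<in>{..<?n}. c b *s cobasis e b) = 0" for c
  proof
    fix a assume a: "a \<in> {..<?n}"
    have "0 = dot (e a) (\<Sum>b\<in>{..<?n}. c b *s cobasis e b)" using c by simp
    also have "\<dots> = (\<Sum>b\<in>{..<?n}. c b * (if a = b then coord_det e basis_list else 0))"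
      unfolding dot_sum_right dot_scale_right using a dot_cobasis[of a _ e] by (intro sum.cong) (auto simp del: dim_UNIV)
    also have "\<dots> = c a * coord_det e basis_list" using a by (simp add: if_distrib del: dim_UNIV cong: if_cong)
    finally show "c a = 0" using D by simp
  qed
  then have "dim (cobasis e ` {..<?n}) = card {..<?n}" using independent_family_iff[of "{..<?n}" "cobasis e"] by blast
  then show ?thesis by (simp add: basis_seq_iff)
qed

lemma perp_basis_span:
  assumes e: "basis_seq e" and k: "k \<le> dim UNIV"
  shows "perp (span (e ` {..<k})) = span (cobasis e ` {k..<dim UNIV})"
proof (intro equalityI subsetI)
  let ?n = "dim UNIV"
  have D: "coord_det e basis_list \<noteq> 0" using e coord_det_basis_list by blast
  fix x assume x: "x \<in> perp (span (e ` {..<k}))"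
  have "x \<in> span (cobasis e ` {..<?n} \<union> {0})"
    using basis_seq_cobasis[OF e] span_mono[of "cobasis e ` {..<?n}" "cobasis e ` {..<?n} \<union> {0}"]
    by (auto simp: basis_seq_def simp del: dim_UNIV)
  then obtain c where c: "x = (\<Sum>b<?n. c b *s cobasis e b)"
    using span_family_Un_iff[of "{..<?n}" "{0}" x "cobasis e"] by auto
  have c0: "c a = 0" if a: "a < k" for a
  proof -
    have an: "a < ?n" using a k by linarith
    have "e a \<in> span (e ` {..<k})" using a by (auto intro: span_base)
    then have "0 = dot (e a) x" using x dot_commute[of x "e a"] by (auto simp: perp_def)
    also have "\<dots> = (\<Sum>b<?n. c b * (if a = b then coord_det e basis_list else 0))"
      unfolding c dot_sum_right dot_scale_right using dot_cobasis[OF an, of _ e] by (intro sum.cong) (auto simp del: dim_UNIV)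
    also have "\<dots> = c a * coord_det e basis_list" using an by (simp add: if_distrib del: dim_UNIV cong: if_cong)
    finally show ?thesis using D by simp
  qed
  show "x \<in> span (cobasis e ` {k..<?n})"
    unfolding c
  proof (rule span_sum)
    fix b assume "b \<in> {..<?n}"
    then have "cobasis e b \<in> span (cobasis e ` {k..<?n})" if "\<not> b < k"
      using that by (intro span_base imageI) auto
    then show "c b *s cobasis e b \<in> span (cobasis e ` {k..<?n})"
      using c0[of b] by (cases "b < k") (auto intro: span_scale simp: span_zero)
  qed
next
  fix x assume "x \<in> span (cobasis e ` {k..<dim UNIV})"
  then show "x \<in> perp (span (e ` {..<k}))"
  proof (rule subsetD[OF span_minimal[OF _ subspace_perp], rotated])
    have "dot (cobasis e b) (e a) = 0" if "k \<le> b" "b < dim UNIV" "a < k" for a b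
      using dot_cobasis[of a b e] that dot_commute[of "cobasis e b" "e a"] by (simp del: dim_UNIV)
    then have "cobasis e ` {k..<dim UNIV} \<subseteq> perp (e ` {..<k})" by (auto simp: perp_def simp del: dim_UNIV)
    then show "cobasis e ` {k..<dim UNIV} \<subseteq> perp (span (e ` {..<k}))" by (simp only: perp_span)
  qed
qed

lemma subspace_adapted_basis:
  assumes "subspace W"
  obtains e where "basis_seq e" "W = span (e ` {..<dim W})"
proof -
  let ?n = "dim UNIV"
  obtain B where B: "B \<subseteq> W" "independent B" "W \<subseteq> span B" "card B = dim W" by (meson basis_exists)
  have W: "span B = W" using B assms by (intro span_subspace) auto
  have finB: "finite B" using B(2) by (rule finiteI_independent)
  obtain g where g: "bij_betw g {..<dim W} B"
    using ex_bij_betw_nat_finite[OF finB] B(4) by (auto simp: atLeast0LessThan)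
  then have gi: "g ` {..<dim W} = B" by (simp add: bij_betw_def)
  obtain t c where t: "\<And>b. b < dim (g ` {..<dim W}) \<Longrightarrow> t b \<in> {..<dim W}"
    "coord_det (\<lambda>b. if b < dim (g ` {..<dim W}) then g (t b) else c b) basis_list \<noteq> 0"
    by (rule dim_witness[of "{..<dim W}" g, OF finite_lessThan], rule that) (assumption | blast)+
  have d: "dim (g ` {..<dim W}) = dim W" unfolding gi using B(2,4) dim_eq_card_independent by simp
  define e where "e b = (if b < dim W then g (t b) else c b)" for b
  have e: "basis_seq e" using t(2) unfolding d coord_det_basis_list e_def .
  have sub: "span (e ` {..<dim W}) \<subseteq> W"
  proof (rule span_minimal[OF _ assms])
    have "g (t b) \<in> W" if "b < dim W" for b using t(1) that gi B(1) unfolding d by blast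
    then show "e ` {..<dim W} \<subseteq> W" by (auto simp: e_def)
  qed
  have "dim W \<le> dim UNIV" by (rule dim_subset) simp
  then have "dim (span (e ` {..<dim W})) = dim W"
    using basis_seq_dim[OF e, of "{..<dim W}"] by (simp del: dim_UNIV)
  then have "span (e ` {..<dim W}) = W" using subspace_dim_equal[OF subspace_span assms sub] by simp
  then show thesis using that e by metis
qed

lemma dim_perp:
  assumes "subspace W"
  shows "dim (perp W) = dim UNIV - dim W"
proof -
  obtain e where e: "basis_seq e" "W = span (e ` {..<dim W})" using subspace_adapted_basis[OF assms] by blast
  have le: "dim W \<le> dim UNIV" by (rule dim_subset) simp
  have "perp W = perp (span (e ` {..<dim W}))" using e(2) by simp
  also have "\<dots> = span (cobasis e ` {dim W..<dim UNIV})" by (rule perp_basis_span[OF e(1) le])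
  finally have "dim (perp W) = dim (cobasis e ` {dim W..<dim UNIV})" by (simp del: dim_UNIV)
  also have "\<dots> = card {dim W..<dim UNIV}"
    by (rule basis_seq_dim[OF basis_seq_cobasis[OF e(1)]]) auto
  finally show ?thesis by simp
qed

lemma perp_perp:
  assumes "subspace W"
  shows "perp (perp W) = W"
proof (rule sym, rule subspace_dim_equal[OF assms subspace_perp])
  show "W \<subseteq> perp (perp W)" by (auto simp: perp_def dot_commute)
  have "dim W \<le> dim UNIV" by (rule dim_subset) simp
  then show "dim (perp (perp W)) \<le> dim W" using dim_perp[OF assms] dim_perp[OF subspace_perp] by (simp del: dim_UNIV)
qed

definition dual_flag :: "(nat \<Rightarrow> 'b set) \<Rightarrow> nat \<Rightarrow> 'b set" where
  "dual_flag f i = perp (f (dim UNIV - i))"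

lemma dual_flag_complete:
  assumes f: "f \<in> complete_flags"
  shows "dual_flag f \<in> complete_flags"
proof -
  note F = complete_flagD[OF f]
  let ?n = "dim UNIV"
  have dims: "dim (dual_flag f i) = i" if "i \<le> ?n" for i
    using dim_perp[OF F(3)] F(5)[of "?n - i"] that by (simp add: dual_flag_def del: dim_UNIV)
  have sub: "subspace (dual_flag f i)" for i by (simp add: dual_flag_def subspace_perp)
  have "dual_flag f 0 = {0}"
  proof -
    have "dual_flag f 0 \<subseteq> {0}" using dims[of 0] by (simp only: dim_eq_0)
    then show ?thesis using subspace_0[OF sub] by blast
  qed
  moreover have "dual_flag f ?n = UNIV"
    using subspace_dim_equal[OF sub subspace_UNIV subset_UNIV] dims[of ?n] by (simp del: dim_UNIV)
  moreover have "dual_flag f i \<subseteq> dual_flag f (Suc i)" for i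
    unfolding dual_flag_def by (intro perp_antimono complete_flag_mono[OF f]) simp
  ultimately show ?thesis unfolding complete_flags_def using dims sub by blast
qed

lemma dual_dual_flag:
  assumes f: "f \<in> complete_flags"
  shows "dual_flag (dual_flag f) = f"
proof
  fix i
  note F = complete_flagD[OF f]
  show "dual_flag (dual_flag f) i = f i"
  proof (cases "i \<le> dim UNIV")
    case True
    then show ?thesis using perp_perp[OF F(3)] by (simp add: dual_flag_def del: dim_UNIV)
  next
    case False
    then show ?thesis
      using complete_flag_UNIV[OF f, of i] complete_flag_UNIV[OF dual_flag_complete[OF dual_flag_complete[OF f]], of i]
      by (simp del: dim_UNIV)
  qed
qed

lemma perp_stable:
  assumes "lin h" "h ` W \<subseteq> W"
  shows "adjoint h ` perp W \<subseteq> perp W"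
  using assms by (auto simp: perp_def dot_adjoint)

lemma dual_flag_stable:
  assumes "lin h" "f \<in> stable_flags h"
  shows "dual_flag f \<in> stable_flags (adjoint h)"
  using dual_flag_complete[OF stable_flag_stable(1)[OF assms(2)]] perp_stable[OF assms(1) stable_flag_stable(2)[OF assms(2)]]
  by (simp add: stable_flags_def dual_flag_def)

lemma adjoint_adjoint:
  assumes "lin h"
  shows "adjoint (adjoint h) = h"
proof
  fix x
  have "dot (adjoint (adjoint h) x - h x) y = 0" for y
    using dot_add_left[of "adjoint (adjoint h) x - h x" "h x" y]
      dot_adjoint[OF lin_adjoint, of h x y] dot_adjoint[OF assms, of y x] by (simp add: dot_commute)
  then show "adjoint (adjoint h) x = h x" using dot_nondegenerate by fastforce
qed

text \<open>The kernel of the m-th power of the adjoint on \<open>perp W\<close> is the orthogonal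
  space of \<open>h^m V + W\<close>; the rest is counting dimensions.\<close>

lemma rank_perp:
  assumes h: "lin h" and W: "subspace W"
  shows "dim ((adjoint h ^^ m) ` perp W) + dim W = dim ((h ^^ m) ` UNIV \<union> W)"
proof -
  let ?T = "h ^^ m" and ?T' = "adjoint h ^^ m"
  let ?S = "span (?T ` UNIV \<union> W)"
  have "{x \<in> perp W. ?T' x = 0} = perp (?T ` UNIV \<union> W)"
  proof (intro equalityI subsetI)
    fix x assume "x \<in> {x \<in> perp W. ?T' x = 0}"
    then show "x \<in> perp (?T ` UNIV \<union> W)" using dot_adjoint_pow[OF h, of m x] by (auto simp: perp_def)
  next
    fix x assume x: "x \<in> perp (?T ` UNIV \<union> W)"
    then have "dot (?T' x) y = 0" for y using dot_adjoint_pow[OF h, of m x y] by (auto simp: perp_def)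
    then have "?T' x = 0" by (rule dot_nondegenerate)
    then show "x \<in> {x \<in> perp W. ?T' x = 0}" using x by (auto simp: perp_def)
  qed
  then have "{x \<in> perp W. ?T' x = 0} = perp ?S" by (simp add: perp_span)
  then have "dim (?T' ` perp W) + dim (perp ?S) = dim (perp W)"
    using rank_nullity[OF lin_funpow[OF lin_adjoint] subspace_perp, of m h W] by simp
  moreover have "dim ?S \<le> dim UNIV" "dim W \<le> dim ?S"
    by (rule dim_subset, simp) (rule dim_subset, auto intro: span_base)
  moreover have "dim ?S = dim (?T ` UNIV \<union> W)" by simp
  ultimately show ?thesis
    using dim_perp[OF W] dim_perp[OF subspace_span, of "?T ` UNIV \<union> W"] by linarith
qed

lemma vpolyfun_cobasis:
  assumes e: "\<And>b. b < dim UNIV \<Longrightarrow> vpolyfun (\<lambda>t. e t b)" and b: "b < dim UNIV"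
  shows "vpolyfun (\<lambda>t. cobasis (e t) b)"
  unfolding cobasis_def
proof (intro vpolyfun_sum vpolyfun_scale vpolyfun_const)
  let ?n = "dim UNIV"
  fix a assume "a \<in> {..<?n}"
  then have a: "a < ?n" by simp
  have "adj_mat (coord_mat (e t)) $$ (a, b) = (- 1) ^ (b + a) * det (mat (?n - 1) (?n - 1) (\<lambda>(i', j').
      representation Basis (e t (if i' < b then i' else Suc i')) (basis_list ! (if j' < a then j' else Suc j'))))" for t
  proof -
    have "mat_delete (coord_mat (e t)) b a = mat (?n - 1) (?n - 1) (\<lambda>(i', j').
      representation Basis (e t (if i' < b then i' else Suc i')) (basis_list ! (if j' < a then j' else Suc j')))"
      by (rule eq_matI) (auto simp: mat_delete_def coord_mat_def simp del: dim_UNIV)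
    then show ?thesis using a b coord_mat[of "e t"]
      unfolding adj_mat_def by (simp add: cofactor_def del: dim_UNIV)
  qed
  moreover have "polyfun (\<lambda>t. (- 1) ^ (b + a) * det (mat (?n - 1) (?n - 1) (\<lambda>(i', j').
      representation Basis (e t (if i' < b then i' else Suc i')) (basis_list ! (if j' < a then j' else Suc j')))))"
  proof (intro polyfun_mult polyfun_const polyfun_det vpolyfun_rep)
    fix i' assume "i' < ?n - 1"
    then show "vpolyfun (\<lambda>t. e t (if i' < b then i' else Suc i'))" using e by (simp del: dim_UNIV)
  qed
  ultimately show "polyfun (\<lambda>t. adj_mat (coord_mat (e t)) $$ (a, b))" by simp
qed

text \<open>By \<open>rank_perp\<close> the dual flags have equal subspace ranks for the adjoint, so
  \<open>r_flag_curve\<close> connects them; dualizing the curve gives the desired one.\<close>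

lemma q_flag_curve:
  assumes h: "lin h" "nilpotent h" and f0: "f0 \<in> stable_flags h" and f1: "f1 \<in> stable_flags h"
    and rank: "\<And>i m. i \<le> dim UNIV \<Longrightarrow> dim ((h ^^ m) ` UNIV \<union> f0 i) = dim ((h ^^ m) ` UNIV \<union> f1 i)"
  shows "\<exists>F e Bad. flag_curve h (\<lambda>m W. dim ((h ^^ m) ` UNIV \<union> W)) f0 f1 F e Bad"
proof -
  let ?n = "dim UNIV" and ?h = "adjoint h"
  have sub: "subspace (f i)" if "f \<in> stable_flags h" for f i
    using complete_flagD(3) stable_flag_stable(1) that by blast
  have dimf: "dim (f i) = i" if "f \<in> stable_flags h" "i \<le> ?n" for f i
    using complete_flagD(5) stable_flag_stable(1) that by blast
  have conv: "dim ((?h ^^ m) ` dual_flag f (?n - i)) + i = dim ((h ^^ m) ` UNIV \<union> f i)"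
    if "f \<in> stable_flags h" "i \<le> ?n" for f i m
    using rank_perp[OF h(1) sub[OF that(1)], of m i] dimf[OF that] that(2) by (simp add: dual_flag_def del: dim_UNIV)
  have rank': "dim ((?h ^^ m) ` dual_flag f0 i) = dim ((?h ^^ m) ` dual_flag f1 i)" if "i \<le> ?n" for i m
    using conv[OF f0, of "?n - i" m] conv[OF f1, of "?n - i" m] rank[of "?n - i" m] that by (simp del: dim_UNIV)
  obtain F e Bad where "flag_curve ?h (\<lambda>m W. dim ((?h ^^ m) ` W)) (dual_flag f0) (dual_flag f1) F e Bad"
    using r_flag_curve[OF lin_adjoint nilpotent_adjoint[OF h] dual_flag_stable[OF h(1) f0] dual_flag_stable[OF h(1) f1] rank']
    by blast
  then have Bad: "finite Bad" "0 \<notin> Bad" "1 \<notin> Bad" and F01: "F 0 = dual_flag f0" "F 1 = dual_flag f1"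
    and poly: "\<And>b. b < ?n \<Longrightarrow> vpolyfun (\<lambda>t. e t b)"
    and st: "\<And>t. t \<notin> Bad \<Longrightarrow> F t \<in> stable_flags ?h" and eb: "\<And>t. t \<notin> Bad \<Longrightarrow> basis_seq (e t)"
    and ea: "\<And>t. t \<notin> Bad \<Longrightarrow> adapted (F t) (e t)"
    and rk: "\<And>t i m. t \<notin> Bad \<Longrightarrow> i \<le> ?n \<Longrightarrow> dim ((?h ^^ m) ` F t i) = dim ((?h ^^ m) ` dual_flag f0 i)"
    unfolding flag_curve_def by blast+
  \<comment> \<open>The orthogonal space of the first \<open>k\<close> basis vectors is spanned by
    the last vectors of the dual basis, hence the reversed index.\<close>
  let ?F = "\<lambda>t. dual_flag (F t)" and ?e = "\<lambda>t b. cobasis (e t) (?n - 1 - b)"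
  have "?F 0 = f0" "?F 1 = f1" using F01 dual_dual_flag stable_flag_stable(1) f0 f1 by auto
  moreover have "vpolyfun (\<lambda>t. ?e t b)" if "b < ?n" for b
    using that by (intro vpolyfun_cobasis poly) (auto simp del: dim_UNIV)
  moreover have "?F t \<in> stable_flags h \<and> basis_seq (?e t) \<and> adapted (?F t) (?e t) \<and>
      (\<forall>i\<le>?n. \<forall>m. dim ((h ^^ m) ` UNIV \<union> ?F t i) = dim ((h ^^ m) ` UNIV \<union> f0 i))" if t: "t \<notin> Bad" for t
  proof (intro conjI allI impI)
    show st': "dual_flag (F t) \<in> stable_flags h"
      using dual_flag_stable[OF lin_adjoint st[OF t]] adjoint_adjoint[OF h(1)] by simp
    have img: "?e t ` {..<i} = cobasis (e t) ` {?n - i..<?n}" if i: "i \<le> ?n" for i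
    proof (intro equalityI subsetI)
      fix x assume "x \<in> ?e t ` {..<i}"
      then obtain b where b: "b < i" "x = cobasis (e t) (?n - 1 - b)" by auto
      have "?n - 1 - b \<in> {?n - i..<?n}" using b(1) i by auto
      then show "x \<in> cobasis (e t) ` {?n - i..<?n}" unfolding b(2) by (rule imageI)
    next
      fix x assume "x \<in> cobasis (e t) ` {?n - i..<?n}"
      then obtain b where b: "?n - i \<le> b" "b < ?n" "x = cobasis (e t) b" by auto
      then have "x = ?e t (?n - 1 - b)" by (simp del: dim_UNIV)
      moreover have "?n - 1 - b \<in> {..<i}" using b(1,2) by auto
      ultimately show "x \<in> ?e t ` {..<i}" by (rule image_eqI)
    qed
    show "adapted (?F t) (?e t)"
      unfolding adapted_def
    proof (intro allI impI)
      fix i assume i: "i \<le> ?n"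
      have "dual_flag (F t) i = perp (span (e t ` {..<?n - i}))" using ea[OF t] by (simp add: dual_flag_def adapted_def)
      also have "\<dots> = span (cobasis (e t) ` {?n - i..<?n})" by (rule perp_basis_span[OF eb[OF t]]) simp
      finally show "dual_flag (F t) i = span (?e t ` {..<i})" unfolding img[OF i] .
    qed
    show "basis_seq (?e t)"
      using img[of ?n] basis_seq_cobasis[OF eb[OF t]] unfolding basis_seq_iff by (simp add: atLeast0LessThan del: dim_UNIV)
    fix i m assume i: "i \<le> ?n"
    have "dual_flag (dual_flag (F t)) = F t" by (rule dual_dual_flag[OF stable_flag_stable(1)[OF st[OF t]]])
    then show "dim ((h ^^ m) ` UNIV \<union> dual_flag (F t) i) = dim ((h ^^ m) ` UNIV \<union> f0 i)"
      using conv[OF st' i, of m] conv[OF f0 i, of m] rk[OF t, of "?n - i" m] by simp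
  qed
  ultimately show ?thesis
    unfolding flag_curve_def using Bad by (intro exI[of _ ?F] exI[of _ ?e] exI[of _ Bad]) blast
qed

end

section \<open>Existence of a pair of flags with the ranks of a growth diagram\<close>

text \<open>At a corner (m+1, i+1, j+1), \<open>r1\<close> and \<open>r2\<close> bound
  \<open>r\<close> above by the minimum minus the opposite corner, and \<open>oct\<close> bounds
  \<open>R\<close> below by the same number; with \<open>R \<le> r\<close> they agree. All powers
  \<open>m\<close> are treated together in the induction on \<open>i + j\<close>.\<close>

lemma octahedron_forward:
  fixes r R :: "nat \<Rightarrow> nat \<Rightarrow> nat \<Rightarrow> nat"
  assumes ge: "\<And>m i j. i \<le> n \<Longrightarrow> j \<le> n \<Longrightarrow> R m i j \<le> r m i j"
    and edge: "\<And>m j. j \<le> n \<Longrightarrow> r m 0 j = R m 0 j" "\<And>m i. i \<le> n \<Longrightarrow> r m i 0 = R m i 0"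
      "\<And>i j. i \<le> n \<Longrightarrow> j \<le> n \<Longrightarrow> r 0 i j = R 0 i j"
    and r1: "\<And>m i j. i < n \<Longrightarrow> j < n \<Longrightarrow> r m i j + r (Suc m) (Suc i) (Suc j) \<le> r m i (Suc j) + r (Suc m) (Suc i) j"
    and r2: "\<And>m i j. i < n \<Longrightarrow> j < n \<Longrightarrow> r m i j + r (Suc m) (Suc i) (Suc j) \<le> r (Suc m) i (Suc j) + r m (Suc i) j"
    and oct: "\<And>m i j. i < n \<Longrightarrow> j < n \<Longrightarrow> min (R m i (Suc j) + R (Suc m) (Suc i) j) (R (Suc m) i (Suc j) + R m (Suc i) j)
      \<le> R m i j + R (Suc m) (Suc i) (Suc j)"
  shows "i \<le> n \<Longrightarrow> j \<le> n \<Longrightarrow> r m i j = R m i j"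
proof (induction "i + j" arbitrary: i j m rule: less_induct)
  case less
  show ?case
  proof (cases "i = 0 \<or> j = 0 \<or> m = 0")
    case True
    then show ?thesis using edge less.prems by auto
  next
    case False
    then obtain i' j' m' where ij: "i = Suc i'" "j = Suc j'" "m = Suc m'" by (metis not0_implies_Suc)
    have lt: "i' < n" "j' < n" using less.prems ij by auto
    have IH: "r m i' j' = R m i' j'" "r m i' j = R m i' j" "r m i j' = R m i j'" for m
      using less.hyps[of i' j' m] less.hyps[of i' j m] less.hyps[of i j' m] less.prems ij by auto
    show ?thesis
      using r1[OF lt, of m'] r2[OF lt, of m'] oct[OF lt, of m'] ge[OF less.prems, of m]
      unfolding ij IH[unfolded ij] by (auto simp: min_le_iff_disj)
  qed
qed

text \<open>The same squeeze solved for the corner (m, i, j), with the induction running down from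
  the edges \<open>i = n\<close> and \<open>j = n\<close>.\<close>

lemma octahedron_backward:
  fixes r R :: "nat \<Rightarrow> nat \<Rightarrow> nat \<Rightarrow> nat"
  assumes ge: "\<And>m i j. i \<le> n \<Longrightarrow> j \<le> n \<Longrightarrow> R m i j \<le> r m i j"
    and edge: "\<And>m j. j \<le> n \<Longrightarrow> r m n j = R m n j" "\<And>m i. i \<le> n \<Longrightarrow> r m i n = R m i n"
    and r1: "\<And>m i j. i < n \<Longrightarrow> j < n \<Longrightarrow> r m i j + r (Suc m) (Suc i) (Suc j) \<le> r m i (Suc j) + r (Suc m) (Suc i) j"
    and r2: "\<And>m i j. i < n \<Longrightarrow> j < n \<Longrightarrow> r m i j + r (Suc m) (Suc i) (Suc j) \<le> r (Suc m) i (Suc j) + r m (Suc i) j"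
    and oct: "\<And>m i j. i < n \<Longrightarrow> j < n \<Longrightarrow> min (R m i (Suc j) + R (Suc m) (Suc i) j) (R (Suc m) i (Suc j) + R m (Suc i) j)
      \<le> R m i j + R (Suc m) (Suc i) (Suc j)"
  shows "i \<le> n \<Longrightarrow> j \<le> n \<Longrightarrow> r m i j = R m i j"
proof (induction "(n - i) + (n - j)" arbitrary: i j m rule: less_induct)
  case less
  show ?case
  proof (cases "i = n \<or> j = n")
    case True
    then show ?thesis using edge less.prems by auto
  next
    case False
    then have lt: "i < n" "j < n" using less.prems by auto
    have IH: "r m (Suc i) (Suc j) = R m (Suc i) (Suc j)" "r m (Suc i) j = R m (Suc i) j" "r m i (Suc j) = R m i (Suc j)" for m
      using less.hyps[of "Suc i" "Suc j" m] less.hyps[of "Suc i" j m] less.hyps[of i "Suc j" m] lt by auto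
    show ?thesis
      using r1[OF lt, of m] r2[OF lt, of m] oct[OF lt, of m] ge[OF less.prems, of m]
      unfolding IH by (auto simp: min_le_iff_disj)
  qed
qed

section \<open>Generic maps that preserve two flags\<close>

context finite_dimensional_vector_space
begin

definition strict_on :: "('b \<Rightarrow> 'b) \<Rightarrow> (nat \<Rightarrow> 'b set) \<Rightarrow> bool" where
  "strict_on h f \<longleftrightarrow> (\<forall>i<dim UNIV. h ` f (Suc i) \<subseteq> f i)"

lemma strict_on_funpow:
  assumes f: "f \<in> complete_flags" and lin: "lin h" and h: "strict_on h f" and i: "i \<le> dim UNIV"
  shows "(h ^^ m) ` f i \<subseteq> f (i - m)"
proof (induction m)
  case (Suc m)
  have "h ` f (i - m) \<subseteq> f (i - Suc m)"
  proof (cases "i - m")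
    case 0
    then have "i - Suc m = 0" by simp
    then show ?thesis using 0 lin_zero_stable[OF lin] complete_flagD(1)[OF f] by simp
  next
    case (Suc k)
    then have "i - Suc m = k" "k < dim UNIV" using i by auto
    then show ?thesis using h Suc by (simp add: strict_on_def del: dim_UNIV)
  qed
  then show ?case using Suc by auto
qed simp

lemma strict_on_stable:
  assumes f: "f \<in> complete_flags" and lin: "lin h" and h: "strict_on h f"
  shows "f \<in> stable_flags h" "nilpotent h"
proof -
  have "h ` f i \<subseteq> f i" if "i \<le> dim UNIV" for i
    using strict_on_funpow[OF f lin h that, of 1] complete_flag_mono[OF f, of "i - 1" i] by auto
  then show "f \<in> stable_flags h" using f by (simp add: stable_flags_def)
  have "(h ^^ dim UNIV) x = 0" for x
    using strict_on_funpow[OF f lin h, of "dim UNIV" "dim UNIV"] complete_flagD(1,2)[OF f] by (auto simp del: dim_UNIV)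
  then show "nilpotent h" by (auto simp: nilpotent_def)
qed

text \<open>The rank of \<open>h ^^ m\<close> on \<open>f i\<close> modulo its intersection with the
  member of codimension \<open>j\<close> of \<open>f'\<close>. Codimension is used so that
  \<open>i\<close> and \<open>j\<close> match the indices of the growth diagram.\<close>

definition pair_rank :: "('b \<Rightarrow> 'b) \<Rightarrow> (nat \<Rightarrow> 'b set) \<Rightarrow> (nat \<Rightarrow> 'b set) \<Rightarrow> nat \<Rightarrow> nat \<Rightarrow> nat \<Rightarrow> nat" where
  "pair_rank h f f' m i j = dim ((h ^^ m) ` f i \<union> f' (dim UNIV - j)) - (dim UNIV - j)"

lemma pair_rank:
  assumes "f' \<in> complete_flags"
  shows "dim ((h ^^ m) ` f i \<union> f' (dim UNIV - j)) = pair_rank h f f' m i j + (dim UNIV - j)"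
proof -
  have "dim UNIV - j = dim (f' (dim UNIV - j))" using complete_flagD(5)[OF assms] by (simp del: dim_UNIV)
  also have "\<dots> \<le> dim ((h ^^ m) ` f i \<union> f' (dim UNIV - j))" by (rule dim_subset) simp
  finally show ?thesis by (simp add: pair_rank_def del: dim_UNIV)
qed

lemma pair_rank_inequalities:
  assumes h: "lin h" and f: "f \<in> complete_flags" "strict_on h f" and f': "f' \<in> complete_flags" "strict_on h f'"
    and ij: "i < dim UNIV" "j < dim UNIV"
  shows "pair_rank h f f' m i j + pair_rank h f f' (Suc m) (Suc i) (Suc j) \<le> pair_rank h f f' m i (Suc j) + pair_rank h f f' (Suc m) (Suc i) j"
    "pair_rank h f f' m i j + pair_rank h f f' (Suc m) (Suc i) (Suc j) \<le> pair_rank h f f' (Suc m) i (Suc j) + pair_rank h f f' m (Suc i) j"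
proof -
  note F = complete_flagD[OF f(1)] and F' = complete_flagD[OF f'(1)]
  let ?n = "dim UNIV"
  have k: "?n - j = Suc (?n - Suc j)" "?n - Suc j < ?n" using ij by auto
  have B: "f' (?n - Suc j) \<subseteq> f' (?n - j)" "h ` f' (?n - j) \<subseteq> f' (?n - Suc j)"
    using F'(4)[of "?n - Suc j"] f'(2) k unfolding strict_on_def by (auto simp del: dim_UNIV)
  have A: "h ` f (Suc i) \<subseteq> f i" using f(2) ij by (simp add: strict_on_def del: dim_UNIV)
  show "pair_rank h f f' m i j + pair_rank h f f' (Suc m) (Suc i) (Suc j) \<le> pair_rank h f f' m i (Suc j) + pair_rank h f f' (Suc m) (Suc i) j"
    using rank_inequality_image[OF h F(3) F(3) A F'(3) F'(3) B(1), of m] unfolding pair_rank[OF f'(1)] by linarith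
  show "pair_rank h f f' m i j + pair_rank h f f' (Suc m) (Suc i) (Suc j) \<le> pair_rank h f f' (Suc m) i (Suc j) + pair_rank h f f' m (Suc i) j"
    using rank_inequality_preimage[OF h F(3) F(3) F(4)[of i] F'(3) F'(3) B(2), of m] unfolding pair_rank[OF f'(1)] by linarith
qed

lemma dim_image_span_Un: "lin T \<Longrightarrow> dim (T ` span A \<union> span B) = dim (T ` A \<union> B)"
proof (rule span_eq_dim, rule span_eq[THEN iffD2], intro conjI Un_least)
  assume T: "lin T"
  have "T ` span A = span (T ` A)" using self.linear_span_image[OF T] by simp
  then show "T ` span A \<subseteq> span (T ` A \<union> B)" using span_mono[of "T ` A" "T ` A \<union> B"] by simp
  show "span B \<subseteq> span (T ` A \<union> B)" by (rule span_mono) simp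
  show "T ` A \<subseteq> span (T ` span A \<union> span B)" "B \<subseteq> span (T ` span A \<union> span B)"
    by (auto intro!: span_base intro: span_base)
qed

lemma vpolyfun_funpow:
  assumes "\<And>t. lin (h t)" "\<And>x. vpolyfun (\<lambda>t. h t x)"
  shows "vpolyfun (\<lambda>t. (h t ^^ m) x)"
  by (induction m) (auto intro: vpolyfun_const vpolyfun_apply assms)

lemma rank_generic:
  assumes h: "\<And>t. lin (h t)" "\<And>x. vpolyfun (\<lambda>t. h t x)" and f: "f \<in> complete_flags" and f': "f' \<in> complete_flags"
    and i: "i \<le> dim UNIV"
  shows "finite {t. pair_rank (h t) f f' m i j < pair_rank (h t0) f f' m i j}"
proof -
  let ?k = "dim UNIV - j"
  obtain e where e: "basis_seq e" "adapted f e" using adapted_basis_exists[OF f] by blast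
  obtain e' where e': "basis_seq e'" "adapted f' e'" using adapted_basis_exists[OF f'] by blast
  define Y where "Y t b = (if b < i then (h t ^^ m) (e b) else e' (b - i))" for t b
  have "Y t ` {..<i + ?k} = (h t ^^ m) ` e ` {..<i} \<union> e' ` {..<?k}" for t
  proof (intro equalityI subsetI)
    fix x assume "x \<in> Y t ` {..<i + ?k}"
    then obtain b where "b < i + ?k" "x = Y t b" by auto
    then show "x \<in> (h t ^^ m) ` e ` {..<i} \<union> e' ` {..<?k}" by (cases "b < i") (auto simp: Y_def simp del: dim_UNIV)
  next
    fix x assume "x \<in> (h t ^^ m) ` e ` {..<i} \<union> e' ` {..<?k}"
    then consider b where "b < i" "x = (h t ^^ m) (e b)" | b where "b < ?k" "x = e' b" by auto
    then show "x \<in> Y t ` {..<i + ?k}"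
    proof cases
      case (1 b)
      then show ?thesis by (intro image_eqI[of _ _ b]) (auto simp: Y_def)
    next
      case (2 b)
      then show ?thesis by (intro image_eqI[of _ _ "i + b"]) (auto simp: Y_def simp del: dim_UNIV)
    qed
  qed
  moreover have "f i = span (e ` {..<i})" "f' ?k = span (e' ` {..<?k})" using e e' i by (auto simp: adapted_def simp del: dim_UNIV)
  ultimately have "dim ((h t ^^ m) ` f i \<union> f' ?k) = dim (Y t ` {..<i + ?k})" for t
    using dim_image_span_Un[OF lin_funpow[OF h(1)], of m t "e ` {..<i}" "e' ` {..<?k}"] by simp
  moreover have "finite {t. dim (Y t ` {..<i + ?k}) < dim (Y t0 ` {..<i + ?k})}"
  proof (rule dim_generic)
    fix b show "vpolyfun (\<lambda>t. Y t b)"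
      unfolding Y_def by (cases "b < i") (auto intro: vpolyfun_const vpolyfun_funpow h)
  qed simp
  moreover have "pair_rank (h t) f f' m i j < pair_rank (h t0) f f' m i j \<longleftrightarrow>
      dim ((h t ^^ m) ` f i \<union> f' ?k) < dim ((h t0 ^^ m) ` f i \<union> f' ?k)" for t
    unfolding pair_rank[OF f'] by linarith
  ultimately show ?thesis by simp
qed

text \<open>Maps strict on both flags form a linear space. On the line through a map good for
  \<open>A\<close> and one good for the new condition, every condition fails for finitely many
  parameters only.\<close>

lemma generic_pair_rank:
  assumes inf: "infinite (UNIV :: 'a set)" and f: "f \<in> complete_flags" and f': "f' \<in> complete_flags"
    and fin: "finite A" and A: "\<And>m i j. (m, i, j) \<in> A \<Longrightarrow> i \<le> dim UNIV"
    and ex: "\<And>m i j. (m, i, j) \<in> A \<Longrightarrow> \<exists>h. lin h \<and> strict_on h f \<and> strict_on h f' \<and> R m i j \<le> pair_rank h f f' m i j"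
  shows "\<exists>h. lin h \<and> strict_on h f \<and> strict_on h f' \<and> (\<forall>(m, i, j)\<in>A. R m i j \<le> pair_rank h f f' m i j)"
  using fin A ex
proof (induction A rule: finite_induct)
  case empty
  have "lin (\<lambda>_. 0)" by (rule linI) auto
  moreover have "strict_on (\<lambda>_. 0) f" "strict_on (\<lambda>_. 0) f'"
    using subspace_0[OF complete_flagD(3)[OF f]] subspace_0[OF complete_flagD(3)[OF f']] by (auto simp: strict_on_def)
  ultimately show ?case by blast
next
  case (insert p A)
  obtain m i j where p: "p = (m, i, j)" by (cases p)
  have "\<exists>h. lin h \<and> strict_on h f \<and> strict_on h f' \<and> (\<forall>(m, i, j)\<in>A. R m i j \<le> pair_rank h f f' m i j)"
    by (rule insert.IH) (use insert.prems in blast)+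
  then obtain h1 where h1: "lin h1" "strict_on h1 f" "strict_on h1 f'" "\<And>m i j. (m, i, j) \<in> A \<Longrightarrow> R m i j \<le> pair_rank h1 f f' m i j"
    by blast
  obtain h2 where h2: "lin h2" "strict_on h2 f" "strict_on h2 f'" "R m i j \<le> pair_rank h2 f f' m i j"
    using insert.prems(2)[of m i j] p by blast
  define h where "h t x = (1 - t) *s h1 x + t *s h2 x" for t x
  have lin: "lin (h t)" for t
    by (rule linI) (simp_all add: h_def self.linear_add[OF h1(1)] self.linear_scale[OF h1(1)]
        self.linear_add[OF h2(1)] self.linear_scale[OF h2(1)] scale_right_distrib mult.commute add_ac)
  have poly: "vpolyfun (\<lambda>t. h t x)" for x
    unfolding h_def by (intro vpolyfun_add vpolyfun_scale vpolyfun_const polyfun_diff polyfun_const polyfun_id)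
  have strict: "strict_on (h t) g" if "g \<in> complete_flags" "strict_on h1 g" "strict_on h2 g" for t g
    unfolding strict_on_def
  proof (intro allI impI subsetI)
    fix i x assume i: "i < dim UNIV" and "x \<in> h t ` g (Suc i)"
    then obtain y where y: "y \<in> g (Suc i)" "x = h t y" by blast
    then have "h1 y \<in> g i" "h2 y \<in> g i" using that(2,3) i unfolding strict_on_def by blast+
    then show "x \<in> g i"
      unfolding y(2) h_def using complete_flagD(3)[OF that(1)] by (intro subspace_add subspace_scale)
  qed
  have h01: "h 0 = h1" "h 1 = h2" by (auto simp: h_def fun_eq_iff)
  define bad where "bad q = {t. case q of (m, i, j) \<Rightarrow> pair_rank (h t) f f' m i j < R m i j}" for q
  have "finite (bad q)" if "q \<in> insert p A" for q
  proof -
    obtain m' i' j' where q: "q = (m', i', j')" by (cases q)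
    have i': "i' \<le> dim UNIV" using insert.prems(1) that q by blast
    \<comment> \<open>The line is at \<open>h1\<close> for \<open>t = 0\<close> and at
      \<open>h2\<close> for \<open>t = 1\<close>; the new condition \<open>p\<close> is known at 1,
      the old ones at 0.\<close>
    define t0 :: 'a where "t0 = (if q = p then 1 else 0)"
    have "R m' i' j' \<le> pair_rank (h t0) f f' m' i' j'"
      using that q p h1(4) h2(4) h01 by (auto simp: t0_def)
    then have "bad q \<subseteq> {t. pair_rank (h t) f f' m' i' j' < pair_rank (h t0) f f' m' i' j'}" by (auto simp: bad_def q)
    then show ?thesis using rank_generic[OF lin poly f f' i'] finite_subset by blast
  qed
  then have "finite (\<Union>q\<in>insert p A. bad q)" using insert.hyps by blast
  then obtain t where t: "t \<notin> (\<Union>q\<in>insert p A. bad q)" using inf ex_new_if_finite by blast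
  have "R m' i' j' \<le> pair_rank (h t) f f' m' i' j'" if "(m', i', j') \<in> insert p A" for m' i' j'
  proof -
    have "t \<notin> bad (m', i', j')" using t that by blast
    then show ?thesis by (simp add: bad_def)
  qed
  then show ?case
    using lin strict[OF f h1(2) h2(2)] strict[OF f' h1(3) h2(3)] by blast
qed

end

section \<open>Coordinate flags of a permutation and their chain maps\<close>

context finite_dimensional_vector_space
begin

text \<open>Together with \<open>opp_flag\<close> this realizes the growth diagram: modulo
  \<open>opp_flag (n - j)\<close>, member \<open>i\<close> has as a basis the vectors at positions
  \<open>p < j\<close> with \<open>s p < i\<close>.\<close>

definition std_flag :: "(nat \<Rightarrow> nat) \<Rightarrow> nat \<Rightarrow> 'b set" where
  "std_flag s i = span ((!) basis_list ` {p. p < dim UNIV \<and> s p < i})"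

definition opp_flag :: "nat \<Rightarrow> 'b set" where
  "opp_flag k = span ((!) basis_list ` {dim UNIV - k..<dim UNIV})"

lemma basis_seq_basis_list: "basis_seq ((!) basis_list)"
proof -
  have "(!) basis_list ` {..<dim UNIV} = Basis"
    using basis_list(2,3) nth_image[of "dim UNIV" basis_list] by (simp add: atLeast0LessThan del: dim_UNIV)
  then show ?thesis unfolding basis_seq_iff by (simp add: dim_eq_card_independent independent_Basis)
qed

lemma complete_flagI:
  assumes sub: "\<And>i. subspace (f i)" "\<And>i. f i \<subseteq> f (Suc i)" and dims: "\<And>i. i \<le> dim UNIV \<Longrightarrow> dim (f i) = i"
  shows "f \<in> complete_flags"
proof -
  have "f 0 \<subseteq> {0}" using dims[of 0] by (simp only: dim_eq_0)
  then have "f 0 = {0}" using subspace_0[OF sub(1)] by blast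
  moreover have "f (dim UNIV) = UNIV"
    using subspace_dim_equal[OF sub(1) subspace_UNIV subset_UNIV] dims[of "dim UNIV"] by (simp del: dim_UNIV)
  ultimately show ?thesis unfolding complete_flags_def using sub dims by blast
qed

lemma std_flag_complete:
  assumes s: "s permutes {..<dim UNIV}"
  shows "std_flag s \<in> complete_flags"
proof (rule complete_flagI)
  fix i
  show "subspace (std_flag s i)" by (simp add: std_flag_def)
  show "std_flag s i \<subseteq> std_flag s (Suc i)" unfolding std_flag_def by (intro span_mono image_mono) auto
  assume i: "i \<le> dim UNIV"
  let ?A = "{p. p < dim UNIV \<and> s p < i}"
  have "s ` ?A = {..<i}"
  proof (intro equalityI subsetI)
    fix a assume "a \<in> {..<i}"
    then have "a \<in> s ` {..<dim UNIV}" using permutes_image[OF s] i by simp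
    then show "a \<in> s ` ?A" using \<open>a \<in> {..<i}\<close> by auto
  qed auto
  moreover have "inj_on s ?A" using permutes_inj_on[OF s] .
  ultimately have "card ?A = i" by (metis card_image card_lessThan)
  then show "dim (std_flag s i) = i"
    using basis_seq_dim[OF basis_seq_basis_list, of ?A] by (auto simp: std_flag_def simp del: dim_UNIV)
qed

lemma opp_flag_complete: "opp_flag \<in> complete_flags"
proof (rule complete_flagI)
  fix i
  show "subspace (opp_flag i)" by (simp add: opp_flag_def)
  show "opp_flag i \<subseteq> opp_flag (Suc i)" unfolding opp_flag_def by (intro span_mono image_mono) auto
  have "{dim UNIV - i..<dim UNIV} \<subseteq> {..<dim UNIV}" by auto
  moreover assume "i \<le> dim UNIV"
  ultimately show "dim (opp_flag i) = i"
    using basis_seq_dim[OF basis_seq_basis_list] by (simp add: opp_flag_def del: dim_UNIV)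
qed

lemma lin_on_basis_list: "\<exists>h. lin h \<and> (\<forall>p<dim UNIV. h (basis_list ! p) = w p)"
proof -
  let ?n = "dim UNIV"
  define h where "h x = (\<Sum>p<?n. representation Basis x (basis_list ! p) *s w p)" for x
  have "lin h" by (rule linI) (simp_all add: h_def scale_left_distrib sum.distrib scale_sum_right)
  moreover have "h (basis_list ! q) = w q" if q: "q < ?n" for q
  proof -
    have "basis_list ! q \<in> Basis" using basis_list(2,3) nth_mem[of q basis_list] q by (simp del: dim_UNIV)
    then have "representation Basis (basis_list ! q) (basis_list ! p) = (if p = q then 1 else 0)" if "p < ?n" for p
      using that q basis_list(1,3) by (simp add: rep_Basis nth_eq_iff_index_eq del: dim_UNIV)
    then have "h (basis_list ! q) = (\<Sum>p<?n. if p = q then w p else 0)"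
      unfolding h_def by (intro sum.cong) auto
    then show ?thesis using q by (simp del: dim_UNIV)
  qed
  ultimately show ?thesis by blast
qed

text \<open>Moving to a later position with a smaller value, a step along a decreasing subsequence,
  lowers the index in both flags.\<close>

lemma strict_on_std_opp:
  assumes h: "lin h"
    and step: "\<And>p. p < dim UNIV \<Longrightarrow> h (basis_list ! p) = 0 \<or>
      (\<exists>q<dim UNIV. p < q \<and> s q < s p \<and> h (basis_list ! p) = basis_list ! q)"
  shows "strict_on h (std_flag s)" "strict_on h opp_flag"
proof -
  have img: "h ` span A \<subseteq> span B" if "h ` A \<subseteq> span B" for A B
    using that self.linear_span_image[OF h, of A] span_minimal[of "h ` A" "span B"] by auto
  show "strict_on h (std_flag s)"
    unfolding strict_on_def std_flag_def
  proof (intro allI impI img subsetI)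
    fix i x assume "x \<in> h ` (!) basis_list ` {p. p < dim UNIV \<and> s p < Suc i}"
    then obtain p where p: "p < dim UNIV" "s p < Suc i" "x = h (basis_list ! p)" by auto
    show "x \<in> span ((!) basis_list ` {p. p < dim UNIV \<and> s p < i})"
      using step[OF p(1)]
    proof
      assume "\<exists>q<dim UNIV. p < q \<and> s q < s p \<and> h (basis_list ! p) = basis_list ! q"
      then obtain q where "q < dim UNIV" "s q < s p" "x = basis_list ! q" using p by auto
      then show ?thesis using p(2) by (intro span_base) auto
    qed (simp add: p(3) span_zero)
  qed
  show "strict_on h opp_flag"
    unfolding strict_on_def opp_flag_def
  proof (intro allI impI img subsetI)
    fix k x assume "x \<in> h ` (!) basis_list ` {dim UNIV - Suc k..<dim UNIV}"
    then obtain p where p: "dim UNIV - Suc k \<le> p" "p < dim UNIV" "x = h (basis_list ! p)" by auto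
    show "x \<in> span ((!) basis_list ` {dim UNIV - k..<dim UNIV})"
      using step[OF p(2)]
    proof
      assume "\<exists>q<dim UNIV. p < q \<and> s q < s p \<and> h (basis_list ! p) = basis_list ! q"
      then obtain q where "q < dim UNIV" "p < q" "x = basis_list ! q" using p by auto
      then show ?thesis using p(1) by (intro span_base) (auto simp del: dim_UNIV)
    qed (simp add: p(3) span_zero)
  qed
qed

text \<open>Mapping each basis vector to the next one in its chain realizes the ranks predicted by
  a family of disjoint chains.\<close>

lemma chain_map_exists:
  assumes s: "s permutes {..<dim UNIV}" and j: "j \<le> dim UNIV"
  shows "\<exists>h. lin h \<and> strict_on h (std_flag s) \<and> strict_on h opp_flag \<and>
    tails (RS_shapes s i j) m \<le> pair_rank h (std_flag s) opp_flag m i j"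
proof -
  let ?n = "dim UNIV" and ?e = "(!) basis_list"
  define k where "k = RS_shapes s i j m"
  have injs: "inj_on s A" for A using permutes_inj_on[OF s] .
  obtain hue where col: "dec_colouring k (filter (\<lambda>a. a < i) (map s [0..<j])) hue"
    and card: "card {a \<in> set (filter (\<lambda>a. a < i) (map s [0..<j])). hue a < k} = m * k + tails (RS_shapes s i j) m"
    using RS_shapes_dec_family[OF injs, of i j m] unfolding dec_family_def k_def by blast
  define A where "A = {p. p < j \<and> s p < i \<and> hue (s p) < k}"
  have dec: "s q < s p" if "p \<in> A" "q \<in> A" "p < q" "hue (s p) = hue (s q)" for p q
  proof -
    have "sorted_wrt (\<lambda>p q. s p < i \<and> s q < i \<longrightarrow> hue (s p) = hue (s q) \<and> hue (s p) < k \<longrightarrow> s q < s p) [0..<j]"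
      using col by (simp add: dec_colouring_def filter_map sorted_wrt_map sorted_wrt_filter_iff o_def)
    then show ?thesis using that unfolding sorted_wrt_iff_nth_less A_def by auto
  qed
  have cardA: "card A = m * k + tails (RS_shapes s i j) m"
  proof -
    have "{a \<in> set (filter (\<lambda>a. a < i) (map s [0..<j])). hue a < k} = s ` A" by (auto simp: A_def)
    then show ?thesis using card card_image[OF injs, of A] by simp
  qed
  define L where "L c = filter (\<lambda>p. p \<in> A \<and> hue (s p) = c) [0..<j]" for c
  have L: "distinct (L c)" "set (L c) = {p \<in> A. hue (s p) = c}" "sorted_wrt (<) (L c)" for c
    by (auto simp: L_def A_def sorted_wrt_filter)
  \<comment> \<open>The place of \<open>p\<close> in its own chain; \<open>h\<close> moves one place
    forward and kills the end of a chain.\<close>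
  define ix where "ix p = (THE t. t < length (L (hue (s p))) \<and> L (hue (s p)) ! t = p)" for p
  have ix: "ix (L c ! t) = t" "hue (s (L c ! t)) = c" "L c ! t \<in> A" if "t < length (L c)" for c t
  proof -
    have "L c ! t \<in> set (L c)" using that by simp
    then show hc: "hue (s (L c ! t)) = c" and "L c ! t \<in> A" using L(2) by auto
    show "ix (L c ! t) = t"
      unfolding ix_def hc using that L(1)[of c] by (intro the_equality) (auto simp: nth_eq_iff_index_eq)
  qed
  obtain h where h: "lin h" "\<And>p. p < ?n \<Longrightarrow> h (?e p) =
      (if p \<in> A \<and> Suc (ix p) < length (L (hue (s p))) then ?e (L (hue (s p)) ! Suc (ix p)) else 0)"
    using lin_on_basis_list[of "\<lambda>p. if p \<in> A \<and> Suc (ix p) < length (L (hue (s p))) then ?e (L (hue (s p)) ! Suc (ix p)) else 0"]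
    by blast
  have An: "p < ?n" if "p \<in> A" for p using that j by (auto simp: A_def simp del: dim_UNIV)
  have "h (?e p) = 0 \<or> (\<exists>q<?n. p < q \<and> s q < s p \<and> h (?e p) = ?e q)" if p: "p < ?n" for p
  proof (cases "p \<in> A \<and> Suc (ix p) < length (L (hue (s p)))")
    case True
    let ?c = "hue (s p)"
    define q where "q = L ?c ! Suc (ix p)"
    have "p \<in> set (L ?c)" using True L(2) by auto
    then obtain t where t: "t < length (L ?c)" "L ?c ! t = p" by (metis in_set_conv_nth)
    then have "ix p = t" using ix(1)[OF t(1)] by simp
    then have "L ?c ! t < q"
      using sorted_wrt_nth_less[OF L(3)[of ?c], of t "Suc t"] True by (simp add: q_def)
    then have "p < q" using t(2) by simp
    moreover have "q \<in> A" "hue (s q) = ?c" using ix(2,3)[of "Suc (ix p)" ?c] True by (auto simp: q_def)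
    ultimately have "s q < s p" using dec[of p q] True by simp
    moreover have "h (?e p) = ?e q" using h(2)[OF p] True by (simp add: q_def)
    ultimately show ?thesis using \<open>p < q\<close> An[OF \<open>q \<in> A\<close>] by blast
  next
    case False
    have "h (?e p) = 0" unfolding h(2)[OF p] using False by (rule if_not_P)
    then show ?thesis by blast
  qed
  note strict = strict_on_std_opp[OF h(1) this]
  have pow: "(h ^^ u) (?e (L c ! t)) = ?e (L c ! (t + u))" if "t + u < length (L c)" for c t u
    using that
  proof (induction u)
    case (Suc u)
    let ?p = "L c ! (t + u)"
    have lt: "t + u < length (L c)" using Suc.prems by simp
    have "h (?e ?p) = ?e (L c ! Suc (t + u))"
      using h(2)[OF An[OF ix(3)[OF lt]]] ix[OF lt] Suc.prems by simp
    then show ?case using Suc by simp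
  qed simp
  \<comment> \<open>\<open>X\<close> omits the first \<open>m\<close> members of each of the
    \<open>k\<close> chains, so at most \<open>m * k\<close> of the \<open>m * k + tails\<close>
    members in total. What remains lies in the image of \<open>h ^^ m\<close>.\<close>
  define X where "X = (\<Union>c<k. set (drop m (L c)))"
  define Z where "Z = (\<Union>c<k. set (take m (L c)))"
  have "A \<subseteq> X \<union> Z"
  proof
    fix p assume p: "p \<in> A"
    then have "p \<in> set (L (hue (s p)))" "hue (s p) < k" using L(2) by (auto simp: A_def)
    then show "p \<in> X \<union> Z" unfolding X_def Z_def by (metis UN_I UnCI UnE append_take_drop_id lessThan_iff set_append)
  qed
  moreover have "card Z \<le> k * m"
  proof -
    have "card Z \<le> (\<Sum>c<k. card (set (take m (L c))))" unfolding Z_def by (rule card_UN_le) simp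
    also have "\<dots> \<le> (\<Sum>c<k. m)" by (intro sum_mono order_trans[OF card_length]) simp
    finally show ?thesis by simp
  qed
  moreover have "finite X" "finite Z" by (auto simp: X_def Z_def)
  ultimately have "card A \<le> card X + k * m"
    using card_mono[of "X \<union> Z" A] card_Un_le[of X Z] by simp
  then have cardX: "tails (RS_shapes s i j) m \<le> card X" using cardA by (simp add: mult.commute)
  have XA: "X \<subseteq> A" using L(2) by (auto simp: X_def dest: in_set_dropD)
  have eX: "?e ` X \<subseteq> (h ^^ m) ` std_flag s i"
  proof
    fix x assume "x \<in> ?e ` X"
    then obtain c p where c: "p \<in> set (drop m (L c))" "x = ?e p" by (auto simp: X_def)
    then obtain t where t: "t < length (drop m (L c))" "p = drop m (L c) ! t" by (metis in_set_conv_nth)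
    then have t': "t + m < length (L c)" "p = L c ! (t + m)" by (auto simp: add.commute)
    have "x = (h ^^ m) (?e (L c ! t))" using pow[OF t'(1)] c(2) t'(2) by simp
    moreover have "L c ! t \<in> A" using ix(3)[of t c] t'(1) by simp
    then have "?e (L c ! t) \<in> std_flag s i"
      unfolding std_flag_def using An by (intro span_base imageI) (auto simp: A_def)
    ultimately show "x \<in> (h ^^ m) ` std_flag s i" by blast
  qed
  \<comment> \<open>Positions in \<open>X\<close> are below \<open>j\<close>, so they are disjoint
    from those spanning the member of the opposite flag and add to its dimension.\<close>
  have "card X + (?n - j) = card (X \<union> {j..<?n})"
    using XA \<open>finite X\<close> by (subst card_Un_disjoint) (auto simp: A_def)
  also have "\<dots> = dim (?e ` (X \<union> {j..<?n}))"
    using XA An by (intro basis_seq_dim[OF basis_seq_basis_list, symmetric]) auto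
  also have "\<dots> \<le> dim ((h ^^ m) ` std_flag s i \<union> opp_flag (?n - j))"
  proof (rule dim_subset)
    have "?e ` {j..<?n} \<subseteq> opp_flag (?n - j)" unfolding opp_flag_def using j span_superset by (simp del: dim_UNIV)
    then show "?e ` (X \<union> {j..<?n}) \<subseteq> (h ^^ m) ` std_flag s i \<union> opp_flag (?n - j)" using eX by (auto simp del: dim_UNIV)
  qed
  finally have "tails (RS_shapes s i j) m \<le> pair_rank h (std_flag s) opp_flag m i j"
    using cardX unfolding pair_rank[OF opp_flag_complete] by linarith
  then show ?thesis using h(1) strict by blast
qed

lemma RS_length_le: "length (fst (RS j s)) \<le> j"
proof (induction j)
  case (Suc j)
  then show ?case using schensted_insert_length[of "s j" "fst (RS j s)"] by (simp add: RS_Suc)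
qed simp

lemma tails_RS_shapes_large:
  assumes "j \<le> m"
  shows "tails (RS_shapes s i j) m = 0"
proof -
  have "RS_shapes s i j r = 0" if "j \<le> r" for r
    using RS_length_le[of j s] that by (simp add: RS_shapes_def shape_def)
  from tails_eq_sum[OF this] show ?thesis using assms by simp
qed

lemma pair_rank_0:
  assumes f: "f \<in> complete_flags" and f': "f' \<in> complete_flags" and i: "i \<le> dim UNIV" and j: "j \<le> dim UNIV"
  shows "pair_rank h f f' 0 i j + dim (f i \<inter> f' (dim UNIV - j)) = i"
  using pair_rank[OF f', where h = h and m = 0 and f = f and i = i and j = j] dim_Un_Int[OF complete_flagD(3)[OF f] complete_flagD(3)[OF f'], of i "dim UNIV - j"]
    complete_flagD(5)[OF f i] complete_flagD(5)[OF f', of "dim UNIV - j"] by (simp del: dim_UNIV)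

text \<open>\<open>chain_map_exists\<close> reaches the bound for one triple at a time and
  \<open>generic_pair_rank\<close> for finitely many at once. The converse bound comes from
  \<open>octahedron_forward\<close>, whose edges are computed directly from the coordinate
  flags.\<close>

lemma growth_map_exists:
  assumes inf: "infinite (UNIV :: 'a set)" and s: "s permutes {..<dim UNIV}"
  shows "\<exists>h. lin h \<and> strict_on h (std_flag s) \<and> strict_on h opp_flag \<and>
    (\<forall>i\<le>dim UNIV. \<forall>j\<le>dim UNIV. \<forall>m. pair_rank h (std_flag s) opp_flag m i j = tails (RS_shapes s i j) m)"
proof -
  let ?n = "dim UNIV"
  \<comment> \<open>Powers beyond \<open>dim UNIV\<close> would make infinitely many conditions; for
    them the tail sums vanish.\<close>
  define T where "T = {..?n} \<times> {..?n} \<times> {..?n}"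
  have finT: "finite T" by (simp add: T_def)
  have T: "(m, i, j) \<in> T \<longleftrightarrow> m \<le> ?n \<and> i \<le> ?n \<and> j \<le> ?n" for m i j by (simp add: T_def)
  note std = std_flag_complete[OF s]
  have "\<exists>h. lin h \<and> strict_on h (std_flag s) \<and> strict_on h opp_flag \<and>
      (\<forall>(m, i, j)\<in>T. tails (RS_shapes s i j) m \<le> pair_rank h (std_flag s) opp_flag m i j)"
    by (rule generic_pair_rank[OF inf std opp_flag_complete finT, of "\<lambda>m i j. tails (RS_shapes s i j) m"])
      (use T chain_map_exists[OF s] in auto)
  then obtain h where h: "lin h" "strict_on h (std_flag s)" "strict_on h opp_flag"
    and geT: "\<And>m i j. m \<le> ?n \<Longrightarrow> i \<le> ?n \<Longrightarrow> j \<le> ?n \<Longrightarrow> tails (RS_shapes s i j) m \<le> pair_rank h (std_flag s) opp_flag m i j"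
    using T by fastforce
  have ge: "tails (RS_shapes s i j) m \<le> pair_rank h (std_flag s) opp_flag m i j" if "i \<le> ?n" "j \<le> ?n" for m i j
  proof (cases "m \<le> ?n")
    case True
    then show ?thesis using geT that by blast
  next
    case False
    then show ?thesis using tails_RS_shapes_large[of j m s i] that by (simp del: dim_UNIV)
  qed
  have injs: "inj_on s B" for B using permutes_inj_on[OF s] .
  have "pair_rank h (std_flag s) opp_flag m i j = tails (RS_shapes s i j) m" if "i \<le> ?n" "j \<le> ?n" for m i j
  proof (rule octahedron_forward[of ?n "\<lambda>m i j. tails (RS_shapes s i j) m" "pair_rank h (std_flag s) opp_flag", OF ge])
    fix m j assume "j \<le> ?n"
    have "(h ^^ m) ` {0} \<subseteq> {0}" using lin_zero_stable[OF lin_funpow[OF h(1)]] .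
    then have "dim ((h ^^ m) ` std_flag s 0 \<union> opp_flag (?n - j)) = dim (opp_flag (?n - j))"
      using complete_flagD(1)[OF std] subspace_0[OF complete_flagD(3)[OF opp_flag_complete], of "?n - j"]
      by (intro arg_cong[of _ _ dim]) (auto simp del: dim_UNIV)
    then show "pair_rank h (std_flag s) opp_flag m 0 j = tails (RS_shapes s 0 j) m"
      using complete_flagD(5)[OF opp_flag_complete, of "?n - j"] by (simp add: pair_rank_def tails_def del: dim_UNIV)
  next
    fix m i assume "i \<le> ?n"
    have "(h ^^ m) ` std_flag s i \<union> opp_flag ?n = UNIV" using complete_flagD(2)[OF opp_flag_complete] by blast
    then show "pair_rank h (std_flag s) opp_flag m i 0 = tails (RS_shapes s i 0) m"
      by (simp add: pair_rank_def tails_def del: dim_UNIV)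
  next
    fix i j assume ij: "i \<le> ?n" "j \<le> ?n"
    have "dim (std_flag s i \<union> opp_flag (?n - j)) = dim ((!) basis_list ` ({p. p < ?n \<and> s p < i} \<union> {j..<?n}))"
      using dim_image_span_Un[OF linear_id, of "(!) basis_list ` {p. p < ?n \<and> s p < i}" "(!) basis_list ` {j..<?n}"] ij
      by (simp add: std_flag_def opp_flag_def image_Un del: dim_UNIV)
    also have "\<dots> = card ({p. p < ?n \<and> s p < i} \<union> {j..<?n})"
      by (rule basis_seq_dim[OF basis_seq_basis_list]) (auto simp del: dim_UNIV)
    also have "{p. p < ?n \<and> s p < i} \<union> {j..<?n} = {p. p < j \<and> s p < i} \<union> {j..<?n}" using ij by auto
    also have "card \<dots> = card {p. p < j \<and> s p < i} + (?n - j)" by (subst card_Un_disjoint) (auto simp del: dim_UNIV)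
    finally show "pair_rank h (std_flag s) opp_flag 0 i j = tails (RS_shapes s i j) 0"
      unfolding tails_RS_shapes_0[OF injs] by (simp add: pair_rank_def del: dim_UNIV)
  next
    fix m i j assume "i < ?n" "j < ?n"
    then show "pair_rank h (std_flag s) opp_flag m i j + pair_rank h (std_flag s) opp_flag (Suc m) (Suc i) (Suc j)
        \<le> pair_rank h (std_flag s) opp_flag m i (Suc j) + pair_rank h (std_flag s) opp_flag (Suc m) (Suc i) j"
      "pair_rank h (std_flag s) opp_flag m i j + pair_rank h (std_flag s) opp_flag (Suc m) (Suc i) (Suc j)
        \<le> pair_rank h (std_flag s) opp_flag (Suc m) i (Suc j) + pair_rank h (std_flag s) opp_flag m (Suc i) j"
      using pair_rank_inequalities[OF h(1) std h(2) opp_flag_complete h(3)] by blast+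
    show "min (tails (RS_shapes s i (Suc j)) m + tails (RS_shapes s (Suc i) j) (Suc m))
        (tails (RS_shapes s i (Suc j)) (Suc m) + tails (RS_shapes s (Suc i) j) m)
      \<le> tails (RS_shapes s i j) m + tails (RS_shapes s (Suc i) (Suc j)) (Suc m)"
      by (rule RS_shapes_octahedron[OF injs])
  qed (use that in auto)
  then show ?thesis using h by blast
qed

text \<open>A linear map that matches the two Jordan bases box by box commutes with the shifts along
  the strings, and it is onto, hence injective.\<close>

lemma conjugate_exists:
  assumes h: "lin h" and h': "lin h'" and l: "is_partition l"
    and v: "jordan_basis h UNIV {0} l v" and v': "jordan_basis h' UNIV {0} l v'"
  shows "\<exists>g. lin g \<and> inj g \<and> (\<forall>x. g (h x) = h' (g x))"
proof -
  let ?Y = "young_diagram l"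
  let ?b = "\<lambda>(i, j). (h ^^ j) (v i)" and ?b' = "\<lambda>(i, j). (h' ^^ j) (v' i)"
  have fin: "finite ?Y" by (rule finite_young_diagram[OF l])
  have qb: "UNIV \<subseteq> span (b ` ?Y \<union> {0})" "dim UNIV = card ?Y"
    if "quotient_basis UNIV {0} ?Y b" for b :: "nat \<times> nat \<Rightarrow> 'b"
    using that quotient_basis_iff[OF fin subspace_UNIV subspace_single_0 subset_UNIV, of b] by auto
  have span: "span (b ` ?Y) = UNIV" if "quotient_basis UNIV {0} ?Y b" for b :: "nat \<times> nat \<Rightarrow> 'b"
  proof -
    have "span (b ` ?Y \<union> {0}) \<subseteq> span (b ` ?Y)" by (intro span_minimal) (auto intro: span_base span_zero)
    then show ?thesis using qb(1)[OF that] by blast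
  qed
  have b: "quotient_basis UNIV {0} ?Y ?b" "\<And>i. l i \<noteq> 0 \<Longrightarrow> (h ^^ l i) (v i) = 0"
    and b': "quotient_basis UNIV {0} ?Y ?b'" "\<And>i. l i \<noteq> 0 \<Longrightarrow> (h' ^^ l i) (v' i) = 0"
    using v v' by (auto simp: jordan_basis_def)
  let ?B = "?b ` ?Y"
  have "dim ?B = dim UNIV" using span[OF b(1)] by (metis dim_span)
  moreover have "dim ?B \<le> card ?B" using fin by (intro dim_le_card') simp
  moreover have "card ?B \<le> card ?Y" by (rule card_image_le[OF fin])
  ultimately have card: "card ?B = card ?Y" "card ?B \<le> dim ?B" using qb(2)[OF b(1)] by linarith+
  have inj: "inj_on ?b ?Y" using card(1) by (intro eq_card_imp_inj_on[OF fin])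
  have ind: "independent ?B" by (rule card_le_dim_spanning[of ?B ?B]) (use card(2) fin span_superset in auto)
  obtain g where g: "lin g" "\<forall>x\<in>?B. g x = ?b' (the_inv_into ?Y ?b x)"
    using self.linear_independent_extend[OF ind, of "\<lambda>x. ?b' (the_inv_into ?Y ?b x)"] by blast
  have gb: "g (?b p) = ?b' p" if "p \<in> ?Y" for p using g(2) that the_inv_into_f_f[OF inj that] by auto
  have comm: "g (h x) = h' (g x)" for x
  proof -
    have "g (h y) = h' (g y)" if "y \<in> ?B" for y
    proof -
      obtain i j where ij: "(i, j) \<in> ?Y" "y = (h ^^ j) (v i)" using \<open>y \<in> ?B\<close> by auto
      have gy: "g y = (h' ^^ j) (v' i)" using gb[OF ij(1)] ij(2) by simp
      have li: "j < l i" "l i \<noteq> 0" using ij(1) by (auto simp: young_diagram_def)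
      show ?thesis
      proof (cases "Suc j < l i")
        case True
        then have "(i, Suc j) \<in> ?Y" by (simp add: young_diagram_def)
        from gb[OF this] show ?thesis using gy ij(2) by simp
      next
        case False
        then have "Suc j = l i" using li by simp
        then have "h y = 0" "h' (g y) = 0" using b(2)[OF li(2)] b'(2)[OF li(2)] gy ij(2) by (auto simp flip: \<open>Suc j = l i\<close>)
        then show ?thesis using self.linear_0[OF g(1)] by simp
      qed
    qed
    moreover have "x \<in> span ?B" using span[OF b(1)] by simp
    ultimately show ?thesis
      using self.linear_eq_on[of "\<lambda>x. g (h x)" "\<lambda>x. h' (g x)" x ?B] lin_compose[OF h g(1)] lin_compose[OF g(1) h'] by blast
  qed
  have "g ` UNIV = span (g ` ?B)" using self.linear_span_image[OF g(1), of ?B] span[OF b(1)] by simp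
  also have "g ` ?B = ?b' ` ?Y" unfolding image_image using gb by (intro image_cong) auto
  finally have "g ` UNIV = UNIV" using span[OF b'(1)] by simp
  then have "inj g" using dim_image_inj_on[OF g(1) subspace_UNIV] by simp
  then show ?thesis using g(1) comm by blast
qed

lemma transport_pair:
  assumes h: "lin h" and g: "lin g" "inj g" "\<And>x. g (h x) = h' (g x)"
    and f: "f \<in> complete_flags" "strict_on h f" and f': "f' \<in> complete_flags" "strict_on h f'"
  shows "(\<lambda>i. g ` f i) \<in> complete_flags" "strict_on h' (\<lambda>i. g ` f i)"
    "pair_rank h' (\<lambda>i. g ` f i) (\<lambda>i. g ` f' i) m i j = pair_rank h f f' m i j"
proof -
  note F = complete_flagD[OF f(1)]
  have dimg: "dim (g ` S) = dim S" for S by (rule inj_on_dim_image[OF g(1) subspace_UNIV g(2)]) simp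
  show "(\<lambda>i. g ` f i) \<in> complete_flags"
  proof (rule complete_flagI)
    show "subspace (g ` f i)" for i by (intro lin_subspace_image g F)
    show "g ` f i \<subseteq> g ` f (Suc i)" for i using F(4) by (rule image_mono)
    show "dim (g ` f i) = i" if "i \<le> dim UNIV" for i unfolding dimg by (rule F(5)[OF that])
  qed
  show "strict_on h' (\<lambda>i. g ` f i)"
    using f(2) g(3) unfolding strict_on_def by (metis (no_types, lifting) image_cong image_image image_mono)
  have "(h' ^^ m) (g x) = g ((h ^^ m) x)" for m x by (induction m) (auto simp: g(3))
  then have "(h' ^^ m) ` g ` f i \<union> g ` f' (dim UNIV - j) = g ` ((h ^^ m) ` f i \<union> f' (dim UNIV - j))"
    by (simp add: image_Un image_image)
  then show "pair_rank h' (\<lambda>i. g ` f i) (\<lambda>i. g ` f' i) m i j = pair_rank h f f' m i j"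
    unfolding pair_rank_def using dimg by metis
qed

section \<open>Relative position\<close>

lemma dim_Int_basis_spans:
  assumes e: "basis_seq e" and A: "A \<subseteq> {..<dim UNIV}" and B: "B \<subseteq> {..<dim UNIV}"
  shows "dim (span (e ` A) \<inter> span (e ` B)) = card (A \<inter> B)"
proof -
  have fin: "finite A" "finite B" using A B finite_subset by blast+
  have "dim (span (e ` A) \<union> span (e ` B)) = dim (e ` (A \<union> B))"
    using dim_image_span_Un[OF linear_id, of "e ` A" "e ` B"] by (simp add: image_Un)
  also have "\<dots> = card (A \<union> B)" using A B by (intro basis_seq_dim[OF e]) auto
  finally show ?thesis
    using dim_Un_Int[OF subspace_span subspace_span, of "e ` A" "e ` B"] basis_seq_dim[OF e A] basis_seq_dim[OF e B]
      card_Un_Int[OF fin] by simp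
qed

text \<open>Relative position is encoded in the dimensions of intersections. For existence, pick for
  each \<open>b\<close> a vector at the place where a row and a column of this table jump together;
  for uniqueness, second differences of the table recover the permutation.\<close>

lemma relative_position_eqI:
  assumes f: "f \<in> complete_flags" and f': "f' \<in> complete_flags" and s: "s permutes {..<dim UNIV}"
    and dims: "\<And>i k. i \<le> dim UNIV \<Longrightarrow> k \<le> dim UNIV \<Longrightarrow> dim (f i \<inter> f' k) = card {b. b < k \<and> s b < i}"
  shows "relative_position f f' = s"
  unfolding relative_position_def
proof (rule the_equality)
  let ?n = "dim UNIV"
  note F = complete_flagD[OF f] and F' = complete_flagD[OF f']
  have sn: "s b < ?n" if "b < ?n" for b using permutes_in_image[OF s, of b] that by simp
  \<comment> \<open>The intersection grows when both indices increase but for neither increase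
    alone, since (b, s b) is the only point of the permutation in its row and column. A vector in
    the increment avoids both smaller members.\<close>
  have "\<exists>x. x \<in> f (Suc (s b)) \<and> x \<in> f' (Suc b) \<and> x \<notin> f (s b) \<and> x \<notin> f' b" if b: "b < ?n" for b
  proof -
    let ?a = "s b"
    have a: "?a < ?n" using sn b by blast
    have e1: "{b'. b' < Suc b \<and> s b' < Suc ?a} = insert b {b'. b' < b \<and> s b' < ?a}"
      and e2: "{b'. b' < b \<and> s b' < Suc ?a} = {b'. b' < b \<and> s b' < ?a}"
      and e3: "{b'. b' < Suc b \<and> s b' < ?a} = {b'. b' < b \<and> s b' < ?a}"
      using injD[OF permutes_inj[OF s]] by (auto simp: less_Suc_eq)
    have c: "card (insert b {b'. b' < b \<and> s b' < ?a}) = Suc (card {b'. b' < b \<and> s b' < ?a})" by simp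
    have d: "dim (f (Suc ?a) \<inter> f' (Suc b)) = Suc (dim (f ?a \<inter> f' b))"
      "dim (f (Suc ?a) \<inter> f' b) = dim (f ?a \<inter> f' b)" "dim (f ?a \<inter> f' (Suc b)) = dim (f ?a \<inter> f' b)"
      using dims[of "Suc ?a" "Suc b"] dims[of ?a b] dims[of "Suc ?a" b] dims[of ?a "Suc b"] a b c
      unfolding e1 e2 e3 by (simp_all del: dim_UNIV)
    have sub: "subspace (f i \<inter> f' k)" for i k using F(3) F'(3) by (rule subspace_inter)
    have "f ?a \<inter> f' b = f (Suc ?a) \<inter> f' b" "f ?a \<inter> f' b = f ?a \<inter> f' (Suc b)"
      using subspace_dim_equal[OF sub sub, of ?a b "Suc ?a" b] subspace_dim_equal[OF sub sub, of ?a b ?a "Suc b"]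
        d F(4)[of ?a] F'(4)[of b] by auto
    moreover have "\<not> f (Suc ?a) \<inter> f' (Suc b) \<subseteq> f ?a \<inter> f' b"
    proof
      assume "f (Suc ?a) \<inter> f' (Suc b) \<subseteq> f ?a \<inter> f' b"
      then have "dim (f (Suc ?a) \<inter> f' (Suc b)) \<le> dim (f ?a \<inter> f' b)" by (rule dim_subset)
      then show False using d(1) by simp
    qed
    ultimately show ?thesis by blast
  qed
  then obtain x where x: "\<And>b. b < ?n \<Longrightarrow> x b \<in> f (Suc (s b)) \<and> x b \<in> f' (Suc b) \<and> x b \<notin> f (s b) \<and> x b \<notin> f' b" by metis
  define e where "e a = x (inv_into UNIV s a)" for a
  have es: "e (s b) = x b" for b unfolding e_def using permutes_inj[OF s] by simp
  have "e a \<in> f (Suc a) \<and> e a \<notin> f a" if "a < ?n" for a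
  proof -
    have "a \<in> s ` {..<?n}" unfolding permutes_image[OF s] using that by simp
    then obtain b where b: "b < ?n" "a = s b" by auto
    then show ?thesis using x[OF b(1)] es by simp
  qed
  then have "basis_seq e" "adapted f e" using adaptedI[OF f, of e] by blast+
  moreover have "adapted f' (e \<circ> s)" using adaptedI[OF f', of "e \<circ> s"] x es by simp
  ultimately show "s permutes {..<?n} \<and> (\<exists>e. basis_seq e \<and> adapted f e \<and> adapted f' (e \<circ> s))" using s by blast
next
  let ?n = "dim UNIV"
  fix s' assume "s' permutes {..<?n} \<and> (\<exists>e. basis_seq e \<and> adapted f e \<and> adapted f' (e \<circ> s'))"
  then obtain e where s': "s' permutes {..<?n}" and e: "basis_seq e" "adapted f e" "adapted f' (e \<circ> s')" by blast
  have dims': "dim (f i \<inter> f' k) = card {b. b < k \<and> s' b < i}" if ik: "i \<le> ?n" "k \<le> ?n" for i k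
  proof -
    have fi: "f i = span (e ` {..<i})" "f' k = span (e ` s' ` {..<k})"
      using e(2,3) ik by (auto simp: adapted_def image_comp simp del: dim_UNIV)
    have "s' ` {..<k} \<subseteq> s' ` {..<?n}" using ik by (intro image_mono) auto
    then have "s' ` {..<k} \<subseteq> {..<?n}" using permutes_image[OF s'] by blast
    then have "dim (f i \<inter> f' k) = card ({..<i} \<inter> s' ` {..<k})"
      unfolding fi using ik by (intro dim_Int_basis_spans[OF e(1)]) auto
    also have "{..<i} \<inter> s' ` {..<k} = s' ` {b. b < k \<and> s' b < i}" by auto
    also have "card \<dots> = card {b. b < k \<and> s' b < i}" by (rule card_image[OF permutes_inj_on[OF s']])
    finally show ?thesis .
  qed
  show "s' = s"
  proof
    fix b show "s' b = s b"
    proof (cases "b < ?n")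
      case True
      have split: "card {b'. b' < Suc b \<and> u b' < i} = card {b'. b' < b \<and> u b' < i} + (if u b < i then 1 else 0)" for u :: "nat \<Rightarrow> nat" and i
      proof -
        have "{b'. b' < Suc b \<and> u b' < i} = {b'. b' < b \<and> u b' < i} \<union> (if u b < i then {b} else {})"
          by (auto simp: less_Suc_eq)
        then show ?thesis by simp
      qed
      \<comment> \<open>The increment from \<open>b\<close> to \<open>Suc b\<close> of the count
        tells whether the value at \<open>b\<close> is below \<open>i\<close>.\<close>
      have iff: "s' b < i \<longleftrightarrow> s b < i" if "i \<le> ?n" for i
        using dims[OF that, of "Suc b"] dims'[OF that, of "Suc b"] dims[OF that, of b] dims'[OF that, of b] True
          split[of s i] split[of s' i] by (auto split: if_splits simp del: dim_UNIV)
      have "s b < ?n" "s' b < ?n" using permutes_in_image[OF s, of b] permutes_in_image[OF s', of b] True by auto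
      then show ?thesis using iff[of "Suc (s b)"] iff[of "Suc (s' b)"] by (simp del: dim_UNIV)
    next
      case False
      then show ?thesis using permutes_not_in[OF s, of b] permutes_not_in[OF s', of b] by simp
    qed
  qed
qed

end

section \<open>The generic pair of flags\<close>

context finite_dimensional_vector_space
begin

text \<open>The edge \<open>j = n\<close> is the restriction of the final insertion tableau. On the
  edge \<open>i = n\<close> nothing is cut off, and the shapes are those remembered by the recording
  tableau.\<close>

lemma RS_edges:
  assumes P: "P \<in> SYT l" and Q: "Q \<in> SYT l" and s: "s permutes {..<n}"
    and RS: "(List.transpose P, List.transpose Q) = RS n s"
  shows "RS_shapes s i n = ptranspose (shape (restrict_tableau i P))"
    "j \<le> n \<Longrightarrow> RS_shapes s n j = ptranspose (shape (restrict_tableau j Q))"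
proof -
  have rows: "\<forall>r\<in>set P. sorted_wrt (<) r" "\<forall>r\<in>set Q. sorted_wrt (<) r" using P Q by (auto simp: SYT_def)
  have RSP: "fst (RS n s) = List.transpose P" "snd (RS n s) = List.transpose Q" by (simp_all add: RS[symmetric])
  show "RS_shapes s i n = ptranspose (shape (restrict_tableau i P))"
    unfolding RS_shapes_def RSP by (rule shape_restrict_transpose[OF rows(1)])
  assume j: "j \<le> n"
  have "set (concat (fst (RS j s))) = s ` {..<j}" using RS_tableau[OF permutes_inj_on[OF s]] by blast
  moreover have "s ` {..<j} \<subseteq> s ` {..<n}" using j by (intro image_mono) auto
  ultimately have "set (concat (fst (RS j s))) \<subseteq> {..<n}" using permutes_image[OF s] by simp
  then have "RS_shapes s n j = shape (fst (RS j s))" unfolding RS_shapes_def by (simp only: restrict_tableau_all)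
  also have "\<dots> = shape (restrict_tableau j (snd (RS n s)))" using RS_recording[of n s] j by simp
  also have "\<dots> = ptranspose (shape (restrict_tableau j Q))" unfolding RSP by (rule shape_restrict_transpose[OF rows(2)])
  finally show "RS_shapes s n j = ptranspose (shape (restrict_tableau j Q))" .
qed

lemma r_flags_rank_iff:
  assumes h: "lin h" "nilpotent h" and P: "P \<in> SYT (jordan_type h UNIV {0})"
  shows "f \<in> r_flags h P \<longleftrightarrow> f \<in> stable_flags h \<and>
    (\<forall>i\<le>dim UNIV. \<forall>m. dim ((h ^^ m) ` f i) = tails (ptranspose (shape (restrict_tableau i P))) m)"
proof (cases "f \<in> stable_flags h")
  case True
  note S = stable_flag_stable[OF True]
  note F = complete_flagD[OF S(1)]
  have "jordan_type h (f i) {0} = shape (restrict_tableau i P) \<longleftrightarrow>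
      (\<forall>m. dim ((h ^^ m) ` f i) = tails (ptranspose (shape (restrict_tableau i P))) m)" for i
    using jordan_type_eq_iff_rank[OF h subspace_single_0 lin_zero_stable[OF h(1)] F(3) S(2) _ SYT_restrict_partition[OF P], of i i]
      subspace_0[OF F(3), of i] by (simp add: dim_insert span_zero)
  then show ?thesis using r_flags_iff[OF h P, of f] True by auto
qed (simp add: r_flags_iff[OF h P])

lemma q_flags_rank_iff:
  assumes h: "lin h" "nilpotent h" and Q: "Q \<in> SYT (jordan_type h UNIV {0})"
  shows "f \<in> q_flags h Q \<longleftrightarrow> f \<in> stable_flags h \<and>
    (\<forall>i\<le>dim UNIV. \<forall>m. dim ((h ^^ m) ` UNIV \<union> f i) = i + tails (ptranspose (shape (restrict_tableau (dim UNIV - i) Q))) m)"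
proof (cases "f \<in> stable_flags h")
  case True
  note S = stable_flag_stable[OF True]
  note F = complete_flagD[OF S(1)]
  have "jordan_type h UNIV (f i) = shape (restrict_tableau (dim UNIV - i) Q) \<longleftrightarrow>
      (\<forall>m. dim ((h ^^ m) ` UNIV \<union> f i) = i + tails (ptranspose (shape (restrict_tableau (dim UNIV - i) Q))) m)"
    if "i \<le> dim UNIV" for i
    using jordan_type_eq_iff_rank[OF h F(3) S(2) subspace_UNIV subset_UNIV subset_UNIV SYT_restrict_partition[OF Q], of i "dim UNIV - i"]
      F(5)[OF that] by (simp del: dim_UNIV)
  then show ?thesis using q_flags_iff[OF h Q, of f] True by auto
qed (simp add: q_flags_iff[OF h Q])

lemma pair_rank_edge_r:
  assumes "f' \<in> complete_flags"
  shows "pair_rank h f f' m i (dim UNIV) = dim ((h ^^ m) ` f i)"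
  using complete_flagD(1)[OF assms] by (simp add: pair_rank_def dim_insert span_zero)

lemma pair_rank_edge_q:
  assumes "f \<in> complete_flags" "f' \<in> complete_flags" "j \<le> dim UNIV"
  shows "dim ((h ^^ m) ` UNIV \<union> f' (dim UNIV - j)) = pair_rank h f f' m (dim UNIV) j + (dim UNIV - j)"
  using pair_rank[OF assms(2), where h = h and m = m and f = f and i = "dim UNIV" and j = j] complete_flagD(2)[OF assms(1)]
  by (simp del: dim_UNIV)

text \<open>The model map has the ranks of the growth diagram; its corner \<open>i = j = n\<close>
  shows that it has the Jordan type of \<open>h\<close>. Conjugating the coordinate flags to
  \<open>h\<close> preserves all ranks, and the edges identify \<open>P\<close> and
  \<open>Q\<close>.\<close>

lemma growth_pair_exists:
  assumes inf: "infinite (UNIV :: 'a set)" and h: "lin h" "nilpotent h"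
    and P: "P \<in> SYT (jordan_type h UNIV {0})" and Q: "Q \<in> SYT (jordan_type h UNIV {0})"
    and s: "s permutes {..<dim UNIV}" and RS: "(List.transpose P, List.transpose Q) = RS (dim UNIV) s"
  shows "\<exists>f\<in>r_flags h P. \<exists>f'\<in>q_flags h Q. \<forall>i\<le>dim UNIV. \<forall>j\<le>dim UNIV. \<forall>m.
    pair_rank h f f' m i j = tails (RS_shapes s i j) m"
proof -
  let ?n = "dim UNIV" and ?l = "jordan_type h UNIV {0}"
  note edges = RS_edges[OF P Q s RS]
  note spec = jordan_type_spec[OF h subspace_single_0 lin_zero_stable[OF h(1)] subspace_UNIV subset_UNIV subset_UNIV]
  obtain h0 where h0: "lin h0" "strict_on h0 (std_flag s)" "strict_on h0 opp_flag"
    and r0: "\<And>i j m. i \<le> ?n \<Longrightarrow> j \<le> ?n \<Longrightarrow> pair_rank h0 (std_flag s) opp_flag m i j = tails (RS_shapes s i j) m"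
    using growth_map_exists[OF inf s] by blast
  note std = std_flag_complete[OF s]
  have nil0: "nilpotent h0" by (rule strict_on_stable(2)[OF std h0(1,2)])
  have "psize ?l = ?n" using spec(3)[of 0] psize_eq_tails_ptranspose[OF spec(1)] by (simp add: Un_absorb2)
  then have "set (concat P) \<subseteq> {..<?n}" "shape P = ?l" using P by (auto simp: SYT_def simp del: dim_UNIV)
  then have shP: "shape (restrict_tableau ?n P) = ?l" by (simp add: restrict_tableau_all del: dim_UNIV)
  have "jordan_type h0 UNIV {0} = ?l"
    unfolding jordan_type_eq_iff_rank[OF h0(1) nil0 subspace_single_0 lin_zero_stable[OF h0(1)] subspace_UNIV subset_UNIV subset_UNIV spec(1)]
  proof
    fix m
    have "dim ((h0 ^^ m) ` UNIV) = tails (RS_shapes s ?n ?n) m"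
      using r0[of ?n ?n m] pair_rank_edge_r[OF opp_flag_complete, where h = h0 and f = "std_flag s" and m = m and i = ?n] complete_flagD(2)[OF std]
      by (simp del: dim_UNIV)
    then show "dim ((h0 ^^ m) ` UNIV \<union> {0}) = dim {0} + tails (ptranspose ?l) m"
      unfolding edges(1) shP by (simp add: dim_insert span_zero)
  qed
  then obtain v0 where v0: "jordan_basis h0 UNIV {0} ?l v0"
    using jordan_type_spec(2)[OF h0(1) nil0 subspace_single_0 lin_zero_stable[OF h0(1)] subspace_UNIV subset_UNIV subset_UNIV] by auto
  obtain v where v: "jordan_basis h UNIV {0} ?l v" using spec(2) by blast
  obtain g where g: "lin g" "inj g" "\<And>x. g (h0 x) = h (g x)"
    using conjugate_exists[OF h0(1) h(1) spec(1) v0 v] by blast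
  define f where "f i = g ` std_flag s i" for i
  define f' where "f' i = g ` opp_flag i" for i
  note tr = transport_pair[OF h0(1) g std h0(2) opp_flag_complete h0(3), folded f_def f'_def]
  note tr' = transport_pair[OF h0(1) g opp_flag_complete h0(3) std h0(2), folded f_def f'_def]
  have f: "f \<in> complete_flags" "strict_on h f" using tr(1,2) by (simp_all add: f_def[abs_def])
  have f': "f' \<in> complete_flags" "strict_on h f'" using tr'(1,2) by (simp_all add: f'_def[abs_def])
  have r: "pair_rank h f f' m i j = tails (RS_shapes s i j) m" if "i \<le> ?n" "j \<le> ?n" for i j m
    using tr(3)[of m i j] r0[OF that, of m] by (simp add: f_def[abs_def] f'_def[abs_def])
  have "f \<in> r_flags h P"
    unfolding r_flags_rank_iff[OF h P]
    using strict_on_stable(1)[OF f(1) h(1) f(2)] r[of _ ?n] pair_rank_edge_r[OF f'(1), where h = h and f = f] edges(1) by simp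
  moreover have "f' \<in> q_flags h Q"
    unfolding q_flags_rank_iff[OF h Q]
  proof (intro conjI allI impI)
    show "f' \<in> stable_flags h" by (rule strict_on_stable(1)[OF f'(1) h(1) f'(2)])
    fix i m assume i: "i \<le> ?n"
    then show "dim ((h ^^ m) ` UNIV \<union> f' i) = i + tails (ptranspose (shape (restrict_tableau (?n - i) Q))) m"
      using pair_rank_edge_q[OF f(1) f'(1), where j = "?n - i" and h = h and m = m] r[of ?n "?n - i" m] edges(2)[of "?n - i"] by (simp del: dim_UNIV)
  qed
  ultimately show ?thesis using r by blast
qed

text \<open>Membership in the two varieties fixes the edges \<open>i = n\<close> and
  \<open>j = n\<close>, from which \<open>octahedron_backward\<close> yields all ranks. They
  determine the transposed types, and the ranks for \<open>m = 0\<close> are dimensions of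
  intersections, hence the relative position.\<close>

lemma growth_pair_good:
  assumes h: "lin h" "nilpotent h"
    and P: "P \<in> SYT (jordan_type h UNIV {0})" and Q: "Q \<in> SYT (jordan_type h UNIV {0})"
    and s: "s permutes {..<dim UNIV}" and RS: "(List.transpose P, List.transpose Q) = RS (dim UNIV) s"
    and f: "f \<in> r_flags h P" and f': "f' \<in> q_flags h Q"
    and ge: "\<And>i j m. i \<le> dim UNIV \<Longrightarrow> j \<le> dim UNIV \<Longrightarrow> tails (RS_shapes s i j) m \<le> pair_rank h f f' m i j"
  shows "type_RSt (dim UNIV) (\<lambda>i j. jordan_type h (f i) (f i \<inter> f' (dim UNIV - j)))"
    "relative_position f f' \<circ> reversal (dim UNIV) = s"
proof -
  let ?n = "dim UNIV" and ?J = "\<lambda>i j. jordan_type h (f i) (f i \<inter> f' (dim UNIV - j))"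
  note edges = RS_edges[OF P Q s RS]
  have st: "f \<in> stable_flags h" "f' \<in> stable_flags h"
    and rf: "\<And>i m. i \<le> ?n \<Longrightarrow> dim ((h ^^ m) ` f i) = tails (ptranspose (shape (restrict_tableau i P))) m"
    and qf: "\<And>i m. i \<le> ?n \<Longrightarrow> dim ((h ^^ m) ` UNIV \<union> f' i) = i + tails (ptranspose (shape (restrict_tableau (?n - i) Q))) m"
    using f f' r_flags_rank_iff[OF h P] q_flags_rank_iff[OF h Q] by blast+
  note S = stable_flag_stable[OF st(1)] and S' = stable_flag_stable[OF st(2)]
  note F = complete_flagD[OF S(1)] and F' = complete_flagD[OF S'(1)]
  have str: "strict_on h f" "strict_on h f'"
    using stable_flag_strict[OF st(1) h] stable_flag_strict[OF st(2) h] by (auto simp: strict_on_def)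
  have injs: "inj_on s B" for B using permutes_inj_on[OF s] .
  have r: "pair_rank h f f' m i j = tails (RS_shapes s i j) m" if "i \<le> ?n" "j \<le> ?n" for i j m
  proof (rule octahedron_backward[of ?n "\<lambda>m i j. tails (RS_shapes s i j) m" "pair_rank h f f'", OF ge])
    fix m j assume j: "j \<le> ?n"
    show "pair_rank h f f' m ?n j = tails (RS_shapes s ?n j) m"
      using qf[of "?n - j" m] pair_rank_edge_q[OF S(1) S'(1) j, where h = h and m = m] j edges(2)[OF j] by (simp del: dim_UNIV)
  next
    fix m i assume i: "i \<le> ?n"
    show "pair_rank h f f' m i ?n = tails (RS_shapes s i ?n) m"
      using rf[OF i, of m] pair_rank_edge_r[OF S'(1), where h = h and f = f and m = m and i = i] edges(1) by (simp del: dim_UNIV)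
  next
    fix m i j assume "i < ?n" "j < ?n"
    then show "pair_rank h f f' m i j + pair_rank h f f' (Suc m) (Suc i) (Suc j)
        \<le> pair_rank h f f' m i (Suc j) + pair_rank h f f' (Suc m) (Suc i) j"
      "pair_rank h f f' m i j + pair_rank h f f' (Suc m) (Suc i) (Suc j)
        \<le> pair_rank h f f' (Suc m) i (Suc j) + pair_rank h f f' m (Suc i) j"
      using pair_rank_inequalities[OF h(1) S(1) str(1) S'(1) str(2)] by blast+
    show "min (tails (RS_shapes s i (Suc j)) m + tails (RS_shapes s (Suc i) j) (Suc m))
        (tails (RS_shapes s i (Suc j)) (Suc m) + tails (RS_shapes s (Suc i) j) m)
      \<le> tails (RS_shapes s i j) m + tails (RS_shapes s (Suc i) (Suc j)) (Suc m)"
      by (rule RS_shapes_octahedron[OF injs])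
  qed (use that in auto)
  have part: "is_partition (?J i j)" for i j
    by (rule jordan_type_spec(1)[OF h subspace_inter[OF F(3) F'(3)] _ F(3) S(2) Int_lower1]) (use S(2)[of i] S'(2)[of "?n - j"] in blast)
  \<comment> \<open>Tail sums of the transposed type are the ranks; their consecutive differences
    recover the shape.\<close>
  have pt: "ptranspose (?J i j) = RS_shapes s i j" if ij: "i \<le> ?n" "j \<le> ?n" for i j
  proof
    fix m
    have t: "tails (ptranspose (?J i j)) m = tails (RS_shapes s i j) m" for m
      using jordan_type_Int_rank[OF h F'(3) S'(2) F(3) S(2), of m i "?n - j"] F'(5)[of "?n - j"]
        pair_rank[OF S'(1), where h = h and m = m and f = f and i = i and j = j] r[OF ij, of m] by (simp del: dim_UNIV)
    have "finite {r. ptranspose (?J i j) r \<noteq> 0}" using is_partition_ptranspose[OF part] by (simp add: is_partition_def)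
    from tails_Suc[OF this, of m] tails_Suc[OF finite_support_RS_shapes, of s i j m]
    show "ptranspose (?J i j) m = RS_shapes s i j m" using t[of m] t[of "Suc m"] by simp
  qed
  have "is_partition (RS_shapes s i j)" if "i \<le> ?n" "j \<le> ?n" for i j
    using is_partition_ptranspose[OF part, of i j] pt[OF that] by simp
  then show "type_RSt ?n ?J"
    unfolding type_RSt_def type_RS_def using part pt RS_shapes_config[OF injs] by (simp del: dim_UNIV)
  \<comment> \<open>\<open>f' k\<close> has codimension \<open>n - k\<close>, so counting along
    \<open>f'\<close> reads the positions of \<open>s\<close> from the end.\<close>
  define u where "u = s \<circ> reversal ?n"
  have rev: "reversal ?n (reversal ?n b) = b" "b < ?n \<Longrightarrow> reversal ?n b < ?n" for b
    by (auto simp: reversal_def simp del: dim_UNIV)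
  have perm: "reversal ?n permutes {..<?n}"
  proof (rule bij_imp_permutes)
    show "bij_betw (reversal ?n) {..<?n} {..<?n}"
      by (rule bij_betw_byWitness[where f' = "reversal ?n"]) (use rev in auto)
  qed (simp add: reversal_def)
  have "relative_position f f' = u"
  proof (rule relative_position_eqI[OF S(1) S'(1)])
    show "u permutes {..<?n}" unfolding u_def using permutes_compose[OF perm s] .
    fix i k assume ik: "i \<le> ?n" "k \<le> ?n"
    let ?A = "{p. p < ?n - k \<and> s p < i}" and ?B = "{p. p < ?n \<and> s p < i}" and ?C = "{b. b < k \<and> u b < i}"
    have "card ?B = i"
    proof -
      have "s ` ?B = {..<i}"
      proof (intro equalityI subsetI)
        fix a assume "a \<in> {..<i}"
        then have "a \<in> s ` {..<?n}" unfolding permutes_image[OF s] using ik by simp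
        then show "a \<in> s ` ?B" using \<open>a \<in> {..<i}\<close> by auto
      qed auto
      then show ?thesis using card_image[OF injs, of ?B] by simp
    qed
    \<comment> \<open>The \<open>i\<close> positions with value below \<open>i\<close> are split at
      position \<open>n - k\<close>: those before it give the rank of \<open>f i\<close> modulo
      \<open>f' k\<close>, and reversal maps the first \<open>k\<close> positions of
      \<open>u\<close> to the others.\<close>
    moreover have "?B = ?A \<union> reversal ?n ` ?C"
    proof (intro equalityI subsetI)
      fix p assume p: "p \<in> ?B"
      show "p \<in> ?A \<union> reversal ?n ` ?C"
      proof (cases "p < ?n - k")
        case False
        then have "reversal ?n p \<in> ?C" using p rev by (auto simp: u_def reversal_def simp del: dim_UNIV)
        then show ?thesis by (intro UnI2 image_eqI[where x = "reversal ?n p"]) (simp_all only: rev(1))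
      qed (use p in auto)
    next
      fix p assume "p \<in> ?A \<union> reversal ?n ` ?C"
      then show "p \<in> ?B" using ik rev(2) by (auto simp: u_def simp del: dim_UNIV)
    qed
    moreover have "?A \<inter> reversal ?n ` ?C = {}" using ik by (auto simp: reversal_def simp del: dim_UNIV)
    moreover have "card (reversal ?n ` ?C) = card ?C" by (rule card_image[OF permutes_inj_on[OF perm]])
    ultimately have "i = card ?A + card ?C" using card_Un_disjoint[of ?A "reversal ?n ` ?C"] by (simp only: finite_Collect_conjI finite_Collect_less_nat finite_imageI disjI1)
    moreover have "pair_rank h f f' 0 i (?n - k) = card ?A"
      using r[OF ik(1), of "?n - k" 0] tails_RS_shapes_0[OF injs] by simp
    ultimately show "dim (f i \<inter> f' k) = card ?C"
      using pair_rank_0[OF S(1) S'(1) ik(1), where j = "?n - k" and h = h] ik(2) by (simp del: dim_UNIV)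
  qed
  then show "relative_position f f' \<circ> reversal ?n = s" unfolding u_def using rev(1) by (simp add: fun_eq_iff del: dim_UNIV)
qed

section \<open>Openness and density\<close>

lemma rank_open_finite:
  assumes fin: "finite A" and f0: "f0 \<in> complete_flags" and f0': "f0' \<in> complete_flags" and h: "lin h"
    and A: "\<forall>(m, i, j)\<in>A. i \<le> dim UNIV"
  shows "\<exists>p\<in>plucker_polys. p (plucker_pair (f0, f0')) \<noteq> 0 \<and>
    (\<forall>f\<in>complete_flags. \<forall>f'\<in>complete_flags. p (plucker_pair (f, f')) \<noteq> 0 \<longrightarrow>
      (\<forall>(m, i, j)\<in>A. pair_rank h f0 f0' m i j \<le> pair_rank h f f' m i j))"
  using fin A
proof (induction A rule: finite_induct)
  case empty
  have "(\<lambda>_. 1) \<in> plucker_polys"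
    unfolding plucker_polys_def mem_Collect_eq by (rule exI, rule multihom.const)
  then show ?case by (intro bexI[of _ "\<lambda>_. 1"]) auto
next
  case (insert a A)
  obtain m i j where a: "a = (m, i, j)" by (cases a)
  have "\<forall>(m, i, j)\<in>A. i \<le> dim UNIV" using insert.prems by blast
  note IH = insert.IH[OF this]
  obtain p where p: "p \<in> plucker_polys" "p (plucker_pair (f0, f0')) \<noteq> 0"
    "\<forall>f\<in>complete_flags. \<forall>f'\<in>complete_flags. p (plucker_pair (f, f')) \<noteq> 0 \<longrightarrow>
      (\<forall>(m, i, j)\<in>A. pair_rank h f0 f0' m i j \<le> pair_rank h f f' m i j)"
    using IH by (elim bexE conjE)
  have "i \<le> dim UNIV" using insert.prems a by blast
  then obtain q where q: "q \<in> plucker_polys" "q (plucker_pair (f0, f0')) \<noteq> 0"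
    "\<And>f f'. f \<in> complete_flags \<Longrightarrow> f' \<in> complete_flags \<Longrightarrow> q (plucker_pair (f, f')) \<noteq> 0 \<Longrightarrow>
      dim ((h ^^ m) ` f0 i \<union> f0' (dim UNIV - j)) \<le> dim ((h ^^ m) ` f i \<union> f' (dim UNIV - j))"
    using rank_open[OF f0 f0' lin_funpow[OF h, of m] _ diff_le_self[of "dim UNIV" j]] by blast
  have "pair_rank h f0 f0' m i j \<le> pair_rank h f f' m i j"
    if "f \<in> complete_flags" "f' \<in> complete_flags" "q (plucker_pair (f, f')) \<noteq> 0" for f f'
    using q(3)[OF that] unfolding pair_rank_def by (rule diff_le_mono)
  then have "\<forall>(m, i, j)\<in>insert a A. pair_rank h f0 f0' m i j \<le> pair_rank h f f' m i j"
    if "f \<in> complete_flags" "f' \<in> complete_flags" "p (plucker_pair (f, f')) * q (plucker_pair (f, f')) \<noteq> 0" for f f'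
    using p(3)[rule_format, of f f'] that by (simp add: a)
  then show ?case
    using p(2) q(2) by (intro bexI[OF _ plucker_polys_mult[OF p(1) q(1)]]) (auto simp del: insert_iff)
qed

text \<open>The open set is the nonvanishing of one polynomial \<open>p\<close> that certifies all
  ranks at the pair (f0, f0'). For density, a pair in a given open set and (f0, f0') are joined by a
  curve in each factor, run with a common parameter: \<open>p\<close> is nonzero at 0 and an
  equation \<open>q\<close> of the complement of the open set is nonzero at 1, so infinitely many
  parameters suit both.\<close>

theorem generic_pairs:
  assumes inf: "infinite (UNIV :: 'a set)" and h: "lin h" "nilpotent h"
    and P: "P \<in> SYT (jordan_type h UNIV {0})" and Q: "Q \<in> SYT (jordan_type h UNIV {0})"
    and s: "s permutes {..<dim UNIV}" and RS: "(List.transpose P, List.transpose Q) = RS (dim UNIV) s"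
  defines "X \<equiv> subtopology zariski_flag_pairs (r_flags h P \<times> q_flags h Q)"
  shows "\<exists>U. openin X U \<and> X closure_of U = topspace X \<and>
    (\<forall>(f, f')\<in>U. type_RSt (dim UNIV) (\<lambda>i j. jordan_type h (f i) (f i \<inter> f' (dim UNIV - j))) \<and>
      relative_position f f' \<circ> reversal (dim UNIV) = s)"
proof -
  let ?n = "dim UNIV" and ?A = "r_flags h P" and ?B = "q_flags h Q" and ?F = "complete_flags \<times> complete_flags"
  have sub: "?A \<times> ?B \<subseteq> ?F" by (auto simp: r_flags_def q_flags_def stable_flags_def)
  obtain f0 f0' where f0: "f0 \<in> ?A" and f0': "f0' \<in> ?B"
    and r0: "\<And>i j m. i \<le> ?n \<Longrightarrow> j \<le> ?n \<Longrightarrow> pair_rank h f0 f0' m i j = tails (RS_shapes s i j) m"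
    using growth_pair_exists[OF inf h P Q s RS] by blast
  have c0: "f0 \<in> complete_flags" "f0' \<in> complete_flags" using f0 f0' sub by auto
  let ?T = "{..?n} \<times> {..?n} \<times> {..?n}"
  have "\<exists>p\<in>plucker_polys. p (plucker_pair (f0, f0')) \<noteq> 0 \<and>
    (\<forall>f\<in>complete_flags. \<forall>f'\<in>complete_flags. p (plucker_pair (f, f')) \<noteq> 0 \<longrightarrow>
      (\<forall>(m, i, j)\<in>?T. pair_rank h f0 f0' m i j \<le> pair_rank h f f' m i j))"
    by (rule rank_open_finite[OF _ c0 h(1)]) auto
  then obtain p where p: "p \<in> plucker_polys" "p (plucker_pair (f0, f0')) \<noteq> 0"
    "\<And>f f'. f \<in> complete_flags \<Longrightarrow> f' \<in> complete_flags \<Longrightarrow> p (plucker_pair (f, f')) \<noteq> 0 \<Longrightarrow>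
      \<forall>(m, i, j)\<in>?T. pair_rank h f0 f0' m i j \<le> pair_rank h f f' m i j" by blast
  define U where "U = {ff \<in> ?A \<times> ?B. p (plucker_pair ff) \<noteq> 0}"
  have "openin X U"
  proof -
    let ?O = "{ff \<in> ?F. p (plucker_pair ff) \<noteq> 0}"
    have "?F - ?O = zero_locus {p}" by (auto simp: zero_locus_def)
    then have "openin zariski_flag_pairs ?O" unfolding openin_zariski_flag_pairs using p(1) by blast
    moreover have "U = ?O \<inter> (?A \<times> ?B)" using sub by (auto simp: U_def)
    ultimately show ?thesis unfolding X_def openin_subtopology by blast
  qed
  moreover have "X closure_of U = topspace X"
  proof (rule antisym[OF closure_of_subset_topspace], rule subsetI)
    fix y assume y: "y \<in> topspace X"
    show "y \<in> X closure_of U"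
      unfolding in_closure_of
    proof (intro conjI allI impI y)
      fix W assume "y \<in> W \<and> openin X W"
      then obtain W' where W': "y \<in> W'" "openin zariski_flag_pairs W'" "W = W' \<inter> (?A \<times> ?B)" "y \<in> ?A \<times> ?B"
        unfolding X_def openin_subtopology by blast
      obtain S where S: "S \<subseteq> plucker_polys" "?F - W' = zero_locus S"
        using W'(2) unfolding openin_zariski_flag_pairs by blast
      obtain f1 f1' where y1: "y = (f1, f1')" "f1 \<in> ?A" "f1' \<in> ?B" using W'(4) by blast
      have "y \<in> ?F" "y \<notin> zero_locus S" using sub W'(1,4) S(2) by blast+
      then obtain q where q: "q \<in> S" "q (plucker_pair (f1, f1')) \<noteq> 0" unfolding zero_locus_def y1(1) by blast
      have qp: "q \<in> plucker_polys" using q(1) S(1) by blast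
      have st: "f0 \<in> stable_flags h" "f1 \<in> stable_flags h" "f0' \<in> stable_flags h" "f1' \<in> stable_flags h"
        using f0 f0' y1 by (auto simp: r_flags_def q_flags_def)
      have "dim ((h ^^ m) ` f0 i) = dim ((h ^^ m) ` f1 i)" if "i \<le> ?n" for i m
        using f0 y1(2) that unfolding r_flags_rank_iff[OF h P] by simp
      from r_flag_curve[OF h st(1,2) this] obtain C e Bad where
        "flag_curve h (\<lambda>m W. dim ((h ^^ m) ` W)) f0 f1 C e Bad" by blast
      then have C: "finite Bad" "0 \<notin> Bad" "1 \<notin> Bad" "C 0 = f0" "C 1 = f1" "\<And>b. b < ?n \<Longrightarrow> vpolyfun (\<lambda>t. e t b)"
        "\<And>t. t \<notin> Bad \<Longrightarrow> C t \<in> stable_flags h" "\<And>t. t \<notin> Bad \<Longrightarrow> basis_seq (e t) \<and> adapted (C t) (e t)"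
        "\<And>t i m. t \<notin> Bad \<Longrightarrow> i \<le> ?n \<Longrightarrow> dim ((h ^^ m) ` C t i) = dim ((h ^^ m) ` f0 i)"
        unfolding flag_curve_def by blast+
      have "dim ((h ^^ m) ` UNIV \<union> f0' i) = dim ((h ^^ m) ` UNIV \<union> f1' i)" if "i \<le> ?n" for i m
        using f0' y1(3) that unfolding q_flags_rank_iff[OF h Q] by simp
      from q_flag_curve[OF h st(3,4) this] obtain C' e' Bad' where
        "flag_curve h (\<lambda>m W. dim ((h ^^ m) ` UNIV \<union> W)) f0' f1' C' e' Bad'" by blast
      then have C': "finite Bad'" "0 \<notin> Bad'" "1 \<notin> Bad'" "C' 0 = f0'" "C' 1 = f1'" "\<And>b. b < ?n \<Longrightarrow> vpolyfun (\<lambda>t. e' t b)"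
        "\<And>t. t \<notin> Bad' \<Longrightarrow> C' t \<in> stable_flags h" "\<And>t. t \<notin> Bad' \<Longrightarrow> basis_seq (e' t) \<and> adapted (C' t) (e' t)"
        "\<And>t i m. t \<notin> Bad' \<Longrightarrow> i \<le> ?n \<Longrightarrow> dim ((h ^^ m) ` UNIV \<union> C' t i) = dim ((h ^^ m) ` UNIV \<union> f0' i)"
        unfolding flag_curve_def by blast+
      \<comment> \<open>Both curves use the same parameter \<open>t\<close>, so that a single
        polynomial in \<open>t\<close> decides each condition on the pair.\<close>
      let ?Bad = "Bad \<union> Bad'"
      have zeros: "finite {t. t \<notin> ?Bad \<and> p' (plucker_pair (C t, C' t)) = 0}"
        if "p' \<in> plucker_polys" "t0 \<notin> ?Bad" "p' (plucker_pair (C t0, C' t0)) \<noteq> 0" for p' t0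
      proof (rule plucker_curve_finite_zeros[where e = e and e' = e' and F = C and F' = C' and Bad = ?Bad and p = p' and ?t0.0 = t0])
        show "C t \<in> complete_flags \<and> basis_seq (e t) \<and> adapted (C t) (e t)"
          "C' t \<in> complete_flags \<and> basis_seq (e' t) \<and> adapted (C' t) (e' t)" if "t \<notin> ?Bad" for t
          using C(7,8) C'(7,8) stable_flag_stable(1) that by blast+
      qed (use that C(6) C'(6) in auto)
      have "finite {t. t \<notin> ?Bad \<and> p (plucker_pair (C t, C' t)) = 0}"
        by (rule zeros[OF p(1), of 0]) (use p(2) C C' in auto)
      moreover have "finite {t. t \<notin> ?Bad \<and> q (plucker_pair (C t, C' t)) = 0}"
        by (rule zeros[OF qp, of 1]) (use q(2) C C' in auto)
      ultimately have "finite (?Bad \<union> {t. t \<notin> ?Bad \<and> p (plucker_pair (C t, C' t)) = 0} \<union>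
          {t. t \<notin> ?Bad \<and> q (plucker_pair (C t, C' t)) = 0})" using C(1) C'(1) by blast
      from ex_new_if_finite[OF inf this] obtain t where "t \<notin> ?Bad \<union> {t. t \<notin> ?Bad \<and> p (plucker_pair (C t, C' t)) = 0} \<union>
          {t. t \<notin> ?Bad \<and> q (plucker_pair (C t, C' t)) = 0}" by (elim exE)
      then have t: "t \<notin> Bad" "t \<notin> Bad'" "p (plucker_pair (C t, C' t)) \<noteq> 0" "q (plucker_pair (C t, C' t)) \<noteq> 0" by auto
      have "C t \<in> ?A"
        using f0 C(7,9)[OF t(1)] unfolding r_flags_rank_iff[OF h P] by simp
      moreover have "C' t \<in> ?B"
        using f0' C'(7,9)[OF t(2)] unfolding q_flags_rank_iff[OF h Q] by simp
      ultimately have z: "(C t, C' t) \<in> ?A \<times> ?B" by blast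
      then have "(C t, C' t) \<in> ?F" using sub by blast
      moreover have "(C t, C' t) \<notin> zero_locus S" using q(1) t(4) by (auto simp: zero_locus_def)
      ultimately have "(C t, C' t) \<in> W'" using S(2) by blast
      then have "(C t, C' t) \<in> W" using W'(3) z by blast
      moreover have "(C t, C' t) \<in> U" using z t(3) by (simp add: U_def)
      ultimately show "\<exists>z. z \<in> U \<and> z \<in> W" by blast
    qed
  qed
  moreover have "type_RSt ?n (\<lambda>i j. jordan_type h (f i) (f i \<inter> f' (?n - j))) \<and>
      relative_position f f' \<circ> reversal ?n = s" if ff: "(f, f') \<in> U" for f f'
  proof -
    have f: "f \<in> ?A" "f' \<in> ?B" "p (plucker_pair (f, f')) \<noteq> 0" using ff by (auto simp: U_def)
    have c: "f \<in> complete_flags" "f' \<in> complete_flags" using f sub by auto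
    have "tails (RS_shapes s i j) m \<le> pair_rank h f f' m i j" if "i \<le> ?n" "j \<le> ?n" for i j m
    proof (cases "m \<le> ?n")
      case True
      then have "(m, i, j) \<in> ?T" using that by simp
      then have "pair_rank h f0 f0' m i j \<le> pair_rank h f f' m i j" using p(3)[OF c f(3)] by blast
      then show ?thesis using r0[OF that] by simp
    next
      \<comment> \<open>\<open>p\<close> controls only powers up to \<open>?n\<close>; beyond that
        the required tail sums are zero.\<close>
      case False
      then show ?thesis using tails_RS_shapes_large[of j m s i] that by (simp del: dim_UNIV)
    qed
    then show ?thesis using growth_pair_good[OF h P Q s RS f(1,2)] by blast
  qed
  ultimately show ?thesis by (intro exI[of _ U]) blast
qed

end

theorem theorem7p6:
  fixes scale :: "'k::field \<Rightarrow> 'v::ab_group_add \<Rightarrow> 'v" and Basis :: "'v set"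
    and n :: nat and \<eta> :: "'v \<Rightarrow> 'v" and l :: "nat \<Rightarrow> nat"
    and P Q :: tableau and \<sigma> :: "nat \<Rightarrow> nat"
  assumes "infinite (UNIV :: 'k set)"
    and "finite_dimensional_vector_space scale Basis"
    and "vector_space.dim scale (UNIV :: 'v set) = n"
    and "Vector_Spaces.linear scale scale \<eta>"
    and "\<exists>m. \<forall>v. (\<eta> ^^ m) v = 0"
    and "finite_dimensional_vector_space.jordan_type scale \<eta> UNIV {0} = l"
    and "P \<in> SYT l" and "Q \<in> SYT l"
    and "\<sigma> permutes {..<n}"
    and "(List.transpose P, List.transpose Q) = RS n \<sigma>"
  shows "let X = subtopology (finite_dimensional_vector_space.zariski_flag_pairs scale Basis)
        (finite_dimensional_vector_space.r_flags scale \<eta> P \<times>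
         finite_dimensional_vector_space.q_flags scale \<eta> Q)
    in \<exists>U. openin X U \<and> X closure_of U = topspace X \<and>
      (\<forall>(f, f') \<in> U.
         type_RSt n (\<lambda>i j. finite_dimensional_vector_space.jordan_type scale \<eta> (f i) (f i \<inter> f' (n - j))) \<and>
         finite_dimensional_vector_space.relative_position scale f f' \<circ> reversal n = \<sigma>)"
proof -
  interpret finite_dimensional_vector_space scale Basis by (rule assms(2))
  have "nilpotent \<eta>" using assms(5) by (simp add: nilpotent_def)
  from generic_pairs[OF assms(1,4) this, of P Q \<sigma>, unfolded assms(3,6), OF assms(7-10)]
  show ?thesis unfolding Let_def .
qed

end
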